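(* Let $0<r_\ast<R_\ast<\infty$ and $\mathbb A^\ast=\{\xi\in\mathbb C: r_\ast<|\xi|<R_\ast\}$. Let $\mathbb S=\{(\xi,w(\xi)):\xi\in\mathbb A^\ast\}\subset\mathbb C\times\mathbb R\cong\mathbb R^3$ be a minimal graph over $\mathbb A^\ast$, i.e. the graph of a $\mathscr C^2$ function $w:\mathbb A^\ast\to\mathbb R$ satisfying the minimal surface equation (zero mean curvature), and assume $\mathbb S$ is conformally equivalent to a circular annulus $A(r,R)=\{z: r<|z|<R\}$, $0<r<R<\infty$. Then $$\operatorname{Mod}\mathbb S\leqslant \log\left(\frac{R_\ast}{r_\ast}+\sqrt{\frac{R_\ast^2}{r_\ast^2}-1}\right).$$ Equality holds if and only if $\mathbb S$ is the upper slab of a catenoid, i.e. $w(\xi)=c\pm r_\ast\log\Big(\frac{|\xi|+\sqrt{|\xi|^2-r_\ast^2}}{r_\ast}\Big)$ for some constant $c\in\mathbb R$.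
   Context: The conformal modulus of a doubly connected surface $\mathbb S$ that is the image of an annulus $A(r,R)$, $0<r<R<\infty$, under a conformal map is $\operatorname{Mod}\mathbb S=\log(R/r)$; this is independent of the choice of conformal parametrization. *)

theory Defs
  imports "HOL-Analysis.Analysis"
begin

definition annulus :: "real \<Rightarrow> real \<Rightarrow> complex set" where
  "annulus r R = {z. r < cmod z \<and> cmod z < R}"

text \<open>w is of class C^2 on the open set U, with (Frechet) first derivative Dw and
  second derivative D2w, the latter continuous.  Partial derivatives are obtained by
  applying these to the directions 1 (x-direction) and i (y-direction).\<close>
definition C2_with ::
  "complex set \<Rightarrow> (complex \<Rightarrow> real) \<Rightarrow> (complex \<Rightarrow> complex \<Rightarrow>\<^sub>L real)
     \<Rightarrow> (complex \<Rightarrow> complex \<Rightarrow>\<^sub>L (complex \<Rightarrow>\<^sub>L real)) \<Rightarrow> bool" where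
  "C2_with U w Dw D2w \<longleftrightarrow>
     (\<forall>z\<in>U. (w has_derivative blinfun_apply (Dw z)) (at z)) \<and>
     (\<forall>z\<in>U. (Dw has_derivative blinfun_apply (D2w z)) (at z)) \<and>
     continuous_on U D2w"

definition minimal_graph :: "complex set \<Rightarrow> (complex \<Rightarrow> real) \<Rightarrow> bool" where
  "minimal_graph U w \<longleftrightarrow>
     (\<exists>Dw D2w. C2_with U w Dw D2w \<and>
        (\<forall>z\<in>U.
          let wx = Dw z 1; wy = Dw z \<i>;
              wxx = D2w z 1 1; wxy = D2w z 1 \<i>; wyy = D2w z \<i> \<i>
          in (1 + wy\<^sup>2) * wxx - 2 * wx * wy * wxy + (1 + wx\<^sup>2) * wyy = 0))"

definition graph_surface :: "complex set \<Rightarrow> (complex \<Rightarrow> real) \<Rightarrow> (complex \<times> real) set" where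
  "graph_surface U w = {(\<xi>, w \<xi>) | \<xi>. \<xi> \<in> U}"

text \<open>F is a conformal parametrization of the surface S by the domain D:
  a homeomorphism of D onto S, differentiable at every point, whose differential
  is a nonzero similarity (|F_x| = |F_y| \<noteq> 0, F_x \<bottom> F_y).\<close>
definition conformal_param :: "complex set \<Rightarrow> (complex \<Rightarrow> complex \<times> real) \<Rightarrow> (complex \<times> real) set \<Rightarrow> bool" where
  "conformal_param D F S \<longleftrightarrow>
     (\<exists>G. homeomorphism D S F G) \<and>
     (\<forall>z\<in>D. \<exists>F'. (F has_derivative F') (at z) \<and>
        F' 1 \<noteq> 0 \<and> norm (F' 1) = norm (F' \<i>) \<and> inner (F' 1) (F' \<i>) = 0)"

text \<open>Conformal modulus of S via a conformal parametrization by A(r,R).\<close>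
definition Mod_annulus :: "real \<Rightarrow> real \<Rightarrow> real" where
  "Mod_annulus r R = ln (R / r)"

end

theory Submission
  imports Defs "HOL-Complex_Analysis.Complex_Analysis"
begin

text \<open>Put T = ln (R / r), so that T is the modulus, and normalise the parameter annulus to
  \<open>annulus 1 (exp T)\<close>. The bound in the theorem is arcosh (Rs / rs), so the claim is
  cosh T \<le> Rs / rs. Let h be the horizontal projection of the conformal parametrization; it is a
  homeomorphism onto \<open>annulus rs Rs\<close>. The proof shows that h is harmonic and then
  proves Nitsche's inequality for harmonic maps between annuli, together with its case of equality.

  Harmonicity (\<open>conformal_graph_harmonic_locally\<close>). The parametrization is only known
  to be differentiable at each point. The minimal surface equation says that the rows of g / sqrt
  (det g), where g is the metric of the graph, are closed one-forms, so they have a local primitive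
  \<Gamma>. Conformality makes h + \<Gamma>(h) and the conjugate of h - \<Gamma>(h) at each point
  both complex linear or both complex antilinear to first order. The first map is injective, and a
  winding number argument shows that the type cannot change from point to point. Hence h is locally
  a holomorphic function plus the conjugate of one.

  Nitsche's inequality (\<open>cosh_le\<close>). Scale h so that the inner radius is 1, and put M =
  Rs / rs. The Fourier coefficients of h on the circle of radius e^t interpolate by hyperbolic sines
  between boundary coefficients x n (inner) and z n (outer). Let Hx be the harmonic extension of x
  to the unit disc. Then h at radius e^t is Hx at radius e^(-t) plus a remainder N of size O(t);
  |Hx| tends to 1 at the unit circle; and since h has no continuous logarithm, Hx has a zero
  (\<open>Hx_zero\<close>). From |h| \<ge> 1 follows 1 - |Hx|^2 \<le> 2 Re (Hx cnj N) + O(t^2).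
  Averaging, dividing by 2t and letting t tend to 0 bounds a pairing with nu, the normal derivative
  of N, from below: the left side is estimated by Parseval and by a sharp Schwarz-Pick inequality
  that uses the zero (\<open>harmonic_schwarz_pick\<close>, \<open>unweighted_limit\<close>,
  \<open>weighted_limit\<close>). Since nu is a combination of x and z, completing the square
  against the bound M^2 for the sum of |z n|^2 (\<open>completed_inequality\<close>) gives M^2 \<ge>
  (cosh T)^2 plus nonnegative remainders. The frequency 0 does no harm when tanh T \<le> 5/6
  (\<open>core_small\<close>); for larger T it is eliminated by averaging against a Poisson kernel
  centred at the zero (\<open>core_large\<close>).

  Equality. If M = cosh T the remainders vanish, only the frequencies 1 and -1 survive, and h = rs
  cosh t times a rotation or reflection of e^(i\<theta>) (\<open>rigid\<close>); conformality then
  makes the height linear in t, which is the catenoid. Conversely, over a catenoid slab arcosh (|h|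
  / rs) is harmonic with constant limits at both ends, hence equals a t; conformality makes h turn
  with angular speed a, injectivity forces a \<le> 1, and this is cosh T \<ge> Rs / rs
  (\<open>catenoid_imp_extremal\<close>).\<close>

section \<open>Harmonicity of the horizontal projection of a conformally parametrized minimal
  graph\<close>

lemma has_vector_derivative_along_line:
  fixes f :: "complex \<Rightarrow> 'a::real_normed_vector"
  assumes "(f has_derivative f') (at (c + of_real s * d))"
  shows "((\<lambda>s. f (c + of_real s * d)) has_vector_derivative f' d) (at s)"
proof -
  have g: "((\<lambda>s. c + of_real s * d) has_vector_derivative d) (at s)"
    by (auto intro!: derivative_eq_intros has_vector_derivative_real_field)
  have "((f \<circ> (\<lambda>s. c + of_real s * d)) has_vector_derivative f' d) (at s)"
    by (rule vector_derivative_diff_chain_within[OF g has_derivative_at_withinI[OF assms]])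
  then show ?thesis by (simp add: o_def)
qed

text \<open>The second difference of \<open>w\<close> over a small square of side t is t^2 times a
  value of \<open>py\<close> and also t^2 times a value of \<open>qx\<close>, by applying the mean
  value theorem twice in either order. Letting t tend to 0 and using continuity of both functions
  gives equality at the corner \<open>z\<close>.\<close>

lemma mixed_partials_eq:
  fixes w p q px py qx qy :: "complex \<Rightarrow> real"
  assumes "open U" "z \<in> U"
    and w: "\<And>\<xi>. \<xi> \<in> U \<Longrightarrow> (w has_derivative (\<lambda>v. Re v * p \<xi> + Im v * q \<xi>)) (at \<xi>)"
    and p: "\<And>\<xi>. \<xi> \<in> U \<Longrightarrow> (p has_derivative (\<lambda>v. Re v * px \<xi> + Im v * py \<xi>)) (at \<xi>)"
    and q: "\<And>\<xi>. \<xi> \<in> U \<Longrightarrow> (q has_derivative (\<lambda>v. Re v * qx \<xi> + Im v * qy \<xi>)) (at \<xi>)"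
    and "continuous_on U py" "continuous_on U qx"
  shows "py z = qx z"
proof -
  obtain d where d: "d > 0" "ball z d \<subseteq> U"
    using assms(1,2) openE by blast
  have inb: "z + of_real a + of_real b * \<i> \<in> U" if "0 \<le> a" "0 \<le> b" "a + b < d" for a b
  proof -
    have "cmod (of_real a + of_real b * \<i>) \<le> a + b"
      using norm_triangle_ineq[of "of_real a" "of_real b * \<i>"] that by (simp add: norm_mult)
    moreover have "dist z (z + of_real a + of_real b * \<i>) = cmod (of_real a + of_real b * \<i>)"
      by (metis add.assoc add_diff_cancel_left' dist_commute dist_norm)
    ultimately show ?thesis using that d by auto
  qed
  have key: "\<exists>a b a' b'. 0 < a \<and> a < t \<and> 0 < b \<and> b < t \<and> 0 < a' \<and> a' < t \<and> 0 < b' \<and> b' < t \<and>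
      py (z + of_real a + of_real b * \<i>) = qx (z + of_real a' + of_real b' * \<i>)"
    if t: "0 < t" "2 * t < d" for t
  proof -
    have wx: "((\<lambda>s. w (z + of_real s + of_real b * \<i>)) has_real_derivative p (z + of_real a + of_real b * \<i>)) (at a)"
      if "0 \<le> a" "a \<le> t" "0 \<le> b" "b \<le> t" for a b
      using has_vector_derivative_along_line[of w "(\<lambda>v. Re v * p (z + of_real a + of_real b * \<i>) + Im v * q (z + of_real a + of_real b * \<i>))"
        "z + of_real b * \<i>" a 1] w[OF inb[of a b]] that t
      by (simp add: has_real_derivative_iff_has_vector_derivative add_ac)
    have wy: "((\<lambda>s. w (z + of_real a + of_real s * \<i>)) has_real_derivative q (z + of_real a + of_real b * \<i>)) (at b)"
      if "0 \<le> a" "a \<le> t" "0 \<le> b" "b \<le> t" for a b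
      using has_vector_derivative_along_line[of w "(\<lambda>v. Re v * p (z + of_real a + of_real b * \<i>) + Im v * q (z + of_real a + of_real b * \<i>))"
        "z + of_real a" b \<i>] w[OF inb[of a b]] that t
      by (simp add: has_real_derivative_iff_has_vector_derivative add_ac)
    have pyd: "((\<lambda>s. p (z + of_real a + of_real s * \<i>)) has_real_derivative py (z + of_real a + of_real b * \<i>)) (at b)"
      if "0 \<le> a" "a \<le> t" "0 \<le> b" "b \<le> t" for a b
      using has_vector_derivative_along_line[of p "(\<lambda>v. Re v * px (z + of_real a + of_real b * \<i>) + Im v * py (z + of_real a + of_real b * \<i>))"
        "z + of_real a" b \<i>] p[OF inb[of a b]] that t
      by (simp add: has_real_derivative_iff_has_vector_derivative add_ac)
    have qxd: "((\<lambda>s. q (z + of_real s + of_real b * \<i>)) has_real_derivative qx (z + of_real a + of_real b * \<i>)) (at a)"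
      if "0 \<le> a" "a \<le> t" "0 \<le> b" "b \<le> t" for a b
      using has_vector_derivative_along_line[of q "(\<lambda>v. Re v * qx (z + of_real a + of_real b * \<i>) + Im v * qy (z + of_real a + of_real b * \<i>))"
        "z + of_real b * \<i>" a 1] q[OF inb[of a b]] that t
      by (simp add: has_real_derivative_iff_has_vector_derivative add_ac)
    define W where "W = (\<lambda>a b. w (z + of_real a + of_real b * \<i>))"
    have "\<exists>a. 0 < a \<and> a < t \<and> (W t t - W t 0) - (W 0 t - W 0 0) =
       (t - 0) * (p (z + of_real a + of_real t * \<i>) - p (z + of_real a + of_real 0 * \<i>))"
      unfolding W_def
      by (rule MVT2[of 0 t "\<lambda>s. w (z + of_real s + of_real t * \<i>) - w (z + of_real s + of_real 0 * \<i>)"])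
         (use t in \<open>auto intro!: DERIV_diff wx simp del: of_real_0\<close>)
    then obtain a where a: "0 < a" "a < t" "W t t - W t 0 - (W 0 t - W 0 0) =
       t * (p (z + of_real a + of_real t * \<i>) - p (z + of_real a + of_real 0 * \<i>))" by auto
    have "\<exists>b. 0 < b \<and> b < t \<and> p (z + of_real a + of_real t * \<i>) - p (z + of_real a + of_real 0 * \<i>)
      = (t - 0) * py (z + of_real a + of_real b * \<i>)"
      by (rule MVT2[of 0 t "\<lambda>s. p (z + of_real a + of_real s * \<i>)"]) (use t a in \<open>auto intro!: pyd\<close>)
    then obtain b where b: "0 < b" "b < t" "p (z + of_real a + of_real t * \<i>) - p (z + of_real a + of_real 0 * \<i>)
      = t * py (z + of_real a + of_real b * \<i>)" by auto
    have "\<exists>b. 0 < b \<and> b < t \<and> (W t t - W 0 t) - (W t 0 - W 0 0) =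
       (t - 0) * (q (z + of_real t + of_real b * \<i>) - q (z + of_real 0 + of_real b * \<i>))"
      unfolding W_def
      by (rule MVT2[of 0 t "\<lambda>s. w (z + of_real t + of_real s * \<i>) - w (z + of_real 0 + of_real s * \<i>)"])
         (use t in \<open>auto intro!: DERIV_diff wy simp del: of_real_0\<close>)
    then obtain b' where b': "0 < b'" "b' < t" "W t t - W 0 t - (W t 0 - W 0 0) =
       t * (q (z + of_real t + of_real b' * \<i>) - q (z + of_real 0 + of_real b' * \<i>))" by auto
    have "\<exists>a. 0 < a \<and> a < t \<and> q (z + of_real t + of_real b' * \<i>) - q (z + of_real 0 + of_real b' * \<i>)
      = (t - 0) * qx (z + of_real a + of_real b' * \<i>)"
      by (rule MVT2[of 0 t "\<lambda>s. q (z + of_real s + of_real b' * \<i>)"]) (use t b' in \<open>auto intro!: qxd\<close>)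
    then obtain a' where a': "0 < a'" "a' < t" "q (z + of_real t + of_real b' * \<i>) - q (z + of_real 0 + of_real b' * \<i>)
      = t * qx (z + of_real a' + of_real b' * \<i>)" by auto
    have "t * (t * py (z + of_real a + of_real b * \<i>)) = t * (t * qx (z + of_real a' + of_real b' * \<i>))"
      using a(3) b(3) b'(3) a'(3) by (simp add: algebra_simps)
    then have "py (z + of_real a + of_real b * \<i>) = qx (z + of_real a' + of_real b' * \<i>)"
      using t by simp
    then show ?thesis using a b a' b' by blast
  qed
  \<comment> \<open>Sides tending to 0; the factor d / 3 ensures 2 t < d, which keeps each square
    inside the ball.\<close>
  define tt where "tt = (\<lambda>n::nat. d / 3 * inverse (real (Suc n)))"
  have tt: "0 < tt n" "2 * tt n < d" for n
  proof -
    have "inverse (real (Suc n)) \<le> 1" by (simp add: inverse_eq_divide)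
    then have "d / 3 * inverse (real (Suc n)) \<le> d / 3 * 1"
      using d by (intro mult_left_mono) auto
    then show "0 < tt n" "2 * tt n < d" using d unfolding tt_def by auto
  qed
  have "\<forall>n. \<exists>a b a' b'. 0 < a \<and> a < tt n \<and> 0 < b \<and> b < tt n \<and> 0 < a' \<and> a' < tt n \<and> 0 < b' \<and> b' < tt n \<and>
      py (z + of_real a + of_real b * \<i>) = qx (z + of_real a' + of_real b' * \<i>)"
    using key tt by blast
  then obtain a b a' b' where ab: "\<And>n. 0 < a n \<and> a n < tt n \<and> 0 < b n \<and> b n < tt n \<and> 0 < a' n \<and> a' n < tt n \<and> 0 < b' n \<and> b' n < tt n \<and>
      py (z + of_real (a n) + of_real (b n) * \<i>) = qx (z + of_real (a' n) + of_real (b' n) * \<i>)"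
    by metis
  have tt0: "tt \<longlonglongrightarrow> 0"
    unfolding tt_def using tendsto_mult[OF tendsto_const LIMSEQ_inverse_real_of_nat, of "d / 3"] by (simp only: mult_zero_right)
  have lim0: "u \<longlonglongrightarrow> 0" if "\<And>n. 0 < u n \<and> u n < tt n" for u
    by (rule tendsto_sandwich[OF _ _ tendsto_const tt0]) (use that less_imp_le in \<open>auto intro!: always_eventually\<close>)
  have la: "a \<longlonglongrightarrow> 0" "b \<longlonglongrightarrow> 0" "a' \<longlonglongrightarrow> 0" "b' \<longlonglongrightarrow> 0"
    using ab by (auto intro!: lim0)
  have c1: "(\<lambda>n. z + of_real (a n) + of_real (b n) * \<i>) \<longlonglongrightarrow> z + of_real 0 + of_real 0 * \<i>"
    by (intro tendsto_intros la)
  have c2: "(\<lambda>n. z + of_real (a' n) + of_real (b' n) * \<i>) \<longlonglongrightarrow> z + of_real 0 + of_real 0 * \<i>"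
    by (intro tendsto_intros la)
  have cp: "isCont py z" "isCont qx z"
    using assms(1,2,6,7) by (auto simp: continuous_on_eq_continuous_at)
  have l1: "(\<lambda>n. py (z + of_real (a n) + of_real (b n) * \<i>)) \<longlonglongrightarrow> py z"
    using isCont_tendsto_compose[OF cp(1), of "\<lambda>n. z + of_real (a n) + of_real (b n) * \<i>" sequentially] c1 by simp
  have l2: "(\<lambda>n. qx (z + of_real (a' n) + of_real (b' n) * \<i>)) \<longlonglongrightarrow> qx z"
    using isCont_tendsto_compose[OF cp(2), of "\<lambda>n. z + of_real (a' n) + of_real (b' n) * \<i>" sequentially] c2 by simp
  show ?thesis
    using l1 l2 ab LIMSEQ_unique by (metis (no_types, lifting) ext)
qed

text \<open>The Poincare lemma by integration along rays from the centre: the primitive at \<xi> is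
  the integral over s in [0,1] of the form evaluated at \<open>l \<xi> s\<close> on the vector \<xi>
  - c. Complex values treat two real one-forms at once.\<close>

lemma closed_form_primitive:
  fixes P Q Px Py Qx Qy :: "complex \<Rightarrow> complex"
  assumes P: "\<And>\<xi>. \<xi> \<in> ball c d \<Longrightarrow> (P has_derivative (\<lambda>v. Re v *\<^sub>R Px \<xi> + Im v *\<^sub>R Py \<xi>)) (at \<xi>)"
    and Q: "\<And>\<xi>. \<xi> \<in> ball c d \<Longrightarrow> (Q has_derivative (\<lambda>v. Re v *\<^sub>R Qx \<xi> + Im v *\<^sub>R Qy \<xi>)) (at \<xi>)"
    and cont: "continuous_on (ball c d) Px" "continuous_on (ball c d) Py"
       "continuous_on (ball c d) Qx" "continuous_on (ball c d) Qy"
    and closed: "\<And>\<xi>. \<xi> \<in> ball c d \<Longrightarrow> Py \<xi> = Qx \<xi>"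
  shows "\<exists>\<Gamma>. \<forall>\<xi>\<in>ball c d. (\<Gamma> has_derivative (\<lambda>v. Re v *\<^sub>R P \<xi> + Im v *\<^sub>R Q \<xi>)) (at \<xi>)"
proof -
  let ?B = "ball c d"
  define l where "l = (\<lambda>\<xi> (s::real). c + of_real s * (\<xi> - c))"
  have lB: "l \<xi> s \<in> ?B" if "\<xi> \<in> ?B" "s \<in> {0..1}" for \<xi> s
  proof -
    have "dist c (l \<xi> s) = \<bar>s\<bar> * dist c \<xi>"
      by (simp add: l_def dist_norm norm_mult norm_minus_commute)
    also have "\<dots> \<le> 1 * dist c \<xi>" using that by (intro mult_right_mono) auto
    finally show ?thesis using that by simp
  qed
  have contP: "continuous_on ?B P" "continuous_on ?B Q"
    using P Q has_derivative_continuous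
    by (blast intro!: continuous_at_imp_continuous_on)+
  have contl: "continuous_on (?B \<times> {0..1}) (\<lambda>x. l (fst x) (snd x))"
    unfolding l_def by (intro continuous_intros)
  note cl = continuous_on_compose2[OF _ contl]
  define f where "f = (\<lambda>\<xi> s. Re (\<xi> - c) *\<^sub>R P (l \<xi> s) + Im (\<xi> - c) *\<^sub>R Q (l \<xi> s))"
  define X where "X = (\<lambda>\<xi> s. P (l \<xi> s) + s *\<^sub>R (Re (\<xi> - c) *\<^sub>R Px (l \<xi> s) + Im (\<xi> - c) *\<^sub>R Qx (l \<xi> s)))"
  define Y where "Y = (\<lambda>\<xi> s. Q (l \<xi> s) + s *\<^sub>R (Re (\<xi> - c) *\<^sub>R Py (l \<xi> s) + Im (\<xi> - c) *\<^sub>R Qy (l \<xi> s)))"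
  \<comment> \<open>The \<xi>-derivative of the integrand, packaged as a bounded linear map so that
    differentiation under the integral sign (\<open>leibniz_rule\<close>) applies.\<close>
  define fx where "fx = (\<lambda>\<xi> s. (blinfun_scaleR_left (X \<xi> s) o\<^sub>L Blinfun Re) + (blinfun_scaleR_left (Y \<xi> s) o\<^sub>L Blinfun Im))"
  have fx_apply: "blinfun_apply (fx \<xi> s) v = Re v *\<^sub>R X \<xi> s + Im v *\<^sub>R Y \<xi> s" for \<xi> s v
    unfolding fx_def
    by (simp add: blinfun.add_left bounded_linear_Blinfun_apply bounded_linear_Re bounded_linear_Im)
  have ap: "(\<lambda>v. blinfun_apply (fx \<xi> s) v) = (\<lambda>v. Re v *\<^sub>R X \<xi> s + Im v *\<^sub>R Y \<xi> s)" for \<xi> s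
    by (rule ext) (rule fx_apply)
  have cP: "continuous_on (?B \<times> {0..1}) (\<lambda>x. P (l (fst x) (snd x)))"
       "continuous_on (?B \<times> {0..1}) (\<lambda>x. Q (l (fst x) (snd x)))"
       "continuous_on (?B \<times> {0..1}) (\<lambda>x. Px (l (fst x) (snd x)))"
       "continuous_on (?B \<times> {0..1}) (\<lambda>x. Py (l (fst x) (snd x)))"
       "continuous_on (?B \<times> {0..1}) (\<lambda>x. Qx (l (fst x) (snd x)))"
       "continuous_on (?B \<times> {0..1}) (\<lambda>x. Qy (l (fst x) (snd x)))"
    using lB by (auto intro!: cl[OF contP(1)] cl[OF contP(2)] cl[OF cont(1)] cl[OF cont(2)] cl[OF cont(3)] cl[OF cont(4)])
  have contX: "continuous_on (?B \<times> {0..1}) (\<lambda>x. X (fst x) (snd x))" "continuous_on (?B \<times> {0..1}) (\<lambda>x. Y (fst x) (snd x))"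
    unfolding X_def Y_def by (intro continuous_intros cP)+
  have contfx: "continuous_on (?B \<times> cbox 0 1) (\<lambda>(\<xi>, s). fx \<xi> s)"
    unfolding split_beta fx_def cbox_interval by (intro continuous_intros contX)
  have slice: "continuous_on {0..1} (\<lambda>s. g \<xi> s)"
    if "continuous_on (?B \<times> {0..1}) (\<lambda>x. g (fst x) (snd x))" "\<xi> \<in> ?B" for g :: "complex \<Rightarrow> real \<Rightarrow> 'x::topological_space" and \<xi>
  proof -
    have "continuous_on {0..1} (\<lambda>s::real. (\<xi>, s))" by (intro continuous_intros)
    from continuous_on_compose2[OF that(1) this] that(2) show ?thesis by (auto simp: image_subset_iff)
  qed
  have contf: "continuous_on {0..1} (f \<xi>)" if "\<xi> \<in> ?B" for \<xi>
  proof -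
    have "continuous_on (?B \<times> {0..1}) (\<lambda>x. f (fst x) (snd x))"
      unfolding f_def by (intro continuous_intros cP)
    then show ?thesis using slice that by blast
  qed
  have df: "((\<lambda>\<xi>. f \<xi> s) has_derivative blinfun_apply (fx \<xi> s)) (at \<xi> within ?B)" if "\<xi> \<in> ?B" "s \<in> cbox 0 1" for \<xi> s
  proof -
    have dl: "((\<lambda>\<xi>. l \<xi> s) has_derivative (\<lambda>v. of_real s * v)) (at \<xi>)"
      unfolding l_def by (auto intro!: derivative_eq_intros)
    have dP: "((\<lambda>\<xi>. P (l \<xi> s)) has_derivative (\<lambda>v. Re (of_real s * v) *\<^sub>R Px (l \<xi> s) + Im (of_real s * v) *\<^sub>R Py (l \<xi> s))) (at \<xi>)"
      using has_derivative_compose[OF dl P[OF lB]] that by auto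
    have dQ: "((\<lambda>\<xi>. Q (l \<xi> s)) has_derivative (\<lambda>v. Re (of_real s * v) *\<^sub>R Qx (l \<xi> s) + Im (of_real s * v) *\<^sub>R Qy (l \<xi> s))) (at \<xi>)"
      using has_derivative_compose[OF dl Q[OF lB]] that by auto
    have "((\<lambda>\<xi>. f \<xi> s) has_derivative (\<lambda>v. Re v *\<^sub>R X \<xi> s + Im v *\<^sub>R Y \<xi> s)) (at \<xi>)"
      unfolding f_def
      by (rule derivative_eq_intros dP dQ | simp)+
         (auto simp: X_def Y_def algebra_simps scaleR_conv_of_real)
    then show ?thesis unfolding ap by (rule has_derivative_at_withinI)
  qed
  define \<Gamma> where "\<Gamma> = (\<lambda>\<xi>. integral (cbox 0 1) (f \<xi>))"
  \<comment> \<open>Closedness \<open>Py = Qx\<close> turns \<open>X\<close> and \<open>Y\<close>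
    into the s-derivatives of s P(l s) and s Q(l s), so their integrals are the values of P and Q at
    the end point.\<close>
  have intP: "integral {0..1} (X \<xi>) = P \<xi>" "integral {0..1} (Y \<xi>) = Q \<xi>" if "\<xi> \<in> ?B" for \<xi>
  proof -
    have dP: "((\<lambda>s. P (l \<xi> s)) has_vector_derivative Re (\<xi>-c) *\<^sub>R Px (l \<xi> s) + Im (\<xi>-c) *\<^sub>R Py (l \<xi> s)) (at s)" if "s \<in> {0..1}" for s
      using has_vector_derivative_along_line[OF P[OF lB[OF \<open>\<xi>\<in>?B\<close> that], unfolded l_def]] by (simp add: l_def)
    have dQ: "((\<lambda>s. Q (l \<xi> s)) has_vector_derivative Re (\<xi>-c) *\<^sub>R Qx (l \<xi> s) + Im (\<xi>-c) *\<^sub>R Qy (l \<xi> s)) (at s)" if "s \<in> {0..1}" for s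
      using has_vector_derivative_along_line[OF Q[OF lB[OF \<open>\<xi>\<in>?B\<close> that], unfolded l_def]] by (simp add: l_def)
    have "((\<lambda>s. s *\<^sub>R P (l \<xi> s)) has_vector_derivative X \<xi> s) (at s)" if "s \<in> {0..1}" for s
      using has_vector_derivative_scaleR[OF DERIV_ident dP[OF that]] closed[OF lB[OF \<open>\<xi>\<in>?B\<close> that]]
      by (simp add: X_def add_ac)
    then have "(X \<xi> has_integral (1 *\<^sub>R P (l \<xi> 1) - 0 *\<^sub>R P (l \<xi> 0))) {0..1}"
      by (intro fundamental_theorem_of_calculus) (auto intro: has_vector_derivative_at_within)
    then show "integral {0..1} (X \<xi>) = P \<xi>" by (simp add: integral_unique l_def)
    have "((\<lambda>s. s *\<^sub>R Q (l \<xi> s)) has_vector_derivative Y \<xi> s) (at s)" if "s \<in> {0..1}" for s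
      using has_vector_derivative_scaleR[OF DERIV_ident dQ[OF that]] closed[OF lB[OF \<open>\<xi>\<in>?B\<close> that]]
      by (simp add: Y_def add_ac)
    then have "(Y \<xi> has_integral (1 *\<^sub>R Q (l \<xi> 1) - 0 *\<^sub>R Q (l \<xi> 0))) {0..1}"
      by (intro fundamental_theorem_of_calculus) (auto intro: has_vector_derivative_at_within)
    then show "integral {0..1} (Y \<xi>) = Q \<xi>" by (simp add: integral_unique l_def)
  qed
  have "(\<Gamma> has_derivative (\<lambda>v. Re v *\<^sub>R P \<xi> + Im v *\<^sub>R Q \<xi>)) (at \<xi>)" if "\<xi> \<in> ?B" for \<xi>
  proof -
    have "(\<Gamma> has_derivative integral (cbox 0 1) (fx \<xi>)) (at \<xi> within ?B)"
      unfolding \<Gamma>_def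
      by (rule leibniz_rule[OF df _ contfx \<open>\<xi> \<in> ?B\<close>]) (auto intro!: integrable_continuous_interval contf)
    moreover have "blinfun_apply (integral (cbox 0 1) (fx \<xi>)) v = Re v *\<^sub>R P \<xi> + Im v *\<^sub>R Q \<xi>" for v
    proof -
      have cfx: "continuous_on {0..1} (fx \<xi>)"
        using slice[of fx \<xi>] contfx that by (simp add: split_beta)
      have "blinfun_apply (integral {0..1} (fx \<xi>)) v = integral {0..1} (\<lambda>s. blinfun_apply (fx \<xi> s) v)"
        by (rule blinfun_apply_integral[OF integrable_continuous_interval[OF cfx]])
      also have "\<dots> = integral {0..1} (\<lambda>s. Re v *\<^sub>R X \<xi> s + Im v *\<^sub>R Y \<xi> s)"
        by (simp add: fx_apply)
      also have "\<dots> = integral {0..1} (\<lambda>s. Re v *\<^sub>R X \<xi> s) + integral {0..1} (\<lambda>s. Im v *\<^sub>R Y \<xi> s)"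
        using slice[OF contX(1) that] slice[OF contX(2) that]
        by (intro integral_add integrable_continuous_interval continuous_intros)
      also have "\<dots> = Re v *\<^sub>R P \<xi> + Im v *\<^sub>R Q \<xi>"
        using that by (simp add: intP)
      finally show ?thesis by simp
    qed
    ultimately show ?thesis
      using that at_within_open[OF that open_ball] by (metis (no_types, lifting) ext)
  qed
  then show ?thesis by blast
qed

text \<open>Here \<open>a\<close> and \<open>b\<close> are the images of 1 and \<open>\<i>\<close>
  under the differential of the projection and \<open>n\<close> is the gradient of the height. The
  matrix of \<open>Q\<close> is g / sqrt (det g) for the graph metric g = I + n n^T, and the
  hypotheses say that \<open>a\<close>, \<open>b\<close> are g-orthogonal of equal g-length. In a
  plane this forces \<open>Q a\<close> to be \<open>b\<close> turned by a right angle, with sign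
  \<open>e\<close> recording the orientation.\<close>

lemma graph_metric_conjugate:
  fixes a b n :: complex
  defines "W \<equiv> sqrt (1 + (Re n)\<^sup>2 + (Im n)\<^sup>2)"
  defines "Q \<equiv> \<lambda>v. Re v *\<^sub>R Complex ((1 + (Re n)\<^sup>2) / W) (Re n * Im n / W)
                + Im v *\<^sub>R Complex (Re n * Im n / W) ((1 + (Im n)\<^sup>2) / W)"
  defines "wa \<equiv> Re a * Re n + Im a * Im n" and "wb \<equiv> Re b * Re n + Im b * Im n"
  assumes norms: "(cmod a)\<^sup>2 + wa\<^sup>2 = (cmod b)\<^sup>2 + wb\<^sup>2"
    and orth: "Re a * Re b + Im a * Im b + wa * wb = 0"
    and nz: "a \<noteq> 0"
  shows "\<exists>e\<in>{1, -1}. Q a = - e * \<i> * b \<and> Q b = e * \<i> * a \<and> a + Q a \<noteq> 0"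
proof -
  obtain a1 a2 b1 b2 p q where [simp]: "a = Complex a1 a2" "b = Complex b1 b2" "n = Complex p q"
    by (metis complex.exhaust)
  have W: "W > 0" "W\<^sup>2 = 1 + p\<^sup>2 + q\<^sup>2"
    unfolding W_def by (auto simp: add_pos_nonneg)
  define u1 u2 v1 v2 where "u1 = (1 + p\<^sup>2) * a1 + p * q * a2" and "u2 = p * q * a1 + (1 + q\<^sup>2) * a2"
    and "v1 = (1 + p\<^sup>2) * b1 + p * q * b2" and "v2 = p * q * b1 + (1 + q\<^sup>2) * b2"
  define l where "l = a1\<^sup>2 + a2\<^sup>2 + (a1 * p + a2 * q)\<^sup>2"
  define J where "J = a1 * b2 - a2 * b1"
  have ua: "u1 * a1 + u2 * a2 = l" unfolding u1_def u2_def l_def by (simp add: algebra_simps power2_eq_square)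
  have orth': "a1 * b1 + a2 * b2 + (a1 * p + a2 * q) * (b1 * p + b2 * q) = 0"
    using orth by (simp add: wa_def wb_def)
  have l': "l = b1\<^sup>2 + b2\<^sup>2 + (b1 * p + b2 * q)\<^sup>2"
    using norms by (simp add: l_def wa_def wb_def cmod_def)
  have ub: "u1 * b1 + u2 * b2 = 0" using orth' unfolding u1_def u2_def by (simp add: algebra_simps power2_eq_square)
  have va: "v1 * a1 + v2 * a2 = 0" using orth' unfolding v1_def v2_def by (simp add: algebra_simps power2_eq_square)
  have vb: "v1 * b1 + v2 * b2 = l" unfolding l' v1_def v2_def by (simp add: algebra_simps power2_eq_square)
  have "(a1 \<noteq> 0 \<or> a2 \<noteq> 0)" using nz by (auto simp: complex_eq_iff)
  then have "a1\<^sup>2 + a2\<^sup>2 > 0" by (simp add: sum_power2_gt_zero_iff)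
  then have lpos: "l > 0" unfolding l_def by (smt (verit) zero_le_power2)
  \<comment> \<open>The Gram determinant of \<open>a\<close>, \<open>b\<close> in the graph metric
    equals det g times the squared Jacobian \<open>J\<close>; the entries of the Gram matrix are l,
    0, 0, l.\<close>
  have "l * l - 0 * 0 = (a1\<^sup>2 + a2\<^sup>2 + (a1 * p + a2 * q)\<^sup>2) * (b1\<^sup>2 + b2\<^sup>2 + (b1 * p + b2 * q)\<^sup>2)
      - (a1 * b1 + a2 * b2 + (a1 * p + a2 * q) * (b1 * p + b2 * q))\<^sup>2"
    using orth' l' by (simp add: l_def)
  also have "\<dots> = (1 + p\<^sup>2 + q\<^sup>2) * J\<^sup>2"
    unfolding J_def by algebra
  finally have "(W * J)\<^sup>2 = l\<^sup>2" using W(2) by (simp add: power_mult_distrib power2_eq_square)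
  then have "W * J = l \<or> W * J = - l" by (rule power2_eq_iff[THEN iffD1])
  then obtain e :: real where e: "e = 1 \<or> e = -1" "W * J = e * l" by force
  have e2: "e * e = 1" using e by auto
  have uJ: "u1 * J = l * b2" "u2 * J = - (l * b1)"
    unfolding ua[symmetric] J_def using ub by algebra+
  have vJ: "v1 * J = - (l * a2)" "v2 * J = l * a1"
    unfolding vb[symmetric] J_def using va by algebra+
  have le: "l = e * (W * J)" using e(2) e2 by (simp flip: mult.assoc)
  have "l * u1 = e * W * (u1 * J)" "l * u2 = e * W * (u2 * J)" "l * v1 = e * W * (v1 * J)" "l * v2 = e * W * (v2 * J)"
    by (subst le, simp)+
  then have "l * u1 = l * (e * W * b2)" "l * u2 = l * (- e * W * b1)" "l * v1 = l * (- e * W * a2)" "l * v2 = l * (e * W * a1)"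
    unfolding uJ vJ by (simp_all add: mult_ac)
  moreover have "l \<noteq> 0" using lpos by simp
  ultimately have u: "u1 = e * W * b2" "u2 = - e * W * b1" "v1 = - e * W * a2" "v2 = e * W * a1"
    by (simp_all only: mult_left_cancel[OF \<open>l \<noteq> 0\<close>])
  have Qa: "Q a = Complex (u1 / W) (u2 / W)" "Q b = Complex (v1 / W) (v2 / W)"
    unfolding Q_def u1_def u2_def v1_def v2_def
    by (auto simp: complex_eq_iff algebra_simps add_divide_distrib)
  have Q1: "Q a = - of_real e * \<i> * b" "Q b = of_real e * \<i> * a"
    unfolding Qa u using W(1) by (auto simp: complex_eq_iff)
  have "a1 * (a1 + u1 / W) + a2 * (a2 + u2 / W) = a1\<^sup>2 + a2\<^sup>2 + l / W"
    unfolding ua[symmetric] by (simp add: algebra_simps power2_eq_square add_divide_distrib)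
  also have "\<dots> > 0" using lpos W(1) by (simp add: add_nonneg_pos)
  finally have "a + Q a \<noteq> 0" unfolding Qa(1) by (auto simp: complex_eq_iff)
  then show ?thesis using Q1 e(1) by (intro bexI[of _ "of_real e"]) auto
qed

text \<open>Writing the factor as \<open>exp l\<close>, the maps exp (s l) g with s from 0 to 1 form
  a homotopy of loops that avoids 0.\<close>

lemma winding_number_mult_const:
  assumes "path g" "pathfinish g = pathstart g" "0 \<notin> path_image g" "\<kappa> \<noteq> 0"
  shows "winding_number (\<lambda>s. \<kappa> * g s) 0 = winding_number g 0"
proof -
  obtain l where l: "\<kappa> = exp l" using assms(4) exp_Ln by metis
  have "homotopic_loops (-{0}) g (\<lambda>s. \<kappa> * g s)"
    unfolding homotopic_loops
  proof (intro exI[of _ "\<lambda>y. exp (of_real (fst y) * l) * g (snd y)"] conjI ballI)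
    have "continuous_on ({0..1} \<times> {0..1}) (\<lambda>y::real\<times>real. g (snd y))"
      using assms(1) unfolding path_def by (rule continuous_on_compose2) (auto intro!: continuous_intros)
    then show "continuous_on ({0..1} \<times> {0..1}) (\<lambda>y. exp (of_real (fst y) * l) * g (snd y))"
      by (intro continuous_intros)
  qed (use assms l in \<open>auto simp: path_image_def pathstart_def pathfinish_def o_def\<close>)
  then show ?thesis using winding_number_homotopic_loops by metis
qed

text \<open>The differential is not assumed continuous, so a connectedness argument on K' is
  replaced by a topological one. The loop s -> K (z + e E(s)) - K z avoids 0 by injectivity, and
  moving z along a segment is a homotopy of such loops. Where K' is complex linear its winding
  number is 1, where K' is antilinear it is -1, so both types cannot occur.\<close>

lemma orientation_constant_on_ball:
  fixes K :: "complex \<Rightarrow> complex"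
  assumes der: "\<And>z. z \<in> ball c d \<Longrightarrow> (K has_derivative K' z) (at z)"
    and conf: "\<And>z. z \<in> ball c d \<Longrightarrow> K' z 1 \<noteq> 0 \<and> (K' z \<i> = \<i> * K' z 1 \<or> K' z \<i> = - \<i> * K' z 1)"
    and inj: "inj_on K (ball c d)"
  shows "(\<forall>z\<in>ball c d. K' z \<i> = \<i> * K' z 1) \<or> (\<forall>z\<in>ball c d. K' z \<i> = - \<i> * K' z 1)"
proof (rule ccontr)
  assume "\<not> ?thesis"
  then obtain z0 z1 where z0: "z0 \<in> ball c d" "K' z0 \<i> = \<i> * K' z0 1" and z1: "z1 \<in> ball c d" "K' z1 \<i> = - \<i> * K' z1 1"
    using conf by metis
  define E where "E = (\<lambda>s::real. exp (of_real (2 * pi * s) * \<i>))"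
  have E: "circlepath 0 1 = E" "reversepath (circlepath 0 1) = (\<lambda>s. cnj (E s))"
    by (auto simp: E_def circlepath reversepath_def exp_cnj[symmetric] fun_eq_iff algebra_simps exp_diff)
       (simp add: exp_cnj exp_minus field_simps)
  have E1: "cmod (E s) = 1" and E0: "E s \<noteq> 0" "cnj (E s) \<noteq> 0" "0 \<noteq> E s" "0 \<noteq> cnj (E s)" for s
    by (auto simp: E_def)
  have w1: "winding_number E 0 = 1"
    unfolding E(1)[symmetric] by (simp add: winding_number_circlepath_centre)
  have w2: "winding_number (\<lambda>s. cnj (E s)) 0 = -1"
    unfolding E(2)[symmetric] by (simp add: winding_number_circlepath_centre winding_number_reversepath path_image_circlepath)
  note wE = w1 w2
  have pE: "path E" "pathfinish E = pathstart E"
    unfolding E(1)[symmetric] by auto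
  have pE': "path (\<lambda>s. cnj (E s))" "pathfinish (\<lambda>s. cnj (E s)) = pathstart (\<lambda>s. cnj (E s))"
    unfolding E(2)[symmetric] by auto
  have lin: "K' z v = Re v *\<^sub>R K' z 1 + Im v *\<^sub>R K' z \<i>" if "z \<in> ball c d" for z v
  proof -
    interpret bounded_linear "K' z" using der[OF that] has_derivative_bounded_linear by blast
    have "v = Re v *\<^sub>R 1 + Im v *\<^sub>R \<i>" by (simp add: complex_eq_iff)
    then show ?thesis by (metis add scaleR)
  qed
  have small: "\<exists>e0>0. \<forall>v. cmod v \<le> e0 \<and> v \<noteq> 0 \<longrightarrow> cmod (K (z + v) - K z - K' z v) < cmod (K' z 1) * cmod v" if "z \<in> ball c d" for z
  proof -
    have "K' z 1 \<noteq> 0" using conf that by auto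
    then have pos: "0 < cmod (K' z 1) / 2" by simp
    have "(K has_derivative K' z) (at z within UNIV)" using der[OF that] by simp
    then obtain \<delta> where \<delta>: "\<delta> > 0" "\<forall>y. cmod (y - z) < \<delta> \<longrightarrow> cmod (K y - K z - K' z (y - z)) \<le> cmod (K' z 1) / 2 * cmod (y - z)"
      unfolding has_derivative_within_alt using pos by (metis iso_tuple_UNIV_I)
    show ?thesis
    proof (intro exI[of _ "\<delta>/2"] conjI allI impI)
      fix v assume v: "cmod v \<le> \<delta> / 2 \<and> v \<noteq> 0"
      then have "cmod (K (z + v) - K z - K' z v) \<le> cmod (K' z 1) / 2 * cmod v"
        using \<delta> by (auto dest!: spec[of _ "z + v"])
      also have "\<dots> < cmod (K' z 1) * cmod v" using v pos by simp
      finally show "cmod (K (z + v) - K z - K' z v) < cmod (K' z 1) * cmod v" .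
    qed (use \<delta> in auto)
  qed
  obtain e0 where e0: "e0 > 0" "\<And>v. cmod v \<le> e0 \<Longrightarrow> v \<noteq> 0 \<Longrightarrow> cmod (K (z0 + v) - K z0 - K' z0 v) < cmod (K' z0 1) * cmod v"
    using small[OF z0(1)] by blast
  obtain e1 where e1: "e1 > 0" "\<And>v. cmod v \<le> e1 \<Longrightarrow> v \<noteq> 0 \<Longrightarrow> cmod (K (z1 + v) - K z1 - K' z1 v) < cmod (K' z1 1) * cmod v"
    using small[OF z1(1)] by blast
  define \<rho> where "\<rho> = max (dist c z0) (dist c z1)"
  \<comment> \<open>Small enough for the first order approximation at both \<open>z0\<close> and
    \<open>z1\<close>, and for all circles centred on the segment between them to stay in the
    ball.\<close>
  define e where "e = min (min e0 e1) ((d - \<rho>) / 2)"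
  have \<rho>: "\<rho> < d" using z0 z1 by (auto simp: \<rho>_def)
  have e: "e > 0" "e \<le> e0" "e \<le> e1" "e \<le> (d - \<rho>) / 2" using e0(1) e1(1) \<rho> unfolding e_def by (simp_all add: min_def)
  have inb: "z + of_real e * E s \<in> ball c d" if "dist c z \<le> \<rho>" for z s
  proof -
    have "dist c (z + of_real e * E s) \<le> dist c z + dist z (z + of_real e * E s)" by (rule dist_triangle)
    also have "dist z (z + of_real e * E s) = e" using e by (simp add: dist_norm norm_mult E1)
    finally show ?thesis using that e \<rho> by auto
  qed
  have inb0: "z \<in> ball c d" if "dist c z \<le> \<rho>" for z using that \<rho> by auto
  define zt where "zt = (\<lambda>t::real. z0 + of_real t * (z1 - z0))"
  have ztl: "dist c (zt t) \<le> \<rho>" if "t \<in> {0..1}" for t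
  proof -
    have "z0 \<in> cball c \<rho>" "z1 \<in> cball c \<rho>" by (auto simp: \<rho>_def)
    moreover have "zt t = (1 - t) *\<^sub>R z0 + t *\<^sub>R z1" by (simp add: zt_def algebra_simps scaleR_conv_of_real)
    ultimately have "zt t \<in> cball c \<rho>" using that convexD_alt[OF convex_cball] by auto
    then show ?thesis by simp
  qed
  define g where "g = (\<lambda>z s. K (z + of_real e * E s) - K z)"
  have contK: "continuous_on (ball c d) K"
    using der has_derivative_continuous by (blast intro!: continuous_at_imp_continuous_on)
  have gnz: "g z s \<noteq> 0" if "dist c z \<le> \<rho>" for z s
  proof
    assume "g z s = 0"
    then have "z + of_real e * E s = z"
      by (intro inj_onD[OF inj _ inb[OF that] inb0[OF that]]) (simp add: g_def)
    then have "of_real e * E s = 0" by simp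
    then show False using e E1[of s] by auto
  qed
  have contE: "continuous_on S E" for S unfolding E_def by (intro continuous_intros)
  have E01: "E 1 = E 0" using pE(2) by (simp add: pathstart_def pathfinish_def)
  have hom: "homotopic_loops (-{0}) (g z0) (g z1)"
    unfolding homotopic_loops
  proof (intro exI[of _ "\<lambda>y. g (zt (fst y)) (snd y)"] conjI ballI)
    have "continuous_on ({0..1} \<times> {0..1}) (\<lambda>y::real\<times>real. E (snd y))"
      by (rule continuous_on_compose2[OF contE[of UNIV]]) (auto intro!: continuous_intros)
    then show "continuous_on ({0..1} \<times> {0..1}) (\<lambda>y. g (zt (fst y)) (snd y))"
      unfolding g_def zt_def
      by (intro continuous_intros continuous_on_compose2[OF contK])
         (use ztl inb inb0 in \<open>auto simp: zt_def\<close>)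
    show "(\<lambda>y. g (zt (fst y)) (snd y)) \<in> ({0..1} \<times> {0..1}) \<rightarrow> - {0}"
      using gnz ztl by auto
  qed (simp_all add: zt_def pathstart_def pathfinish_def o_def g_def E01)
  have pg: "path (g z)" if "dist c z \<le> \<rho>" for z
    unfolding path_def g_def
    by (intro continuous_intros continuous_on_compose2[OF contK] contE) (use inb that in auto)
  have lg: "pathfinish (g z) = pathstart (g z)" for z
    using pE by (simp add: pathstart_def pathfinish_def g_def)
  have w0: "winding_number (g z0) 0 = 1"
  proof -
    have k: "K' z0 1 \<noteq> 0" using conf z0 by auto
    have K0: "K' z0 v = K' z0 1 * v" for v
      using lin[OF z0(1), of v] z0(2) by (simp add: complex_eq_iff algebra_simps scaleR_conv_of_real)
    have "winding_number (\<lambda>s. (K' z0 1 * of_real e) * E s) 0 = winding_number E 0"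
      by (rule winding_number_mult_const) (use pE k e E0 in \<open>auto simp: path_image_def\<close>)
    moreover have "winding_number (g z0) 0 = winding_number (\<lambda>s. (K' z0 1 * of_real e) * E s) 0"
    proof (rule winding_number_nearby_loops_eq)
      show "path (\<lambda>s. (K' z0 1 * of_real e) * E s)" unfolding path_def by (intro continuous_intros contE)
      show "path (g z0)" by (rule pg) (auto simp: \<rho>_def)
      show "pathfinish (\<lambda>s. K' z0 1 * complex_of_real e * E s) = pathstart (\<lambda>s. K' z0 1 * complex_of_real e * E s)"
        using pE by (simp add: pathstart_def pathfinish_def)
      fix t :: real
      show "cmod (g z0 t - K' z0 1 * complex_of_real e * E t) < cmod (K' z0 1 * complex_of_real e * E t - 0)"
        using e0(2)[of "of_real e * E t"] e E0[of t] E1[of t] K0[of "of_real e * E t"]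
        by (auto simp: g_def norm_mult mult.assoc)
    qed (rule lg)
    ultimately show ?thesis using wE by simp
  qed
  have w1: "winding_number (g z1) 0 = -1"
  proof -
    have k: "K' z1 1 \<noteq> 0" using conf z1 by auto
    have K0: "K' z1 v = K' z1 1 * cnj v" for v
      using lin[OF z1(1), of v] z1(2) by (simp add: complex_eq_iff algebra_simps scaleR_conv_of_real)
    have "winding_number (\<lambda>s. (K' z1 1 * of_real e) * cnj (E s)) 0 = winding_number (\<lambda>s. cnj (E s)) 0"
      by (rule winding_number_mult_const) (use pE pE' k e E0 in \<open>auto simp: path_image_def\<close>)
    moreover have "winding_number (g z1) 0 = winding_number (\<lambda>s. (K' z1 1 * of_real e) * cnj (E s)) 0"
    proof (rule winding_number_nearby_loops_eq)
      show "path (\<lambda>s. (K' z1 1 * of_real e) * cnj (E s))" unfolding path_def by (intro continuous_intros contE)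
      show "path (g z1)" by (rule pg) (auto simp: \<rho>_def)
      show "pathfinish (\<lambda>s. K' z1 1 * complex_of_real e * cnj (E s)) = pathstart (\<lambda>s. K' z1 1 * complex_of_real e * cnj (E s))"
        using pE by (simp add: pathstart_def pathfinish_def)
      fix t :: real
      show "cmod (g z1 t - K' z1 1 * complex_of_real e * cnj (E t)) < cmod (K' z1 1 * complex_of_real e * cnj (E t) - 0)"
        using e1(2)[of "of_real e * E t"] e E0[of t] E1[of t] K0[of "of_real e * E t"]
        by (auto simp: g_def norm_mult mult.assoc)
    qed (rule lg)
    ultimately show ?thesis using wE by simp
  qed
  show False using winding_number_homotopic_loops[OF hom] w0 w1 by simp
qed

lemma quotient_derivative_identity:
  fixes W :: real
  assumes "W \<noteq> 0"
  shows "- f * (inverse W * (a * (A / W) + b * (B / W)) * inverse W) + (a * fx + b * fy) / W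
     = a * ((fx * (W * W) - f * A) / W ^ 3) + b * ((fy * (W * W) - f * B) / W ^ 3)"
  using assms by (simp add: field_simps power3_eq_cube)

text \<open>The minimal surface equation makes the two rows of the symmetric matrix g / sqrt (det g)
  closed one-forms; \<Gamma> is their common primitive, a map whose Jacobian matrix is g / sqrt (det
  g). It is the map that produces isothermal coordinates \<xi> + \<Gamma>(\<xi>) on the
  graph.\<close>

lemma minimal_graph_potential:
  fixes w :: "complex \<Rightarrow> real"
  assumes C2: "C2_with U w Dw D2w" and "open U" and sub: "ball c d \<subseteq> U"
    and mse: "\<And>z. z \<in> U \<Longrightarrow> (1 + (Dw z \<i>)\<^sup>2) * D2w z 1 1 - 2 * Dw z 1 * Dw z \<i> * D2w z 1 \<i>
        + (1 + (Dw z 1)\<^sup>2) * D2w z \<i> \<i> = 0"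
  defines "W \<equiv> \<lambda>z. sqrt (1 + (Dw z 1)\<^sup>2 + (Dw z \<i>)\<^sup>2)"
  shows "\<exists>\<Gamma>. \<forall>z\<in>ball c d. (\<Gamma> has_derivative
     (\<lambda>v. Re v *\<^sub>R Complex ((1 + (Dw z 1)\<^sup>2) / W z) (Dw z 1 * Dw z \<i> / W z)
        + Im v *\<^sub>R Complex (Dw z 1 * Dw z \<i> / W z) ((1 + (Dw z \<i>)\<^sup>2) / W z))) (at z)"
proof -
  define p q where "p = (\<lambda>z. Dw z 1)" and "q = (\<lambda>z. Dw z \<i>)"
  define r s t where "r = (\<lambda>z. D2w z 1 1)" and "s = (\<lambda>z. D2w z 1 \<i>)" and "t = (\<lambda>z. D2w z \<i> \<i>)"
  have lin: "blinfun_apply L v = Re v *\<^sub>R L 1 + Im v *\<^sub>R L \<i>" for L :: "complex \<Rightarrow>\<^sub>L 'x::real_normed_vector" and v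
  proof -
    have "v = Re v *\<^sub>R 1 + Im v *\<^sub>R \<i>" by (simp add: complex_eq_iff)
    from arg_cong[OF this, of "blinfun_apply L"] show ?thesis
      unfolding blinfun.add_right blinfun.scaleR_right .
  qed
  have dw: "(w has_derivative (\<lambda>v. Re v * p z + Im v * q z)) (at z)" if "z \<in> U" for z
  proof -
    have "blinfun_apply (Dw z) = (\<lambda>v. Re v * p z + Im v * q z)"
      by (rule ext, subst lin) (simp add: p_def q_def)
    moreover have "(w has_derivative blinfun_apply (Dw z)) (at z)" using C2 that unfolding C2_with_def by blast
    ultimately show ?thesis by simp
  qed
  have dDw: "((\<lambda>z. Dw z a) has_derivative (\<lambda>v. Re v * D2w z 1 a + Im v * D2w z \<i> a)) (at z)" if "z \<in> U" for z a
  proof -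
    have "(Dw has_derivative blinfun_apply (D2w z)) (at z)" using C2 that unfolding C2_with_def by auto
    then have "((\<lambda>z. Dw z a) has_derivative (\<lambda>v. D2w z v a)) (at z)"
      by (rule bounded_linear.has_derivative[OF blinfun.bounded_linear_left]) 
    moreover have "(\<lambda>v. blinfun_apply (D2w z v) a) = (\<lambda>v. Re v * D2w z 1 a + Im v * D2w z \<i> a)"
      by (rule ext, subst lin[of "D2w z"]) (simp only: blinfun.add_left blinfun.scaleR_left real_scaleR_def)
    ultimately show ?thesis by (rule has_derivative_eq_rhs)
  qed
  have contD2: "continuous_on U (\<lambda>z. D2w z a b)" for a b
  proof -
    have "continuous_on U D2w" using C2 unfolding C2_with_def by blast
    then show ?thesis by (rule bounded_linear.continuous_on[OF blinfun.bounded_linear_left, OF bounded_linear.continuous_on[OF blinfun.bounded_linear_left]])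
  qed
  have sym: "D2w z \<i> 1 = s z" if "z \<in> U" for z
  proof -
    have P: "\<And>z. z \<in> U \<Longrightarrow> (p has_derivative (\<lambda>v. Re v * D2w z 1 1 + Im v * D2w z \<i> 1)) (at z)"
      unfolding p_def by (rule dDw)
    have Q: "\<And>z. z \<in> U \<Longrightarrow> (q has_derivative (\<lambda>v. Re v * D2w z 1 \<i> + Im v * D2w z \<i> \<i>)) (at z)"
      unfolding q_def by (rule dDw)
    show ?thesis
      unfolding s_def using mixed_partials_eq[OF \<open>open U\<close> that dw P Q contD2 contD2] .
  qed
  have dp: "(p has_derivative (\<lambda>v. Re v * r z + Im v * s z)) (at z)" if "z \<in> U" for z
    using dDw[OF that, of 1] unfolding sym[OF that] p_def r_def .
  have dq: "(q has_derivative (\<lambda>v. Re v * s z + Im v * t z)) (at z)" if "z \<in> U" for z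
    using dDw[OF that, of \<i>] unfolding q_def s_def t_def .
  have Wpos: "W z > 0" "W z * W z = 1 + (p z)\<^sup>2 + (q z)\<^sup>2" for z
    unfolding W_def p_def q_def by (auto simp: add_pos_nonneg)
  have dW: "(W has_derivative (\<lambda>v. Re v * ((p z * r z + q z * s z) / W z) + Im v * ((p z * s z + q z * t z) / W z))) (at z)" if "z \<in> U" for z
  proof -
    have eq: "W = (\<lambda>z. sqrt (1 + (p z)\<^sup>2 + (q z)\<^sup>2))" by (simp add: W_def p_def q_def fun_eq_iff)
    have "0 < 1 + (p z)\<^sup>2 + (q z)\<^sup>2" by (simp add: add_pos_nonneg)
    moreover have "((\<lambda>z. 1 + (p z)\<^sup>2 + (q z)\<^sup>2) has_derivative
        (\<lambda>v. 2 * (Re v * r z + Im v * s z) * p z + 2 * (Re v * s z + Im v * t z) * q z)) (at z)"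
      unfolding power2_eq_square
      by (rule has_derivative_eq_rhs[OF has_derivative_add[OF has_derivative_add[OF has_derivative_const
            has_derivative_mult[OF dp[OF that] dp[OF that]]] has_derivative_mult[OF dq[OF that] dq[OF that]]]])
         (simp add: fun_eq_iff algebra_simps)
    ultimately have "((\<lambda>z. sqrt (1 + (p z)\<^sup>2 + (q z)\<^sup>2)) has_derivative (\<lambda>v. (2 * (Re v * r z + Im v * s z) * p z + 2 * (Re v * s z + Im v * t z) * q z) * (inverse (sqrt (1 + (p z)\<^sup>2 + (q z)\<^sup>2)) / 2))) (at z)"
      by (rule has_derivative_real_sqrt)
    then have *: "(W has_derivative (\<lambda>v. (2 * (Re v * r z + Im v * s z) * p z + 2 * (Re v * s z + Im v * t z) * q z) * (inverse (W z) / 2))) (at z)"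
      unfolding eq .
    show ?thesis
      by (rule has_derivative_eq_rhs[OF *], rule ext) (use Wpos(1)[of z] in \<open>simp add: field_simps\<close>)
  qed
  \<comment> \<open>The x- and y-derivatives of f / W over the common denominator W^3, so that
    closedness can be checked on numerators.\<close>
  define A1 where "A1 = (\<lambda>f fx z. (fx z * (W z * W z) - f z * (p z * r z + q z * s z)) / (W z ^ 3))"
  define A2 where "A2 = (\<lambda>f fy z. (fy z * (W z * W z) - f z * (p z * s z + q z * t z)) / (W z ^ 3))"
  have quot: "((\<lambda>z. f z / W z) has_derivative (\<lambda>v. Re v * A1 f fx z + Im v * A2 f fy z)) (at z)"
    if f: "(f has_derivative (\<lambda>v. Re v * fx z + Im v * fy z)) (at z)" and "z \<in> U" for f fx fy z
  proof -
    have "W z \<noteq> 0" using Wpos(1)[of z] by simp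
    show ?thesis
      apply (rule has_derivative_eq_rhs[OF has_derivative_divide[OF f dW[OF \<open>z\<in>U\<close>] \<open>W z \<noteq> 0\<close>]])
      using \<open>W z \<noteq> 0\<close> unfolding A1_def A2_def by - (rule ext, rule quotient_derivative_identity)
  qed
  define f11 f12 f22 where "f11 = (\<lambda>z. 1 + (p z)\<^sup>2)" and "f12 = (\<lambda>z. p z * q z)" and "f22 = (\<lambda>z. 1 + (q z)\<^sup>2)"
  define f11x f11y f12x f12y f22x f22y where
    "f11x = (\<lambda>z. 2 * p z * r z)" and "f11y = (\<lambda>z. 2 * p z * s z)"
    and "f12x = (\<lambda>z. r z * q z + p z * s z)" and "f12y = (\<lambda>z. s z * q z + p z * t z)"
    and "f22x = (\<lambda>z. 2 * q z * s z)" and "f22y = (\<lambda>z. 2 * q z * t z)"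
  have d11: "(f11 has_derivative (\<lambda>v. Re v * f11x z + Im v * f11y z)) (at z)"
    and d12: "(f12 has_derivative (\<lambda>v. Re v * f12x z + Im v * f12y z)) (at z)"
    and d22: "(f22 has_derivative (\<lambda>v. Re v * f22x z + Im v * f22y z)) (at z)" if "z \<in> U" for z
    unfolding f11_def f12_def f22_def f11x_def f11y_def f12x_def f12y_def f22x_def f22y_def
    unfolding power2_eq_square
      apply (rule has_derivative_eq_rhs[OF has_derivative_add[OF has_derivative_const has_derivative_mult[OF dp[OF that] dp[OF that]]]])
      apply (simp add: fun_eq_iff algebra_simps)
     apply (rule has_derivative_eq_rhs[OF has_derivative_mult[OF dp[OF that] dq[OF that]]])
     apply (simp add: fun_eq_iff algebra_simps)
    apply (rule has_derivative_eq_rhs[OF has_derivative_add[OF has_derivative_const has_derivative_mult[OF dq[OF that] dq[OF that]]]])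
    apply (simp add: fun_eq_iff algebra_simps)
    done
  have q11: "((\<lambda>z. f11 z / W z) has_derivative (\<lambda>v. Re v * A1 f11 f11x z + Im v * A2 f11 f11y z)) (at z)"
    if "z \<in> U" for z
    using d11[OF that] that by (rule quot)
  have q12: "((\<lambda>z. f12 z / W z) has_derivative (\<lambda>v. Re v * A1 f12 f12x z + Im v * A2 f12 f12y z)) (at z)"
    if "z \<in> U" for z
    using d12[OF that] that by (rule quot)
  have q22: "((\<lambda>z. f22 z / W z) has_derivative (\<lambda>v. Re v * A1 f22 f22x z + Im v * A2 f22 f22y z)) (at z)"
    if "z \<in> U" for z
    using d22[OF that] that by (rule quot)
  \<comment> \<open>The numerators of the two mixed derivatives differ by q times the minimal
    surface operator; for the second row the factor is p.\<close>
  have close1: "A2 f11 f11y z = A1 f12 f12x z" if "z \<in> U" for z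
  proof -
    have "(f12x z * (W z * W z) - f12 z * (p z * r z + q z * s z)) - (f11y z * (W z * W z) - f11 z * (p z * s z + q z * t z))
       = q z * ((1 + (q z)\<^sup>2) * r z - 2 * p z * q z * s z + (1 + (p z)\<^sup>2) * t z)"
      unfolding f11y_def f12x_def f11_def f12_def Wpos(2) by (simp add: algebra_simps power2_eq_square)
    then show ?thesis using mse[OF that] unfolding A1_def A2_def p_def q_def r_def s_def t_def by simp
  qed
  have close2: "A2 f12 f12y z = A1 f22 f22x z" if "z \<in> U" for z
  proof -
    have "(f12y z * (W z * W z) - f12 z * (p z * s z + q z * t z)) - (f22x z * (W z * W z) - f22 z * (p z * r z + q z * s z))
       = p z * ((1 + (q z)\<^sup>2) * r z - 2 * p z * q z * s z + (1 + (p z)\<^sup>2) * t z)"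
      unfolding f12y_def f22x_def f12_def f22_def Wpos(2) by (simp add: algebra_simps power2_eq_square)
    then show ?thesis using mse[OF that] unfolding A1_def A2_def p_def q_def r_def s_def t_def by simp
  qed
  have cpq: "continuous_on U p" "continuous_on U q" "continuous_on U W"
    using dp dq dW has_derivative_continuous by (blast intro!: continuous_at_imp_continuous_on)+
  have crst: "continuous_on U r" "continuous_on U s" "continuous_on U t"
    unfolding r_def s_def t_def by (rule contD2)+
  have Wn: "W z \<noteq> 0" for z using Wpos(1)[of z] by simp
  have Cder: "((\<lambda>z. Complex (g z) (k z)) has_derivative (\<lambda>v. Re v *\<^sub>R Complex gx kx + Im v *\<^sub>R Complex gy ky)) (at z)"
    if "(g has_derivative (\<lambda>v. Re v * gx + Im v * gy)) (at z)" "(k has_derivative (\<lambda>v. Re v * kx + Im v * ky)) (at z)"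
    for g k :: "complex \<Rightarrow> real" and gx gy kx ky z
    unfolding Complex_eq
    by (rule has_derivative_eq_rhs[OF has_derivative_add[OF has_derivative_of_real[OF that(1)]
          has_derivative_mult_right[OF has_derivative_of_real[OF that(2)]]]])
       (simp add: fun_eq_iff complex_eq_iff)
  have contC: "continuous_on S (\<lambda>z. Complex (g z) (k z))" if "continuous_on S g" "continuous_on S k" for S g k
    using that by (intro continuous_on_Complex)
  have cf: "continuous_on U f11" "continuous_on U f12" "continuous_on U f22" "continuous_on U f11x" "continuous_on U f11y"
     "continuous_on U f12x" "continuous_on U f12y" "continuous_on U f22x" "continuous_on U f22y"
    unfolding f11_def f12_def f22_def f11x_def f11y_def f12x_def f12y_def f22x_def f22y_def
    by (intro continuous_intros cpq crst)+
  have cA: "continuous_on U (A1 f fx)" "continuous_on U (A2 f fx)" if "continuous_on U f" "continuous_on U fx" for f fx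
    unfolding A1_def A2_def by (intro continuous_intros cpq crst that ballI; simp add: Wn)+
  note cA = cA[OF cf(1) cf(4)] cA[OF cf(1) cf(5)] cA[OF cf(2) cf(6)] cA[OF cf(2) cf(7)] cA[OF cf(3) cf(8)] cA[OF cf(3) cf(9)]
  have "\<exists>\<Gamma>. \<forall>z\<in>ball c d. (\<Gamma> has_derivative
     (\<lambda>v. Re v *\<^sub>R Complex (f11 z / W z) (f12 z / W z)
        + Im v *\<^sub>R Complex (f12 z / W z) (f22 z / W z))) (at z)"
  proof (rule closed_form_primitive)
    fix z assume "z \<in> ball c d"
    then have z: "z \<in> U" using sub by auto
    show "((\<lambda>z. Complex (f11 z / W z) (f12 z / W z)) has_derivative
       (\<lambda>v. Re v *\<^sub>R Complex (A1 f11 f11x z) (A1 f12 f12x z) + Im v *\<^sub>R Complex (A2 f11 f11y z) (A2 f12 f12y z))) (at z)"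
      using Cder[OF q11[OF z] q12[OF z]] .
    show "((\<lambda>z. Complex (f12 z / W z) (f22 z / W z)) has_derivative
       (\<lambda>v. Re v *\<^sub>R Complex (A1 f12 f12x z) (A1 f22 f22x z) + Im v *\<^sub>R Complex (A2 f12 f12y z) (A2 f22 f22y z))) (at z)"
      using Cder[OF q12[OF z] q22[OF z]] .
    show "Complex (A2 f11 f11y z) (A2 f12 f12y z) = Complex (A1 f12 f12x z) (A1 f22 f22x z)"
      using close1[OF z] close2[OF z] by simp
  qed (use cA in \<open>auto intro!: contC intro: continuous_on_subset[OF _ sub]\<close>)
  then show ?thesis by (simp add: f11_def f12_def f22_def p_def q_def)
qed

text \<open>With \<open>k\<close> = h + \<Gamma>(h) and \<open>m\<close> the conjugate of h -
  \<Gamma>(h), \<open>graph_metric_conjugate\<close> shows that at each point both satisfy the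
  Cauchy-Riemann equations or both the conjugate ones, with the same sign. Since \<open>k\<close> is
  injective, \<open>orientation_constant_on_ball\<close> makes the sign constant on a ball, so
  \<open>k\<close> and \<open>m\<close> are both holomorphic or both antiholomorphic, and h = (k +
  cnj m) / 2.\<close>

lemma conformal_graph_harmonic_locally:
  fixes w :: "complex \<Rightarrow> real" and h :: "complex \<Rightarrow> complex"
  assumes C2: "C2_with U w Dw D2w" and "open U" and "open A" and "z0 \<in> A"
    and mse: "\<And>z. z \<in> U \<Longrightarrow> (1 + (Dw z \<i>)\<^sup>2) * D2w z 1 1 - 2 * Dw z 1 * Dw z \<i> * D2w z 1 \<i>
        + (1 + (Dw z 1)\<^sup>2) * D2w z \<i> \<i> = 0"
    and hA: "\<And>z. z \<in> A \<Longrightarrow> h z \<in> U" and inj: "inj_on h A"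
    and der: "\<And>z. z \<in> A \<Longrightarrow> (h has_derivative h' z) (at z)"
    and conf: "\<And>z. z \<in> A \<Longrightarrow> h' z 1 \<noteq> 0 \<and> (cmod (h' z 1))\<^sup>2 + (Dw (h z) (h' z 1))\<^sup>2 = (cmod (h' z \<i>))\<^sup>2 + (Dw (h z) (h' z \<i>))\<^sup>2
       \<and> Re (h' z 1) * Re (h' z \<i>) + Im (h' z 1) * Im (h' z \<i>) + Dw (h z) (h' z 1) * Dw (h z) (h' z \<i>) = 0"
  shows "\<exists>r u v. r > 0 \<and> ball z0 r \<subseteq> A \<and> u holomorphic_on ball z0 r \<and> v holomorphic_on ball z0 r
      \<and> (\<forall>z\<in>ball z0 r. h z = u z + cnj (v z))"
proof -
  define W where "W = (\<lambda>z. sqrt (1 + (Dw z 1)\<^sup>2 + (Dw z \<i>)\<^sup>2))"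
  define Q where "Q = (\<lambda>z v. Re v *\<^sub>R Complex ((1 + (Dw z 1)\<^sup>2) / W z) (Dw z 1 * Dw z \<i> / W z)
        + Im v *\<^sub>R Complex (Dw z 1 * Dw z \<i> / W z) ((1 + (Dw z \<i>)\<^sup>2) / W z))"
  have lin: "blinfun_apply L v = Re v * L 1 + Im v * L \<i>" for L :: "complex \<Rightarrow>\<^sub>L real" and v
  proof -
    have "v = Re v *\<^sub>R 1 + Im v *\<^sub>R \<i>" by (simp add: complex_eq_iff)
    from arg_cong[OF this, of "blinfun_apply L"] show ?thesis
      unfolding blinfun.add_right blinfun.scaleR_right real_scaleR_def .
  qed
  obtain d where d: "d > 0" "ball (h z0) d \<subseteq> U"
    using \<open>open U\<close> hA[OF \<open>z0 \<in> A\<close>] openE by blast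
  obtain \<Gamma> where \<Gamma>: "\<And>z. z \<in> ball (h z0) d \<Longrightarrow> (\<Gamma> has_derivative Q z) (at z)"
    using minimal_graph_potential[OF C2 \<open>open U\<close> d(2) mse] unfolding Q_def W_def by blast
  have "continuous (at z0) h" using der[OF \<open>z0\<in>A\<close>] has_derivative_continuous by blast
  then obtain r1 where r1: "r1 > 0" "\<And>z. dist z z0 < r1 \<Longrightarrow> dist (h z) (h z0) < d"
    using d(1) unfolding continuous_at_eps_delta by blast
  obtain r2 where r2: "r2 > 0" "ball z0 r2 \<subseteq> A" using \<open>open A\<close> \<open>z0 \<in> A\<close> openE by blast
  define r where "r = min r1 r2"
  have r: "r > 0" "ball z0 r \<subseteq> A" using r1 r2 by (auto simp: r_def)
  have hB: "h z \<in> ball (h z0) d" if "z \<in> ball z0 r" for z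
    using r1(2)[of z] that by (simp add: r_def dist_commute)
  define k where "k = (\<lambda>z. h z + \<Gamma> (h z))"
  define m where "m = (\<lambda>z. cnj (h z - \<Gamma> (h z)))"
  define k' where "k' = (\<lambda>z v. h' z v + Q (h z) (h' z v))"
  define m' where "m' = (\<lambda>z v. cnj (h' z v - Q (h z) (h' z v)))"
  have dG: "((\<lambda>z. \<Gamma> (h z)) has_derivative (\<lambda>v. Q (h z) (h' z v))) (at z)" if "z \<in> ball z0 r" for z
    using has_derivative_compose[OF der \<Gamma>[OF hB[OF that]]] that r by auto
  have dk: "(k has_derivative k' z) (at z)" if "z \<in> ball z0 r" for z
    unfolding k_def k'_def using that r by (intro has_derivative_add der dG) auto
  have dm: "(m has_derivative m' z) (at z)" if "z \<in> ball z0 r" for z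
    unfolding m_def m'_def using that r by (intro has_derivative_cnj has_derivative_diff der dG) auto
  have alg: "\<exists>e\<in>{1,-1}. Q (h z) (h' z 1) = - e * \<i> * h' z \<i> \<and> Q (h z) (h' z \<i>) = e * \<i> * h' z 1 \<and> h' z 1 + Q (h z) (h' z 1) \<noteq> 0"
    if "z \<in> ball z0 r" for z
  proof -
    have zA: "z \<in> A" using that r by auto
    show ?thesis
      using graph_metric_conjugate[of "h' z 1" "Complex (Dw (h z) 1) (Dw (h z) \<i>)" "h' z \<i>"] conf[OF zA]
        lin[of "Dw (h z)" "h' z 1"] lin[of "Dw (h z)" "h' z \<i>"]
      unfolding Q_def W_def by simp
  qed
  \<comment> \<open>The derivative of \<xi> + \<Gamma>(\<xi>) is I + Q with Q positive semidefinite,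
    so along any segment of direction v its inner product with v is strictly increasing. Hence
    \<open>k\<close> inherits injectivity from \<open>h\<close>.\<close>
  have injk: "inj_on k (ball z0 r)"
  proof (rule inj_onI, rule ccontr)
    fix a b assume ab: "a \<in> ball z0 r" "b \<in> ball z0 r" "k a = k b" "a \<noteq> b"
    define x y where "x = h a" and "y = h b"
    have xy: "x \<in> ball (h z0) d" "y \<in> ball (h z0) d" using hB ab by (auto simp: x_def y_def)
    have ne: "x \<noteq> y" using inj_onD[OF inj, of a b] ab r(2) unfolding x_def y_def by blast
    define v where "v = y - x"
    define l where "l = (\<lambda>s. x + of_real s * v)"
    have lB: "l s \<in> ball (h z0) d" if "0 \<le> s" "s \<le> 1" for s
    proof -
      have "l s = (1 - s) *\<^sub>R x + s *\<^sub>R y" by (simp add: l_def v_def algebra_simps scaleR_conv_of_real)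
      then show ?thesis using convexD_alt[OF convex_ball xy, of s] that by simp
    qed
    have Qpos: "v \<bullet> Q z v \<ge> 0" for z
    proof -
      obtain p q where pq: "p = Dw z 1" "q = Dw z \<i>" by blast
      have "v \<bullet> Q z v = ((Re v)\<^sup>2 + (Im v)\<^sup>2 + (Re v * p + Im v * q)\<^sup>2) / W z"
        unfolding Q_def pq[symmetric] inner_complex_def by (simp add: algebra_simps add_divide_distrib power2_eq_square)
      then show ?thesis unfolding W_def by (simp add: add_nonneg_nonneg)
    qed
    have "((\<lambda>s. v \<bullet> (l s + \<Gamma> (l s))) has_real_derivative v \<bullet> (v + Q (l s) v)) (at s)" if "0 \<le> s" "s \<le> 1" for s
    proof -
      have "((\<lambda>s. \<Gamma> (l s)) has_vector_derivative Q (l s) v) (at s)"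
        using has_vector_derivative_along_line[OF \<Gamma>[OF lB[OF that], unfolded l_def]] unfolding l_def by simp
      moreover have "(l has_vector_derivative v) (at s)"
        unfolding l_def by (auto intro!: derivative_eq_intros has_vector_derivative_real_field)
      ultimately have "((\<lambda>s. l s + \<Gamma> (l s)) has_vector_derivative (v + Q (l s) v)) (at s)"
        by (rule has_vector_derivative_add[rotated])
      then show ?thesis unfolding has_real_derivative_iff_has_vector_derivative
        by (rule bounded_linear.has_vector_derivative[OF bounded_linear_inner_right])
    qed
    then have "\<exists>s. 0 < s \<and> s < 1 \<and> v \<bullet> (l 1 + \<Gamma> (l 1)) - v \<bullet> (l 0 + \<Gamma> (l 0)) = (1 - 0) * (v \<bullet> (v + Q (l s) v))"
      by (intro MVT2) auto
    moreover have "v \<bullet> (l 1 + \<Gamma> (l 1)) = v \<bullet> (l 0 + \<Gamma> (l 0))"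
      using ab(3) by (simp add: l_def v_def k_def x_def y_def)
    ultimately obtain s where "v \<bullet> (v + Q (l s) v) = 0" by auto
    then have "v \<bullet> v \<le> 0" using Qpos[of "l s"] by (simp add: inner_add_right)
    then have "v = 0" by (metis inner_ge_zero inner_eq_zero_iff order_antisym)
    then show False using ne by (simp add: v_def)
  qed
  have konf: "k' z 1 \<noteq> 0 \<and> (k' z \<i> = \<i> * k' z 1 \<or> k' z \<i> = - \<i> * k' z 1)"
    and mk: "k' z \<i> = \<i> * k' z 1 \<Longrightarrow> m' z \<i> = \<i> * m' z 1" and mk': "k' z \<i> = - \<i> * k' z 1 \<Longrightarrow> m' z \<i> = - \<i> * m' z 1"
    if zb: "z \<in> ball z0 r" for z
  proof -
    obtain e where e: "e \<in> {1,-1}" "Q (h z) (h' z 1) = - e * \<i> * h' z \<i>" "Q (h z) (h' z \<i>) = e * \<i> * h' z 1" "h' z 1 + Q (h z) (h' z 1) \<noteq> 0"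
      using alg[OF zb] by blast
    have k1: "k' z 1 \<noteq> 0" using e(4) by (simp add: k'_def)
    have ki: "k' z \<i> = e * \<i> * k' z 1" using e(1) unfolding k'_def e(2,3) by (auto simp: algebra_simps)
    have mi: "m' z \<i> = e * \<i> * m' z 1" using e(1) unfolding m'_def e(2,3) by (auto simp: algebra_simps)
    show "k' z 1 \<noteq> 0 \<and> (k' z \<i> = \<i> * k' z 1 \<or> k' z \<i> = - \<i> * k' z 1)"
      using k1 ki e(1) by auto
    have "e = 1" if "k' z \<i> = \<i> * k' z 1"
      using that ki k1 by (simp)
    then show "k' z \<i> = \<i> * k' z 1 \<Longrightarrow> m' z \<i> = \<i> * m' z 1" using mi by simp
    have "e = -1" if "k' z \<i> = - \<i> * k' z 1"
      using that ki k1 e(1) by (auto simp: complex_eq_iff)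
    then show "k' z \<i> = - \<i> * k' z 1 \<Longrightarrow> m' z \<i> = - \<i> * m' z 1" using mi by simp
  qed
  \<comment> \<open>Differentiability at every point together with the Cauchy-Riemann equation gives
    a complex derivative at every point of an open set, which already is holomorphy.\<close>
  have hol: "f holomorphic_on ball z0 r"
    if df: "\<And>z. z \<in> ball z0 r \<Longrightarrow> (f has_derivative f' z) (at z)" and fi: "\<And>z. z \<in> ball z0 r \<Longrightarrow> f' z \<i> = \<i> * f' z 1" for f f'
    unfolding holomorphic_on_def
  proof
    fix z assume zb: "z \<in> ball z0 r"
    interpret bounded_linear "f' z" using df[OF zb] has_derivative_bounded_linear by blast
    have "f' z v = f' z 1 * v" for v
    proof -
      have "v = Re v *\<^sub>R 1 + Im v *\<^sub>R \<i>" by (simp add: complex_eq_iff)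
      then have "f' z v = Re v *\<^sub>R f' z 1 + Im v *\<^sub>R f' z \<i>" by (metis add scaleR)
      then show ?thesis using fi[OF zb] by (simp add: complex_eq_iff algebra_simps)
    qed
    then have "f' z = (*) (f' z 1)" by (rule ext)
    then have "(f has_field_derivative f' z 1) (at z)" using df[OF zb] unfolding has_field_derivative_def by simp
    then show "f field_differentiable at z within ball z0 r"
      using field_differentiable_def has_field_derivative_at_within by blast
  qed
  have hkm: "h z = (k z + cnj (m z)) / 2" for z by (simp add: k_def m_def)
  from orientation_constant_on_ball[OF dk konf injk] show ?thesis
  proof
    assume *: "\<forall>z\<in>ball z0 r. k' z \<i> = \<i> * k' z 1"
    have "k holomorphic_on ball z0 r" "m holomorphic_on ball z0 r"
      using hol[OF dk] hol[OF dm] * mk by auto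
    then show ?thesis using r hkm
      by (intro exI[of _ r] exI[of _ "\<lambda>z. k z / 2"] exI[of _ "\<lambda>z. m z / 2"])
         (auto intro!: holomorphic_intros simp: add_divide_distrib)
  next
    assume *: "\<forall>z\<in>ball z0 r. k' z \<i> = - \<i> * k' z 1"
    have "(\<lambda>z. cnj (k z)) holomorphic_on ball z0 r" "(\<lambda>z. cnj (m z)) holomorphic_on ball z0 r"
      using hol[OF has_derivative_cnj[OF dk]] hol[OF has_derivative_cnj[OF dm]] * mk' by auto
    then show ?thesis using r hkm
      by (intro exI[of _ r] exI[of _ "\<lambda>z. cnj (m z) / 2"] exI[of _ "\<lambda>z. cnj (k z) / 2"])
         (auto intro!: holomorphic_intros simp: add_divide_distrib)
  qed
qed

section \<open>Circle means and Fourier coefficients of continuous functions\<close>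

definition circle_mean :: "(real \<Rightarrow> 'a::real_normed_vector) \<Rightarrow> 'a" where
  "circle_mean f = integral {0..2*pi} f /\<^sub>R (2*pi)"

abbreviation circle_cont :: "(real \<Rightarrow> 'a::topological_space) \<Rightarrow> bool" where
  "circle_cont f \<equiv> continuous_on {0..2*pi} f"

lemma circle_mean_const [simp]: "circle_mean (\<lambda>\<theta>. c) = (c::'a::euclidean_space)"
  by (simp add: circle_mean_def)

lemma circle_mean_add:
  fixes f g :: "real \<Rightarrow> 'a::euclidean_space"
  assumes "circle_cont f" "circle_cont g"
  shows "circle_mean (\<lambda>\<theta>. f \<theta> + g \<theta>) = circle_mean f + circle_mean g"
  unfolding circle_mean_def
  by (subst integral_add) (auto intro!: integrable_continuous_interval assms simp: scaleR_add_right)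

lemma circle_mean_diff:
  fixes f g :: "real \<Rightarrow> 'a::euclidean_space"
  assumes "circle_cont f" "circle_cont g"
  shows "circle_mean (\<lambda>\<theta>. f \<theta> - g \<theta>) = circle_mean f - circle_mean g"
  unfolding circle_mean_def
  by (subst integral_diff) (auto intro!: integrable_continuous_interval assms simp: scaleR_diff_right)

lemma circle_mean_sum:
  fixes f :: "'i \<Rightarrow> real \<Rightarrow> 'a::euclidean_space"
  assumes "finite S" "\<And>i. i \<in> S \<Longrightarrow> circle_cont (f i)"
  shows "circle_mean (\<lambda>\<theta>. \<Sum>i\<in>S. f i \<theta>) = (\<Sum>i\<in>S. circle_mean (f i))"
  unfolding circle_mean_def
  by (subst integral_sum) (auto intro!: integrable_continuous_interval assms simp: scaleR_sum_right)

lemma circle_mean_bounded_linear: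
  fixes f :: "real \<Rightarrow> 'a::euclidean_space" and L :: "'a \<Rightarrow> 'b::euclidean_space"
  assumes "bounded_linear L" "circle_cont f"
  shows "circle_mean (\<lambda>\<theta>. L (f \<theta>)) = L (circle_mean f)"
proof -
  interpret bounded_linear L by fact
  have "integral {0..2*pi} (L \<circ> f) = L (integral {0..2*pi} f)"
    by (rule integral_linear[OF integrable_continuous_interval[OF assms(2)] assms(1)])
  then show ?thesis unfolding circle_mean_def by (simp add: o_def scaleR)
qed

lemma circle_mean_mult_right:
  fixes f :: "real \<Rightarrow> complex"
  assumes "circle_cont f"
  shows "circle_mean (\<lambda>\<theta>. c * f \<theta>) = c * circle_mean f"
  by (rule circle_mean_bounded_linear[OF bounded_linear_mult_right assms])

lemma circle_mean_mult_right_real: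
  fixes f :: "real \<Rightarrow> real"
  assumes "circle_cont f"
  shows "circle_mean (\<lambda>\<theta>. c * f \<theta>) = c * circle_mean f"
  by (rule circle_mean_bounded_linear[OF bounded_linear_mult_right assms])

lemma circle_mean_mono:
  fixes f g :: "real \<Rightarrow> real"
  assumes "circle_cont f" "circle_cont g" "\<And>\<theta>. \<theta> \<in> {0..2*pi} \<Longrightarrow> f \<theta> \<le> g \<theta>"
  shows "circle_mean f \<le> circle_mean g"
  unfolding circle_mean_def
  by (auto intro!: mult_left_mono integral_le integrable_continuous_interval assms)

lemma circle_mean_norm_le:
  fixes f :: "real \<Rightarrow> 'a::euclidean_space"
  assumes "circle_cont f" "\<And>\<theta>. \<theta> \<in> {0..2*pi} \<Longrightarrow> norm (f \<theta>) \<le> B"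
  shows "norm (circle_mean f) \<le> B"
proof -
  have "norm (integral {0..2*pi} f) \<le> B * (2*pi - 0)"
    using assms by (intro integral_bound) auto
  then show ?thesis unfolding circle_mean_def by (simp add: field_simps)
qed

definition fourier :: "(real \<Rightarrow> complex) \<Rightarrow> int \<Rightarrow> complex" where
  "fourier f n = circle_mean (\<lambda>\<theta>. f \<theta> * cis (- (of_int n * \<theta>)))"

lemma continuous_on_cis_of_int [continuous_intros]:
  "continuous_on S (\<lambda>\<theta>. cis (of_int n * \<theta>))" "continuous_on S (\<lambda>\<theta>. cis (- (of_int n * \<theta>)))"
  by (intro continuous_intros)+

lemma circle_mean_cis: "circle_mean (\<lambda>\<theta>. cis (of_int n * \<theta>)) = (if n = 0 then 1 else 0)"
proof (cases "n = 0")
  case False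
  have "((\<lambda>\<theta>. cis (of_int n * \<theta>)) has_integral (cis (of_int n * (2*pi)) / (\<i> * of_int n) - cis (of_int n * 0) / (\<i> * of_int n))) {0..2*pi}"
  proof (rule fundamental_theorem_of_calculus)
    fix x :: real
    have "((\<lambda>z. exp (\<i> * of_int n * z) / (\<i> * of_int n)) has_field_derivative exp (\<i> * of_int n * of_real x)) (at (of_real x))"
      by (auto intro!: derivative_eq_intros simp: False)
    from has_vector_derivative_real_field[OF this]
    show "((\<lambda>\<theta>. cis (of_int n * \<theta>) / (\<i> * of_int n)) has_vector_derivative cis (of_int n * x)) (at x within {0..2*pi})"
      by (simp add: cis_conv_exp mult.assoc)
  qed simp
  moreover have "cis (of_int n * (2*pi)) = 1" by (metis cis_multiple_2pi Ints_of_int mult.commute)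
  ultimately show ?thesis using False by (simp add: circle_mean_def integral_unique)
qed simp

lemma fourier_cis: "fourier (\<lambda>\<theta>. cis (of_int m * \<theta>)) n = (if m = n then 1 else 0)"
proof -
  have "cis (of_int m * \<theta>) * cis (- (of_int n * \<theta>)) = cis (of_int (m - n) * \<theta>)" for \<theta>
    by (simp add: cis_mult algebra_simps)
  then have "fourier (\<lambda>\<theta>. cis (of_int m * \<theta>)) n = circle_mean (\<lambda>\<theta>. cis (of_int (m - n) * \<theta>))"
    unfolding fourier_def by (simp only:)
  then show ?thesis unfolding circle_mean_cis by simp
qed

lemma circle_mean_mult_trig_cnj:
  assumes "circle_cont f" "finite S"
  shows "circle_mean (\<lambda>\<theta>. f \<theta> * cnj (\<Sum>n\<in>S. a n * cis (of_int n * \<theta>))) = (\<Sum>n\<in>S. cnj (a n) * fourier f n)"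
proof -
  have "circle_mean (\<lambda>\<theta>. f \<theta> * cnj (\<Sum>n\<in>S. a n * cis (of_int n * \<theta>)))
     = circle_mean (\<lambda>\<theta>. \<Sum>n\<in>S. cnj (a n) * (f \<theta> * cis (- (of_int n * \<theta>))))"
    by (rule arg_cong[of _ _ circle_mean]) (simp add: sum_distrib_left cis_cnj mult_ac fun_eq_iff)
  also have "\<dots> = (\<Sum>n\<in>S. circle_mean (\<lambda>\<theta>. cnj (a n) * (f \<theta> * cis (- (of_int n * \<theta>)))))"
    by (rule circle_mean_sum) (use assms in \<open>auto intro!: continuous_intros\<close>)
  also have "\<dots> = (\<Sum>n\<in>S. cnj (a n) * fourier f n)"
    unfolding fourier_def
    by (intro sum.cong refl circle_mean_mult_right) (use assms in \<open>auto intro!: continuous_intros\<close>)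
  finally show ?thesis .
qed

lemma continuous_on_trig [continuous_intros]:
  "continuous_on T (\<lambda>\<theta>. \<Sum>n\<in>S. a n * cis (of_int n * \<theta>))"
  by (intro continuous_intros)

lemma fourier_trig:
  assumes "finite S"
  shows "fourier (\<lambda>\<theta>. \<Sum>n\<in>S. a n * cis (of_int n * \<theta>)) m = (if m \<in> S then a m else 0)"
proof -
  have "fourier (\<lambda>\<theta>. \<Sum>n\<in>S. a n * cis (of_int n * \<theta>)) m
      = circle_mean (\<lambda>\<theta>. \<Sum>n\<in>S. a n * (cis (of_int n * \<theta>) * cis (- (of_int m * \<theta>))))"
    unfolding fourier_def by (simp only: sum_distrib_right mult.assoc)
  also have "\<dots> = (\<Sum>n\<in>S. circle_mean (\<lambda>\<theta>. a n * (cis (of_int n * \<theta>) * cis (- (of_int m * \<theta>)))))"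
    by (rule circle_mean_sum) (use assms in \<open>auto intro!: continuous_intros\<close>)
  also have "\<dots> = (\<Sum>n\<in>S. a n * fourier (\<lambda>\<theta>. cis (of_int n * \<theta>)) m)"
    unfolding fourier_def
    by (intro sum.cong refl circle_mean_mult_right) (auto intro!: continuous_intros)
  also have "\<dots> = (\<Sum>n\<in>S. if n = m then a n else 0)"
    by (intro sum.cong) (auto simp: fourier_cis)
  finally show ?thesis using assms by simp
qed

text \<open>Pythagoras: after expanding the square, the mean of f times the conjugate partial sum
  and the mean of the squared partial sum are both the sum of the squared coefficients.\<close>

lemma bessel_identity:
  assumes f: "circle_cont f" and S: "finite S"
  shows "circle_mean (\<lambda>\<theta>. (cmod (f \<theta> - (\<Sum>n\<in>S. fourier f n * cis (of_int n * \<theta>))))\<^sup>2)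
     = circle_mean (\<lambda>\<theta>. (cmod (f \<theta>))\<^sup>2) - (\<Sum>n\<in>S. (cmod (fourier f n))\<^sup>2)"
proof -
  define P where "P = (\<lambda>\<theta>. \<Sum>n\<in>S. fourier f n * cis (of_int n * \<theta>))"
  have cP: "circle_cont P" unfolding P_def by (intro continuous_intros)
  have fP: "circle_mean (\<lambda>\<theta>. f \<theta> * cnj (P \<theta>)) = of_real (\<Sum>n\<in>S. (cmod (fourier f n))\<^sup>2)"
    unfolding P_def circle_mean_mult_trig_cnj[OF f S] of_real_sum
    by (intro sum.cong refl) (simp add: complex_norm_square mult.commute del: of_real_power)
  have PP: "circle_mean (\<lambda>\<theta>. P \<theta> * cnj (P \<theta>)) = of_real (\<Sum>n\<in>S. (cmod (fourier f n))\<^sup>2)"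
    unfolding P_def circle_mean_mult_trig_cnj[OF cP[unfolded P_def] S] fourier_trig[OF S] of_real_sum
    by (intro sum.cong refl) (simp add: complex_norm_square mult.commute del: of_real_power)
  have Re_mean: "circle_mean (\<lambda>\<theta>. Re (g \<theta>)) = Re (circle_mean g)" if "circle_cont g" for g
    by (rule circle_mean_bounded_linear[OF bounded_linear_Re that])
  have "(cmod (f \<theta> - P \<theta>))\<^sup>2 = ((cmod (f \<theta>))\<^sup>2 - 2 * Re (f \<theta> * cnj (P \<theta>))) + Re (P \<theta> * cnj (P \<theta>))" for \<theta>
    unfolding cmod_power2 by (simp add: power2_eq_square algebra_simps)
  then have "circle_mean (\<lambda>\<theta>. (cmod (f \<theta> - P \<theta>))\<^sup>2)
     = circle_mean (\<lambda>\<theta>. ((cmod (f \<theta>))\<^sup>2 - 2 * Re (f \<theta> * cnj (P \<theta>))) + Re (P \<theta> * cnj (P \<theta>)))" by simp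
  also have "\<dots> = circle_mean (\<lambda>\<theta>. (cmod (f \<theta>))\<^sup>2 - 2 * Re (f \<theta> * cnj (P \<theta>))) + circle_mean (\<lambda>\<theta>. Re (P \<theta> * cnj (P \<theta>)))"
    by (rule circle_mean_add) (intro continuous_intros f cP)+
  also have "circle_mean (\<lambda>\<theta>. (cmod (f \<theta>))\<^sup>2 - 2 * Re (f \<theta> * cnj (P \<theta>))) = circle_mean (\<lambda>\<theta>. (cmod (f \<theta>))\<^sup>2) - circle_mean (\<lambda>\<theta>. 2 * Re (f \<theta> * cnj (P \<theta>)))"
    by (rule circle_mean_diff) (intro continuous_intros f cP)+
  also have "circle_mean (\<lambda>\<theta>. 2 * Re (f \<theta> * cnj (P \<theta>))) = 2 * circle_mean (\<lambda>\<theta>. Re (f \<theta> * cnj (P \<theta>)))"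
    by (rule circle_mean_mult_right_real) (intro continuous_intros f cP)+
  also have "circle_mean (\<lambda>\<theta>. Re (f \<theta> * cnj (P \<theta>))) = (\<Sum>n\<in>S. (cmod (fourier f n))\<^sup>2)"
    by (subst Re_mean) (auto intro!: continuous_intros f cP simp: fP simp del: of_real_sum of_real_power)
  also have "circle_mean (\<lambda>\<theta>. Re (P \<theta> * cnj (P \<theta>))) = (\<Sum>n\<in>S. (cmod (fourier f n))\<^sup>2)"
    by (subst Re_mean) (auto intro!: continuous_intros cP simp: PP simp del: of_real_sum of_real_power complex_mult_cnj)
  also have "circle_mean (\<lambda>\<theta>. (cmod (f \<theta>))\<^sup>2) - 2 * (\<Sum>n\<in>S. (cmod (fourier f n))\<^sup>2) + (\<Sum>n\<in>S. (cmod (fourier f n))\<^sup>2)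
     = circle_mean (\<lambda>\<theta>. (cmod (f \<theta>))\<^sup>2) - (\<Sum>n\<in>S. (cmod (fourier f n))\<^sup>2)" by simp
  finally show ?thesis unfolding P_def .
qed

lemma bessel_inequality:
  assumes f: "circle_cont f" and S: "finite S"
  shows "(\<Sum>n\<in>S. (cmod (fourier f n))\<^sup>2) \<le> circle_mean (\<lambda>\<theta>. (cmod (f \<theta>))\<^sup>2)"
proof -
  have "circle_mean (\<lambda>\<theta>. 0) \<le> circle_mean (\<lambda>\<theta>. (cmod (f \<theta> - (\<Sum>n\<in>S. fourier f n * cis (of_int n * \<theta>))))\<^sup>2)"
    by (rule circle_mean_mono) (auto intro!: continuous_intros f)
  then show ?thesis unfolding bessel_identity[OF assms] by simp
qed

text \<open>The half of Parseval's identity that needs convergence, in a quantitative form for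
  uniformly approximating partial sums.\<close>

lemma parseval_approx:
  assumes f: "circle_cont f" and S: "finite S"
    and "\<And>\<theta>. \<theta> \<in> {0..2*pi} \<Longrightarrow> cmod (f \<theta> - (\<Sum>n\<in>S. fourier f n * cis (of_int n * \<theta>))) \<le> d"
  shows "circle_mean (\<lambda>\<theta>. (cmod (f \<theta>))\<^sup>2) \<le> (\<Sum>n\<in>S. (cmod (fourier f n))\<^sup>2) + d\<^sup>2"
proof -
  have "circle_mean (\<lambda>\<theta>. (cmod (f \<theta> - (\<Sum>n\<in>S. fourier f n * cis (of_int n * \<theta>))))\<^sup>2) \<le> circle_mean (\<lambda>\<theta>. d\<^sup>2)"
    by (rule circle_mean_mono) (auto intro!: continuous_intros f power_mono assms)
  then show ?thesis unfolding bessel_identity[OF f S] by simp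
qed

text \<open>Functions with vanishing Fourier coefficients (the set \<open>Z\<close>) are stable
  under multiplication by powers of \<open>cis\<close>, hence by polynomials in the real
  coordinates. If p approximates cnj g uniformly (Stone-Weierstrass), then p g has mean 0, so the
  mean of |g|^2 equals that of (cnj g - p) g and is arbitrarily small.\<close>

lemma fourier_zero_imp_zero:
  fixes g :: "complex \<Rightarrow> complex"
  assumes g: "continuous_on (sphere 0 1) g" and z: "\<And>n. fourier (\<lambda>\<theta>. g (cis \<theta>)) n = 0" and u: "cmod u = 1"
  shows "g u = 0"
proof -
  define Z where "Z = {f. circle_cont f \<and> (\<forall>n. fourier f n = 0)}"
  have cg: "circle_cont (\<lambda>\<theta>. g (cis \<theta>))"
    by (rule continuous_on_compose2[OF g]) (auto intro!: continuous_intros)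
  have gZ: "(\<lambda>\<theta>. g (cis \<theta>)) \<in> Z" using cg z by (auto simp: Z_def)
  have Zadd: "(\<lambda>\<theta>. f \<theta> + f' \<theta>) \<in> Z" if "f \<in> Z" "f' \<in> Z" for f f'
  proof -
    have "fourier (\<lambda>\<theta>. f \<theta> + f' \<theta>) n = fourier f n + fourier f' n" for n
      using that unfolding fourier_def Z_def distrib_right
      by (intro circle_mean_add continuous_intros) auto
    then show ?thesis using that by (auto simp: Z_def intro!: continuous_intros)
  qed
  have Zscale: "(\<lambda>\<theta>. c * f \<theta>) \<in> Z" if "f \<in> Z" for f c
  proof -
    have "fourier (\<lambda>\<theta>. c * f \<theta>) n = c * fourier f n" for n
      using that unfolding fourier_def Z_def mult.assoc
      by (intro circle_mean_mult_right continuous_intros) auto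
    then show ?thesis using that by (auto simp: Z_def intro!: continuous_intros)
  qed
  have Zcis: "(\<lambda>\<theta>. cis (of_int k * \<theta>) * f \<theta>) \<in> Z" if "f \<in> Z" for f k
  proof -
    have "cis (of_int k * \<theta>) * f \<theta> * cis (- (of_int n * \<theta>)) = f \<theta> * cis (- (of_int (n - k) * \<theta>))" for n \<theta>
      by (simp add: cis_mult algebra_simps flip: mult.assoc)
    then have "fourier (\<lambda>\<theta>. cis (of_int k * \<theta>) * f \<theta>) n = fourier f (n - k)" for n
      unfolding fourier_def by (simp only:)
    then show ?thesis using that by (auto simp: Z_def intro!: continuous_intros)
  qed
  have Zpoly: "\<forall>f\<in>Z. (\<lambda>\<theta>. of_real (q (cis \<theta>)) * f \<theta>) \<in> Z" if "real_polynomial_function q" for q :: "complex \<Rightarrow> real"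
    using that
  proof induction
    case (linear q)
    interpret bounded_linear q by fact
    show ?case
    proof
      fix f assume f: "f \<in> Z"
      have "q (cis \<theta>) = cos \<theta> * q 1 + sin \<theta> * q \<i>" for \<theta>
      proof -
        have "cis \<theta> = cos \<theta> *\<^sub>R 1 + sin \<theta> *\<^sub>R \<i>" by (simp add: complex_eq_iff)
        from arg_cong[OF this, of q] show ?thesis unfolding add scaleR by simp
      qed
      \<comment> \<open>A real linear functional restricted to the unit circle is a combination of
        the frequencies 1 and -1.\<close>
      then have "complex_of_real (q (cis \<theta>)) = (of_real (q 1 / 2) - \<i> * of_real (q \<i> / 2)) * cis (of_int 1 * \<theta>)
          + (of_real (q 1 / 2) + \<i> * of_real (q \<i> / 2)) * cis (of_int (-1) * \<theta>)" for \<theta>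
        by (simp add: complex_eq_iff algebra_simps)
      then have "(\<lambda>\<theta>. of_real (q (cis \<theta>)) * f \<theta>) = (\<lambda>\<theta>. (of_real (q 1 / 2) - \<i> * of_real (q \<i> / 2)) * (cis (of_int 1 * \<theta>) * f \<theta>)
          + (of_real (q 1 / 2) + \<i> * of_real (q \<i> / 2)) * (cis (of_int (-1) * \<theta>) * f \<theta>))"
        by (intro ext) (simp only: distrib_right mult.assoc)
      also have "\<dots> \<in> Z" by (intro Zadd Zscale Zcis f)
      finally show "(\<lambda>\<theta>. of_real (q (cis \<theta>)) * f \<theta>) \<in> Z" .
    qed
  next
    case (const c)
    then show ?case using Zscale by simp
  next
    case (add p q)
    then show ?case using Zadd by (auto simp: distrib_right)
  next
    case (mult p q)
    show ?case
    proof
      fix f assume "f \<in> Z"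
      then have "(\<lambda>\<theta>. of_real (q (cis \<theta>)) * f \<theta>) \<in> Z" using mult.IH(2) by blast
      from bspec[OF mult.IH(1) this] have "(\<lambda>\<theta>. of_real (p (cis \<theta>)) * (of_real (q (cis \<theta>)) * f \<theta>)) \<in> Z" .
      then show "(\<lambda>\<theta>. of_real (p (cis \<theta>) * q (cis \<theta>)) * f \<theta>) \<in> Z" by (simp add: mult.assoc)
    qed
  qed
  have Z0: "circle_mean f = 0" if "f \<in> Z" for f
  proof -
    have "fourier f 0 = 0" using that by (auto simp: Z_def)
    then show ?thesis by (simp add: fourier_def)
  qed
  obtain B where B: "\<And>v. cmod v = 1 \<Longrightarrow> cmod (g v) \<le> B" "B > 0"
  proof -
    have "compact (g ` sphere 0 1)" using g by (intro compact_continuous_image) auto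
    then have "bounded (g ` sphere 0 1)" by (rule compact_imp_bounded)
    then obtain b where "b > 0" "\<forall>x\<in>g ` sphere 0 1. norm x \<le> b" using bounded_pos by metis
    then show ?thesis using that[of b] by auto
  qed
  have mean0: "circle_mean (\<lambda>\<theta>. (cmod (g (cis \<theta>)))\<^sup>2) = 0"
  proof -
    have small: "circle_mean (\<lambda>\<theta>. (cmod (g (cis \<theta>)))\<^sup>2) \<le> B * e" if "e > 0" for e
    proof -
      obtain p where p: "polynomial_function p" "\<And>v. v \<in> sphere 0 1 \<Longrightarrow> norm (cnj (g v) - p v) < e"
        using Stone_Weierstrass_polynomial_function[of "sphere 0 1" "\<lambda>v. cnj (g v)" e] g \<open>e > 0\<close>
        by (auto intro!: continuous_intros)
      have rp: "real_polynomial_function (\<lambda>v. Re (p v))" "real_polynomial_function (\<lambda>v. Im (p v))"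
        using p(1) bounded_linear_Re bounded_linear_Im unfolding polynomial_function_def o_def by blast+
      have "(\<lambda>\<theta>. of_real (Re (p (cis \<theta>))) * g (cis \<theta>) + \<i> * (of_real (Im (p (cis \<theta>))) * g (cis \<theta>))) \<in> Z"
        using bspec[OF Zpoly[OF rp(1)] gZ] Zscale[OF bspec[OF Zpoly[OF rp(2)] gZ], of \<i>] by (rule Zadd)
      moreover have "of_real (Re (p v)) * g v + \<i> * (of_real (Im (p v)) * g v) = p v * g v" for v
        by (simp add: complex_eq_iff)
      ultimately have m: "circle_mean (\<lambda>\<theta>. p (cis \<theta>) * g (cis \<theta>)) = 0" using Z0 by simp
      have cp: "circle_cont (\<lambda>\<theta>. p (cis \<theta>))"
        by (rule continuous_on_compose2[OF continuous_on_polymonial_function[OF p(1), of UNIV]]) (auto intro!: continuous_intros)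
      have "of_real (circle_mean (\<lambda>\<theta>. (cmod (g (cis \<theta>)))\<^sup>2)) = circle_mean (\<lambda>\<theta>. complex_of_real ((cmod (g (cis \<theta>)))\<^sup>2))"
        by (rule circle_mean_bounded_linear[OF bounded_linear_of_real, symmetric]) (intro continuous_intros cg)
      also have "\<dots> = circle_mean (\<lambda>\<theta>. (cnj (g (cis \<theta>)) - p (cis \<theta>)) * g (cis \<theta>) + p (cis \<theta>) * g (cis \<theta>))"
        by (rule arg_cong[of _ _ circle_mean], rule ext) (simp add: complex_norm_square algebra_simps del: of_real_power)
      also have "\<dots> = circle_mean (\<lambda>\<theta>. (cnj (g (cis \<theta>)) - p (cis \<theta>)) * g (cis \<theta>))"
        by (subst circle_mean_add) (auto intro!: continuous_intros cg cp simp: m)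
      finally have eq: "of_real (circle_mean (\<lambda>\<theta>. (cmod (g (cis \<theta>)))\<^sup>2)) = circle_mean (\<lambda>\<theta>. (cnj (g (cis \<theta>)) - p (cis \<theta>)) * g (cis \<theta>))" .
      have "cmod (circle_mean (\<lambda>\<theta>. (cnj (g (cis \<theta>)) - p (cis \<theta>)) * g (cis \<theta>))) \<le> e * B"
      proof (rule circle_mean_norm_le)
        show "circle_cont (\<lambda>\<theta>. (cnj (g (cis \<theta>)) - p (cis \<theta>)) * g (cis \<theta>))" by (intro continuous_intros cg cp)
        show "cmod ((cnj (g (cis \<theta>)) - p (cis \<theta>)) * g (cis \<theta>)) \<le> e * B" for \<theta>
          unfolding norm_mult using p(2)[of "cis \<theta>"] B(1)[of "cis \<theta>"] \<open>e > 0\<close> by (intro mult_mono) auto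
      qed
      then show ?thesis unfolding eq[symmetric] norm_of_real by (simp add: mult.commute)
    qed
    have "circle_mean (\<lambda>\<theta>. (cmod (g (cis \<theta>)))\<^sup>2) \<le> 0"
    proof (rule field_le_epsilon)
      fix e :: real assume "e > 0"
      then show "circle_mean (\<lambda>\<theta>. (cmod (g (cis \<theta>)))\<^sup>2) \<le> 0 + e" using small[of "e / B"] B(2) by simp
    qed
    moreover have "circle_mean (\<lambda>\<theta>. 0) \<le> circle_mean (\<lambda>\<theta>. (cmod (g (cis \<theta>)))\<^sup>2)"
      by (rule circle_mean_mono) (auto intro!: continuous_intros cg)
    ultimately show ?thesis by simp
  qed
  have "\<forall>\<theta>\<in>{0..2*pi}. (cmod (g (cis \<theta>)))\<^sup>2 = 0"
  proof -
    have "integral {0..2*pi} (\<lambda>\<theta>. (cmod (g (cis \<theta>)))\<^sup>2) = 0" using mean0 by (simp add: circle_mean_def)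
    moreover have cc: "circle_cont (\<lambda>\<theta>. (cmod (g (cis \<theta>)))\<^sup>2)" by (intro continuous_intros cg)
    ultimately show ?thesis by (subst (asm) integral_eq_0_iff) auto
  qed
  moreover have "u = cis (Arg2pi u)"
    using Arg2pi_eq[of u] u by (simp add: cis_conv_exp)
  moreover have "Arg2pi u \<in> {0..2*pi}"
    using Arg2pi_ge_0[of u] Arg2pi_lt_2pi[of u] by simp
  ultimately have "(cmod (g u))\<^sup>2 = 0" by metis
  then show ?thesis by simp
qed

section \<open>Harmonic series with a summable majorant\<close>

lemma sum_symmetric_int_interval:
  fixes d :: "int \<Rightarrow> 'a::ab_group_add"
  shows "(\<Sum>n\<in>{-int N..int N}. d n) = d 0 + (\<Sum>k<N. d (int k + 1) + d (- (int k + 1)))"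
proof (induction N)
  case (Suc N)
  have "{-int (Suc N)..int (Suc N)} = insert (int N + 1) (insert (- (int N + 1)) {-int N..int N})" by auto
  then show ?case using Suc by (simp add: add_ac)
qed simp

text \<open>\<open>u\<close> ranges over the closed unit disc; for \<open>u = cis \<theta>\<close> this is the full
  two-sided Fourier series, for \<open>|u| < 1\<close> its harmonic extension.\<close>
definition harm_series :: "(int \<Rightarrow> complex) \<Rightarrow> complex \<Rightarrow> complex" where
  "harm_series d u = d 0 + (\<Sum>k. d (int k + 1) * u ^ (k + 1) + d (- (int k + 1)) * cnj u ^ (k + 1))"

text \<open>The Weierstrass M-test. The series is indexed by k with the frequencies k + 1 and -(k +
  1) taken together, hence the factor 2 and the shifts by one in the tail bound. Coefficients are
  recovered by comparing with the partial sums up to N, whose coefficients are exact once N \<ge>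
  |m|.\<close>

lemma
  fixes d :: "int \<Rightarrow> complex"
  assumes b: "summable b" "\<And>n. cmod (d n) \<le> b (nat \<bar>n\<bar>)"
  shows harm_series_summable: "cmod u \<le> 1 \<Longrightarrow> summable (\<lambda>k. d (int k + 1) * u ^ (k + 1) + d (- (int k + 1)) * cnj u ^ (k + 1))"
    and harm_series_tail: "cmod (harm_series d (cis \<theta>) - (\<Sum>n\<in>{-int N..int N}. d n * cis (of_int n * \<theta>))) \<le> 2 * (\<Sum>k. b (k + N + 1))"
    and continuous_on_harm_series: "continuous_on (cball 0 1) (harm_series d)"
    and fourier_harm_series: "fourier (\<lambda>\<theta>. harm_series d (cis \<theta>)) m = d m"
proof -
  define a where "a = (\<lambda>k u. d (int k + 1) * u ^ (k + 1) + d (- (int k + 1)) * cnj u ^ (k + 1))"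
  have b0: "b k \<ge> 0" for k using order_trans[OF norm_ge_zero b(2)[of "int k"]] by simp
  have sb: "summable (\<lambda>k. 2 * b (k + 1))" by (rule summable_mult[OF summable_ignore_initial_segment[OF b(1), of 1]])
  have ab: "cmod (a k u) \<le> 2 * b (k + 1)" if "cmod u \<le> 1" for k u
  proof -
    have p: "cmod u ^ (k + 1) \<le> 1" using that by (intro power_le_one) auto
    have e: "nat \<bar>int k + 1\<bar> = k + 1" "nat \<bar>- (int k + 1)\<bar> = k + 1" by auto
    have "cmod (a k u) \<le> cmod (d (int k + 1)) * cmod u ^ (k + 1) + cmod (d (- (int k + 1))) * cmod u ^ (k + 1)"
      unfolding a_def by (rule order_trans[OF norm_triangle_ineq]) (simp add: norm_mult norm_power)
    also have "\<dots> \<le> b (k + 1) * 1 + b (k + 1) * 1"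
      using b(2)[of "int k + 1"] b(2)[of "- (int k + 1)"] p b0 unfolding e
      by (intro add_mono mult_mono) auto
    finally show ?thesis by simp
  qed
  have hs: "harm_series d u = d 0 + (\<Sum>k. a k u)" for u by (simp add: harm_series_def a_def)
  have sa: "summable (\<lambda>k. a k u)" if "cmod u \<le> 1" for u
    using ab that by (intro summable_comparison_test'[OF sb]) auto
  then show "summable (\<lambda>k. d (int k + 1) * u ^ (k + 1) + d (- (int k + 1)) * cnj u ^ (k + 1))" if "cmod u \<le> 1" for u
    using that unfolding a_def by blast
  have tail: "cmod (harm_series d u - (d 0 + (\<Sum>k<N. a k u))) \<le> 2 * (\<Sum>k. b (k + N + 1))" if "cmod u \<le> 1" for u N
  proof -
    have "harm_series d u - (d 0 + (\<Sum>k<N. a k u)) = (\<Sum>k. a (k + N) u)"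
      unfolding hs using suminf_minus_initial_segment[OF sa[OF that], of N] by simp
    also have "cmod \<dots> \<le> (\<Sum>k. 2 * b (k + N + 1))"
    proof (rule norm_suminf_le)
      show "norm (a (k + N) u) \<le> 2 * b (k + N + 1)" for k using ab[OF that, of "k + N"] by simp
      show "summable (\<lambda>k. 2 * b (k + N + 1))" by (rule summable_ignore_initial_segment[OF sb, of N])
    qed
    also have "\<dots> = 2 * (\<Sum>k. b (k + N + 1))"
      by (rule suminf_mult) (rule summable_ignore_initial_segment[OF b(1), of "N + 1", folded add.assoc])
    finally show ?thesis .
  qed
  have sum_eq: "(\<Sum>n\<in>{-int N..int N}. d n * cis (of_int n * \<theta>)) = d 0 + (\<Sum>k<N. a k (cis \<theta>))" for N \<theta>
  proof -
    have "cis (of_int (int k + 1) * \<theta>) = cis \<theta> ^ (k + 1)" "cis (of_int (- (int k + 1)) * \<theta>) = cnj (cis \<theta>) ^ (k + 1)" for k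
      unfolding cis_cnj Complex.DeMoivre by (rule arg_cong[of _ _ cis], simp add: algebra_simps)+
    then show ?thesis by (simp add: sum_symmetric_int_interval a_def)
  qed
  have tail_cis: "cmod (harm_series d (cis \<theta>) - (\<Sum>n\<in>{-int N..int N}. d n * cis (of_int n * \<theta>))) \<le> 2 * (\<Sum>k. b (k + N + 1))" for \<theta> N
    unfolding sum_eq by (rule tail) simp
  then show "cmod (harm_series d (cis \<theta>) - (\<Sum>n\<in>{-int N..int N}. d n * cis (of_int n * \<theta>))) \<le> 2 * (\<Sum>k. b (k + N + 1))" .
  have "continuous_on (cball 0 1) (\<lambda>u. \<Sum>k. a k u)"
  proof (rule uniform_limit_theorem)
    show "uniform_limit (cball 0 1) (\<lambda>n u. \<Sum>k<n. a k u) (\<lambda>u. \<Sum>k. a k u) sequentially"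
      using ab by (intro Weierstrass_m_test[OF _ sb]) auto
    show "\<forall>\<^sub>F n in sequentially. continuous_on (cball 0 1) (\<lambda>u. \<Sum>k<n. a k u)"
      unfolding a_def by (intro always_eventually allI continuous_intros)
  qed simp
  then show cont: "continuous_on (cball 0 1) (harm_series d)"
    unfolding hs[abs_def] by (intro continuous_intros)
  have cc: "circle_cont (\<lambda>\<theta>. harm_series d (cis \<theta>))"
    by (rule continuous_on_compose2[OF cont]) (auto intro!: continuous_intros)
  have lim0: "(\<lambda>N. \<Sum>k. b (k + N + 1)) \<longlonglongrightarrow> 0"
  proof -
    have "(\<lambda>N. suminf b - sum b {..<N + 1}) \<longlonglongrightarrow> suminf b - suminf b"
      by (intro tendsto_intros LIMSEQ_ignore_initial_segment[where k=1, OF summable_LIMSEQ[OF b(1)]])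
    moreover have "suminf b - sum b {..<N + 1} = (\<Sum>k. b (k + N + 1))" for N
      using suminf_minus_initial_segment[OF b(1), of "N + 1"] by (simp add: add.assoc)
    ultimately show ?thesis by simp
  qed
  have "cmod (fourier (\<lambda>\<theta>. harm_series d (cis \<theta>)) m - d m) \<le> 2 * (\<Sum>k. b (k + N + 1))" if N: "nat \<bar>m\<bar> \<le> N" for N
  proof -
    define P where "P = (\<lambda>\<theta>. \<Sum>n\<in>{-int N..int N}. d n * cis (of_int n * \<theta>))"
    have cP: "circle_cont P" unfolding P_def by (intro continuous_intros)
    have "fourier P m = d m" unfolding P_def using N by (subst fourier_trig) auto
    then have "fourier (\<lambda>\<theta>. harm_series d (cis \<theta>)) m - d m = circle_mean (\<lambda>\<theta>. harm_series d (cis \<theta>) * cis (- (of_int m * \<theta>)) - P \<theta> * cis (- (of_int m * \<theta>)))"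
      unfolding fourier_def by (subst circle_mean_diff) (auto intro!: continuous_intros cc cP)
    also have "cmod \<dots> \<le> 2 * (\<Sum>k. b (k + N + 1))"
    proof (rule circle_mean_norm_le)
      show "circle_cont (\<lambda>\<theta>. harm_series d (cis \<theta>) * cis (- (of_int m * \<theta>)) - P \<theta> * cis (- (of_int m * \<theta>)))"
        by (intro continuous_intros cc cP)
      show "cmod (harm_series d (cis \<theta>) * cis (- (of_int m * \<theta>)) - P \<theta> * cis (- (of_int m * \<theta>))) \<le> 2 * (\<Sum>k. b (k + N + 1))" for \<theta>
        using tail_cis[of \<theta> N] unfolding P_def by (simp flip: left_diff_distrib add: norm_mult)
    qed
    finally show ?thesis .
  qed
  then have "\<forall>\<^sub>F N in sequentially. cmod (fourier (\<lambda>\<theta>. harm_series d (cis \<theta>)) m - d m) \<le> 2 * (\<Sum>k. b (k + N + 1))"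
    unfolding eventually_sequentially by blast
  then have "cmod (fourier (\<lambda>\<theta>. harm_series d (cis \<theta>)) m - d m) \<le> 2 * 0"
    by (intro tendsto_lowerbound[OF tendsto_mult[OF tendsto_const lim0]]) auto
  then show "fourier (\<lambda>\<theta>. harm_series d (cis \<theta>)) m = d m" by simp
qed

lemma harm_series_tail_tendsto_0:
  assumes "summable b"
  shows "(\<lambda>N. 2 * (\<Sum>k. b (k + N + 1))) \<longlonglongrightarrow> (0::real)"
proof -
  have "(\<lambda>N. suminf b - sum b {..<N + 1}) \<longlonglongrightarrow> suminf b - suminf b"
    by (intro tendsto_intros LIMSEQ_ignore_initial_segment[where k=1, OF summable_LIMSEQ[OF assms]])
  moreover have "suminf b - sum b {..<N + 1} = (\<Sum>k. b (k + N + 1))" for N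
    using suminf_minus_initial_segment[OF assms, of "N + 1"] by (simp add: add.assoc)
  ultimately have "(\<lambda>N. \<Sum>k. b (k + N + 1)) \<longlonglongrightarrow> 0" by simp
  from tendsto_mult[OF tendsto_const this, of 2] show ?thesis by simp
qed

text \<open>The difference of the two sides is continuous with vanishing Fourier coefficients, so
  uniqueness applies.\<close>

lemma eq_harm_series:
  assumes g: "continuous_on (sphere 0 1) g"
    and b: "summable b" "\<And>n. cmod (fourier (\<lambda>\<theta>. g (cis \<theta>)) n) \<le> b (nat \<bar>n\<bar>)" and u: "cmod u = 1"
  shows "g u = harm_series (fourier (\<lambda>\<theta>. g (cis \<theta>))) u"
proof -
  define d where "d = fourier (\<lambda>\<theta>. g (cis \<theta>))"
  have b': "\<And>n. cmod (d n) \<le> b (nat \<bar>n\<bar>)" using b(2) by (simp add: d_def)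
  have c: "continuous_on (sphere 0 1) (harm_series d)"
    using continuous_on_harm_series[OF b(1) b'] by (rule continuous_on_subset) auto
  have cc: "circle_cont (\<lambda>\<theta>. f (cis \<theta>))" if "continuous_on (sphere 0 1) f" for f :: "complex \<Rightarrow> complex"
    by (rule continuous_on_compose2[OF that]) (auto intro!: continuous_intros)
  have "fourier (\<lambda>\<theta>. g (cis \<theta>) - harm_series d (cis \<theta>)) n = 0" for n
  proof -
    have "fourier (\<lambda>\<theta>. g (cis \<theta>) - harm_series d (cis \<theta>)) n = d n - fourier (\<lambda>\<theta>. harm_series d (cis \<theta>)) n"
      unfolding d_def fourier_def left_diff_distrib
      by (subst circle_mean_diff) (auto intro!: continuous_intros cc g c[unfolded d_def fourier_def])
    then show ?thesis using fourier_harm_series[OF b(1) b'] by simp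
  qed
  then have "g u - harm_series d u = 0"
    by (intro fourier_zero_imp_zero[of "\<lambda>u. g u - harm_series d u"] u continuous_intros g c)
  then show ?thesis by (simp add: d_def)
qed

section \<open>Fourier coefficients of a harmonic function on an annulus\<close>

lemma open_annulus: "open (annulus r R)"
proof -
  have "annulus r R = {z. r < cmod z} \<inter> {z. cmod z < R}" by (auto simp: annulus_def)
  then show ?thesis by (auto intro!: open_Int open_Collect_less continuous_intros)
qed

lemma annulus_polar [simp]: "of_real (exp t) * cis \<theta> \<in> annulus 1 (exp T) \<longleftrightarrow> t \<in> {0<..<T}"
  by (auto simp: annulus_def norm_mult)

text \<open>In the logarithmic coordinate, F (exp \<zeta>) exp (- n \<zeta>) is holomorphic and 2 pi
  i periodic. Its integral over a vertical period does not depend on the real part, because the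
  t-derivative is -i times the \<theta>-derivative, which integrates to 0 over a period.\<close>

lemma fourier_holomorphic_annulus:
  assumes F: "F holomorphic_on annulus 1 (exp T)"
  shows "\<exists>a. \<forall>t\<in>{0<..<T}. fourier (\<lambda>\<theta>. F (of_real (exp t) * cis \<theta>)) n = a * of_real (exp (of_int n * t))"
proof -
  define S where "S = {\<zeta>. 0 < Re \<zeta> \<and> Re \<zeta> < T}"
  have oS: "open S"
    unfolding S_def by (intro open_Collect_conj open_Collect_less continuous_intros)
  define \<Phi> where "\<Phi> = (\<lambda>\<zeta>. F (exp \<zeta>) * exp (- (of_int n * \<zeta>)))"
  have hol: "\<Phi> holomorphic_on S"
    unfolding \<Phi>_def
    by (intro holomorphic_intros holomorphic_on_compose_gen[OF _ F, unfolded o_def]) (auto simp: S_def annulus_def)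
  have der: "(\<Phi> has_derivative (\<lambda>v. deriv \<Phi> \<zeta> * v)) (at \<zeta>)" if "\<zeta> \<in> S" for \<zeta>
    using holomorphic_derivI[OF hol oS that] unfolding has_field_derivative_def .
  have dt: "((\<lambda>s. \<Phi> (\<i> * of_real \<theta> + of_real s)) has_vector_derivative deriv \<Phi> (\<i> * of_real \<theta> + of_real t)) (at t)"
    if "t \<in> {0<..<T}" for t \<theta>
    using has_vector_derivative_along_line[of \<Phi> "(\<lambda>v. deriv \<Phi> (\<i> * of_real \<theta> + of_real t) * v)" "\<i> * of_real \<theta>" t 1] der[of "\<i> * of_real \<theta> + of_real t"] that
    by (simp add: S_def)
  have d\<theta>: "((\<lambda>s. \<Phi> (\<i> * of_real s + of_real t)) has_vector_derivative deriv \<Phi> (\<i> * of_real \<theta> + of_real t) * \<i>) (at \<theta>)"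
    if "t \<in> {0<..<T}" for t \<theta>
    using has_vector_derivative_along_line[of \<Phi> "(\<lambda>v. deriv \<Phi> (\<i> * of_real \<theta> + of_real t) * v)" "of_real t" \<theta> \<i>] der[of "\<i> * of_real \<theta> + of_real t"] that
    by (simp add: S_def algebra_simps)
  have cd: "continuous_on S (deriv \<Phi>)" by (intro holomorphic_on_imp_continuous_on holomorphic_deriv hol oS)
  have int0: "integral (cbox 0 (2*pi)) (\<lambda>\<theta>. deriv \<Phi> (\<i> * of_real \<theta> + of_real t)) = 0" if "t \<in> {0<..<T}" for t
  proof -
    have "((\<lambda>\<theta>. deriv \<Phi> (\<i> * of_real \<theta> + of_real t) * \<i>) has_integral (\<Phi> (\<i> * of_real (2*pi) + of_real t) - \<Phi> (\<i> * of_real 0 + of_real t))) {0..2*pi}"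
      by (rule fundamental_theorem_of_calculus) (use d\<theta>[OF that] in \<open>auto intro: has_vector_derivative_at_within\<close>)
    moreover have "\<Phi> (\<i> * of_real (2*pi) + of_real t) = \<Phi> (\<i> * of_real 0 + of_real t)"
    proof -
      have e1: "exp (\<i> * of_real (2*pi) + of_real t) = exp (of_real t :: complex)"
        by (simp add: exp_add exp_two_pi_i mult.commute)
      have "exp (- (of_int n * (\<i> * of_real (2*pi) + of_real t))) = exp (- (of_int n * of_real t) + 2 * of_int (-n) * of_real pi * \<i>)"
        by (simp add: algebra_simps)
      also have "\<dots> = exp (- (of_int n * of_real t))"
      proof -
        have "cis (2 * pi * of_int (-n)) = 1" by (rule cis_multiple_2pi) simp
        then have "exp (2 * of_int (-n) * of_real pi * \<i>) = 1" by (simp add: cis_conv_exp mult_ac)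
        then show ?thesis unfolding exp_add by simp
      qed
      finally show ?thesis unfolding \<Phi>_def using e1 by simp
    qed
    ultimately have "((\<lambda>\<theta>. (deriv \<Phi> (\<i> * of_real \<theta> + of_real t) * \<i>) * (-\<i>)) has_integral 0 * (-\<i>)) {0..2*pi}"
      by (intro has_integral_mult_left) simp
    then have "((\<lambda>\<theta>. deriv \<Phi> (\<i> * of_real \<theta> + of_real t)) has_integral 0) {0..2*pi}"
      by (simp add: mult.assoc)
    then show ?thesis by (simp add: integral_unique)
  qed
  have cont\<Phi>: "continuous_on S \<Phi>" using hol by (rule holomorphic_on_imp_continuous_on)
  have "((\<lambda>t. integral (cbox 0 (2*pi)) (\<lambda>\<theta>. \<Phi> (\<i> * of_real \<theta> + of_real t))) has_vector_derivative 0) (at t within {0<..<T})"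
    if t: "t \<in> {0<..<T}" for t
  proof -
    have "((\<lambda>t. integral (cbox 0 (2*pi)) (\<lambda>\<theta>. \<Phi> (\<i> * of_real \<theta> + of_real t))) has_vector_derivative
       integral (cbox 0 (2*pi)) (\<lambda>\<theta>. deriv \<Phi> (\<i> * of_real \<theta> + of_real t))) (at t within {0<..<T})"
    proof (rule leibniz_rule_vector_derivative)
      show "continuous_on ({0<..<T} \<times> cbox 0 (2*pi)) (\<lambda>(t, \<theta>). deriv \<Phi> (\<i> * of_real \<theta> + of_real t))"
        unfolding split_beta by (rule continuous_on_compose2[OF cd]) (auto intro!: continuous_intros simp: S_def)
      show "(\<lambda>\<theta>. \<Phi> (\<i> * of_real \<theta> + of_real x)) integrable_on cbox 0 (2*pi)" if "x \<in> {0<..<T}" for x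
        unfolding cbox_interval
        by (rule integrable_continuous_interval, rule continuous_on_compose2[OF cont\<Phi>]) (use that in \<open>auto intro!: continuous_intros simp: S_def\<close>)
    qed (use t dt in \<open>auto intro: has_vector_derivative_at_within\<close>)
    then show ?thesis
      unfolding int0[OF t] .
  qed
  from has_vector_derivative_zero_constant[OF _ this]
  obtain c where c: "\<And>t. t \<in> {0<..<T} \<Longrightarrow> integral {0..2*pi} (\<lambda>\<theta>. \<Phi> (\<i> * of_real \<theta> + of_real t)) = c"
    by auto
  have "fourier (\<lambda>\<theta>. F (of_real (exp t) * cis \<theta>)) n = (c /\<^sub>R (2*pi)) * of_real (exp (of_int n * t))" if "t \<in> {0<..<T}" for t
  proof -
    have "F (of_real (exp t) * cis \<theta>) * cis (- (of_int n * \<theta>)) = of_real (exp (of_int n * t)) * \<Phi> (\<i> * of_real \<theta> + of_real t)" for \<theta>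
    proof -
      have a: "of_real (exp t) * cis \<theta> = exp (\<i> * of_real \<theta> + of_real t)"
        by (simp add: exp_add cis_conv_exp exp_of_real mult.commute)
      have b: "cis (- (of_int n * \<theta>)) = of_real (exp (of_int n * t)) * exp (- (of_int n * (\<i> * of_real \<theta> + of_real t)))"
        by (simp add: cis_conv_exp exp_of_real[symmetric] exp_add[symmetric] algebra_simps)
      show ?thesis unfolding a b \<Phi>_def by (simp add: mult_ac)
    qed
    then have "fourier (\<lambda>\<theta>. F (of_real (exp t) * cis \<theta>)) n = integral {0..2*pi} (\<lambda>\<theta>. of_real (exp (of_int n * t)) * \<Phi> (\<i> * of_real \<theta> + of_real t)) /\<^sub>R (2*pi)"
      unfolding fourier_def circle_mean_def by simp
    also have "\<dots> = (of_real (exp (of_int n * t)) * c) /\<^sub>R (2*pi)"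
      unfolding c[OF that, symmetric] by simp
    finally show ?thesis by (simp add: scaleR_conv_of_real mult_ac)
  qed
  then show ?thesis by blast
qed

text \<open>Harmonicity is encoded by the differential: \<phi> is the z-derivative of h and \<psi>
  the conjugate of its conjugate derivative. A global splitting f + cnj g is not demanded, since on
  an annulus a logarithmic term may occur.\<close>

locale annulus_harmonic =
  fixes T :: real and h \<phi> \<psi> :: "complex \<Rightarrow> complex"
  assumes T: "T > 0"
    and hol: "\<phi> holomorphic_on annulus 1 (exp T)" "\<psi> holomorphic_on annulus 1 (exp T)"
    and der: "\<And>z. z \<in> annulus 1 (exp T) \<Longrightarrow> (h has_derivative (\<lambda>v. \<phi> z * v + cnj (\<psi> z * v))) (at z)"
begin

definition coeff :: "int \<Rightarrow> real \<Rightarrow> complex" where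
  "coeff n t = fourier (\<lambda>\<theta>. h (of_real (exp t) * cis \<theta>)) n"

text \<open>With z = e^t e^(i\<theta>), the t-derivative of h is F + cnj G and its
  \<theta>-derivative is i (F - cnj G).\<close>

definition F where "F z = z * \<phi> z"
definition G where "G z = z * \<psi> z"

lemma holFG: "F holomorphic_on annulus 1 (exp T)" "G holomorphic_on annulus 1 (exp T)"
  unfolding F_def G_def by (intro holomorphic_intros hol)+

lemma conts:
  "continuous_on (annulus 1 (exp T)) F" "continuous_on (annulus 1 (exp T)) G" "continuous_on (annulus 1 (exp T)) h"
  using holFG holomorphic_on_imp_continuous_on apply blast
  using holFG holomorphic_on_imp_continuous_on apply blast
  using der has_derivative_continuous by (blast intro!: continuous_at_imp_continuous_on)

lemma circle_cont_compose:
  assumes "continuous_on (annulus 1 (exp T)) f" "t \<in> {0<..<T}"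
  shows "circle_cont (\<lambda>\<theta>. f (of_real (exp t) * cis \<theta>))"
  by (rule continuous_on_compose2[OF assms(1)]) (use assms(2) in \<open>auto intro!: continuous_intros simp del: of_real_exp\<close>)

lemma deriv_theta:
  assumes "t \<in> {0<..<T}"
  shows "((\<lambda>\<theta>. h (of_real (exp t) * cis \<theta>)) has_vector_derivative
     \<i> * F (of_real (exp t) * cis \<theta>) - \<i> * cnj (G (of_real (exp t) * cis \<theta>))) (at \<theta>)"
proof -
  let ?z = "of_real (exp t) * cis \<theta>"
  have "((\<lambda>\<theta>. of_real (exp t) * cis \<theta>) has_vector_derivative \<i> * ?z) (at \<theta>)"
  proof -
    have "((\<lambda>z. of_real (exp t) * exp (\<i> * z)) has_field_derivative \<i> * (of_real (exp t) * exp (\<i> * of_real \<theta>))) (at (of_real \<theta>))"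
      by (auto intro!: derivative_eq_intros)
    from has_vector_derivative_real_field[OF this] show ?thesis by (simp add: cis_conv_exp)
  qed
  note curve = this
  have "?z \<in> annulus 1 (exp T)" using assms by (simp del: of_real_exp)
  from vector_derivative_diff_chain_within[OF curve has_derivative_at_withinI[OF der[OF this]]]
  show ?thesis by (simp add: o_def F_def G_def algebra_simps del: of_real_exp)
qed

lemma deriv_t:
  assumes "t \<in> {0<..<T}"
  shows "((\<lambda>t. h (of_real (exp t) * cis \<theta>)) has_vector_derivative
     F (of_real (exp t) * cis \<theta>) + cnj (G (of_real (exp t) * cis \<theta>))) (at t)"
proof -
  let ?z = "of_real (exp t) * cis \<theta>"
  have "((\<lambda>t. of_real (exp t) * cis \<theta>) has_vector_derivative ?z) (at t)"
  proof -
    have "((\<lambda>z. exp z * cis \<theta>) has_field_derivative exp (of_real t) * cis \<theta>) (at (of_real t))"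
      by (auto intro!: derivative_eq_intros)
    from has_vector_derivative_real_field[OF this] show ?thesis by (simp add: exp_of_real)
  qed
  note curve = this
  have "?z \<in> annulus 1 (exp T)" using assms by (simp del: of_real_exp)
  from vector_derivative_diff_chain_within[OF curve has_derivative_at_withinI[OF der[OF this]]]
  show ?thesis by (simp add: o_def F_def G_def algebra_simps del: of_real_exp)
qed

lemma fourier_cnj: 
  assumes "circle_cont f"
  shows "fourier (\<lambda>\<theta>. cnj (f \<theta>)) n = cnj (fourier f (- n))"
proof -
  have "fourier (\<lambda>\<theta>. cnj (f \<theta>)) n = circle_mean (\<lambda>\<theta>. cnj (f \<theta> * cis (- (of_int (- n) * \<theta>))))"
    unfolding fourier_def by (simp add: cis_cnj)
  also have "\<dots> = cnj (fourier f (- n))"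
    unfolding fourier_def
    by (rule circle_mean_bounded_linear[OF bounded_linear_cnj]) (intro continuous_intros assms)
  finally show ?thesis .
qed

text \<open>Integration by parts in \<theta>; the boundary terms cancel by periodicity. For n
  \<noteq> 0 this reduces the coefficient of h to those of holomorphic functions.\<close>

lemma coeff_parts:
  assumes t: "t \<in> {0<..<T}"
  shows "of_int n * coeff n t = fourier (\<lambda>\<theta>. F (of_real (exp t) * cis \<theta>)) n - cnj (fourier (\<lambda>\<theta>. G (of_real (exp t) * cis \<theta>)) (- n))"
proof -
  let ?z = "\<lambda>\<theta>. of_real (exp t) * cis \<theta>"
  let ?e = "\<lambda>\<theta>. cis (- (of_int n * \<theta>))"
  note cF = circle_cont_compose[OF conts(1) t] and cG = circle_cont_compose[OF conts(2) t] and ch = circle_cont_compose[OF conts(3) t]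
  have de: "(?e has_vector_derivative (- \<i> * of_int n) * ?e \<theta>) (at \<theta>)" for \<theta>
  proof -
    have "((\<lambda>z. exp (- (\<i> * of_int n * z))) has_field_derivative (- \<i> * of_int n) * exp (- (\<i> * of_int n * of_real \<theta>))) (at (of_real \<theta>))"
      by (auto intro!: derivative_eq_intros)
    from has_vector_derivative_real_field[OF this] show ?thesis by (simp add: cis_conv_exp mult_ac)
  qed
  have "((\<lambda>\<theta>. h (?z \<theta>) * ((- \<i> * of_int n) * ?e \<theta>) + (\<i> * F (?z \<theta>) - \<i> * cnj (G (?z \<theta>))) * ?e \<theta>) has_integral
     (h (?z (2*pi)) * ?e (2*pi) - h (?z 0) * ?e 0)) {0..2*pi}"
    by (rule fundamental_theorem_of_calculus)
       (simp, rule has_vector_derivative_at_within, rule has_vector_derivative_mult[OF deriv_theta[OF t] de])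
  moreover have "?e (2*pi) = ?e 0" using cis_multiple_2pi[of "- of_int n"] by (simp add: mult_ac)
  ultimately have i0: "circle_mean (\<lambda>\<theta>. h (?z \<theta>) * ((- \<i> * of_int n) * ?e \<theta>) + (\<i> * F (?z \<theta>) - \<i> * cnj (G (?z \<theta>))) * ?e \<theta>) = 0"
    unfolding circle_mean_def by (simp add: integral_unique)
  have "(\<lambda>\<theta>. h (?z \<theta>) * ((- \<i> * of_int n) * ?e \<theta>) + (\<i> * F (?z \<theta>) - \<i> * cnj (G (?z \<theta>))) * ?e \<theta>)
     = (\<lambda>\<theta>. (- \<i> * of_int n) * (h (?z \<theta>) * ?e \<theta>) + (\<i> * (F (?z \<theta>) * ?e \<theta>) - \<i> * (cnj (G (?z \<theta>)) * ?e \<theta>)))"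
    by (simp add: algebra_simps)
  then have "0 = circle_mean (\<lambda>\<theta>. (- \<i> * of_int n) * (h (?z \<theta>) * ?e \<theta>) + (\<i> * (F (?z \<theta>) * ?e \<theta>) - \<i> * (cnj (G (?z \<theta>)) * ?e \<theta>)))"
    using i0 by simp
  also have "\<dots> = circle_mean (\<lambda>\<theta>. (- \<i> * of_int n) * (h (?z \<theta>) * ?e \<theta>)) + circle_mean (\<lambda>\<theta>. \<i> * (F (?z \<theta>) * ?e \<theta>) - \<i> * (cnj (G (?z \<theta>)) * ?e \<theta>))"
    by (rule circle_mean_add) (intro continuous_intros cF cG ch)+
  also have "circle_mean (\<lambda>\<theta>. \<i> * (F (?z \<theta>) * ?e \<theta>) - \<i> * (cnj (G (?z \<theta>)) * ?e \<theta>)) = circle_mean (\<lambda>\<theta>. \<i> * (F (?z \<theta>) * ?e \<theta>)) - circle_mean (\<lambda>\<theta>. \<i> * (cnj (G (?z \<theta>)) * ?e \<theta>))"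
    by (rule circle_mean_diff) (intro continuous_intros cF cG ch)+
  also have "circle_mean (\<lambda>\<theta>. (- \<i> * of_int n) * (h (?z \<theta>) * ?e \<theta>)) = (- \<i> * of_int n) * coeff n t"
    unfolding coeff_def fourier_def by (rule circle_mean_mult_right) (intro continuous_intros ch)
  also have "circle_mean (\<lambda>\<theta>. \<i> * (F (?z \<theta>) * ?e \<theta>)) = \<i> * fourier (\<lambda>\<theta>. F (?z \<theta>)) n"
    unfolding fourier_def by (rule circle_mean_mult_right) (intro continuous_intros cF)
  also have "circle_mean (\<lambda>\<theta>. \<i> * (cnj (G (?z \<theta>)) * ?e \<theta>)) = \<i> * fourier (\<lambda>\<theta>. cnj (G (?z \<theta>))) n"
    unfolding fourier_def by (rule circle_mean_mult_right) (intro continuous_intros cG)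
  also have "fourier (\<lambda>\<theta>. cnj (G (?z \<theta>))) n = cnj (fourier (\<lambda>\<theta>. G (?z \<theta>)) (- n))"
    by (rule fourier_cnj[OF cG])
  finally have "\<i> * (of_int n * coeff n t) = \<i> * (fourier (\<lambda>\<theta>. F (?z \<theta>)) n - cnj (fourier (\<lambda>\<theta>. G (?z \<theta>)) (- n)))"
    by (simp add: algebra_simps)
  then show ?thesis by simp
qed

text \<open>For frequency 0 integration by parts says nothing about h, so the mean is differentiated
  in t instead; its derivative is the mean of F + cnj G, a constant. The slope is the logarithmic
  term.\<close>

lemma coeff_0:
  "\<exists>a b. \<forall>t\<in>{0<..<T}. coeff 0 t = a + of_real t * b"
proof -
  obtain a where a: "\<And>t. t\<in>{0<..<T} \<Longrightarrow> fourier (\<lambda>\<theta>. F (of_real (exp t) * cis \<theta>)) 0 = a * of_real (exp (of_int 0 * t))"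
    using fourier_holomorphic_annulus[OF holFG(1)] by blast
  obtain b where b: "\<And>t. t\<in>{0<..<T} \<Longrightarrow> fourier (\<lambda>\<theta>. G (of_real (exp t) * cis \<theta>)) 0 = b * of_real (exp (of_int 0 * t))"
    using fourier_holomorphic_annulus[OF holFG(2)] by blast
  let ?hp = "\<lambda>t \<theta>. F (of_real (exp t) * cis \<theta>) + cnj (G (of_real (exp t) * cis \<theta>))"
  have "((\<lambda>t. coeff 0 t - of_real t * (a + cnj b)) has_vector_derivative 0) (at t within {0<..<T})"
    if t: "t \<in> {0<..<T}" for t
  proof -
    note cF = circle_cont_compose[OF conts(1) t] and cG = circle_cont_compose[OF conts(2) t]
    have "((\<lambda>t. integral (cbox 0 (2*pi)) (\<lambda>\<theta>. h (of_real (exp t) * cis \<theta>))) has_vector_derivative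
       integral (cbox 0 (2*pi)) (?hp t)) (at t within {0<..<T})"
    proof (rule leibniz_rule_vector_derivative)
      show "continuous_on ({0<..<T} \<times> cbox 0 (2*pi)) (\<lambda>(t, \<theta>). ?hp t \<theta>)"
        unfolding split_beta
        by (intro continuous_intros continuous_on_compose2[OF conts(1)] continuous_on_compose2[OF conts(2)]) (auto simp del: of_real_exp)
      show "(\<lambda>\<theta>. h (of_real (exp x) * cis \<theta>)) integrable_on cbox 0 (2*pi)" if "x \<in> {0<..<T}" for x
        unfolding cbox_interval
        by (rule integrable_continuous_interval, rule circle_cont_compose[OF conts(3) that])
    qed (use t deriv_t in \<open>auto intro: has_vector_derivative_at_within simp del: of_real_exp\<close>)
    then have "((\<lambda>t. integral {0..2*pi} (\<lambda>\<theta>. h (of_real (exp t) * cis \<theta>)) /\<^sub>R (2*pi)) has_vector_derivative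
       integral {0..2*pi} (?hp t) /\<^sub>R (2*pi)) (at t within {0<..<T})"
      unfolding cbox_interval by (rule bounded_linear.has_vector_derivative[OF bounded_linear_scaleR_right])
    moreover have "integral {0..2*pi} (?hp t) /\<^sub>R (2*pi) = a + cnj b"
    proof -
      have "integral {0..2*pi} (?hp t) /\<^sub>R (2*pi) = circle_mean (\<lambda>\<theta>. F (of_real (exp t) * cis \<theta>)) + circle_mean (\<lambda>\<theta>. cnj (G (of_real (exp t) * cis \<theta>)))"
        unfolding circle_mean_def[symmetric] by (rule circle_mean_add) (intro continuous_intros cF cG)+
      also have "circle_mean (\<lambda>\<theta>. cnj (G (of_real (exp t) * cis \<theta>))) = cnj (circle_mean (\<lambda>\<theta>. G (of_real (exp t) * cis \<theta>)))"
        by (rule circle_mean_bounded_linear[OF bounded_linear_cnj cG])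
      finally show ?thesis using a[OF t] b[OF t] by (simp add: fourier_def)
    qed
    moreover have "coeff 0 = (\<lambda>t. integral {0..2*pi} (\<lambda>\<theta>. h (of_real (exp t) * cis \<theta>)) /\<^sub>R (2*pi))"
      by (simp add: coeff_def[abs_def] fourier_def circle_mean_def)
    ultimately have "(coeff 0 has_vector_derivative (a + cnj b)) (at t within {0<..<T})" by simp
    then have "((\<lambda>t. coeff 0 t - of_real t * (a + cnj b)) has_vector_derivative (a + cnj b) - (a + cnj b)) (at t within {0<..<T})"
    proof (rule has_vector_derivative_diff)
      show "((\<lambda>t. complex_of_real t * (a + cnj b)) has_vector_derivative (a + cnj b)) (at t within {0<..<T})"
        unfolding scaleR_conv_of_real[symmetric]
        using bounded_linear.has_vector_derivative[OF bounded_linear_scaleR_left has_vector_derivative_id, of "a + cnj b"] by simp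
    qed
    then show ?thesis by simp
  qed
  from has_vector_derivative_zero_constant[OF _ this]
  obtain c where "\<And>t. t \<in> {0<..<T} \<Longrightarrow> coeff 0 t - of_real t * (a + cnj b) = c"
    by auto
  then show ?thesis by (metis diff_eq_eq)
qed

text \<open>The solution of y'' = n^2 y with y(0) = 0 and y(T) = 1; the linear function is the
  limiting case n = 0.\<close>

definition sg :: "int \<Rightarrow> real \<Rightarrow> real" where
  "sg n t = (if n = 0 then t / T else sinh (of_int n * t) / sinh (of_int n * T))"

text \<open>Each coefficient solves y'' = n^2 y, and the functions \<open>sg n (T - t)\<close> and
  \<open>sg n t\<close> form the basis of solutions adapted to the two ends. Thus \<open>x n\<close>
  and \<open>z n\<close> play the role of Fourier coefficients of h on the inner and outer boundary
  circle, although h need not extend continuously there.\<close>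

lemma coeff_boundary_values:
  "\<exists>x z. \<forall>n. \<forall>t\<in>{0<..<T}. coeff n t = of_real (sg n (T - t)) * x n + of_real (sg n t) * z n"
proof -
  have "\<exists>x z. \<forall>t\<in>{0<..<T}. coeff n t = of_real (sg n (T - t)) * x + of_real (sg n t) * z" for n
  proof (cases "n = 0")
    case True
    obtain a b where ab: "\<And>t. t\<in>{0<..<T} \<Longrightarrow> coeff 0 t = a + of_real t * b" using coeff_0 by blast
    have "coeff n t = of_real (sg n (T - t)) * a + of_real (sg n t) * (a + of_real T * b)" if "t \<in> {0<..<T}" for t
      using T ab[OF that] True by (simp add: sg_def field_simps)
    then show ?thesis by blast
  next
    case False
    obtain a where a: "\<And>t. t\<in>{0<..<T} \<Longrightarrow> fourier (\<lambda>\<theta>. F (of_real (exp t) * cis \<theta>)) n = a * of_real (exp (of_int n * t))"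
      using fourier_holomorphic_annulus[OF holFG(1)] by blast
    obtain b where b: "\<And>t. t\<in>{0<..<T} \<Longrightarrow> fourier (\<lambda>\<theta>. G (of_real (exp t) * cis \<theta>)) (-n) = b * of_real (exp (of_int (-n) * t))"
      using fourier_holomorphic_annulus[OF holFG(2)] by blast
    define A B where "A = a / of_int n" and "B = - cnj b / of_int n"
    have c: "coeff n t = A * of_real (exp (of_int n * t)) + B * of_real (exp (- (of_int n * t)))" if "t \<in> {0<..<T}" for t
    proof -
      have "of_int n * coeff n t = of_int n * (A * of_real (exp (of_int n * t)) + B * of_real (exp (- (of_int n * t))))"
        unfolding coeff_parts[OF that] a[OF that] b[OF that] A_def B_def using False by (simp add: algebra_simps del: of_real_exp)
      then show ?thesis using False by simp
    qed
    have s: "sinh (of_int n * T) \<noteq> (0::real)" using False T by simp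
    have "coeff n t = of_real (sg n (T - t)) * (A + B) + of_real (sg n t) * (A * of_real (exp (of_int n * T)) + B * of_real (exp (- (of_int n * T))))"
      if "t \<in> {0<..<T}" for t
    proof -
      define m where "m = real_of_int n"
      have e1: "sinh (m * (T - t)) + sinh (m * t) * exp (m * T) = exp (m * t) * sinh (m * T)"
        by (simp add: sinh_def exp_add exp_diff exp_minus field_simps)
      have e2: "sinh (m * (T - t)) + sinh (m * t) * exp (- (m * T)) = exp (- (m * t)) * sinh (m * T)"
        by (simp add: sinh_def exp_add exp_diff exp_minus field_simps)
      have s': "sinh (m * T) \<noteq> 0" using s by (simp add: m_def)
      have "sg n (T - t) + sg n t * exp (m * T) = exp (m * t)"
        using e1 False s' by (simp add: sg_def m_def[symmetric] field_simps)
      moreover have "sg n (T - t) + sg n t * exp (- (m * T)) = exp (- (m * t))"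
        using e2 False s' by (simp add: sg_def m_def[symmetric] field_simps)
      moreover have "of_real (sg n (T - t)) * (A + B) + of_real (sg n t) * (A * of_real (exp (m * T)) + B * of_real (exp (- (m * T))))
        = A * of_real (sg n (T - t) + sg n t * exp (m * T)) + B * of_real (sg n (T - t) + sg n t * exp (- (m * T)))"
        by (simp add: algebra_simps del: of_real_exp)
      ultimately show ?thesis unfolding c[OF that] m_def[symmetric] by (simp only:)
    qed
    then show ?thesis by blast
  qed
  then show ?thesis by metis
qed

end

section \<open>Schwarz-Pick inequality and Poisson kernel means\<close>

lemma circle_mean_value:
  assumes "g holomorphic_on cball 0 r" "r > 0"
  shows "circle_mean (\<lambda>\<theta>. g (of_real r * cis \<theta>)) = g 0"
proof -
  have "((\<lambda>u. g u / (u - 0)) has_contour_integral (2 * of_real pi * \<i>) * g 0) (circlepath 0 r)"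
    by (rule Cauchy_integral_circlepath_simple) (use assms in auto)
  then have "contour_integral (part_circlepath 0 r 0 (2*pi)) (\<lambda>u. g u / u) = (2 * of_real pi * \<i>) * g 0"
    by (simp add: circlepath_def contour_integral_unique)
  then have "integral {0..2*pi} (\<lambda>t. g (0 + of_real r * cis t) / (0 + of_real r * cis t) * of_real r * \<i> * cis t) = (2 * of_real pi * \<i>) * g 0"
    by (subst (asm) contour_integral_part_circlepath_eq) (use pi_gt_zero in simp_all)
  moreover have "(\<lambda>t. g (0 + of_real r * cis t) / (0 + of_real r * cis t) * of_real r * \<i> * cis t) = (\<lambda>t. \<i> * g (of_real r * cis t))"
    using assms(2) by (simp add: fun_eq_iff field_simps)
  ultimately have "\<i> * integral {0..2*pi} (\<lambda>t. g (of_real r * cis t)) = (2 * of_real pi * \<i>) * g 0"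
    by simp
  then have "integral {0..2*pi} (\<lambda>t. g (of_real r * cis t)) = 2 * of_real pi * g 0" by simp
  then show ?thesis unfolding circle_mean_def by (simp add: scaleR_conv_of_real)
qed

lemma circle_mean_Re:
  assumes "circle_cont g"
  shows "circle_mean (\<lambda>\<theta>. Re (g \<theta>)) = Re (circle_mean g)"
  by (rule circle_mean_bounded_linear[OF bounded_linear_Re assms])

lemma circle_cont_polar:
  assumes "continuous_on (sphere 0 r) g" "r \<ge> 0"
  shows "circle_cont (\<lambda>\<theta>. g (of_real r * cis \<theta>))"
  by (rule continuous_on_compose2[OF assms(1)]) (use assms(2) in \<open>auto intro!: continuous_intros simp: norm_mult\<close>)

text \<open>A sharp Schwarz--Pick inequality for a harmonic \<open>H = f + cnj g\<close>.  Dividing \<open>f\<close> and \<open>g\<close> by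
  the Blaschke factor with zero \<open>w\<close> leaves \<open>|H|\<close> unchanged on the boundary circle, and
  \<open>|F|\<^sup>2 + |G|\<^sup>2 + 2 Re (f g)\<close> is subharmonic.\<close>
lemma harmonic_schwarz_pick:
  assumes hol: "f holomorphic_on ball 0 1" "g holomorphic_on ball 0 1"
    and le1: "\<And>z. z \<in> ball 0 1 \<Longrightarrow> cmod (f z + cnj (g z)) \<le> 1"
    and w: "w \<in> ball 0 1" "f w = 0" "g w = 0" and z0: "z0 \<in> ball 0 1"
  shows "(1 - (cmod w)\<^sup>2) * (1 - (cmod z0)\<^sup>2) * ((cmod (f z0))\<^sup>2 + (cmod (g z0))\<^sup>2)
     \<le> (cmod (z0 - w))\<^sup>2 * (1 - (cmod (f z0 + cnj (g z0)))\<^sup>2)"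
proof -
  \<comment> \<open>The quotient with its removable singularity filled in; as f and g vanish at w,
    they are (z - w) times holomorphic functions.\<close>
  define quo where "quo = (\<lambda>(f::complex\<Rightarrow>complex) z. if z = w then deriv f w else (f z - f w) / (z - w))"
  have hq: "quo f holomorphic_on ball 0 1" if "f holomorphic_on ball 0 1" for f
    unfolding quo_def by (rule pole_lemma[OF that]) (use w in auto)
  define f1 g1 where "f1 = quo f" and "g1 = quo g"
  have f1: "f1 holomorphic_on ball 0 1" "f z = (z - w) * f1 z" and g1: "g1 holomorphic_on ball 0 1" "g z = (z - w) * g1 z" for z
    using hq[OF hol(1)] hq[OF hol(2)] w by (auto simp: f1_def g1_def quo_def)
  have main: "((cmod (f1 z0))\<^sup>2 + (cmod (g1 z0))\<^sup>2) * ((cmod (of_real (\<rho>\<^sup>2) - cnj w * z0))\<^sup>2 / \<rho>\<^sup>2) + 2 * Re (f z0 * g z0) \<le> 1"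
    if \<rho>: "cmod w < \<rho>" "cmod z0 < \<rho>" "\<rho> < 1" for \<rho>
  proof -
    have \<rho>0: "\<rho> > 0" using \<rho>(1) norm_ge_zero[of w] by linarith
    define F where "F = (\<lambda>z. f1 z * (of_real (\<rho>\<^sup>2) - cnj w * z) / of_real \<rho>)"
    define G where "G = (\<lambda>z. g1 z * (of_real (\<rho>\<^sup>2) - cnj w * z) / of_real \<rho>)"
    \<comment> \<open>A holomorphic function touching at \<open>z0\<close>: on the circle, 2 Re (cnj
      a b) \<le> |a|^2 + |b|^2 bounds Re \<Theta> by 1 + |F z0|^2 + |G z0|^2, while at
      \<open>z0\<close> that inequality is sharp. The maximum principle for Re \<Theta> thereby
      replaces subharmonicity.\<close>
    define \<Theta> where "\<Theta> = (\<lambda>z. 2 * cnj (F z0) * F z + 2 * cnj (G z0) * G z + 2 * (f z * g z))"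
    have sub: "cball 0 \<rho> \<subseteq> ball 0 1" using \<rho> by auto
    have hol\<Theta>: "\<Theta> holomorphic_on cball 0 \<rho>"
      unfolding \<Theta>_def F_def G_def
      by (intro holomorphic_intros holomorphic_on_subset[OF hol(1) sub] holomorphic_on_subset[OF hol(2) sub]
          holomorphic_on_subset[OF f1(1) sub] holomorphic_on_subset[OF g1(1) sub]) (use \<rho>0 in auto)
    have bd: "Re (\<Theta> z) \<le> 1 + (cmod (F z0))\<^sup>2 + (cmod (G z0))\<^sup>2" if "z \<in> frontier (cball 0 \<rho>)" for z
    proof -
      have zn: "cmod z = \<rho>" using that by simp
      have zz: "z * cnj z = of_real (\<rho>\<^sup>2)" using zn by (metis complex_norm_square of_real_power)
      have "of_real (\<rho>\<^sup>2) - cnj w * z = z * cnj (z - w)" using zz by (simp add: algebra_simps)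
      then have nB: "cmod (of_real (\<rho>\<^sup>2) - cnj w * z) = \<rho> * cmod (z - w)" by (simp add: norm_mult zn flip: complex_cnj_diff)
      have nF: "cmod (F z) = cmod (f z)" "cmod (G z) = cmod (g z)"
        unfolding F_def G_def f1(2) g1(2) norm_mult norm_divide nB using \<rho>0 by simp_all
      have amgm: "2 * Re (cnj a * b) \<le> (cmod a)\<^sup>2 + (cmod b)\<^sup>2" for a b
      proof -
        have "0 \<le> (cmod (a - b))\<^sup>2" by simp
        then show ?thesis unfolding cmod_power2 by (simp add: power2_eq_square algebra_simps)
      qed
      have "(cmod (f z + cnj (g z)))\<^sup>2 = (cmod (f z))\<^sup>2 + (cmod (g z))\<^sup>2 + 2 * Re (f z * g z)"
        unfolding cmod_power2 by (simp add: power2_eq_square algebra_simps)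
      moreover have "(cmod (f z + cnj (g z)))\<^sup>2 \<le> 1" using le1[of z] zn \<rho> by (simp add: power_le_one)
      moreover have "Re (\<Theta> z) = 2 * Re (cnj (F z0) * F z) + 2 * Re (cnj (G z0) * G z) + 2 * Re (f z * g z)"
        unfolding \<Theta>_def by (simp add: algebra_simps)
      ultimately show ?thesis using amgm[of "F z0" "F z"] amgm[of "G z0" "G z"] unfolding nF by linarith
    qed
    have "Re (\<Theta> z0) \<le> 1 + (cmod (F z0))\<^sup>2 + (cmod (G z0))\<^sup>2"
    proof (rule maximum_real_frontier[of \<Theta> "cball 0 \<rho>"])
      show "\<Theta> holomorphic_on interior (cball 0 \<rho>)" by (rule holomorphic_on_subset[OF hol\<Theta>]) simp
      show "continuous_on (closure (cball 0 \<rho>)) \<Theta>" using holomorphic_on_imp_continuous_on[OF hol\<Theta>] by simp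
    qed (use bd \<rho> in auto)
    moreover have "Re (\<Theta> z0) = 2 * (cmod (F z0))\<^sup>2 + 2 * (cmod (G z0))\<^sup>2 + 2 * Re (f z0 * g z0)"
      unfolding \<Theta>_def cmod_power2 by (simp add: power2_eq_square algebra_simps)
    ultimately have "(cmod (F z0))\<^sup>2 + (cmod (G z0))\<^sup>2 + 2 * Re (f z0 * g z0) \<le> 1" by linarith
    then show ?thesis unfolding F_def G_def norm_mult norm_divide
      using \<rho>0 by (simp add: power_mult_distrib power_divide algebra_simps add_divide_distrib)
  qed
  have lim: "((\<lambda>\<rho>. ((cmod (f1 z0))\<^sup>2 + (cmod (g1 z0))\<^sup>2) * ((cmod (of_real (\<rho>\<^sup>2) - cnj w * z0))\<^sup>2 / \<rho>\<^sup>2) + 2 * Re (f z0 * g z0)) \<longlongrightarrow>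
     ((cmod (f1 z0))\<^sup>2 + (cmod (g1 z0))\<^sup>2) * ((cmod (of_real (1\<^sup>2) - cnj w * z0))\<^sup>2 / 1\<^sup>2) + 2 * Re (f z0 * g z0)) (at_left 1)"
    by (intro tendsto_intros) auto
  have "((cmod (f1 z0))\<^sup>2 + (cmod (g1 z0))\<^sup>2) * ((cmod (of_real (1\<^sup>2) - cnj w * z0))\<^sup>2 / 1\<^sup>2) + 2 * Re (f z0 * g z0) \<le> 1"
  proof (rule tendsto_upperbound[OF lim])
    have "max (cmod w) (cmod z0) < 1" using w z0 by auto
    then show "\<forall>\<^sub>F \<rho> in at_left 1. ((cmod (f1 z0))\<^sup>2 + (cmod (g1 z0))\<^sup>2) * ((cmod (of_real (\<rho>\<^sup>2) - cnj w * z0))\<^sup>2 / \<rho>\<^sup>2) + 2 * Re (f z0 * g z0) \<le> 1"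
      unfolding eventually_at_left[OF \<open>max (cmod w) (cmod z0) < 1\<close>]
      by (intro exI[of _ "max (cmod w) (cmod z0)"] conjI allI impI main) auto
  qed simp
  then have le: "((cmod (f1 z0))\<^sup>2 + (cmod (g1 z0))\<^sup>2) * (cmod (1 - cnj w * z0))\<^sup>2 + 2 * Re (f z0 * g z0) \<le> 1" by simp
  have id: "(cmod (1 - cnj w * z0))\<^sup>2 = (cmod (z0 - w))\<^sup>2 + (1 - (cmod w)\<^sup>2) * (1 - (cmod z0)\<^sup>2)"
    unfolding cmod_power2 by (simp add: power2_eq_square algebra_simps)
  define q where "q = (cmod (z0 - w))\<^sup>2"
  have nf: "(cmod (f z0))\<^sup>2 = q * (cmod (f1 z0))\<^sup>2" "(cmod (g z0))\<^sup>2 = q * (cmod (g1 z0))\<^sup>2"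
    unfolding f1(2) g1(2) q_def by (simp_all add: norm_mult power_mult_distrib)
  have H: "(cmod (f z0 + cnj (g z0)))\<^sup>2 = (cmod (f z0))\<^sup>2 + (cmod (g z0))\<^sup>2 + 2 * Re (f z0 * g z0)"
    unfolding cmod_power2 by (simp add: power2_eq_square algebra_simps)
  have "q * (((cmod (f1 z0))\<^sup>2 + (cmod (g1 z0))\<^sup>2) * (q + (1 - (cmod w)\<^sup>2) * (1 - (cmod z0)\<^sup>2)) + 2 * Re (f z0 * g z0)) \<le> q * 1"
    using le unfolding id q_def[symmetric] by (intro mult_left_mono) (auto simp: q_def)
  then show ?thesis unfolding H nf q_def[symmetric] by (simp add: algebra_simps)
qed

text \<open>On the circle of radius \<rho> the weight |z - w|^2 agrees with a rational function of z
  alone. This is what allows means against |z - w|^(-2) and |z - w|^(-4) to be evaluated by the mean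
  value property.\<close>

lemma on_circle:
  assumes "\<rho> > cmod w"
  defines "z \<equiv> \<lambda>\<theta>. of_real \<rho> * cis \<theta>"
  shows "z \<theta> - w \<noteq> 0" and "of_real (\<rho>\<^sup>2) - cnj w * z \<theta> \<noteq> 0"
    and "of_real ((cmod (z \<theta> - w))\<^sup>2) = (z \<theta> - w) * (of_real (\<rho>\<^sup>2) - cnj w * z \<theta>) / z \<theta>"
    and "z \<theta> \<noteq> 0" and "cmod (z \<theta>) = \<rho>" and "z \<theta> * cnj (z \<theta>) = of_real (\<rho>\<^sup>2)"
proof -
  have \<rho>0: "\<rho> > 0" using assms(1) norm_ge_zero[of w] by linarith
  then show zn: "cmod (z \<theta>) = \<rho>" by (simp add: z_def norm_mult)
  then show z0: "z \<theta> \<noteq> 0" using \<rho>0 by auto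
  show zz: "z \<theta> * cnj (z \<theta>) = of_real (\<rho>\<^sup>2)" using zn by (metis complex_norm_square of_real_power)
  show zw: "z \<theta> - w \<noteq> 0" using zn assms(1) by auto
  have e: "of_real (\<rho>\<^sup>2) - cnj w * z \<theta> = z \<theta> * cnj (z \<theta> - w)" using zz by (simp add: algebra_simps)
  then show "of_real (\<rho>\<^sup>2) - cnj w * z \<theta> \<noteq> 0" using z0 zw by (metis complex_cnj_zero_iff mult_eq_0_iff)
  show "of_real ((cmod (z \<theta> - w))\<^sup>2) = (z \<theta> - w) * (of_real (\<rho>\<^sup>2) - cnj w * z \<theta>) / z \<theta>"
  proof -
    have "(z \<theta> - w) * (z \<theta> * cnj (z \<theta> - w)) / z \<theta> = (z \<theta> - w) * cnj (z \<theta> - w)"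
      using z0 by (metis mult.left_commute nonzero_mult_div_cancel_left)
    then show ?thesis unfolding e by (simp only: complex_norm_square)
  qed
qed

lemma denominator_nonzero:
  assumes "cmod w < \<rho>" "z \<in> cball 0 \<rho>"
  shows "of_real (\<rho>\<^sup>2) - cnj w * z \<noteq> 0"
proof
  assume "of_real (\<rho>\<^sup>2) - cnj w * z = 0"
  then have "of_real (\<rho>\<^sup>2) = cnj w * z" by simp
  then have "cmod w * cmod z = \<rho>\<^sup>2" by (metis complex_mod_cnj norm_mult norm_of_real abs_power2)
  moreover have "cmod w * cmod z \<le> cmod w * \<rho>" using assms by (intro mult_left_mono) auto
  moreover have "cmod w * \<rho> < \<rho> * \<rho>" using assms(1) norm_ge_zero[of w] by (intro mult_strict_right_mono) linarith+
  ultimately show False by (simp add: power2_eq_square)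
qed

text \<open>The Poisson kernel is the real part of the function \<open>Q\<close>, holomorphic in the
  disc, with value 1 at the centre.\<close>

lemma circle_mean_inverse_square:
  assumes "\<rho> > cmod w"
  shows "circle_mean (\<lambda>\<theta>. 1 / (cmod (of_real \<rho> * cis \<theta> - w))\<^sup>2) = 1 / (\<rho>\<^sup>2 - (cmod w)\<^sup>2)"
proof -
  let ?z = "\<lambda>\<theta>. of_real \<rho> * cis \<theta>"
  note oc = on_circle[OF assms]
  have \<rho>0: "\<rho> > 0" using assms(1) norm_ge_zero[of w] by linarith
  have pos: "\<rho>\<^sup>2 - (cmod w)\<^sup>2 > 0" using assms power_strict_mono[of "cmod w" \<rho> 2] by simp
  define Q where "Q = (\<lambda>z. (of_real (\<rho>\<^sup>2) + cnj w * z) / (of_real (\<rho>\<^sup>2) - cnj w * z))"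
  have holQ: "Q holomorphic_on cball 0 \<rho>"
    unfolding Q_def by (intro holomorphic_intros denominator_nonzero assms)
  have P: "(\<rho>\<^sup>2 - (cmod w)\<^sup>2) / (cmod (?z \<theta> - w))\<^sup>2 = Re (Q (?z \<theta>))" for \<theta>
  proof -
    have e: "of_real (\<rho>\<^sup>2) - cnj w * ?z \<theta> = ?z \<theta> * cnj (?z \<theta> - w)" "of_real (\<rho>\<^sup>2) + cnj w * ?z \<theta> = ?z \<theta> * cnj (?z \<theta> + w)"
      using oc(6)[of \<theta>] by (simp_all add: algebra_simps)
    have nz: "cmod (?z \<theta> - w) \<noteq> 0" using oc(1) by simp
    have "Q (?z \<theta>) = cnj (?z \<theta> + w) / cnj (?z \<theta> - w)" unfolding Q_def e using oc(4) by simp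
    also have "\<dots> = cnj (?z \<theta> + w) * (?z \<theta> - w) / of_real ((cmod (?z \<theta> - w))\<^sup>2)"
    proof -
      have "a / cnj b = a * b / of_real ((cmod b)\<^sup>2)" if "b \<noteq> 0" for a b :: complex
        unfolding complex_norm_square using that by simp
      then show ?thesis using oc(1) by blast
    qed
    finally have "Re (Q (?z \<theta>)) = Re (cnj (?z \<theta> + w) * (?z \<theta> - w)) / (cmod (?z \<theta> - w))\<^sup>2" by (simp only: Re_divide_of_real)
    also have "Re (cnj (?z \<theta> + w) * (?z \<theta> - w)) = (cmod (?z \<theta>))\<^sup>2 - (cmod w)\<^sup>2"
      unfolding cmod_power2 by (simp add: power2_eq_square algebra_simps)
    finally show ?thesis using oc(5) by simp
  qed
  have cQ: "circle_cont (\<lambda>\<theta>. Q (?z \<theta>))"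
    by (rule circle_cont_polar) (use \<rho>0 holomorphic_on_imp_continuous_on[OF holQ] in \<open>auto intro: continuous_on_subset\<close>)
  have "circle_mean (\<lambda>\<theta>. (\<rho>\<^sup>2 - (cmod w)\<^sup>2) * (1 / (cmod (?z \<theta> - w))\<^sup>2)) = Re (circle_mean (\<lambda>\<theta>. Q (?z \<theta>)))"
    using P by (simp add: circle_mean_Re[OF cQ])
  also have "\<dots> = 1" unfolding circle_mean_value[OF holQ \<rho>0] using \<rho>0 by (simp add: Q_def)
  finally have "(\<rho>\<^sup>2 - (cmod w)\<^sup>2) * circle_mean (\<lambda>\<theta>. 1 / (cmod (?z \<theta> - w))\<^sup>2) = 1"
    by (subst (asm) circle_mean_mult_right_real) (use oc(1) in \<open>auto intro!: continuous_intros\<close>)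
  then show ?thesis using pos by (simp add: field_simps)
qed

text \<open>The square of the Poisson kernel is, on the circle, the real part of a function
  \<open>A\<close> holomorphic in the disc, and A(0) = c. With X = cnj w z / \<rho>^2 and Y its
  conjugate, this is an identity between rational functions of X and Y, where X Y is constant on the
  circle.\<close>

lemma circle_mean_inverse_fourth:
  assumes "\<rho> > cmod w"
  shows "circle_mean (\<lambda>\<theta>. 1 / (cmod (of_real \<rho> * cis \<theta> - w)) ^ 4) = (\<rho>\<^sup>2 + (cmod w)\<^sup>2) / (\<rho>\<^sup>2 - (cmod w)\<^sup>2) ^ 3"
proof -
  let ?z = "\<lambda>\<theta>. of_real \<rho> * cis \<theta>"
  note oc = on_circle[OF assms]
  have \<rho>0: "\<rho> > 0" using assms(1) norm_ge_zero[of w] by linarith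
  have pos: "\<rho>\<^sup>2 - (cmod w)\<^sup>2 > 0" using assms power_strict_mono[of "cmod w" \<rho> 2] by simp
  define c where "c = (\<rho>\<^sup>2 + (cmod w)\<^sup>2) / (\<rho>\<^sup>2 - (cmod w)\<^sup>2)"
  define Z where "Z = (\<lambda>z. cnj w * z / of_real (\<rho>\<^sup>2))"
  define A where "A = (\<lambda>z. of_real c * (1 + Z z) / (1 - Z z) + 2 * Z z / (1 - Z z)\<^sup>2)"
  have Z1: "1 - Z z \<noteq> 0" if "z \<in> cball 0 \<rho>" for z
  proof -
    have "1 - Z z = (of_real (\<rho>\<^sup>2) - cnj w * z) / of_real (\<rho>\<^sup>2)" using \<rho>0 by (simp add: Z_def field_simps)
    then show ?thesis using denominator_nonzero[OF assms that] \<rho>0 by simp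
  qed
  have holA: "A holomorphic_on cball 0 \<rho>"
  proof -
    have "Z holomorphic_on cball 0 \<rho>" unfolding Z_def by (intro holomorphic_intros) (use \<rho>0 in auto)
    then show ?thesis unfolding A_def using Z1 by (intro holomorphic_intros) auto
  qed
  have P: "(\<rho>\<^sup>2 - (cmod w)\<^sup>2)\<^sup>2 / (cmod (?z \<theta> - w)) ^ 4 = Re (A (?z \<theta>))" for \<theta>
  proof -
    define X Y where "X = Z (?z \<theta>)" and "Y = cnj (Z (?z \<theta>))"
    have zb: "?z \<theta> \<in> cball 0 \<rho>" using oc(5) by simp
    have X1: "1 - X \<noteq> 0" unfolding X_def by (rule Z1[OF zb])
    have Y1: "1 - Y \<noteq> 0" using X1 unfolding X_def Y_def by (metis complex_cnj_cancel_iff complex_cnj_diff complex_cnj_one eq_iff_diff_eq_0)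
    have nX: "cmod X = cmod w / \<rho>" unfolding X_def Z_def norm_divide norm_mult oc(5) using \<rho>0 by (simp add: power2_eq_square norm_mult)
    have XY: "X * Y = of_real ((cmod w)\<^sup>2 / \<rho>\<^sup>2)"
      unfolding Y_def X_def[symmetric] by (simp only: complex_norm_square[symmetric] nX) (simp add: power_divide)
    have XY1: "1 - X * Y \<noteq> 0"
    proof -
      have "1 - X * Y = of_real (1 - (cmod w)\<^sup>2 / \<rho>\<^sup>2)" unfolding XY by simp
      moreover have "(cmod w)\<^sup>2 / \<rho>\<^sup>2 < 1" using pos \<rho>0 by (simp add: divide_less_eq)
      then have "1 - (cmod w)\<^sup>2 / \<rho>\<^sup>2 \<noteq> 0" by linarith
      ultimately show ?thesis by (metis of_real_eq_0_iff)
    qed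
    have c: "of_real c = (1 + X * Y) / (1 - X * Y)"
    proof -
      have "1 + (cmod w)\<^sup>2 / \<rho>\<^sup>2 = (\<rho>\<^sup>2 + (cmod w)\<^sup>2) / \<rho>\<^sup>2" "1 - (cmod w)\<^sup>2 / \<rho>\<^sup>2 = (\<rho>\<^sup>2 - (cmod w)\<^sup>2) / \<rho>\<^sup>2"
        using \<rho>0 by (simp_all add: add_divide_distrib diff_divide_distrib)
      then have "c = (1 + (cmod w)\<^sup>2 / \<rho>\<^sup>2) / (1 - (cmod w)\<^sup>2 / \<rho>\<^sup>2)"
        unfolding c_def using \<rho>0 by simp
      then show ?thesis unfolding XY by (simp only: of_real_divide of_real_add of_real_diff of_real_1)
    qed
    have A1: "A (?z \<theta>) = (1 + X * Y) / (1 - X * Y) * (1 + X) / (1 - X) + 2 * X / (1 - X)\<^sup>2"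
      by (simp only: A_def X_def[symmetric] c)
    have "cnj X = Y" "cnj Y = X" by (simp_all add: X_def Y_def)
    then have A2: "cnj (A (?z \<theta>)) = (1 + X * Y) / (1 - X * Y) * (1 + Y) / (1 - Y) + 2 * Y / (1 - Y)\<^sup>2"
      unfolding A1 by (simp add: mult.commute)
    have "(1 - X * Y)\<^sup>2 / ((1 - X)\<^sup>2 * (1 - Y)\<^sup>2) = (((1 + X * Y) / (1 - X * Y) * (1 + X) / (1 - X) + 2 * X / (1 - X)\<^sup>2)
      + ((1 + X * Y) / (1 - X * Y) * (1 + Y) / (1 - Y) + 2 * Y / (1 - Y)\<^sup>2)) / 2"
    proof -
      have "(1 + X) / (1 - X) + (1 + Y) / (1 - Y) = 2 * (1 - X * Y) / ((1 - X) * (1 - Y))"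
        using X1 Y1 by (simp add: field_simps)
      then have "(1 + X * Y) / (1 - X * Y) * ((1 + X) / (1 - X) + (1 + Y) / (1 - Y)) = 2 * (1 + X * Y) / ((1 - X) * (1 - Y))"
      proof -
        have "N / D * (2 * D / E) = 2 * N / E" if "D \<noteq> 0" for N D E :: complex using that by simp
        then show ?thesis unfolding \<open>(1 + X) / (1 - X) + (1 + Y) / (1 - Y) = _\<close> using XY1 by blast
      qed
      then have "(((1 + X * Y) / (1 - X * Y) * (1 + X) / (1 - X) + 2 * X / (1 - X)\<^sup>2)
      + ((1 + X * Y) / (1 - X * Y) * (1 + Y) / (1 - Y) + 2 * Y / (1 - Y)\<^sup>2)) / 2
        = (1 + X * Y) / ((1 - X) * (1 - Y)) + X / (1 - X)\<^sup>2 + Y / (1 - Y)\<^sup>2"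
      proof -
        have gen: "((c * P + 2 * x) + (c * Q + 2 * y)) / 2 = u + x + y" if "c * (P + Q) = 2 * u" for c P Q x y u :: complex
        proof -
          have "(c * P + 2 * x) + (c * Q + 2 * y) = c * (P + Q) + 2 * x + 2 * y" by (simp add: algebra_simps)
          then show ?thesis unfolding that by simp
        qed
        assume "(1 + X * Y) / (1 - X * Y) * ((1 + X) / (1 - X) + (1 + Y) / (1 - Y)) = 2 * (1 + X * Y) / ((1 - X) * (1 - Y))"
        then have "(1 + X * Y) / (1 - X * Y) * ((1 + X) / (1 - X) + (1 + Y) / (1 - Y)) = 2 * ((1 + X * Y) / ((1 - X) * (1 - Y)))"
          by simp
        from gen[OF this, of "X / (1 - X)\<^sup>2" "Y / (1 - Y)\<^sup>2"] show ?thesis by simp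
      qed
      also have "\<dots> = ((1 + X * Y) * ((1 - X) * (1 - Y)) + X * (1 - Y)\<^sup>2 + Y * (1 - X)\<^sup>2) / ((1 - X)\<^sup>2 * (1 - Y)\<^sup>2)"
        using X1 Y1 by (simp add: add_divide_distrib power2_eq_square)
      also have "(1 + X * Y) * ((1 - X) * (1 - Y)) + X * (1 - Y)\<^sup>2 + Y * (1 - X)\<^sup>2 = (1 - X * Y)\<^sup>2"
        by (simp add: power2_eq_square algebra_simps)
      finally show ?thesis by simp
    qed
    also have "\<dots> = (A (?z \<theta>) + cnj (A (?z \<theta>))) / 2"
      by (subst A2, subst A1) (rule refl)
    also have "\<dots> = of_real (Re (A (?z \<theta>)))" by (simp add: complex_add_cnj)
    finally have eq: "(1 - X * Y)\<^sup>2 / ((1 - X)\<^sup>2 * (1 - Y)\<^sup>2) = of_real (Re (A (?z \<theta>)))" .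
    have "1 - X = (of_real (\<rho>\<^sup>2) - cnj w * ?z \<theta>) / of_real (\<rho>\<^sup>2)" unfolding X_def Z_def using \<rho>0 by (simp add: field_simps)
    moreover have "of_real (\<rho>\<^sup>2) - cnj w * ?z \<theta> = ?z \<theta> * cnj (?z \<theta> - w)" using oc(6)[of \<theta>] by (simp add: algebra_simps)
    ultimately have "1 - X = ?z \<theta> * cnj (?z \<theta> - w) / of_real (\<rho>\<^sup>2)" by (simp only:)
    then have "cmod (1 - X) = cmod (?z \<theta> - w) / \<rho>" using oc(5)[of \<theta>] \<rho>0
      by (simp add: norm_mult norm_divide power2_eq_square flip: complex_cnj_diff)
    moreover have "(1 - X)\<^sup>2 * (1 - Y)\<^sup>2 = of_real (cmod (1 - X) ^ 4)"
    proof -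
      have "(1 - X) * (1 - Y) = of_real ((cmod (1 - X))\<^sup>2)" unfolding complex_norm_square Y_def X_def by simp
      then have "((1 - X) * (1 - Y))\<^sup>2 = (of_real ((cmod (1 - X))\<^sup>2))\<^sup>2" by simp
      then show ?thesis by (simp add: power_mult_distrib flip: power_mult of_real_power)
    qed
    moreover have "(1 - X * Y)\<^sup>2 = of_real ((1 - (cmod w)\<^sup>2 / \<rho>\<^sup>2)\<^sup>2)" unfolding XY by simp
    ultimately have "Re (A (?z \<theta>)) = (1 - (cmod w)\<^sup>2 / \<rho>\<^sup>2)\<^sup>2 / (cmod (?z \<theta> - w) / \<rho>) ^ 4"
      using eq by (metis of_real_divide of_real_eq_iff)
    also have "\<dots> = (\<rho>\<^sup>2 - (cmod w)\<^sup>2)\<^sup>2 / (cmod (?z \<theta> - w)) ^ 4"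
    proof -
      have "1 - (cmod w)\<^sup>2 / \<rho>\<^sup>2 = (\<rho>\<^sup>2 - (cmod w)\<^sup>2) / \<rho>\<^sup>2" using \<rho>0 by (simp add: field_simps)
      moreover have "(\<rho>\<^sup>2)\<^sup>2 = \<rho> ^ 4" by (simp flip: power_mult)
      ultimately show ?thesis using \<rho>0 by (simp add: power_divide)
    qed
    finally show ?thesis by simp
  qed
  have cA: "circle_cont (\<lambda>\<theta>. A (?z \<theta>))"
    by (rule circle_cont_polar) (use \<rho>0 holomorphic_on_imp_continuous_on[OF holA] in \<open>auto intro: continuous_on_subset\<close>)
  have "circle_mean (\<lambda>\<theta>. (\<rho>\<^sup>2 - (cmod w)\<^sup>2)\<^sup>2 * (1 / (cmod (?z \<theta> - w)) ^ 4)) = Re (circle_mean (\<lambda>\<theta>. A (?z \<theta>)))"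
    using P by (simp add: circle_mean_Re[OF cA])
  also have "\<dots> = c" unfolding circle_mean_value[OF holA \<rho>0] by (simp add: A_def Z_def)
  finally have "(\<rho>\<^sup>2 - (cmod w)\<^sup>2)\<^sup>2 * circle_mean (\<lambda>\<theta>. 1 / (cmod (?z \<theta> - w)) ^ 4) = c"
    by (subst (asm) circle_mean_mult_right_real) (use oc(1) in \<open>auto intro!: continuous_intros\<close>)
  moreover have "X = S / D ^ 3" if "D\<^sup>2 * X = S / D" "D > 0" for D X S :: real
    using that by (simp add: field_simps power2_eq_square power3_eq_cube)
  ultimately show ?thesis using pos unfolding c_def by blast
qed

text \<open>The Schwarz-Pick inequality is divided by |z - w|^2, respectively |z - w|^4, and
  averaged. Writing |f|^2 + |g|^2 = |H|^2 - 2 Re (f g), the term with Re (f g) has mean 0 and only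
  |H|^2 \<ge> m^2 is left to integrate against a known kernel.\<close>

lemma harmonic_zero_weighted_means:
  assumes hol: "f holomorphic_on ball 0 1" "g holomorphic_on ball 0 1"
    and le1: "\<And>z. z \<in> ball 0 1 \<Longrightarrow> cmod (f z + cnj (g z)) \<le> 1"
    and w: "f w = 0" "g w = 0" and \<rho>: "cmod w < \<rho>" "\<rho> < 1"
    and m: "m \<ge> 0" "\<And>\<theta>. m \<le> cmod (f (of_real \<rho> * cis \<theta>) + cnj (g (of_real \<rho> * cis \<theta>)))"
  defines "H \<equiv> \<lambda>\<theta>. cmod (f (of_real \<rho> * cis \<theta>) + cnj (g (of_real \<rho> * cis \<theta>)))"
  shows "circle_mean (\<lambda>\<theta>. 1 - (H \<theta>)\<^sup>2) \<ge> (1 - (cmod w)\<^sup>2) * (1 - \<rho>\<^sup>2) * m\<^sup>2 / (\<rho>\<^sup>2 - (cmod w)\<^sup>2)"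
    and "circle_mean (\<lambda>\<theta>. (1 - (H \<theta>)\<^sup>2) / (cmod (of_real \<rho> * cis \<theta> - w))\<^sup>2)
       \<ge> (1 - (cmod w)\<^sup>2) * (1 - \<rho>\<^sup>2) * m\<^sup>2 * (\<rho>\<^sup>2 + (cmod w)\<^sup>2) / (\<rho>\<^sup>2 - (cmod w)\<^sup>2) ^ 3"
proof -
  let ?z = "\<lambda>\<theta>. of_real \<rho> * cis \<theta>"
  note oc = on_circle[OF \<rho>(1)]
  have \<rho>0: "\<rho> > 0" using \<rho>(1) norm_ge_zero[of w] by linarith
  define c where "c = (1 - (cmod w)\<^sup>2) * (1 - \<rho>\<^sup>2)"
  have w1: "w \<in> ball 0 1" using \<rho> by simp
  have c0: "c \<ge> 0" unfolding c_def using \<rho> \<rho>0 by (intro mult_nonneg_nonneg) (auto simp: power_le_one)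
  define quo where "quo = (\<lambda>(f::complex\<Rightarrow>complex) z. if z = w then deriv f w else (f z - f w) / (z - w))"
  have hq: "quo f holomorphic_on ball 0 1" if "f holomorphic_on ball 0 1" for f
    unfolding quo_def by (rule pole_lemma[OF that]) (use w1 in auto)
  define f1 g1 where "f1 = quo f" and "g1 = quo g"
  have f1: "f1 holomorphic_on ball 0 1" "f z = (z - w) * f1 z" and g1: "g1 holomorphic_on ball 0 1" "g z = (z - w) * g1 z" for z
    using hq[OF hol(1)] hq[OF hol(2)] w by (auto simp: f1_def g1_def quo_def)
  have sub: "cball 0 \<rho> \<subseteq> ball 0 1" using \<rho> by auto
  have zb: "?z \<theta> \<in> ball 0 1" for \<theta> using oc(5)[of \<theta>] \<rho> by simp
  have cf: "circle_cont (\<lambda>\<theta>. f (?z \<theta>))" "circle_cont (\<lambda>\<theta>. g (?z \<theta>))"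
    by (rule circle_cont_polar, use \<rho> \<rho>0 holomorphic_on_imp_continuous_on[OF hol(1)] holomorphic_on_imp_continuous_on[OF hol(2)] in \<open>auto intro: continuous_on_subset\<close>)+
  define d where "d = (\<lambda>\<theta>. (cmod (?z \<theta> - w))\<^sup>2)"
  have d0: "d \<theta> > 0" for \<theta> using oc(1)[of \<theta>] by (simp add: d_def)
  have cd: "circle_cont d" unfolding d_def by (intro continuous_intros)
  define p where "p = (\<lambda>\<theta>. Re (f (?z \<theta>) * g (?z \<theta>)))"
  have cp: "circle_cont p" unfolding p_def by (intro continuous_intros cf)
  have cH: "circle_cont H" unfolding H_def by (intro continuous_intros cf)
  have HH: "(cmod (f (?z \<theta>)))\<^sup>2 + (cmod (g (?z \<theta>)))\<^sup>2 = (H \<theta>)\<^sup>2 - 2 * p \<theta>" for \<theta>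
    unfolding H_def p_def cmod_power2 by (simp add: power2_eq_square algebra_simps)
  have sp: "c * ((H \<theta>)\<^sup>2 - 2 * p \<theta>) \<le> d \<theta> * (1 - (H \<theta>)\<^sup>2)" for \<theta>
  proof -
    have "c * ((cmod (f (?z \<theta>)))\<^sup>2 + (cmod (g (?z \<theta>)))\<^sup>2) \<le> d \<theta> * (1 - (H \<theta>)\<^sup>2)"
      using harmonic_schwarz_pick[OF hol le1 w1 w zb[of \<theta>]] unfolding c_def d_def H_def oc(5) .
    then show ?thesis unfolding HH .
  qed
  have mH: "m\<^sup>2 \<le> (H \<theta>)\<^sup>2" for \<theta> using m unfolding H_def by (intro power_mono) auto
  have dz: "of_real (d \<theta>) = (?z \<theta> - w) * (of_real (\<rho>\<^sup>2) - cnj w * ?z \<theta>) / ?z \<theta>" for \<theta>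
    unfolding d_def by (rule oc(3))
  \<comment> \<open>Because f has a factor z - w, f g / |z - w|^2 is on the circle a function
    holomorphic in the disc that vanishes at 0. The second weight needs the factor of g as
    well.\<close>
  have m1: "circle_mean (\<lambda>\<theta>. p \<theta> / d \<theta>) = 0"
  proof -
    define K where "K = (\<lambda>z. f1 z * g z * z / (of_real (\<rho>\<^sup>2) - cnj w * z))"
    have hK: "K holomorphic_on cball 0 \<rho>"
      unfolding K_def by (intro holomorphic_intros holomorphic_on_subset[OF f1(1) sub] holomorphic_on_subset[OF hol(2) sub] denominator_nonzero \<rho>)
    have "p \<theta> / d \<theta> = Re (K (?z \<theta>))" for \<theta>
    proof -
      have "K (?z \<theta>) = f (?z \<theta>) * g (?z \<theta>) / of_real (d \<theta>)"
        unfolding K_def dz f1(2)[of "?z \<theta>"] using oc(1,2,4)[of \<theta>] by simp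
      then show ?thesis unfolding p_def by (simp only: Re_divide_of_real)
    qed
    moreover have cK: "circle_cont (\<lambda>\<theta>. K (?z \<theta>))"
      by (rule circle_cont_polar) (use \<rho>0 holomorphic_on_imp_continuous_on[OF hK] in \<open>auto intro: continuous_on_subset\<close>)
    ultimately show ?thesis using circle_mean_Re[OF cK] circle_mean_value[OF hK \<rho>0] by (simp add: K_def)
  qed
  have m2: "circle_mean (\<lambda>\<theta>. p \<theta> / (d \<theta>)\<^sup>2) = 0"
  proof -
    define K where "K = (\<lambda>z. f1 z * g1 z * z\<^sup>2 / (of_real (\<rho>\<^sup>2) - cnj w * z)\<^sup>2)"
    have hK: "K holomorphic_on cball 0 \<rho>"
      unfolding K_def using denominator_nonzero[OF \<rho>(1)]
      by (intro holomorphic_intros holomorphic_on_subset[OF f1(1) sub] holomorphic_on_subset[OF g1(1) sub]) auto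
    have "p \<theta> / (d \<theta>)\<^sup>2 = Re (K (?z \<theta>))" for \<theta>
    proof -
      have "K (?z \<theta>) = f (?z \<theta>) * g (?z \<theta>) / of_real ((d \<theta>)\<^sup>2)"
        unfolding K_def of_real_power dz f1(2)[of "?z \<theta>"] g1(2)[of "?z \<theta>"] using oc(1,2,4)[of \<theta>]
        by (simp add: power_divide power_mult_distrib power2_eq_square)
      then show ?thesis unfolding p_def by (simp only: Re_divide_of_real)
    qed
    moreover have cK: "circle_cont (\<lambda>\<theta>. K (?z \<theta>))"
      by (rule circle_cont_polar) (use \<rho>0 holomorphic_on_imp_continuous_on[OF hK] in \<open>auto intro: continuous_on_subset\<close>)
    ultimately show ?thesis using circle_mean_Re[OF cK] circle_mean_value[OF hK \<rho>0] by (simp add: K_def)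
  qed
  have d0': "d \<theta> \<noteq> 0" for \<theta> using d0[of \<theta>] by simp
  note ci = continuous_intros cd cp cH
  have split: "circle_mean (\<lambda>\<theta>. c * m\<^sup>2 * k \<theta> - 2 * c * (p \<theta> * k \<theta>)) = c * m\<^sup>2 * circle_mean k - 2 * c * circle_mean (\<lambda>\<theta>. p \<theta> * k \<theta>)"
    if "circle_cont k" for k
    by (subst circle_mean_diff, (intro ci that)+, subst circle_mean_mult_right_real, rule that,
        subst circle_mean_mult_right_real, (intro ci that)+, rule refl)
  show "circle_mean (\<lambda>\<theta>. 1 - (H \<theta>)\<^sup>2) \<ge> (1 - (cmod w)\<^sup>2) * (1 - \<rho>\<^sup>2) * m\<^sup>2 / (\<rho>\<^sup>2 - (cmod w)\<^sup>2)"
  proof -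
    have cinv: "circle_cont (\<lambda>\<theta>. 1 / d \<theta>)" by (intro ci ballI d0')
    have "circle_mean (\<lambda>\<theta>. c * m\<^sup>2 * (1 / d \<theta>) - 2 * c * (p \<theta> * (1 / d \<theta>))) \<le> circle_mean (\<lambda>\<theta>. 1 - (H \<theta>)\<^sup>2)"
    proof (rule circle_mean_mono)
      fix \<theta>
      have "c * m\<^sup>2 - 2 * c * p \<theta> \<le> c * ((H \<theta>)\<^sup>2 - 2 * p \<theta>)"
        using mult_left_mono[OF mH[of \<theta>] c0] by (simp add: algebra_simps)
      also have "\<dots> \<le> d \<theta> * (1 - (H \<theta>)\<^sup>2)" by (rule sp)
      finally have "(c * m\<^sup>2 - 2 * c * p \<theta>) / d \<theta> \<le> 1 - (H \<theta>)\<^sup>2"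
        using d0[of \<theta>] by (simp add: divide_le_eq mult.commute)
      then show "c * m\<^sup>2 * (1 / d \<theta>) - 2 * c * (p \<theta> * (1 / d \<theta>)) \<le> 1 - (H \<theta>)\<^sup>2" by (simp add: diff_divide_distrib mult.assoc)
    qed (intro ci cinv)+
    also have "circle_mean (\<lambda>\<theta>. c * m\<^sup>2 * (1 / d \<theta>) - 2 * c * (p \<theta> * (1 / d \<theta>))) = c * m\<^sup>2 * (1 / (\<rho>\<^sup>2 - (cmod w)\<^sup>2))"
      unfolding split[OF cinv] using m1 circle_mean_inverse_square[OF \<rho>(1)] by (simp add: d_def)
    finally show ?thesis by (simp add: c_def)
  qed
  show "circle_mean (\<lambda>\<theta>. (1 - (H \<theta>)\<^sup>2) / (cmod (of_real \<rho> * cis \<theta> - w))\<^sup>2)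
       \<ge> (1 - (cmod w)\<^sup>2) * (1 - \<rho>\<^sup>2) * m\<^sup>2 * (\<rho>\<^sup>2 + (cmod w)\<^sup>2) / (\<rho>\<^sup>2 - (cmod w)\<^sup>2) ^ 3"
  proof -
    have cinv: "circle_cont (\<lambda>\<theta>. 1 / (d \<theta>)\<^sup>2)" by (intro ci ballI) (simp add: d0')
    have "circle_mean (\<lambda>\<theta>. c * m\<^sup>2 * (1 / (d \<theta>)\<^sup>2) - 2 * c * (p \<theta> * (1 / (d \<theta>)\<^sup>2))) \<le> circle_mean (\<lambda>\<theta>. (1 - (H \<theta>)\<^sup>2) / d \<theta>)"
    proof (rule circle_mean_mono)
      fix \<theta>
      have "c * m\<^sup>2 - 2 * c * p \<theta> \<le> c * ((H \<theta>)\<^sup>2 - 2 * p \<theta>)"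
        using mult_left_mono[OF mH[of \<theta>] c0] by (simp add: algebra_simps)
      also have "\<dots> \<le> d \<theta> * (1 - (H \<theta>)\<^sup>2)" by (rule sp)
      finally have "(c * m\<^sup>2 - 2 * c * p \<theta>) / (d \<theta>)\<^sup>2 \<le> (1 - (H \<theta>)\<^sup>2) / d \<theta>"
        using d0[of \<theta>] by (simp add: divide_le_eq power2_eq_square mult.commute)
      then show "c * m\<^sup>2 * (1 / (d \<theta>)\<^sup>2) - 2 * c * (p \<theta> * (1 / (d \<theta>)\<^sup>2)) \<le> (1 - (H \<theta>)\<^sup>2) / d \<theta>" by (simp add: diff_divide_distrib mult.assoc)
    qed (intro ci cinv ballI d0')+
    also have "circle_mean (\<lambda>\<theta>. c * m\<^sup>2 * (1 / (d \<theta>)\<^sup>2) - 2 * c * (p \<theta> * (1 / (d \<theta>)\<^sup>2))) = c * m\<^sup>2 * ((\<rho>\<^sup>2 + (cmod w)\<^sup>2) / (\<rho>\<^sup>2 - (cmod w)\<^sup>2) ^ 3)"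
      unfolding split[OF cinv] using m2 circle_mean_inverse_fourth[OF \<rho>(1)] by (simp add: d_def flip: power_mult)
    finally show ?thesis by (simp add: c_def d_def)
  qed
qed

section \<open>Nitsche's setting: reflection of the inner boundary values into the unit disc\<close>

lemma sinh_mult_le:
  fixes a s :: real
  assumes "a \<ge> 0" "0 \<le> s" "s \<le> 1"
  shows "sinh (s * a) \<le> s * sinh a"
proof -
  have "convex_on {0..} (sinh :: real \<Rightarrow> real)"
    by (rule f''_ge0_imp_convex[where f' = cosh and f'' = sinh]) (auto intro!: derivative_eq_intros)
  from convex_onD[OF this, of s 0 a] show ?thesis using assms by simp
qed

text \<open>A harmonic map of the annulus scaled to inner radius 1, with M the ratio of the target
  radii. Only the modulus is controlled at the inner circle, and nothing is assumed there about
  boundary extension. \<open>no_log\<close> says that h is homotopically nontrivial as a map to the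
  punctured plane.\<close>

locale nitsche = annulus_harmonic +
  fixes x z :: "int \<Rightarrow> complex" and M :: real
  assumes coeff_eq: "\<And>n t. t \<in> {0<..<T} \<Longrightarrow> coeff n t = of_real (sg n (T - t)) * x n + of_real (sg n t) * z n"
    and lower: "\<And>u. u \<in> annulus 1 (exp T) \<Longrightarrow> 1 \<le> cmod (h u)"
    and upper: "\<And>u. u \<in> annulus 1 (exp T) \<Longrightarrow> cmod (h u) \<le> M"
    and inner_limit: "\<And>e. e > 0 \<Longrightarrow> \<exists>d>0. \<forall>t \<theta>. 0 < t \<and> t < d \<and> t < T \<longrightarrow> cmod (h (of_real (exp t) * cis \<theta>)) \<le> 1 + e"
    and no_log: "\<not> (\<exists>q. continuous_on (annulus 1 (exp T)) q \<and> (\<forall>u\<in>annulus 1 (exp T). h u = exp (q u)))"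
begin

lemma M1: "M \<ge> 1"
proof -
  have "of_real (exp (T/2)) * cis 0 \<in> annulus 1 (exp T)" unfolding annulus_polar using T by simp
  then show ?thesis using lower upper order_trans by blast
qed

definition dec :: "int \<Rightarrow> real \<Rightarrow> real" where
  "dec n t = exp (- (of_int \<bar>n\<bar> * t))"

lemma sg_abs: "n \<noteq> 0 \<Longrightarrow> sg n t = sinh (of_int \<bar>n\<bar> * t) / sinh (of_int \<bar>n\<bar> * T)"
  by (cases "n > 0") (auto simp: sg_def abs_if)

lemma sg_simps [simp]: "sg n 0 = 0" "sg n T = 1"
  using T by (auto simp: sg_def)

lemma sg_continuous: "isCont (sg n) t"
proof (cases "n = 0")
  case True
  then have "sg n = (\<lambda>t. t / T)" by (simp add: sg_def fun_eq_iff)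
  then show ?thesis by (auto intro!: continuous_intros simp: T less_imp_neq[OF T, symmetric])
next
  case False
  then have "sg n = (\<lambda>t. sinh (of_int n * t) / sinh (of_int n * T))" by (simp add: sg_def fun_eq_iff)
  moreover have "isCont (\<lambda>t. sinh (of_int n * t) / sinh (of_int n * T)) t"
    using False T by (intro isCont_divide isCont_sinh continuous_intros) auto
  ultimately show ?thesis by simp
qed

text \<open>Both sides solve y'' = n^2 y with value 1 at 0 and 0 at T. The first term on the right
  is the one that continues harmonically into the disc; the second vanishes at t = 0.\<close>

lemma sg_reflect: "sg n (T - t) = dec n t - dec n T * sg n t"
proof (cases "n = 0")
  case True then show ?thesis using T by (simp add: sg_def dec_def field_simps)
next
  case False
  define m where "m = real_of_int \<bar>n\<bar>"
  have "m > 0" using False by (simp add: m_def)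
  then have s: "sinh (m * T) \<noteq> 0" using T by simp
  have "sinh (m * (T - t)) = exp (- (m * t)) * sinh (m * T) - exp (- (m * T)) * sinh (m * t)"
    by (simp add: sinh_def exp_add exp_diff exp_minus field_simps)
  then show ?thesis using s unfolding sg_abs[OF False] dec_def m_def[symmetric] by (simp add: diff_divide_distrib)
qed

text \<open>Convexity of sinh gives the factor t and the doubling formula gives exponential decay in
  |n|, so the terms \<open>sg n t\<close> are summable over n with total O(t).\<close>

lemma sg_bounds:
  assumes "0 \<le> t" "t \<le> T / 2"
  shows "0 \<le> sg n t" "sg n t \<le> t * (2 / T * exp (- (of_int \<bar>n\<bar> * (T / 2))))"
proof -
  have "0 \<le> sg n t \<and> sg n t \<le> t * (2 / T * exp (- (of_int \<bar>n\<bar> * (T / 2))))"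
  proof (cases "n = 0")
    case True then show ?thesis using T assms by (simp add: sg_def field_simps)
  next
    case False
    define m where "m = real_of_int \<bar>n\<bar>"
    have m: "m > 0" using False by (simp add: m_def)
    then have s: "sinh (m * T) > 0" using T by simp
    have "sinh (m * t) = sinh ((2 * t / T) * (m * (T / 2)))"
      using T by (intro arg_cong[of _ _ sinh]) (simp add: field_simps)
    also have "\<dots> \<le> (2 * t / T) * sinh (m * (T / 2))"
      using assms T m by (intro sinh_mult_le) auto
    finally have 1: "sinh (m * t) \<le> (2 * t / T) * sinh (m * (T / 2))" .
    have 2: "sinh (m * T) = 2 * sinh (m * (T / 2)) * cosh (m * (T / 2))"
      using sinh_double[of "m * (T / 2)"] by simp
    have s2: "sinh (m * (T / 2)) > 0" using m T by simp
    have 3: "exp (m * (T / 2)) \<le> 2 * cosh (m * (T / 2))" by (simp add: cosh_def)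
    have "sinh (m * t) / sinh (m * T) \<le> ((2 * t / T) * sinh (m * (T / 2))) / sinh (m * T)"
      using 1 s by (intro divide_right_mono) auto
    also have "\<dots> = (2 * t / T) * (1 / (2 * cosh (m * (T / 2))))"
    proof -
      have "a * b / (2 * b * c) = a * (1 / (2 * c))" if "b > 0" for a b c :: real using that by simp
      then show ?thesis unfolding 2 using s2 by blast
    qed
    also have "\<dots> \<le> (2 * t / T) * (1 / exp (m * (T / 2)))"
    proof (rule mult_left_mono)
      show "1 / (2 * cosh (m * (T / 2))) \<le> 1 / exp (m * (T / 2))"
        unfolding inverse_eq_divide[symmetric] by (rule le_imp_inverse_le[OF 3 exp_gt_zero])
    qed (use assms T in simp)
    finally have "sinh (m * t) / sinh (m * T) \<le> t * (2 / T * exp (- (m * (T / 2))))"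
      by (simp only: exp_minus divide_inverse mult_ac mult_1)
    moreover have "0 \<le> sinh (m * t)" using assms m by (simp only: sinh_real_nonneg_iff) simp
    then have "0 \<le> sinh (m * t) / sinh (m * T)" using s by (simp only: zero_le_divide_iff) simp
    ultimately show ?thesis unfolding sg_abs[OF False] m_def[symmetric] by blast
  qed
  then show "0 \<le> sg n t" "sg n t \<le> t * (2 / T * exp (- (of_int \<bar>n\<bar> * (T / 2))))" by blast+
qed

lemma coeff_bessel:
  assumes "finite S" "t \<in> {0<..<T}" "\<And>\<theta>. cmod (h (of_real (exp t) * cis \<theta>)) \<le> B"
  shows "(\<Sum>n\<in>S. (cmod (coeff n t))\<^sup>2) \<le> B\<^sup>2"
proof -
  note ch = circle_cont_compose[OF conts(3) assms(2)]
  have "(\<Sum>n\<in>S. (cmod (coeff n t))\<^sup>2) \<le> circle_mean (\<lambda>\<theta>. (cmod (h (of_real (exp t) * cis \<theta>)))\<^sup>2)"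
    unfolding coeff_def by (rule bessel_inequality[OF ch assms(1)])
  also have "\<dots> \<le> circle_mean (\<lambda>\<theta>. B\<^sup>2)"
    by (rule circle_mean_mono) (auto intro!: continuous_intros ch power_mono assms simp del: of_real_exp)
  finally show ?thesis by simp
qed

text \<open>Bessel's inequality on the circle of radius e^t, where |h| \<le> 1 + e for small t; then
  t and afterwards e tend to 0. Finite sums suffice to pass to the limit termwise.\<close>

lemma sum_x_le: "finite S \<Longrightarrow> (\<Sum>n\<in>S. (cmod (x n))\<^sup>2) \<le> 1"
proof -
  assume S: "finite S"
  let ?c = "\<lambda>n t. of_real (sg n (T - t)) * x n + of_real (sg n t) * z n"
  have lim: "((\<lambda>t. \<Sum>n\<in>S. (cmod (?c n t))\<^sup>2) \<longlongrightarrow> (\<Sum>n\<in>S. (cmod (of_real (sg n (T - 0)) * x n + of_real (sg n 0) * z n))\<^sup>2)) (at_right 0)"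
    by (intro tendsto_intros isCont_tendsto_compose[OF sg_continuous])
  have "(\<Sum>n\<in>S. (cmod (x n))\<^sup>2) \<le> (1 + e)\<^sup>2" if e: "e > 0" for e
  proof -
    obtain d where d: "d > 0" "\<And>t \<theta>. 0 < t \<and> t < d \<and> t < T \<Longrightarrow> cmod (h (of_real (exp t) * cis \<theta>)) \<le> 1 + e"
      using inner_limit[OF e] by blast
    have "\<forall>\<^sub>F t in at_right 0. (\<Sum>n\<in>S. (cmod (?c n t))\<^sup>2) \<le> (1 + e)\<^sup>2"
    proof -
      have "0 < min d T" using d T by simp
      then show ?thesis unfolding eventually_at_right[OF \<open>0 < min d T\<close>]
      proof (intro exI[of _ "min d T"] conjI allI impI)
        fix t assume t: "t > 0" "t < min d T"
        show "(\<Sum>n\<in>S. (cmod (?c n t))\<^sup>2) \<le> (1 + e)\<^sup>2"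
          using coeff_bessel[OF S, of t "1 + e"] d(2)[of t] t coeff_eq[of t] by simp
      qed simp
    qed
    from tendsto_upperbound[OF lim this] show ?thesis by simp
  qed
  then have "\<And>e. e > 0 \<Longrightarrow> (\<Sum>n\<in>S. (cmod (x n))\<^sup>2) \<le> (1 + e)\<^sup>2" .
  moreover have "((\<lambda>e. (1 + e)\<^sup>2) \<longlongrightarrow> (1 + 0)\<^sup>2) (at_right (0::real))" by (intro tendsto_intros)
  ultimately have "(\<Sum>n\<in>S. (cmod (x n))\<^sup>2) \<le> (1 + 0)\<^sup>2"
    by (intro tendsto_lowerbound[of "\<lambda>e. (1 + e)\<^sup>2" _ "at_right (0::real)"]) (auto simp: eventually_at_right_less intro: eventually_mono[OF eventually_at_right_less])
  then show ?thesis by simp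
qed

lemma sum_z_le: "finite S \<Longrightarrow> (\<Sum>n\<in>S. (cmod (z n))\<^sup>2) \<le> M\<^sup>2"
proof -
  assume S: "finite S"
  let ?c = "\<lambda>n t. of_real (sg n (T - t)) * x n + of_real (sg n t) * z n"
  have lim: "((\<lambda>t. \<Sum>n\<in>S. (cmod (?c n t))\<^sup>2) \<longlongrightarrow> (\<Sum>n\<in>S. (cmod (of_real (sg n (T - T)) * x n + of_real (sg n T) * z n))\<^sup>2)) (at_left T)"
    by (intro tendsto_intros isCont_tendsto_compose[OF sg_continuous])
  have "\<forall>\<^sub>F t in at_left T. (\<Sum>n\<in>S. (cmod (?c n t))\<^sup>2) \<le> M\<^sup>2"
    unfolding eventually_at_left[OF T]
  proof (intro exI[of _ 0] conjI allI impI T)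
    fix t assume t: "t > 0" "t < T"
    have "cmod (h (of_real (exp t) * cis \<theta>)) \<le> M" for \<theta> by (rule upper) (use t in \<open>simp del: of_real_exp\<close>)
    then show "(\<Sum>n\<in>S. (cmod (?c n t))\<^sup>2) \<le> M\<^sup>2"
      using coeff_bessel[OF S, of t M] t coeff_eq[of t] by simp
  qed
  from tendsto_upperbound[OF lim this] show ?thesis by simp
qed

lemma x_le: "cmod (x n) \<le> 1"
  using sum_x_le[of "{n}"] by (simp add: power2_le_iff_abs_le abs_square_le_1)

lemma z_le: "cmod (z n) \<le> M"
  by (rule power2_le_imp_le) (use sum_z_le[of "{n}"] M1 in simp_all)

text \<open>What remains of the coefficient after removing the decaying part
  \<open>x n * dec n t\<close> that belongs to the disc.\<close>

definition Nc :: "int \<Rightarrow> real \<Rightarrow> complex" where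
  "Nc n t = (z n - x n * of_real (dec n T)) * of_real (sg n t)"

lemma coeff_decomp: "t \<in> {0<..<T} \<Longrightarrow> coeff n t = x n * of_real (dec n t) + Nc n t"
  unfolding coeff_eq Nc_def sg_reflect by (simp add: algebra_simps)

text \<open>Geometric majorant of |Nc n t| / t, valid for 0 < t \<le> T / 2.\<close>

definition bN :: "nat \<Rightarrow> real" where
  "bN k = 2 / T * (M + 1) * exp (- (T / 2)) ^ k"

lemma bN_summable: "summable bN"
  unfolding bN_def[abs_def] using T by (intro summable_mult summable_geometric) simp

lemma bN_nonneg: "bN k \<ge> 0" using T M1 by (simp add: bN_def)

lemma dec_nat: "dec n t = exp (- t) ^ nat \<bar>n\<bar>"
  unfolding dec_def exp_of_nat_mult[symmetric] by (simp add: mult.commute)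

lemma Nc_le:
  assumes "0 \<le> t" "t \<le> T / 2"
  shows "cmod (Nc n t) \<le> t * bN (nat \<bar>n\<bar>)"
proof -
  have d1: "dec n T \<le> 1" "dec n T \<ge> 0" using T by (auto simp: dec_def)
  have "cmod (z n - x n * of_real (dec n T)) \<le> cmod (z n) + cmod (x n) * dec n T"
    using d1 norm_triangle_ineq4[of "z n" "x n * of_real (dec n T)"] by (simp add: norm_mult)
  also have "\<dots> \<le> M + 1 * 1" using z_le[of n] x_le[of n] d1 by (intro add_mono mult_mono) auto
  finally have 1: "cmod (z n - x n * of_real (dec n T)) \<le> M + 1" by simp
  have e: "exp (- (of_int \<bar>n\<bar> * (T / 2))) = exp (- (T / 2)) ^ nat \<bar>n\<bar>"
    using dec_nat[of n "T / 2"] by (simp add: dec_def)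
  have "cmod (Nc n t) = cmod (z n - x n * of_real (dec n T)) * sg n t"
    unfolding Nc_def norm_mult using sg_bounds(1)[OF assms] by simp
  also have "\<dots> \<le> (M + 1) * (t * (2 / T * exp (- (of_int \<bar>n\<bar> * (T / 2)))))"
    using 1 sg_bounds[OF assms] M1 by (intro mult_mono) auto
  finally show ?thesis unfolding e bN_def by (simp only: mult_ac)
qed

text \<open>Harmonic extension of the inner boundary coefficients to the unit disc, and the
  remainder on the circle of radius e^t.\<close>

definition Hx :: "complex \<Rightarrow> complex" where "Hx = harm_series x"
definition N :: "real \<Rightarrow> real \<Rightarrow> complex" where "N t \<theta> = harm_series (\<lambda>n. Nc n t) (cis \<theta>)"

lemma dec_summable:
  fixes t :: real
  assumes "t > 0"
  shows "summable (\<lambda>k. exp (- t) ^ k)"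
  by (rule summable_geometric) (use assms in simp)

lemma xdec_le: "cmod (x n * of_real (dec n t)) \<le> exp (- t) ^ nat \<bar>n\<bar>"
  unfolding dec_nat[symmetric] norm_mult using x_le[of n] by (simp add: dec_def mult_le_one)

lemma Hx_polar: "Hx (of_real (exp (- t)) * cis \<theta>) = harm_series (\<lambda>n. x n * of_real (dec n t)) (cis \<theta>)"
proof -
  have e: "nat \<bar>int k + 1\<bar> = k + 1" "nat \<bar>- (int k + 1)\<bar> = k + 1" for k by auto
  show ?thesis unfolding Hx_def harm_series_def dec_nat e
    by (simp add: power_mult_distrib mult.assoc dec_nat del: of_real_exp power_Suc)
qed

text \<open>A reflection in the unit circle: the value at radius e^t outside is compared with the
  disc extension at radius e^(-t) inside. Both coefficient families have summable majorants for
  fixed t > 0, so the Fourier series may be split.\<close>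

lemma h_decomp:
  assumes t: "0 < t" "t \<le> T / 2"
  shows "h (of_real (exp t) * cis \<theta>) = Hx (of_real (exp (- t)) * cis \<theta>) + N t \<theta>"
proof -
  have tT: "t \<in> {0<..<T}" using t T by auto
  define g where "g = (\<lambda>u. h (of_real (exp t) * u))"
  have cg: "continuous_on (sphere 0 1) g"
    unfolding g_def
  proof (rule continuous_on_compose2[OF conts(3)])
    show "(\<lambda>u. of_real (exp t) * u) ` sphere 0 1 \<subseteq> annulus 1 (exp T)" using t T by (auto simp: annulus_def norm_mult)
  qed (intro continuous_intros)
  have fg: "fourier (\<lambda>\<theta>. g (cis \<theta>)) = (\<lambda>n. x n * of_real (dec n t) + Nc n t)"
    unfolding g_def using coeff_decomp[OF tT] by (simp add: coeff_def fun_eq_iff)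
  define b where "b = (\<lambda>k. exp (- t) ^ k + t * bN k)"
  have sb: "summable b" unfolding b_def using t by (intro summable_add dec_summable summable_mult bN_summable) simp
  have le: "cmod (x n * of_real (dec n t) + Nc n t) \<le> b (nat \<bar>n\<bar>)" for n
    unfolding b_def using norm_triangle_ineq xdec_le Nc_le[of t n] t by (meson add_mono less_imp_le order_trans)
  have "g (cis \<theta>) = harm_series (\<lambda>n. x n * of_real (dec n t) + Nc n t) (cis \<theta>)"
    using eq_harm_series[OF cg sb, of "cis \<theta>"] le unfolding fg by simp
  also have "\<dots> = harm_series (\<lambda>n. x n * of_real (dec n t)) (cis \<theta>) + harm_series (\<lambda>n. Nc n t) (cis \<theta>)"
  proof -
    have s1: "summable (\<lambda>k. x (int k + 1) * of_real (dec (int k + 1) t) * cis \<theta> ^ (k + 1) + x (- (int k + 1)) * of_real (dec (- (int k + 1)) t) * cnj (cis \<theta>) ^ (k + 1))"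
      using harm_series_summable[OF dec_summable[OF t(1)] xdec_le, of "cis \<theta>"] by simp
    have s2: "summable (\<lambda>k. Nc (int k + 1) t * cis \<theta> ^ (k + 1) + Nc (- (int k + 1)) t * cnj (cis \<theta>) ^ (k + 1))"
      using harm_series_summable[OF summable_mult[OF bN_summable] Nc_le, of t "cis \<theta>"] t by simp
    show ?thesis unfolding harm_series_def using suminf_add[OF s1 s2] by (simp add: algebra_simps)
  qed
  finally show ?thesis unfolding Hx_polar N_def g_def .
qed

text \<open>The total of the majorants over all frequencies, so that |N| \<le> t KN on each circle
  with t \<le> T / 2.\<close>

definition KN :: real where "KN = bN 0 + 2 * (\<Sum>k. bN (k + 1))"

lemma KN_nonneg: "KN \<ge> 0"
  unfolding KN_def using bN_nonneg by (intro add_nonneg_nonneg mult_nonneg_nonneg suminf_nonneg summable_ignore_initial_segment bN_summable) auto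

lemma N_tail:
  assumes "0 < t" "t \<le> T / 2"
  shows "cmod (N t \<theta> - (\<Sum>n\<in>{-int K..int K}. Nc n t * cis (of_int n * \<theta>))) \<le> t * (2 * (\<Sum>k. bN (k + K + 1)))"
proof -
  have "cmod (N t \<theta> - (\<Sum>n\<in>{-int K..int K}. Nc n t * cis (of_int n * \<theta>))) \<le> 2 * (\<Sum>k. t * bN (k + K + 1))"
    unfolding N_def by (rule harm_series_tail[OF summable_mult[OF bN_summable] Nc_le]) (use assms in auto)
  also have "(\<Sum>k. t * bN (k + K + 1)) = t * (\<Sum>k. bN (k + K + 1))"
    by (rule suminf_mult) (rule summable_ignore_initial_segment[OF bN_summable, of "K + 1", folded add.assoc])
  finally show ?thesis by simp
qed

lemma N_le:
  assumes "0 < t" "t \<le> T / 2"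
  shows "cmod (N t \<theta>) \<le> t * KN"
proof -
  have "cmod (N t \<theta> - Nc 0 t) \<le> t * (2 * (\<Sum>k. bN (k + 1)))"
    using N_tail[OF assms, of \<theta> 0] by simp
  moreover have "cmod (Nc 0 t) \<le> t * bN 0" using Nc_le[of t 0] assms by simp
  moreover have "cmod (N t \<theta>) \<le> cmod (N t \<theta> - Nc 0 t) + cmod (Nc 0 t)" using norm_triangle_sub[of "N t \<theta>" "Nc 0 t"] by linarith
  ultimately show ?thesis unfolding KN_def by (simp add: algebra_simps)
qed

text \<open>|h| tends to 1 uniformly at the inner circle and N = O(t), so |Hx| tends to 1 uniformly
  at the unit circle, even though Hx itself need not have boundary values.\<close>

lemma Hx_boundary:
  assumes "e > 0"
  shows "\<exists>d>0. d \<le> T / 2 \<and> (\<forall>t \<theta>. 0 < t \<and> t < d \<longrightarrow> 1 - e \<le> cmod (Hx (of_real (exp (- t)) * cis \<theta>)) \<and> cmod (Hx (of_real (exp (- t)) * cis \<theta>)) \<le> 1 + e)"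
proof -
  obtain d where d: "d > 0" "\<And>t \<theta>. 0 < t \<and> t < d \<and> t < T \<Longrightarrow> cmod (h (of_real (exp t) * cis \<theta>)) \<le> 1 + e / 2"
    using inner_limit[of "e / 2"] assms by auto
  define d' where "d' = min (min d (T / 2)) (e / (2 * (KN + 1)))"
  have K: "KN + 1 > 0" using KN_nonneg by simp
  have "e / (2 * (KN + 1)) > 0" using assms K by simp
  then have d': "d' > 0" using d(1) T by (simp add: d'_def)
  have d'_le: "d' \<le> T / 2" "d' \<le> d" "d' \<le> e / (2 * (KN + 1))" unfolding d'_def
    by (rule min.coboundedI1, rule min.cobounded2, rule min.coboundedI1, rule min.cobounded1, rule min.cobounded2)
  note d' = d' d'_le
  show ?thesis
  proof (intro exI[of _ d'] conjI allI impI)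
    fix t \<theta> assume t: "0 < t \<and> t < d'"
    have tT: "0 < t" "t \<le> T / 2" using t d' by auto
    have "t * KN \<le> d' * (KN + 1)" using t KN_nonneg by (intro mult_mono) auto
    also have "\<dots> \<le> e / 2" using d'(4) K by (simp add: field_simps)
    finally have n: "cmod (N t \<theta>) \<le> e / 2" using N_le[OF tT, of \<theta>] by linarith
    have h1: "1 \<le> cmod (h (of_real (exp t) * cis \<theta>))" by (rule lower) (use tT T in \<open>simp del: of_real_exp\<close>)
    have h2: "cmod (h (of_real (exp t) * cis \<theta>)) \<le> 1 + e / 2" using d(2) t d' T by auto
    have eq: "Hx (of_real (exp (- t)) * cis \<theta>) = h (of_real (exp t) * cis \<theta>) - N t \<theta>" using h_decomp[OF tT] by simp
    show "1 - e \<le> cmod (Hx (of_real (exp (- t)) * cis \<theta>))"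
      unfolding eq using norm_triangle_ineq2[of "h (of_real (exp t) * cis \<theta>)" "N t \<theta>"] h1 n assms by linarith
    show "cmod (Hx (of_real (exp (- t)) * cis \<theta>)) \<le> 1 + e"
      unfolding eq using norm_triangle_ineq4[of "h (of_real (exp t) * cis \<theta>)" "N t \<theta>"] h2 n by linarith
  qed (use d' in auto)
qed

text \<open>Holomorphic and antiholomorphic part of Hx. The constant term goes to \<open>fx\<close>,
  which is why \<open>gx\<close> starts with 0.\<close>

definition fx :: "complex \<Rightarrow> complex" where "fx u = (\<Sum>k. x (int k) * u ^ k)"
definition gx :: "complex \<Rightarrow> complex" where "gx u = (\<Sum>k. (if k = 0 then 0 else cnj (x (- int k))) * u ^ k)"

lemma bounded_power_series:
  fixes a :: "nat \<Rightarrow> complex"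
  assumes "\<And>k. cmod (a k) \<le> 1" "cmod u < 1"
  shows "summable (\<lambda>k. a k * u ^ k)"
proof (rule summable_comparison_test')
  show "summable (\<lambda>k. cmod u ^ k)" by (rule summable_geometric) (use assms(2) in simp)
  show "norm (a k * u ^ k) \<le> cmod u ^ k" for k
    unfolding norm_mult norm_power using assms(1)[of k] by (intro mult_left_le_one_le) auto
qed

lemma fx_gx_holomorphic: "fx holomorphic_on ball 0 1" "gx holomorphic_on ball 0 1"
  unfolding fx_def gx_def
  by (rule power_series_holomorphic, simp, rule summable_sums, rule bounded_power_series, auto simp: x_le)+

lemma Hx_eq: 
  assumes "u \<in> ball 0 1"
  shows "Hx u = fx u + cnj (gx u)"
proof -
  have u: "cmod u < 1" using assms by simp
  have s1: "summable (\<lambda>k. x (int k) * u ^ k)" by (rule bounded_power_series) (auto simp: x_le u)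
  have s2: "summable (\<lambda>k. (if k = 0 then 0 else cnj (x (- int k))) * u ^ k)" by (rule bounded_power_series) (auto simp: x_le u)
  have f: "fx u = x 0 + (\<Sum>k. x (int k + 1) * u ^ (k + 1))"
    unfolding fx_def using suminf_split_head[OF s1] by (simp add: add.commute)
  have g: "gx u = (\<Sum>k. cnj (x (- (int k + 1))) * u ^ (k + 1))"
    unfolding gx_def using suminf_split_head[OF s2] by (simp add: add.commute)
  have s1': "summable (\<lambda>k. x (int k + 1) * u ^ (k + 1))"
    using summable_ignore_initial_segment[OF s1, of 1] by (simp add: add.commute)
  have s2': "summable (\<lambda>k. cnj (x (- (int k + 1))) * u ^ (k + 1))"
    using summable_ignore_initial_segment[OF s2, of 1] by (simp add: add.commute)
  have cg: "cnj (gx u) = (\<Sum>k. x (- (int k + 1)) * cnj u ^ (k + 1))"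
    unfolding g using bounded_linear.suminf[OF bounded_linear_cnj s2'] by simp
  have s3: "summable (\<lambda>k. x (- (int k + 1)) * cnj u ^ (k + 1))"
    using bounded_linear.summable[OF bounded_linear_cnj s2'] by simp
  show ?thesis unfolding Hx_def harm_series_def f cg using suminf_add[OF s1' s3] by simp
qed

lemma polar_ball: "u \<in> ball 0 1 \<Longrightarrow> u \<noteq> 0 \<Longrightarrow> \<exists>t>0. \<exists>\<theta>. u = of_real (exp (- t)) * cis \<theta>"
  by (intro exI[of _ "- ln (cmod u)"] exI[of _ "Arg u"] conjI) (auto simp: rcis_cmod_Arg[unfolded rcis_def])

text \<open>The maximum principle is applied to Re (cnj c Hx), where c is the direction of Hx u;
  this is the real part of the holomorphic function cnj c fx + c gx. The circle is taken close
  enough to the boundary to have |Hx| \<le> 1 + e on it.\<close>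

lemma Hx_le_1:
  assumes "u \<in> ball 0 1"
  shows "cmod (Hx u) \<le> 1"
proof (rule field_le_epsilon)
  fix e :: real assume e: "e > 0"
  obtain d where d: "d > 0" "d \<le> T / 2" "\<And>t \<theta>. 0 < t \<and> t < d \<Longrightarrow> cmod (Hx (of_real (exp (- t)) * cis \<theta>)) \<le> 1 + e"
    using Hx_boundary[OF e] by blast
  obtain \<rho> where \<rho>: "max (cmod u) (exp (- d)) < \<rho>" "\<rho> < 1"
    using dense[of "max (cmod u) (exp (- d))" 1] assms d by auto
  define t where "t = - ln \<rho>"
  have \<rho>0: "\<rho> > 0" using \<rho> exp_gt_zero[of "- d"] by linarith
  have t: "0 < t" "t < d" "exp (- t) = \<rho>"
  proof -
    show "0 < t" using \<rho> \<rho>0 by (simp add: t_def)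
    have "ln (exp (- d)) < ln \<rho>" using \<rho> \<rho>0 by (subst ln_less_cancel_iff) auto
    then show "t < d" by (simp add: t_def)
    show "exp (- t) = \<rho>" using \<rho>0 by (simp add: t_def)
  qed
  show "cmod (Hx u) \<le> 1 + e"
  proof (cases "Hx u = 0")
    case False
    define c where "c = Hx u / of_real (cmod (Hx u))"
    have c1: "cmod c = 1" using False by (simp add: c_def norm_divide)
    define \<Phi> where "\<Phi> = (\<lambda>v. cnj c * fx v + c * gx v)"
    have sub: "cball 0 \<rho> \<subseteq> ball 0 1" using \<rho> by auto
    have hol: "\<Phi> holomorphic_on cball 0 \<rho>"
      unfolding \<Phi>_def by (intro holomorphic_intros holomorphic_on_subset[OF fx_gx_holomorphic(1) sub] holomorphic_on_subset[OF fx_gx_holomorphic(2) sub])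
    have Re\<Phi>: "Re (\<Phi> v) = Re (cnj c * Hx v)" if "v \<in> ball 0 1" for v
      unfolding \<Phi>_def Hx_eq[OF that] by (simp add: algebra_simps)
    have "Re (\<Phi> u) \<le> 1 + e"
    proof (rule maximum_real_frontier[of \<Phi> "cball 0 \<rho>"])
      fix v :: complex assume "v \<in> frontier (cball 0 \<rho>)"
      then have v: "cmod v = \<rho>" by simp
      then have "v = of_real (exp (- t)) * cis (Arg v)" unfolding t(3) using rcis_cmod_Arg[of v] by (simp add: rcis_def)
      then have "cmod (Hx v) \<le> 1 + e" using d(3)[of t "Arg v"] t by simp
      moreover have "Re (cnj c * Hx v) \<le> cmod (cnj c * Hx v)" by (rule complex_Re_le_cmod)
      ultimately show "Re (\<Phi> v) \<le> 1 + e" using Re\<Phi>[of v] v \<rho> c1 by (simp add: norm_mult)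
    qed (use \<rho> in \<open>auto intro: holomorphic_on_subset[OF hol] holomorphic_on_imp_continuous_on[OF hol]\<close>)
    moreover have "cnj c * Hx u = of_real (cmod (Hx u))"
      using False by (simp add: c_def field_simps complex_norm_square[symmetric] power2_eq_square flip: of_real_mult)
    ultimately show ?thesis using Re\<Phi>[OF assms] by simp
  qed (use e in simp)
qed

end

section \<open>Limits of weighted Fourier coefficients at the unit circle\<close>

lemma eventually_right_0I:
  assumes "d > 0" "\<And>t. 0 < t \<Longrightarrow> t < d \<Longrightarrow> P t"
  shows "eventually P (at_right (0::real))"
  unfolding eventually_at_right[OF assms(1)] using assms by blast

lemma fourier_add:
  assumes "circle_cont f" "circle_cont g"
  shows "fourier (\<lambda>\<theta>. f \<theta> + g \<theta>) n = fourier f n + fourier g n"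
  unfolding fourier_def distrib_right by (rule circle_mean_add) (intro continuous_intros assms)+

lemma fourier_mult_const:
  assumes "circle_cont f"
  shows "fourier (\<lambda>\<theta>. c * f \<theta>) n = c * fourier f n"
  unfolding fourier_def mult.assoc by (rule circle_mean_mult_right) (intro continuous_intros assms)

lemma fourier_diff:
  assumes "circle_cont f" "circle_cont g"
  shows "fourier (\<lambda>\<theta>. f \<theta> - g \<theta>) n = fourier f n - fourier g n"
  unfolding fourier_def left_diff_distrib by (rule circle_mean_diff) (intro continuous_intros assms)+

lemma fourier_cis_mult: "fourier (\<lambda>\<theta>. cis \<theta> * f \<theta>) n = fourier f (n - 1)"
    "fourier (\<lambda>\<theta>. cnj (cis \<theta>) * f \<theta>) n = fourier f (n + 1)"
proof -
  have "cis \<theta> * f \<theta> * cis (- (of_int n * \<theta>)) = f \<theta> * cis (- (of_int (n - 1) * \<theta>))" for \<theta>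
    by (simp add: cis_mult algebra_simps flip: mult.assoc)
  then show "fourier (\<lambda>\<theta>. cis \<theta> * f \<theta>) n = fourier f (n - 1)" unfolding fourier_def by (simp only:)
  have "cnj (cis \<theta>) * f \<theta> * cis (- (of_int n * \<theta>)) = f \<theta> * cis (- (of_int (n + 1) * \<theta>))" for \<theta>
    by (simp add: cis_mult cis_cnj algebra_simps flip: mult.assoc)
  then show "fourier (\<lambda>\<theta>. cnj (cis \<theta>) * f \<theta>) n = fourier f (n + 1)" unfolding fourier_def by (simp only:)
qed

text \<open>For n = -k the coefficient is the circle mean of A(u) (u / \<rho>)^k, which is its value
  at 0.\<close>

lemma fourier_holomorphic_nonpos:
  assumes "A holomorphic_on cball 0 \<rho>" "\<rho> > 0" "A 0 = 0" "n \<le> 0"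
  shows "fourier (\<lambda>\<theta>. A (of_real \<rho> * cis \<theta>)) n = 0"
proof -
  define k where "k = nat (- n)"
  have k: "n = - int k" using assms(4) by (simp add: k_def)
  define B where "B = (\<lambda>u. A u * (u / of_real \<rho>) ^ k)"
  have "A (of_real \<rho> * cis \<theta>) * cis (- (of_int n * \<theta>)) = B (of_real \<rho> * cis \<theta>)" for \<theta>
    unfolding B_def k using assms(2) by (simp add: Complex.DeMoivre)
  then have "fourier (\<lambda>\<theta>. A (of_real \<rho> * cis \<theta>)) n = circle_mean (\<lambda>\<theta>. B (of_real \<rho> * cis \<theta>))"
    unfolding fourier_def by (simp only:)
  also have "\<dots> = B 0"
    by (rule circle_mean_value) (use assms in \<open>auto simp: B_def intro!: holomorphic_intros\<close>)
  finally show ?thesis using assms(3) by (simp add: B_def)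
qed

text \<open>Rescaling by e^(-1) puts the circles into the annulus case, where the coefficient is an
  explicit exponential in t; so the limit exists without boundary values of F.\<close>

lemma fourier_disc_tendsto:
  assumes "F holomorphic_on ball 0 1"
  shows "\<exists>a. ((\<lambda>t. fourier (\<lambda>\<theta>. F (of_real (exp (- t)) * cis \<theta>)) n) \<longlongrightarrow> a) (at_right 0)"
proof -
  define F' where "F' = (\<lambda>u. F (of_real (exp (-1)) * u))"
  have "F' holomorphic_on annulus 1 (exp 1)"
    unfolding F'_def
  proof (rule holomorphic_on_compose_gen[OF _ assms, unfolded o_def])
    show "(\<lambda>u. of_real (exp (-1)) * u) ` annulus 1 (exp 1) \<subseteq> ball 0 1"
    proof safe
      fix u assume "u \<in> annulus 1 (exp 1)"
      then have "exp (-1) * cmod u < exp (-1) * exp 1" by (intro mult_strict_left_mono) (auto simp: annulus_def)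
      then show "of_real (exp (-1)) * u \<in> ball 0 1" by (simp add: norm_mult exp_add[symmetric] del: of_real_exp)
    qed
  qed (intro holomorphic_intros)
  from fourier_holomorphic_annulus[OF this, of n] obtain a where
    a: "\<And>t. t \<in> {0<..<1} \<Longrightarrow> fourier (\<lambda>\<theta>. F' (of_real (exp t) * cis \<theta>)) n = a * of_real (exp (of_int n * t))" by blast
  have eq: "fourier (\<lambda>\<theta>. F (of_real (exp (- t)) * cis \<theta>)) n = a * of_real (exp (of_int n * (1 - t)))" if "0 < t" "t < 1" for t
  proof -
    have "of_real (exp (-1)) * (of_real (exp (1 - t)) * c) = of_real (exp (- t)) * (c :: complex)" for c
      by (simp add: exp_add[symmetric] exp_of_real[symmetric] flip: mult.assoc of_real_mult)
    then have "(\<lambda>\<theta>. F' (of_real (exp (1 - t)) * cis \<theta>)) = (\<lambda>\<theta>. F (of_real (exp (- t)) * cis \<theta>))"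
      unfolding F'_def by (simp only:)
    then show ?thesis using a[of "1 - t"] that by (simp del: of_real_exp)
  qed
  have "((\<lambda>t. a * of_real (exp (of_int n * (1 - t)))) \<longlongrightarrow> a * of_real (exp (of_int n * (1 - 0)))) (at_right 0)"
    by (intro tendsto_intros)
  then show ?thesis
    by (intro exI, rule Lim_transform_eventually) (rule eventually_right_0I[of 1], simp, metis eq)
qed

text \<open>The weight \<open>(1 - |w|\<^sup>2) / |u - w|\<^sup>2\<close> tends to the Poisson kernel of \<open>w\<close> at the unit circle;
  against a holomorphic \<open>f\<close> vanishing at \<open>w\<close> it produces no nonpositive frequencies.\<close>
definition weight :: "complex \<Rightarrow> real \<Rightarrow> real \<Rightarrow> real" where
  "weight w t \<theta> = (1 - (cmod w)\<^sup>2) / (cmod (of_real (exp (- t)) * cis \<theta> - w))\<^sup>2"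

text \<open>On the circle of radius e^(-t) the weighted function equals a function
  \<open>A t\<close> holomorphic in the closed disc and vanishing at 0, since the zero of f cancels
  one factor of |u - w|^2. Hence there are no frequencies n \<le> 0. Multiplying by the denominator
  of \<open>A t\<close> yields a two-term recursion, and the limits for positive n follow by
  induction.\<close>

lemma weighted_fourier_tendsto:
  assumes hol: "f holomorphic_on ball 0 1" and w: "f w = 0" "cmod w < 1"
  shows "\<exists>p. ((\<lambda>t. fourier (\<lambda>\<theta>. of_real (weight w t \<theta>) * f (of_real (exp (- t)) * cis \<theta>)) n) \<longlongrightarrow> p) (at_right 0)"
    and "n \<le> 0 \<Longrightarrow> t > 0 \<Longrightarrow> cmod w < exp (- t) \<Longrightarrow> fourier (\<lambda>\<theta>. of_real (weight w t \<theta>) * f (of_real (exp (- t)) * cis \<theta>)) n = 0"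
proof -
  define f1 where "f1 = (\<lambda>u. if u = w then deriv f w else (f u - f w) / (u - w))"
  have hf1: "f1 holomorphic_on ball 0 1"
    unfolding f1_def by (rule pole_lemma[OF hol]) (use w in auto)
  have ff1: "f u = (u - w) * f1 u" for u using w by (simp add: f1_def)
  define W where "W = (\<lambda>t \<theta>. of_real (weight w t \<theta>) * f (of_real (exp (- t)) * cis \<theta>))"
  define A where "A = (\<lambda>t u. of_real (1 - (cmod w)\<^sup>2) * (u * f1 u) / (of_real ((exp (- t))\<^sup>2) - cnj w * u))"
  have WA: "W t \<theta> = A t (of_real (exp (- t)) * cis \<theta>)" if "cmod w < exp (- t)" for t \<theta>
  proof -
    note oc = on_circle[OF that]
    have d: "of_real (1 - (cmod w)\<^sup>2) / of_real ((cmod (of_real (exp (- t)) * cis \<theta> - w))\<^sup>2)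
       = (of_real (weight w t \<theta>) :: complex)" by (simp add: weight_def)
    have "c / (a * D / v) * (a * k) = c * (v * k) / D" if "a \<noteq> 0" "D \<noteq> 0" "v \<noteq> 0" for a c D v k :: complex
      using that by (simp add: field_simps)
    then show ?thesis unfolding W_def A_def d[symmetric] oc(3) ff1[of "of_real (exp (- t)) * cis \<theta>"]
      using oc(1)[of \<theta>] oc(2)[of \<theta>] oc(4)[of \<theta>] by blast
  qed
  have holA: "A t holomorphic_on cball 0 (exp (- t))" if "cmod w < exp (- t)" "t > 0" for t
  proof -
    have "exp (- t) < 1" using that by simp
    then have "cball 0 (exp (- t)) \<subseteq> ball (0::complex) 1"
      by (metis cball_subset_ball_iff dist_self add_0)
    then show ?thesis unfolding A_def
      by (intro holomorphic_intros holomorphic_on_subset[OF hf1] denominator_nonzero that)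
  qed
  show zero: "fourier (\<lambda>\<theta>. of_real (weight w t \<theta>) * f (of_real (exp (- t)) * cis \<theta>)) n = 0"
    if "n \<le> 0" "t > 0" "cmod w < exp (- t)" for n t
  proof -
    have "fourier (\<lambda>\<theta>. A t (of_real (exp (- t)) * cis \<theta>)) n = 0"
      by (rule fourier_holomorphic_nonpos[OF holA[OF that(3,2)] exp_gt_zero _ that(1)]) (simp add: A_def)
    then show ?thesis unfolding WA[OF that(3), unfolded W_def] .
  qed
  have evw: "\<forall>\<^sub>F t in at_right 0. cmod w < exp (- t) \<and> 0 < t"
  proof -
    obtain r where r: "cmod w < r" "r < 1" using dense w(2) by blast
    have r0: "r > 0" using r(1) norm_ge_zero[of w] by linarith
    show ?thesis
    proof (rule eventually_right_0I[of "- ln r"])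
      show "0 < - ln r" using r r0 by simp
      fix t assume t: "0 < t" "t < - ln r"
      then have "exp (ln r) < exp (- t)" by (subst exp_less_cancel_iff) simp
      then show "cmod w < exp (- t) \<and> 0 < t" using t r r0 by simp
    qed
  qed
  have cf1: "circle_cont (\<lambda>\<theta>. g (of_real (exp (- t)) * cis \<theta>))" if "t > 0" "g holomorphic_on ball 0 1" for t g
    by (rule circle_cont_polar, rule continuous_on_subset[OF holomorphic_on_imp_continuous_on[OF that(2)]]) (use that(1) in auto)
  \<comment> \<open>Multiplying \<open>W t\<close> by r^2 - cnj w u, where r = e^(-t) and u is the
    point on the circle, removes the denominator; multiplication by \<open>cis\<close> shifts the
    frequency, so the coefficients of \<open>f1\<close> give the coefficient at n from that at n -
    1.\<close>
  have rec: "of_real ((exp (- t))\<^sup>2) * fourier (W t) n - cnj w * of_real (exp (- t)) * fourier (W t) (n - 1)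
      = of_real (1 - (cmod w)\<^sup>2) * of_real (exp (- t)) * fourier (\<lambda>\<theta>. f1 (of_real (exp (- t)) * cis \<theta>)) (n - 1)"
    if t: "cmod w < exp (- t)" "t > 0" for t n
  proof -
    note oc = on_circle[OF t(1)]
    have cW: "circle_cont (W t)"
      unfolding W_def weight_def using oc(1) by (intro continuous_intros cf1[OF t(2) hol]) auto
    have "of_real ((exp (- t))\<^sup>2) * W t \<theta> - cnj w * of_real (exp (- t)) * (cis \<theta> * W t \<theta>)
       = of_real (1 - (cmod w)\<^sup>2) * of_real (exp (- t)) * (cis \<theta> * f1 (of_real (exp (- t)) * cis \<theta>))" for \<theta>
    proof -
      have "of_real ((exp (- t))\<^sup>2) * W t \<theta> - cnj w * of_real (exp (- t)) * (cis \<theta> * W t \<theta>)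
         = (of_real ((exp (- t))\<^sup>2) - cnj w * (of_real (exp (- t)) * cis \<theta>)) * W t \<theta>" by (simp add: algebra_simps del: of_real_exp)
      also have "\<dots> = of_real (1 - (cmod w)\<^sup>2) * (of_real (exp (- t)) * cis \<theta> * f1 (of_real (exp (- t)) * cis \<theta>))"
        unfolding WA[OF t(1)] A_def using oc(2)[of \<theta>] by simp
      finally show ?thesis by (simp only: mult.assoc)
    qed
    then have "fourier (\<lambda>\<theta>. of_real ((exp (- t))\<^sup>2) * W t \<theta> - cnj w * of_real (exp (- t)) * (cis \<theta> * W t \<theta>)) n
       = fourier (\<lambda>\<theta>. of_real (1 - (cmod w)\<^sup>2) * of_real (exp (- t)) * (cis \<theta> * f1 (of_real (exp (- t)) * cis \<theta>))) n"
      by (simp only:)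
    also have "\<dots> = of_real (1 - (cmod w)\<^sup>2) * of_real (exp (- t)) * fourier (\<lambda>\<theta>. f1 (of_real (exp (- t)) * cis \<theta>)) (n - 1)"
      by (subst fourier_mult_const, intro continuous_intros cf1[OF t(2) hf1]) (simp only: fourier_cis_mult)
    also have "fourier (\<lambda>\<theta>. of_real ((exp (- t))\<^sup>2) * W t \<theta> - cnj w * of_real (exp (- t)) * (cis \<theta> * W t \<theta>)) n
       = fourier (\<lambda>\<theta>. of_real ((exp (- t))\<^sup>2) * W t \<theta>) n - fourier (\<lambda>\<theta>. cnj w * of_real (exp (- t)) * (cis \<theta> * W t \<theta>)) n"
      by (rule fourier_diff) (intro continuous_intros cW)+
    also have "fourier (\<lambda>\<theta>. of_real ((exp (- t))\<^sup>2) * W t \<theta>) n = of_real ((exp (- t))\<^sup>2) * fourier (W t) n"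
      by (rule fourier_mult_const[OF cW])
    also have "fourier (\<lambda>\<theta>. cnj w * of_real (exp (- t)) * (cis \<theta> * W t \<theta>)) n = cnj w * of_real (exp (- t)) * fourier (W t) (n - 1)"
      by (subst fourier_mult_const, intro continuous_intros cW) (simp only: fourier_cis_mult)
    finally show ?thesis .
  qed
  have nat: "\<exists>p. ((\<lambda>t. fourier (W t) (int k)) \<longlongrightarrow> p) (at_right 0)" for k
  proof (induction k)
    case 0
    have "\<forall>\<^sub>F t in at_right 0. 0 = fourier (W t) (int 0)"
      using evw by eventually_elim (use zero in \<open>simp add: W_def\<close>)
    then show ?case by (intro exI[of _ 0], rule Lim_transform_eventually[OF tendsto_const])
  next
    case (Suc k)
    obtain p where p: "((\<lambda>t. fourier (W t) (int k)) \<longlongrightarrow> p) (at_right 0)" using Suc by blast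
    obtain a where a: "((\<lambda>t. fourier (\<lambda>\<theta>. f1 (of_real (exp (- t)) * cis \<theta>)) (int k)) \<longlongrightarrow> a) (at_right 0)"
      using fourier_disc_tendsto[OF hf1] by blast
    let ?r = "\<lambda>t. complex_of_real (exp (- t))"
    have "((\<lambda>t. (of_real (1 - (cmod w)\<^sup>2) * ?r t * fourier (\<lambda>\<theta>. f1 (?r t * cis \<theta>)) (int k) + cnj w * ?r t * fourier (W t) (int k)) / of_real ((exp (- t))\<^sup>2))
      \<longlongrightarrow> (of_real (1 - (cmod w)\<^sup>2) * of_real (exp (- 0)) * a + cnj w * of_real (exp (- 0)) * p) / of_real ((exp (- 0))\<^sup>2)) (at_right 0)"
      by (intro tendsto_intros a p) auto
    moreover have "\<forall>\<^sub>F t in at_right 0. (of_real (1 - (cmod w)\<^sup>2) * ?r t * fourier (\<lambda>\<theta>. f1 (?r t * cis \<theta>)) (int k) + cnj w * ?r t * fourier (W t) (int k)) / of_real ((exp (- t))\<^sup>2)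
       = fourier (W t) (int (Suc k))"
      using evw
    proof eventually_elim
      case (elim t)
      have "of_real ((exp (- t))\<^sup>2) \<noteq> (0::complex)" by simp
      moreover have "of_real ((exp (- t))\<^sup>2) * fourier (W t) (int (Suc k)) = of_real (1 - (cmod w)\<^sup>2) * ?r t * fourier (\<lambda>\<theta>. f1 (?r t * cis \<theta>)) (int k) + cnj w * ?r t * fourier (W t) (int k)"
        using rec[of t "int (Suc k)"] elim by (simp add: algebra_simps del: of_real_exp)
      ultimately show ?case by (metis nonzero_mult_div_cancel_left)
    qed
    ultimately show ?case by (intro exI, rule Lim_transform_eventually)
  qed
  show "\<exists>p. ((\<lambda>t. fourier (\<lambda>\<theta>. of_real (weight w t \<theta>) * f (of_real (exp (- t)) * cis \<theta>)) n) \<longlongrightarrow> p) (at_right 0)"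
  proof (cases "n \<ge> 0")
    case True
    then show ?thesis using nat[of "nat n"] by (simp add: W_def)
  next
    case False
    have "\<forall>\<^sub>F t in at_right 0. 0 = fourier (W t) n"
      using evw by eventually_elim (use zero False in \<open>simp add: W_def\<close>)
    then show ?thesis unfolding W_def by (intro exI[of _ 0], rule Lim_transform_eventually[OF tendsto_const])
  qed
qed

section \<open>Existence of a zero of the disc extension\<close>

context nitsche
begin

text \<open>A zero-free Hx has a continuous logarithm on the simply connected disc. On a fixed
  circle near the inner one h is within relative distance 1 of Hx, so there h has a logarithm too,
  and by radial homotopy h has one on the whole annulus, contradicting
  \<open>no_log\<close>.\<close>

lemma Hx_zero: "\<exists>w\<in>ball 0 1. Hx w = 0"
proof (rule ccontr)
  assume "\<not> ?thesis"
  then have nz: "\<And>u. u \<in> ball 0 1 \<Longrightarrow> Hx u \<noteq> 0" by blast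
  let ?A = "annulus 1 (exp T)"
  have "continuous_on (ball 0 1) (\<lambda>u. fx u + cnj (gx u))"
    by (intro continuous_intros holomorphic_on_imp_continuous_on fx_gx_holomorphic)
  then have cH: "continuous_on (ball 0 1) Hx" by (rule continuous_on_eq) (simp add: Hx_eq)
  obtain L where L: "continuous_on (ball 0 1) L" "\<And>u. u \<in> ball 0 1 \<Longrightarrow> Hx u = exp (L u)"
    using continuous_logarithm_on_ball[OF cH nz] by blast
  \<comment> \<open>Chosen so that t KN < 1 \<le> |h|; then the remainder is smaller than h on the
    circle of radius e^t.\<close>
  define t where "t = min (T / 2) (1 / (2 * (KN + 1)))"
  have K: "KN + 1 > 0" using KN_nonneg by simp
  have t: "t > 0" "t \<le> T / 2" "t * KN < 1"
  proof -
    show "t > 0" using T K by (simp add: t_def)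
    show "t \<le> T / 2" by (simp add: t_def)
    have "t * KN \<le> 1 / (2 * (KN + 1)) * KN" by (rule mult_right_mono) (use KN_nonneg in \<open>auto simp: t_def\<close>)
    also have "\<dots> < 1" using KN_nonneg by (simp add: field_simps)
    finally show "t * KN < 1" .
  qed
  define r where "r = (\<lambda>u::complex. of_real (exp t) * (u / of_real (cmod u)))"
  define r' where "r' = (\<lambda>u::complex. of_real (exp (- t)) * (u / of_real (cmod u)))"
  have unz: "u \<noteq> 0" if "u \<in> ?A" for u using that by (auto simp: annulus_def)
  have polar: "u / of_real (cmod u) = cis (Arg u)" if "u \<in> ?A" for u
    using rcis_cmod_Arg[of u] unz[OF that] by (simp add: rcis_def field_simps)
  have near: "cmod (Hx (r' u) / h (r u) - 1) < 1" "h (r u) \<noteq> 0" if "u \<in> ?A" for u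
  proof -
    have hd: "h (r u) = Hx (r' u) + N t (Arg u)" unfolding r_def r'_def polar[OF that] by (rule h_decomp[OF t(1,2)])
    have ge: "1 \<le> cmod (h (r u))" unfolding r_def polar[OF that] by (rule lower) (use t T in \<open>simp del: of_real_exp\<close>)
    then show nz': "h (r u) \<noteq> 0" by auto
    have "Hx (r' u) / h (r u) - 1 = - N t (Arg u) / h (r u)" using hd nz' by (simp add: field_simps)
    then have "cmod (Hx (r' u) / h (r u) - 1) = cmod (N t (Arg u)) / cmod (h (r u))" by (simp add: norm_divide)
    also have "\<dots> \<le> cmod (N t (Arg u)) / 1" using ge by (intro divide_left_mono) auto
    also have "\<dots> < 1" using N_le[OF t(1,2), of "Arg u"] t(3) by simp
    finally show "cmod (Hx (r' u) / h (r u) - 1) < 1" .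
  qed
  have cr: "continuous_on ?A r" "continuous_on ?A r'"
    unfolding r_def r'_def using unz by (auto intro!: continuous_intros)
  have r'b: "r' u \<in> ball 0 1" if "u \<in> ?A" for u
    unfolding r'_def polar[OF that] using t by (simp add: norm_mult del: of_real_exp)
  have rA: "r u \<in> ?A" if "u \<in> ?A" for u
    unfolding r_def polar[OF that] using t T by (simp del: of_real_exp)
  have chr: "continuous_on ?A (\<lambda>u. h (r u))"
    by (rule continuous_on_compose2[OF conts(3) cr(1)]) (use rA in auto)
  have cHr: "continuous_on ?A (\<lambda>u. Hx (r' u))"
    by (rule continuous_on_compose2[OF cH cr(2)]) (use r'b in auto)
  have cLr: "continuous_on ?A (\<lambda>u. L (r' u))"
    by (rule continuous_on_compose2[OF L(1) cr(2)]) (use r'b in auto)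
  define q where "q = (\<lambda>u. L (r' u) - Ln (Hx (r' u) / h (r u)))"
  have pos: "Re (Hx (r' u) / h (r u)) > 0" if "u \<in> ?A" for u
    using near(1)[OF that] abs_Re_le_cmod[of "Hx (r' u) / h (r u) - 1"] by (simp add: abs_if split: if_splits)
  have cq: "continuous_on ?A q"
    unfolding q_def
  proof (intro continuous_intros cLr cHr chr)
    show "Hx (r' u) / h (r u) \<notin> \<real>\<^sub>\<le>\<^sub>0" if "u \<in> ?A" for u
      using pos[OF that] by (auto simp: complex_nonpos_Reals_iff)
  qed (use near in auto)
  have expq: "h (r u) = exp (q u)" if "u \<in> ?A" for u
  proof -
    have "Hx (r' u) / h (r u) \<noteq> 0" using pos[OF that] by auto
    then have "exp (q u) = Hx (r' u) / (Hx (r' u) / h (r u))"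
      unfolding q_def exp_diff using L(2)[OF r'b[OF that]] by simp
    then show ?thesis using \<open>Hx (r' u) / h (r u) \<noteq> 0\<close> by auto
  qed
  have "homotopic_with_canon (\<lambda>_. True) ?A (-{0}) h (\<lambda>u. h (r u))"
  proof -
    \<comment> \<open>The radial homotopy onto the circle of radius e^t, linear in the logarithm of
      the modulus so that it stays inside the annulus.\<close>
    define k where "k = (\<lambda>y::real \<times> complex. of_real (exp ((1 - fst y) * ln (cmod (snd y)) + fst y * t)) * (snd y / of_real (cmod (snd y))))"
    have kA: "k y \<in> ?A" if y: "y \<in> {0..1} \<times> ?A" for y
    proof -
      have l: "0 < ln (cmod (snd y))" "ln (cmod (snd y)) < T"
      proof -
        have yn: "1 < cmod (snd y)" "cmod (snd y) < exp T" using y by (auto simp: annulus_def)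
        show "0 < ln (cmod (snd y))" by (rule ln_gt_zero[OF yn(1)])
        have "ln (cmod (snd y)) < ln (exp T)" using yn by (subst ln_less_cancel_iff) auto
        then show "ln (cmod (snd y)) < T" by simp
      qed
      have tT: "0 < t" "t < T" using t T by auto
      let ?l = "ln (cmod (snd y))"
      have s: "0 \<le> fst y" "fst y \<le> 1" using y by auto
      have lo: "min ?l t \<le> (1 - fst y) * ?l + fst y * t"
        using s convex_bound_le[of "- ?l" "- min ?l t" "- t" "1 - fst y" "fst y"] by simp
      have hi: "(1 - fst y) * ?l + fst y * t \<le> max ?l t"
        using s convex_bound_le[of ?l "max ?l t" t "1 - fst y" "fst y"] by simp
      have "0 < (1 - fst y) * ?l + fst y * t" "(1 - fst y) * ?l + fst y * t < T"
        using lo hi l tT by linarith+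
      moreover have "snd y / of_real (cmod (snd y)) = cis (Arg (snd y))" using polar y by auto
      ultimately show ?thesis unfolding k_def by (simp del: of_real_exp)
    qed
    have ck: "continuous_on ({0..1} \<times> ?A) k"
      unfolding k_def using unz by (intro continuous_intros) auto
    have chk: "continuous_on ({0..1} \<times> ?A) (\<lambda>y. h (k y))"
      by (rule continuous_on_compose2[OF conts(3) ck]) (use kA in auto)
    have k0: "k (0, u) = u" "k (1, u) = r u" if "u \<in> ?A" for u
      using unz[OF that] by (simp_all add: k_def r_def)
    have hnz: "h (k y) \<noteq> 0" if "y \<in> {0..1} \<times> ?A" for y using lower[OF kA[OF that]] by auto
    show ?thesis
    proof (subst homotopic_with)
      show "\<exists>f. continuous_map (prod_topology (top_of_set {0..1::real}) (top_of_set ?A)) (top_of_set (-{0})) f \<and>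
          (\<forall>u\<in>topspace (top_of_set ?A). f (0, u) = h u) \<and> (\<forall>u\<in>topspace (top_of_set ?A). f (1, u) = h (r u)) \<and> (\<forall>t\<in>{0..1::real}. True)"
      proof (intro exI[of _ "\<lambda>y. h (k y)"] conjI ballI)
        show "continuous_map (prod_topology (top_of_set {0..1}) (top_of_set ?A)) (top_of_set (-{0})) (\<lambda>y. h (k y))"
          unfolding prod_topology_subtopology_eu continuous_map_in_subtopology
          using chk hnz by (auto simp: continuous_map_iff_continuous)
      qed (use k0 in auto)
    qed simp
  qed
  moreover have "\<exists>a. homotopic_with_canon (\<lambda>_. True) ?A (-{0}) (\<lambda>u. h (r u)) (\<lambda>_. a)"
    unfolding inessential_eq_continuous_logarithm using cq expq by blast
  ultimately have "\<exists>a. homotopic_with_canon (\<lambda>_. True) ?A (-{0}) h (\<lambda>_. a)"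
    using homotopic_with_trans by blast
  then show False using no_log unfolding inessential_eq_continuous_logarithm by blast
qed

end

section \<open>Integral inequalities at the inner circle in the limit\<close>

lemma combine_bounds: "(a::real) \<le> 2 * q + c \<Longrightarrow> c \<le> d \<Longrightarrow> q \<le> p + e \<Longrightarrow> a \<le> 2 * (p + e) + d"
  by simp

lemma one_minus_exp_over_t: "((\<lambda>t. (1 - (exp (- t))\<^sup>2) / (2 * t)) \<longlongrightarrow> 1) (at_right (0::real))"
proof -
  have "((\<lambda>t::real. - exp (- 2 * t) / 2) has_real_derivative 1) (at 0)"
    by (auto intro!: derivative_eq_intros)
  then have "((\<lambda>t::real. ((- exp (- 2 * t) / 2) - (- exp (- 2 * 0) / 2)) / (t - 0)) \<longlongrightarrow> 1) (at 0)"
    by (simp add: has_field_derivative_iff)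
  then have "((\<lambda>t::real. ((- exp (- 2 * t) / 2) - (- exp (- 2 * 0) / 2)) / (t - 0)) \<longlongrightarrow> 1) (at_right 0)"
    by (rule filterlim_mono[OF _ order_refl at_le]) simp
  moreover have "((- exp (- 2 * t) / 2) - (- exp (- 2 * 0) / 2)) / (t - 0) = (1 - (exp (- t))\<^sup>2) / (2 * t)" for t :: real
    by (simp add: exp_double[symmetric] diff_divide_distrib)
  ultimately show ?thesis by simp
qed

context nitsche
begin

text \<open>The t-derivative of \<open>Nc n\<close> at 0: the Fourier coefficients of the normal
  derivative of the remainder on the inner circle.\<close>

definition nu :: "int \<Rightarrow> complex" where
  "nu n = (z n - x n * of_real (dec n T)) * of_real (if n = 0 then 1 / T else of_int n / sinh (of_int n * T))"

text \<open>Bounds the part of N / t with frequencies beyond K, uniformly for small t.\<close>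

definition eps :: "nat \<Rightarrow> real" where "eps K = 2 * (\<Sum>k. bN (k + K + 1))"

lemma eps_tendsto: "eps \<longlonglongrightarrow> 0"
  unfolding eps_def[abs_def] by (rule harm_series_tail_tendsto_0[OF bN_summable])

lemma Nc_over_t: "((\<lambda>t. Nc n t / of_real t) \<longlongrightarrow> nu n) (at_right 0)"
proof -
  define s where "s = (if n = 0 then 1 / T else of_int n / sinh (of_int n * T))"
  have "((\<lambda>t. sg n t) has_real_derivative s) (at 0)"
  proof (cases "n = 0")
    case True
    have "((\<lambda>t. t / T) has_real_derivative 1 / T) (at 0)" using T by (auto intro!: derivative_eq_intros)
    then show ?thesis using True by (simp add: sg_def s_def)
  next
    case False
    have "((\<lambda>t. sinh (of_int n * t) / sinh (of_int n * T)) has_real_derivative of_int n / sinh (of_int n * T)) (at 0)"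
      using False T by (auto intro!: derivative_eq_intros)
    then show ?thesis using False by (simp add: sg_def s_def)
  qed
  then have "((\<lambda>t. (sg n t - sg n 0) / (t - 0)) \<longlongrightarrow> s) (at 0)" by (simp add: has_field_derivative_iff)
  then have "((\<lambda>t. (sg n t - sg n 0) / (t - 0)) \<longlongrightarrow> s) (at_right 0)"
    by (rule filterlim_mono[OF _ order_refl at_le]) simp
  then have "((\<lambda>t. (z n - x n * of_real (dec n T)) * of_real (sg n t / t)) \<longlongrightarrow> (z n - x n * of_real (dec n T)) * of_real s) (at_right 0)"
    by (intro tendsto_intros) simp
  then show ?thesis unfolding nu_def s_def[symmetric] Nc_def by simp
qed

abbreviation (input) Ht :: "real \<Rightarrow> real \<Rightarrow> complex" where
  "Ht t \<theta> \<equiv> Hx (of_real (exp (- t)) * cis \<theta>)"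

lemma exp_ball: "t > 0 \<Longrightarrow> of_real (exp (- t)) * cis \<theta> \<in> ball 0 1"
  by (simp add: norm_mult del: of_real_exp)

lemma cont_Hx: "continuous_on (ball 0 1) Hx"
proof -
  have "continuous_on (ball 0 1) (\<lambda>u. fx u + cnj (gx u))"
    by (intro continuous_intros holomorphic_on_imp_continuous_on fx_gx_holomorphic)
  then show ?thesis by (rule continuous_on_eq) (simp add: Hx_eq)
qed

lemma circle_cont_Ht: "t > 0 \<Longrightarrow> circle_cont (Ht t)"
  by (rule circle_cont_polar, rule continuous_on_subset[OF cont_Hx]) auto

lemma N_def': "0 < t \<Longrightarrow> t \<le> T / 2 \<Longrightarrow> N t \<theta> = h (of_real (exp t) * cis \<theta>) - Ht t \<theta>"
  using h_decomp by simp

lemma fourier_Ht: "t > 0 \<Longrightarrow> fourier (Ht t) n = x n * of_real (dec n t)"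
  unfolding Hx_polar by (rule fourier_harm_series[OF dec_summable xdec_le])

text \<open>Expanding 1 \<le> |h|^2 with h = Ht + N gives 1 - |Ht|^2 \<le> 2 Re (Ht cnj N) + |N|^2.
  Replacing N by its partial sum costs at most t \<open>eps K\<close> because |Ht| \<le> 1, and
  |N|^2 is at most (t KN)^2. The weight \<open>s\<close> is kept general in order to use both the
  constant weight and a Poisson weight.\<close>

lemma key_inequality:
  assumes t: "0 < t" "t \<le> T / 2" and s: "circle_cont s" "\<And>\<theta>. s \<theta> \<ge> 0"
  shows "circle_mean (\<lambda>\<theta>. s \<theta> * (1 - (cmod (Ht t \<theta>))\<^sup>2))
     \<le> 2 * (\<Sum>n\<in>{-int K..int K}. Re (cnj (Nc n t) * fourier (\<lambda>\<theta>. of_real (s \<theta>) * Ht t \<theta>) n)) + (2 * t * eps K + t\<^sup>2 * KN\<^sup>2) * circle_mean s"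
proof -
  note cH = circle_cont_Ht[OF t(1)]
  define P where "P = (\<lambda>\<theta>. \<Sum>n\<in>{-int K..int K}. Nc n t * cis (of_int n * \<theta>))"
  have cP: "circle_cont P" unfolding P_def by (intro continuous_intros)
  define R where "R = (\<lambda>\<theta>. Re (of_real (s \<theta>) * Ht t \<theta> * cnj (P \<theta>)))"
  have cR: "circle_cont R" unfolding R_def by (intro continuous_intros cH cP s)
  have eps0: "eps K \<ge> 0" unfolding eps_def
    by (intro mult_nonneg_nonneg suminf_nonneg bN_nonneg summable_ignore_initial_segment[OF bN_summable, of "K + 1", folded add.assoc]) simp
  have pw: "s \<theta> * (1 - (cmod (Ht t \<theta>))\<^sup>2) \<le> 2 * R \<theta> + (2 * t * eps K + t\<^sup>2 * KN\<^sup>2) * s \<theta>" for \<theta>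
  proof -
    have h1: "1 \<le> cmod (Ht t \<theta> + N t \<theta>)"
      unfolding h_decomp[OF t, symmetric] by (rule lower) (use t T in \<open>simp del: of_real_exp\<close>)
    have H1: "cmod (Ht t \<theta>) \<le> 1" by (rule Hx_le_1[OF exp_ball[OF t(1)]])
    have "1 \<le> (cmod (Ht t \<theta> + N t \<theta>))\<^sup>2" using h1 by simp
    also have "\<dots> = (cmod (Ht t \<theta>))\<^sup>2 + 2 * Re (Ht t \<theta> * cnj (N t \<theta>)) + (cmod (N t \<theta>))\<^sup>2"
      unfolding cmod_power2 by (simp add: power2_eq_square algebra_simps)
    finally have 1: "1 - (cmod (Ht t \<theta>))\<^sup>2 \<le> 2 * Re (Ht t \<theta> * cnj (N t \<theta>)) + (cmod (N t \<theta>))\<^sup>2" by simp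
    have 2: "(cmod (N t \<theta>))\<^sup>2 \<le> t\<^sup>2 * KN\<^sup>2" using power_mono[OF N_le[OF t, of \<theta>], of 2] by (simp add: power_mult_distrib)
    have 4: "Re (a * cnj b) = Re (a * cnj c) + Re (a * cnj (b - c))" for a b c by (simp add: algebra_simps)
    have "Re (Ht t \<theta> * cnj (N t \<theta> - P \<theta>)) \<le> cmod (Ht t \<theta> * cnj (N t \<theta> - P \<theta>))" by (rule complex_Re_le_cmod)
    also have "\<dots> \<le> 1 * (t * eps K)"
      unfolding norm_mult complex_mod_cnj using H1 N_tail[OF t, of \<theta> K] by (intro mult_mono) (auto simp: P_def eps_def)
    finally have 3: "Re (Ht t \<theta> * cnj (N t \<theta>)) \<le> Re (Ht t \<theta> * cnj (P \<theta>)) + t * eps K"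
      unfolding 4[of "Ht t \<theta>" "N t \<theta>" "P \<theta>"] by linarith
    have "1 - (cmod (Ht t \<theta>))\<^sup>2 \<le> 2 * (Re (Ht t \<theta> * cnj (P \<theta>)) + t * eps K) + t\<^sup>2 * KN\<^sup>2"
      by (rule combine_bounds[OF 1 2 3])
    then have "s \<theta> * (1 - (cmod (Ht t \<theta>))\<^sup>2) \<le> s \<theta> * (2 * (Re (Ht t \<theta> * cnj (P \<theta>)) + t * eps K) + t\<^sup>2 * KN\<^sup>2)"
      by (rule mult_left_mono) (rule s(2))
    also have "\<dots> = 2 * R \<theta> + (2 * t * eps K + t\<^sup>2 * KN\<^sup>2) * s \<theta>"
    proof -
      have "R \<theta> = s \<theta> * Re (Ht t \<theta> * cnj (P \<theta>))" unfolding R_def mult.assoc by (simp only: times_complex.sel Re_complex_of_real Im_complex_of_real mult_zero_left diff_zero)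
      then show ?thesis by (simp add: algebra_simps)
    qed
    finally show ?thesis .
  qed
  have "circle_mean (\<lambda>\<theta>. s \<theta> * (1 - (cmod (Ht t \<theta>))\<^sup>2)) \<le> circle_mean (\<lambda>\<theta>. 2 * R \<theta> + (2 * t * eps K + t\<^sup>2 * KN\<^sup>2) * s \<theta>)"
    by (rule circle_mean_mono) (intro continuous_intros cH cR s pw)+
  also have "\<dots> = circle_mean (\<lambda>\<theta>. 2 * R \<theta>) + circle_mean (\<lambda>\<theta>. (2 * t * eps K + t\<^sup>2 * KN\<^sup>2) * s \<theta>)"
    by (rule circle_mean_add) (intro continuous_intros cR s)+
  also have "circle_mean (\<lambda>\<theta>. 2 * R \<theta>) = 2 * circle_mean R" by (rule circle_mean_mult_right_real[OF cR])
  also have "circle_mean (\<lambda>\<theta>. (2 * t * eps K + t\<^sup>2 * KN\<^sup>2) * s \<theta>) = (2 * t * eps K + t\<^sup>2 * KN\<^sup>2) * circle_mean s" by (rule circle_mean_mult_right_real[OF s(1)])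
  also have "circle_mean R = Re (circle_mean (\<lambda>\<theta>. of_real (s \<theta>) * Ht t \<theta> * cnj (P \<theta>)))"
    unfolding R_def by (rule circle_mean_Re) (intro continuous_intros cH cP s)
  also have "circle_mean (\<lambda>\<theta>. of_real (s \<theta>) * Ht t \<theta> * cnj (P \<theta>)) = (\<Sum>n\<in>{-int K..int K}. cnj (Nc n t) * fourier (\<lambda>\<theta>. of_real (s \<theta>) * Ht t \<theta>) n)"
    unfolding P_def by (rule circle_mean_mult_trig_cnj) (intro continuous_intros cH s, simp)
  finally show ?thesis by simp
qed

text \<open>\<open>key_inequality\<close> divided by 2 t, as t tends to 0: the quadratic error
  disappears, \<open>Nc n t / t\<close> becomes \<open>nu n\<close>, and only the tail error
  \<open>eps K\<close> stays until K grows.\<close>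

lemma limit_inequality:
  assumes s: "\<And>t. 0 < t \<Longrightarrow> t < d \<Longrightarrow> circle_cont (s t)" "\<And>t \<theta>. 0 < t \<Longrightarrow> t < d \<Longrightarrow> s t \<theta> \<ge> 0" and d: "d > 0"
    and p: "\<And>n. ((\<lambda>t. fourier (\<lambda>\<theta>. of_real (s t \<theta>) * Ht t \<theta>) n) \<longlongrightarrow> p n) (at_right 0)"
    and S: "((\<lambda>t. circle_mean (s t)) \<longlongrightarrow> S) (at_right 0)"
    and low: "\<And>t. 0 < t \<Longrightarrow> t < d \<Longrightarrow> L t \<le> circle_mean (\<lambda>\<theta>. s t \<theta> * (1 - (cmod (Ht t \<theta>))\<^sup>2))"
    and L: "((\<lambda>t. L t / (2 * t)) \<longlongrightarrow> l) (at_right 0)"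
  shows "l \<le> (\<Sum>n\<in>{-int K..int K}. Re (cnj (nu n) * p n)) + eps K * S"
proof -
  let ?I = "{-int K..int K}"
  let ?R = "\<lambda>t. (\<Sum>n\<in>?I. Re (cnj (Nc n t / of_real t) * fourier (\<lambda>\<theta>. of_real (s t \<theta>) * Ht t \<theta>) n)) + (eps K + t * (KN\<^sup>2 / 2)) * circle_mean (s t)"
  have "(?R \<longlongrightarrow> (\<Sum>n\<in>?I. Re (cnj (nu n) * p n)) + (eps K + 0 * (KN\<^sup>2 / 2)) * S) (at_right 0)"
    by (intro tendsto_intros Nc_over_t p S)
  then have R: "(?R \<longlongrightarrow> (\<Sum>n\<in>?I. Re (cnj (nu n) * p n)) + eps K * S) (at_right 0)" by simp
  show ?thesis
  proof (rule tendsto_le[OF _ R L])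
    have "min d (T / 2) > 0" using d T by simp
    then show "\<forall>\<^sub>F t in at_right 0. L t / (2 * t) \<le> ?R t"
    proof (rule eventually_right_0I)
      fix t assume t: "0 < t" "t < min d (T / 2)"
      have "L t \<le> 2 * (\<Sum>n\<in>?I. Re (cnj (Nc n t) * fourier (\<lambda>\<theta>. of_real (s t \<theta>) * Ht t \<theta>) n)) + (2 * t * eps K + t\<^sup>2 * KN\<^sup>2) * circle_mean (s t)"
        by (rule order_trans[OF low key_inequality]) (use t s in auto)
      then have "L t / (2 * t) \<le> (2 * (\<Sum>n\<in>?I. Re (cnj (Nc n t) * fourier (\<lambda>\<theta>. of_real (s t \<theta>) * Ht t \<theta>) n)) + (2 * t * eps K + t\<^sup>2 * KN\<^sup>2) * circle_mean (s t)) / (2 * t)"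
        using t by (intro divide_right_mono) auto
      also have "\<dots> = (\<Sum>n\<in>?I. Re (cnj (Nc n t) * fourier (\<lambda>\<theta>. of_real (s t \<theta>) * Ht t \<theta>) n)) / t + (eps K + t * (KN\<^sup>2 / 2)) * circle_mean (s t)"
      proof -
        have "(2 * a + (2 * t * b + t\<^sup>2 * c) * e) / (2 * t) = a / t + (b + t * (c / 2)) * e" for a b c e :: real
          using t by (simp add: field_simps power2_eq_square)
        then show ?thesis .
      qed
      also have "(\<Sum>n\<in>?I. Re (cnj (Nc n t) * fourier (\<lambda>\<theta>. of_real (s t \<theta>) * Ht t \<theta>) n)) / t
         = (\<Sum>n\<in>?I. Re (cnj (Nc n t / of_real t) * fourier (\<lambda>\<theta>. of_real (s t \<theta>) * Ht t \<theta>) n))"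
        unfolding sum_divide_distrib
      proof (intro sum.cong refl)
        fix n
        have "cnj (Nc n t / of_real t) * q = cnj (Nc n t) * q / of_real t" for q by simp
        then show "Re (cnj (Nc n t) * fourier (\<lambda>\<theta>. of_real (s t \<theta>) * Ht t \<theta>) n) / t = Re (cnj (Nc n t / of_real t) * fourier (\<lambda>\<theta>. of_real (s t \<theta>) * Ht t \<theta>) n)"
          by (simp only: Re_divide_of_real)
      qed
      finally show "L t / (2 * t) \<le> ?R t" .
    qed
  qed simp
qed

text \<open>Parseval on the circle of radius e^(-t), where the n-th coefficient of Hx is x n e^(-|n|
  t), combined with total mass at most 1. Keeping only |n| \<le> K in the subtracted sum is enough,
  because all its terms are nonnegative.\<close>

lemma mean_Ht_le:
  assumes t: "t > 0"
  shows "circle_mean (\<lambda>\<theta>. (cmod (Ht t \<theta>))\<^sup>2) \<le> 1 - (\<Sum>n\<in>{-int K..int K}. (cmod (x n))\<^sup>2 * (1 - (dec n t)\<^sup>2))"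
proof -
  let ?I = "\<lambda>K. {-int K..int K}"
  define b where "b = (\<lambda>k. exp (- t) ^ k)"
  have sb: "summable b" unfolding b_def by (rule dec_summable[OF t])
  have dle: "(dec n t)\<^sup>2 \<le> 1" for n using t by (simp add: dec_def power_le_one)
  have "circle_mean (\<lambda>\<theta>. (cmod (Ht t \<theta>))\<^sup>2) \<le> 1 - (\<Sum>n\<in>?I K. (cmod (x n))\<^sup>2 * (1 - (dec n t)\<^sup>2)) + (2 * (\<Sum>k. b (k + K' + 1)))\<^sup>2"
    if K': "K' \<ge> K" for K'
  proof -
    have "circle_mean (\<lambda>\<theta>. (cmod (Ht t \<theta>))\<^sup>2) \<le> (\<Sum>n\<in>?I K'. (cmod (fourier (Ht t) n))\<^sup>2) + (2 * (\<Sum>k. b (k + K' + 1)))\<^sup>2"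
    proof (rule parseval_approx[OF circle_cont_Ht[OF t]])
      show "cmod (Ht t \<theta> - (\<Sum>n\<in>?I K'. fourier (Ht t) n * cis (of_int n * \<theta>))) \<le> 2 * (\<Sum>k. b (k + K' + 1))" for \<theta>
        unfolding fourier_Ht[OF t] unfolding Hx_polar
        by (rule harm_series_tail[OF sb]) (simp only: b_def xdec_le)
    qed simp
    moreover have "(\<Sum>n\<in>?I K'. (cmod (fourier (Ht t) n))\<^sup>2) = (\<Sum>n\<in>?I K'. (cmod (x n))\<^sup>2) - (\<Sum>n\<in>?I K'. (cmod (x n))\<^sup>2 * (1 - (dec n t)\<^sup>2))"
      unfolding sum_subtractf[symmetric] fourier_Ht[OF t] by (intro sum.cong refl) (simp add: norm_mult power_mult_distrib algebra_simps)
    moreover have "(\<Sum>n\<in>?I K'. (cmod (x n))\<^sup>2) \<le> 1" by (rule sum_x_le) simp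
    moreover have "(\<Sum>n\<in>?I K. (cmod (x n))\<^sup>2 * (1 - (dec n t)\<^sup>2)) \<le> (\<Sum>n\<in>?I K'. (cmod (x n))\<^sup>2 * (1 - (dec n t)\<^sup>2))"
      using K' dle by (intro sum_mono2) auto
    ultimately show ?thesis by linarith
  qed
  then have ev: "\<forall>\<^sub>F K' in sequentially. circle_mean (\<lambda>\<theta>. (cmod (Ht t \<theta>))\<^sup>2) \<le> 1 - (\<Sum>n\<in>?I K. (cmod (x n))\<^sup>2 * (1 - (dec n t)\<^sup>2)) + (2 * (\<Sum>k. b (k + K' + 1)))\<^sup>2"
    unfolding eventually_sequentially by blast
  have "(\<lambda>K'. 1 - (\<Sum>n\<in>?I K. (cmod (x n))\<^sup>2 * (1 - (dec n t)\<^sup>2)) + (2 * (\<Sum>k. b (k + K' + 1)))\<^sup>2) \<longlonglongrightarrow> 1 - (\<Sum>n\<in>?I K. (cmod (x n))\<^sup>2 * (1 - (dec n t)\<^sup>2)) + 0\<^sup>2"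
    by (intro tendsto_intros harm_series_tail_tendsto_0[OF sb])
  from tendsto_lowerbound[OF this ev] show ?thesis by simp
qed

text \<open>|Hx| is close to 1 on circles near the boundary, so no mass escapes to high frequencies.
  With \<open>sum_x_le\<close> the squared coefficients of x sum to exactly 1.\<close>

lemma mass_one:
  assumes "e > 0"
  shows "\<exists>K. 1 - e \<le> (\<Sum>n\<in>{-int K..int K}. (cmod (x n))\<^sup>2)"
proof -
  define e' where "e' = min (e / 4) 1"
  have e': "e' > 0" "e' \<le> 1" "e' \<le> e / 4" using assms by (auto simp: e'_def)
  obtain d where d: "d > 0" "\<And>t \<theta>. 0 < t \<and> t < d \<Longrightarrow> 1 - e' \<le> cmod (Ht t \<theta>)"
    using Hx_boundary[OF e'(1)] by blast
  define t where "t = d / 2"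
  have t: "t > 0" "t < d" using d by (auto simp: t_def)
  define b where "b = (\<lambda>k. exp (- t) ^ k)"
  have sb: "summable b" unfolding b_def by (rule dec_summable[OF t(1)])
  have "(\<lambda>K. (2 * (\<Sum>k. b (k + K + 1)))\<^sup>2) \<longlonglongrightarrow> 0\<^sup>2" by (intro tendsto_intros harm_series_tail_tendsto_0[OF sb])
  then have "\<forall>\<^sub>F K in sequentially. (2 * (\<Sum>k. b (k + K + 1)))\<^sup>2 < e / 2"
    using assms by (intro order_tendstoD(2)[where y=0]) auto
  then obtain K where K: "(2 * (\<Sum>k. b (k + K + 1)))\<^sup>2 < e / 2" unfolding eventually_sequentially by blast
  have "circle_mean (\<lambda>\<theta>. (1 - e')\<^sup>2) \<le> circle_mean (\<lambda>\<theta>. (cmod (Ht t \<theta>))\<^sup>2)"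
    by (rule circle_mean_mono) (use e' d t in \<open>auto intro!: continuous_intros circle_cont_Ht power_mono simp del: of_real_exp\<close>)
  also have "\<dots> \<le> (\<Sum>n\<in>{-int K..int K}. (cmod (fourier (Ht t) n))\<^sup>2) + (2 * (\<Sum>k. b (k + K + 1)))\<^sup>2"
  proof (rule parseval_approx[OF circle_cont_Ht[OF t(1)]])
    show "cmod (Ht t \<theta> - (\<Sum>n\<in>{-int K..int K}. fourier (Ht t) n * cis (of_int n * \<theta>))) \<le> 2 * (\<Sum>k. b (k + K + 1))" for \<theta>
      unfolding fourier_Ht[OF t(1)] unfolding Hx_polar
      by (rule harm_series_tail[OF sb]) (simp only: b_def xdec_le)
  qed simp
  finally have *: "circle_mean (\<lambda>\<theta>. (1 - e')\<^sup>2) \<le> (\<Sum>n\<in>{-int K..int K}. (cmod (fourier (Ht t) n))\<^sup>2) + (2 * (\<Sum>k. b (k + K + 1)))\<^sup>2" .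
  have "(\<Sum>n\<in>{-int K..int K}. (cmod (fourier (Ht t) n))\<^sup>2) \<le> (\<Sum>n\<in>{-int K..int K}. (cmod (x n))\<^sup>2)"
  proof (rule sum_mono)
    fix n
    have "cmod (fourier (Ht t) n) \<le> cmod (x n) * 1"
      unfolding fourier_Ht[OF t(1)] norm_mult using t(1) by (intro mult_left_mono) (auto simp: dec_def)
    then show "(cmod (fourier (Ht t) n))\<^sup>2 \<le> (cmod (x n))\<^sup>2" by (intro power_mono) auto
  qed
  then have "(1 - e')\<^sup>2 \<le> (\<Sum>n\<in>{-int K..int K}. (cmod (x n))\<^sup>2) + e / 2" using K * unfolding circle_mean_const by linarith
  moreover have "1 - 2 * e' \<le> (1 - e')\<^sup>2" by (simp add: power2_eq_square algebra_simps)
  ultimately show ?thesis using e'(3) by (intro exI[of _ K]) linarith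
qed

definition zr :: complex where "zr = (SOME w. w \<in> ball 0 1 \<and> Hx w = 0)"

lemma zr: "cmod zr < 1" "Hx zr = 0"
proof -
  have "zr \<in> ball 0 1 \<and> Hx zr = 0" unfolding zr_def by (rule someI_ex) (use Hx_zero in blast)
  then show "cmod zr < 1" "Hx zr = 0" by auto
qed

text \<open>The two parts shifted so that both vanish at the zero \<open>zr\<close>; the constants
  cancel in f0 + cnj g0 because Hx vanishes there. This is the form required by the Schwarz-Pick
  inequality.\<close>

definition f0 where "f0 u = fx u - fx zr"
definition g0 where "g0 u = gx u - gx zr"

lemma f0g0: "f0 holomorphic_on ball 0 1" "g0 holomorphic_on ball 0 1" "f0 zr = 0" "g0 zr = 0"
  "u \<in> ball 0 1 \<Longrightarrow> Hx u = f0 u + cnj (g0 u)" "u \<in> ball 0 1 \<Longrightarrow> cmod (f0 u + cnj (g0 u)) \<le> 1"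
proof -
  have "fx zr + cnj (gx zr) = 0" using Hx_eq[of zr] zr by simp
  then show H: "Hx u = f0 u + cnj (g0 u)" if "u \<in> ball 0 1" for u
    unfolding f0_def g0_def Hx_eq[OF that] by (simp add: algebra_simps)
  show "u \<in> ball 0 1 \<Longrightarrow> cmod (f0 u + cnj (g0 u)) \<le> 1" using H Hx_le_1 by simp
  show "f0 holomorphic_on ball 0 1" "g0 holomorphic_on ball 0 1"
    unfolding f0_def[abs_def] g0_def[abs_def] by (intro holomorphic_intros fx_gx_holomorphic)+
qed (simp_all add: f0_def g0_def)

lemma ev_zr: "\<exists>d>0. \<forall>t. 0 < t \<and> t < d \<longrightarrow> cmod zr < exp (- t)"
proof -
  obtain r where r: "cmod zr < r" "r < 1" using dense zr(1) by blast
  have r0: "r > 0" using r(1) norm_ge_zero[of zr] by linarith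
  show ?thesis
  proof (intro exI[of _ "- ln r"] conjI allI impI)
    show "0 < - ln r" using r r0 by simp
    fix t assume t: "0 < t \<and> t < - ln r"
    then have "exp (ln r) < exp (- t)" by (subst exp_less_cancel_iff) simp
    then show "cmod zr < exp (- t)" using r r0 by simp
  qed
qed

lemma Ht_lower:
  assumes "0 < m" "m < 1"
  shows "\<exists>d>0. \<forall>t. 0 < t \<and> t < d \<longrightarrow> cmod zr < exp (- t) \<and> (\<forall>\<theta>. m \<le> cmod (Ht t \<theta>))"
proof -
  obtain d1 where d1: "d1 > 0" "\<And>t. 0 < t \<and> t < d1 \<Longrightarrow> cmod zr < exp (- t)" using ev_zr by blast
  obtain d2 where d2: "d2 > 0" "\<And>t \<theta>. 0 < t \<and> t < d2 \<Longrightarrow> 1 - (1 - m) \<le> cmod (Ht t \<theta>)"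
    using Hx_boundary[of "1 - m"] assms by auto
  show ?thesis using d1 d2 by (intro exI[of _ "min d1 d2"]) auto
qed

text \<open>Near the unit circle |Ht| \<ge> m is available for every m < 1 only; this lets m tend to
  1.\<close>

lemma le_by_squares:
  assumes "\<And>m. 0 < m \<Longrightarrow> m < 1 \<Longrightarrow> m\<^sup>2 * a \<le> (b::real)"
  shows "a \<le> b"
proof -
  have "((\<lambda>m. m\<^sup>2 * a) \<longlongrightarrow> 1\<^sup>2 * a) (at_left (1::real))" by (intro tendsto_intros)
  moreover have "\<forall>\<^sub>F m in at_left 1. m\<^sup>2 * a \<le> b"
    unfolding eventually_at_left[OF zero_less_one] using assms by (intro exI[of _ 0]) auto
  ultimately have "1\<^sup>2 * a \<le> b" by (rule tendsto_upperbound) simp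
  then show ?thesis by simp
qed

text \<open>With the constant weight, the limit of the mean of 1 - |Ht|^2 divided by 2 t is bounded
  below in two ways: by 1, from Schwarz-Pick and the zero of Hx, and by the sum of |n| |x n|^2, from
  Parseval.\<close>

lemma unweighted_limit:
  shows "1 \<le> (\<Sum>n\<in>{-int K..int K}. Re (cnj (nu n) * x n)) + eps K"
    and "(\<Sum>n\<in>{-int K..int K}. of_int \<bar>n\<bar> * (cmod (x n))\<^sup>2) \<le> (\<Sum>n\<in>{-int K..int K}. Re (cnj (nu n) * x n)) + eps K"
proof -
  let ?I = "{-int K..int K}"
  have p: "((\<lambda>t. fourier (\<lambda>\<theta>. of_real 1 * Ht t \<theta>) n) \<longlongrightarrow> x n) (at_right 0)" for n
  proof -
    have "((\<lambda>t. x n * of_real (dec n t)) \<longlongrightarrow> x n * of_real (dec n 0)) (at_right 0)"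
      unfolding dec_def by (intro tendsto_intros)
    moreover have "\<forall>\<^sub>F t in at_right 0. x n * of_real (dec n t) = fourier (\<lambda>\<theta>. of_real 1 * Ht t \<theta>) n"
      by (rule eventually_right_0I[of 1]) (simp_all add: fourier_Ht del: of_real_exp)
    ultimately show ?thesis by (simp add: dec_def Lim_transform_eventually del: of_real_exp)
  qed
  have gen: "l \<le> (\<Sum>n\<in>?I. Re (cnj (nu n) * x n)) + eps K"
    if "d > 0" "\<And>t. 0 < t \<Longrightarrow> t < d \<Longrightarrow> L t \<le> circle_mean (\<lambda>\<theta>. 1 - (cmod (Ht t \<theta>))\<^sup>2)" "((\<lambda>t. L t / (2 * t)) \<longlongrightarrow> l) (at_right 0)" for d L l
    using limit_inequality[of d "\<lambda>t \<theta>. 1" x 1 L l K] that p by simp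
  show "1 \<le> (\<Sum>n\<in>?I. Re (cnj (nu n) * x n)) + eps K"
  proof (rule le_by_squares)
    fix m :: real assume m: "0 < m" "m < 1"
    obtain d where d: "d > 0" "\<And>t. 0 < t \<and> t < d \<Longrightarrow> cmod zr < exp (- t)" "\<And>t \<theta>. 0 < t \<and> t < d \<Longrightarrow> m \<le> cmod (Ht t \<theta>)"
      using Ht_lower[OF m] by blast
    define L where "L = (\<lambda>t. (1 - (cmod zr)\<^sup>2) * (1 - (exp (- t))\<^sup>2) * m\<^sup>2 / ((exp (- t))\<^sup>2 - (cmod zr)\<^sup>2))"
    have z1: "1 - (cmod zr)\<^sup>2 > 0" using zr(1) by (simp add: power_less_one_iff)
    show "m\<^sup>2 * 1 \<le> (\<Sum>n\<in>?I. Re (cnj (nu n) * x n)) + eps K"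
    proof (rule gen[OF d(1)])
      fix t assume t: "0 < t" "t < d"
      show "L t \<le> circle_mean (\<lambda>\<theta>. 1 - (cmod (Ht t \<theta>))\<^sup>2)"
        using harmonic_zero_weighted_means(1)[OF f0g0(1,2,6,3,4), of "exp (- t)" m] d(2)[of t] d(3)[of t] t m
        unfolding L_def f0g0(5)[OF exp_ball[OF t(1)], symmetric] by simp
    next
      have "((\<lambda>t. (1 - (exp (- t))\<^sup>2) / (2 * t) * ((1 - (cmod zr)\<^sup>2) * m\<^sup>2 / ((exp (- t))\<^sup>2 - (cmod zr)\<^sup>2))) \<longlongrightarrow> 1 * ((1 - (cmod zr)\<^sup>2) * m\<^sup>2 / ((exp (- 0))\<^sup>2 - (cmod zr)\<^sup>2))) (at_right 0)"
        by (intro tendsto_mult one_minus_exp_over_t tendsto_divide tendsto_diff tendsto_const tendsto_power tendsto_exp tendsto_minus tendsto_ident_at) (use z1 in simp)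
      moreover have "(1 - (exp (- t))\<^sup>2) / (2 * t) * ((1 - (cmod zr)\<^sup>2) * m\<^sup>2 / ((exp (- t))\<^sup>2 - (cmod zr)\<^sup>2)) = L t / (2 * t)" for t
        unfolding L_def by (simp only: times_divide_times_eq divide_divide_eq_left mult_ac)
      ultimately show "((\<lambda>t. L t / (2 * t)) \<longlongrightarrow> m\<^sup>2 * 1) (at_right 0)" using z1 by simp
    qed
  qed
  show "(\<Sum>n\<in>?I. of_int \<bar>n\<bar> * (cmod (x n))\<^sup>2) \<le> (\<Sum>n\<in>?I. Re (cnj (nu n) * x n)) + eps K"
  proof (rule gen[OF zero_less_one])
    fix t :: real assume t: "0 < t" "t < 1"
    have "circle_mean (\<lambda>\<theta>. 1 - (cmod (Ht t \<theta>))\<^sup>2) = 1 - circle_mean (\<lambda>\<theta>. (cmod (Ht t \<theta>))\<^sup>2)"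
      using circle_mean_diff[of "\<lambda>\<theta>. 1" "\<lambda>\<theta>. (cmod (Ht t \<theta>))\<^sup>2"] circle_cont_Ht[OF t(1)] by (simp add: continuous_intros del: of_real_exp)
    then show "(\<Sum>n\<in>?I. (cmod (x n))\<^sup>2 * (1 - (dec n t)\<^sup>2)) \<le> circle_mean (\<lambda>\<theta>. 1 - (cmod (Ht t \<theta>))\<^sup>2)"
      using mean_Ht_le[OF t(1), of K] by simp
  next
    have lim: "((\<lambda>t. (1 - (dec n t)\<^sup>2) / (2 * t)) \<longlongrightarrow> of_int \<bar>n\<bar>) (at_right 0)" for n
    proof -
      have "((\<lambda>t::real. - exp (- 2 * of_int \<bar>n\<bar> * t) / 2) has_real_derivative of_int \<bar>n\<bar>) (at 0)"
        by (auto intro!: derivative_eq_intros)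
      then have "((\<lambda>t::real. ((- exp (- 2 * of_int \<bar>n\<bar> * t) / 2) - (- exp (- 2 * of_int \<bar>n\<bar> * 0) / 2)) / (t - 0)) \<longlongrightarrow> of_int \<bar>n\<bar>) (at 0)"
        by (simp add: has_field_derivative_iff)
      then have "((\<lambda>t::real. ((- exp (- 2 * of_int \<bar>n\<bar> * t) / 2) - (- exp (- 2 * of_int \<bar>n\<bar> * 0) / 2)) / (t - 0)) \<longlongrightarrow> of_int \<bar>n\<bar>) (at_right 0)"
        by (rule filterlim_mono[OF _ order_refl at_le]) simp
      moreover have "((- exp (- 2 * of_int \<bar>n\<bar> * t) / 2) - (- exp (- 2 * of_int \<bar>n\<bar> * 0) / 2)) / (t - 0) = (1 - (dec n t)\<^sup>2) / (2 * t)" for t :: real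
        unfolding dec_def exp_double[symmetric] by (simp add: diff_divide_distrib mult_ac)
      ultimately show ?thesis by simp
    qed
    have "((\<lambda>t. \<Sum>n\<in>?I. (cmod (x n))\<^sup>2 * ((1 - (dec n t)\<^sup>2) / (2 * t))) \<longlongrightarrow> (\<Sum>n\<in>?I. (cmod (x n))\<^sup>2 * of_int \<bar>n\<bar>)) (at_right 0)"
      by (intro tendsto_intros lim)
    then show "((\<lambda>t. (\<Sum>n\<in>?I. (cmod (x n))\<^sup>2 * (1 - (dec n t)\<^sup>2)) / (2 * t)) \<longlongrightarrow> (\<Sum>n\<in>?I. of_int \<bar>n\<bar> * (cmod (x n))\<^sup>2)) (at_right 0)"
      by (simp add: sum_divide_distrib mult.commute)
  qed
qed

end

section \<open>The Poisson-weighted inequality\<close>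

lemma cmod_diff_polar:
  "complex_of_real ((cmod (of_real \<rho> * cis \<theta> - w))\<^sup>2)
     = of_real (\<rho>\<^sup>2 + (cmod w)\<^sup>2) - cnj w * of_real \<rho> * cis \<theta> - w * of_real \<rho> * cnj (cis \<theta>)"
proof -
  have c: "cis \<theta> * cnj (cis \<theta>) = 1" by (simp add: cis_cnj cis_mult)
  have "complex_of_real ((cmod (of_real \<rho> * cis \<theta> - w))\<^sup>2) = (of_real \<rho> * cis \<theta> - w) * cnj (of_real \<rho> * cis \<theta> - w)"
    by (rule complex_norm_square)
  also have "\<dots> = of_real (\<rho>\<^sup>2) * (cis \<theta> * cnj (cis \<theta>)) + w * cnj w - cnj w * of_real \<rho> * cis \<theta> - w * of_real \<rho> * cnj (cis \<theta>)"
    by (simp add: algebra_simps power2_eq_square)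
  also have "\<dots> = of_real (\<rho>\<^sup>2 + (cmod w)\<^sup>2) - cnj w * of_real \<rho> * cis \<theta> - w * of_real \<rho> * cnj (cis \<theta>)"
    unfolding c complex_norm_square[symmetric] by simp
  finally show ?thesis .
qed

lemma polar_diff_nonzero: "cmod w < exp (- t) \<Longrightarrow> of_real (exp (- t)) * cis \<theta> - w \<noteq> 0"
proof
  assume a: "cmod w < exp (- t)" "of_real (exp (- t)) * cis \<theta> - w = 0"
  then have "cmod (of_real (exp (- t)) * cis \<theta>) = cmod w" by simp
  then show False using a(1) by (simp add: norm_mult del: of_real_exp)
qed

lemma trans_eq_add: "a = b + c \<Longrightarrow> c = d \<Longrightarrow> a = b + d" for a b c d :: complex
  by simp

lemma bound_scale: "(1 - o') * ((1 - o') * a * m * b / c) = (1 - o')\<^sup>2 * m * a * (b / c)" for a b c m o' :: real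
  by (simp add: power2_eq_square)

context nitsche
begin

definition om :: real where "om = (cmod zr)\<^sup>2"

lemma om: "0 \<le> om" "om < 1"
  using zr(1) by (simp_all add: om_def power_less_one_iff)

lemma exp_om: "cmod zr < exp (- t) \<Longrightarrow> om < (exp (- t))\<^sup>2"
  unfolding om_def by (intro power_strict_mono) auto

lemma circle_cont_weight:
  assumes "cmod zr < exp (- t)"
  shows "circle_cont (weight zr t)"
proof -
  have "of_real (exp (- t)) * cis \<theta> - zr \<noteq> 0" for \<theta> by (rule polar_diff_nonzero[OF assms])
  then show ?thesis unfolding weight_def[abs_def] by (intro continuous_intros) (simp del: of_real_exp)
qed

lemma weight_nonneg: "weight zr t \<theta> \<ge> 0"
  using om unfolding weight_def om_def by simp

lemma mean_weight: "cmod zr < exp (- t) \<Longrightarrow> circle_mean (weight zr t) = (1 - om) / ((exp (- t))\<^sup>2 - om)"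
proof -
  assume a: "cmod zr < exp (- t)"
  have nz: "of_real (exp (- t)) * cis \<theta> - zr \<noteq> 0" for \<theta> by (rule polar_diff_nonzero) fact
  have "circle_mean (weight zr t) = circle_mean (\<lambda>\<theta>. (1 - om) * (1 / (cmod (of_real (exp (- t)) * cis \<theta> - zr))\<^sup>2))"
    unfolding weight_def[abs_def] om_def by simp
  also have "\<dots> = (1 - om) * circle_mean (\<lambda>\<theta>. 1 / (cmod (of_real (exp (- t)) * cis \<theta> - zr))\<^sup>2)"
    by (rule circle_mean_mult_right_real) (intro continuous_intros, use nz in \<open>simp del: of_real_exp\<close>)
  also have "circle_mean (\<lambda>\<theta>. 1 / (cmod (of_real (exp (- t)) * cis \<theta> - zr))\<^sup>2) = 1 / ((exp (- t))\<^sup>2 - om)"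
    unfolding om_def by (rule circle_mean_inverse_square[OF a])
  finally show ?thesis by simp
qed

lemma mean_weight_sq: "cmod zr < exp (- t) \<Longrightarrow>
   circle_mean (\<lambda>\<theta>. (weight zr t \<theta>)\<^sup>2) = (1 - om)\<^sup>2 * (((exp (- t))\<^sup>2 + om) / ((exp (- t))\<^sup>2 - om) ^ 3)"
proof -
  assume a: "cmod zr < exp (- t)"
  have nz: "of_real (exp (- t)) * cis \<theta> - zr \<noteq> 0" for \<theta> by (rule polar_diff_nonzero) fact
  have "circle_mean (\<lambda>\<theta>. (weight zr t \<theta>)\<^sup>2) = circle_mean (\<lambda>\<theta>. (1 - om)\<^sup>2 * (1 / (cmod (of_real (exp (- t)) * cis \<theta> - zr)) ^ 4))"
    unfolding weight_def[abs_def] om_def by (simp add: power_divide flip: power_mult)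
  also have "\<dots> = (1 - om)\<^sup>2 * circle_mean (\<lambda>\<theta>. 1 / (cmod (of_real (exp (- t)) * cis \<theta> - zr)) ^ 4)"
    by (rule circle_mean_mult_right_real) (intro continuous_intros, use nz in \<open>simp del: of_real_exp\<close>)
  also have "circle_mean (\<lambda>\<theta>. 1 / (cmod (of_real (exp (- t)) * cis \<theta> - zr)) ^ 4) = ((exp (- t))\<^sup>2 + om) / ((exp (- t))\<^sup>2 - om) ^ 3"
    unfolding om_def by (rule circle_mean_inverse_fourth[OF a])
  finally show ?thesis by simp
qed

abbreviation (input) wH :: "real \<Rightarrow> int \<Rightarrow> complex" where
  "wH t n \<equiv> fourier (\<lambda>\<theta>. of_real (weight zr t \<theta>) * Ht t \<theta>) n"

lemma exp_minus_tendsto: "((\<lambda>t::real. exp (- t)) \<longlongrightarrow> 1) (at_right 0)"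
proof -
  have "((\<lambda>t::real. exp (- t)) \<longlongrightarrow> exp (- 0)) (at_right 0)" by (intro tendsto_intros)
  then show ?thesis by simp
qed

lemma wH_split:
  assumes t: "t > 0" "cmod zr < exp (- t)"
  shows "wH t n = fourier (\<lambda>\<theta>. of_real (weight zr t \<theta>) * f0 (of_real (exp (- t)) * cis \<theta>)) n
     + cnj (fourier (\<lambda>\<theta>. of_real (weight zr t \<theta>) * g0 (of_real (exp (- t)) * cis \<theta>)) (- n))"
proof -
  have cf: "circle_cont (\<lambda>\<theta>. k (of_real (exp (- t)) * cis \<theta>))" if "k holomorphic_on ball 0 1" for k
    by (rule circle_cont_polar, rule continuous_on_subset[OF holomorphic_on_imp_continuous_on[OF that]]) (use t in auto)
  note cs = circle_cont_weight[OF t(2)]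
  have "of_real (weight zr t \<theta>) * Ht t \<theta> = of_real (weight zr t \<theta>) * f0 (of_real (exp (- t)) * cis \<theta>)
      + cnj (of_real (weight zr t \<theta>) * g0 (of_real (exp (- t)) * cis \<theta>))" for \<theta>
    unfolding f0g0(5)[OF exp_ball[OF t(1)]] by (simp add: algebra_simps del: of_real_exp)
  then have "wH t n = fourier (\<lambda>\<theta>. of_real (weight zr t \<theta>) * f0 (of_real (exp (- t)) * cis \<theta>)) n
      + fourier (\<lambda>\<theta>. cnj (of_real (weight zr t \<theta>) * g0 (of_real (exp (- t)) * cis \<theta>))) n"
    by (simp only:) (rule fourier_add, (intro continuous_intros cs cf f0g0)+)
  moreover have "fourier (\<lambda>\<theta>. cnj (of_real (weight zr t \<theta>) * g0 (of_real (exp (- t)) * cis \<theta>))) n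
      = cnj (fourier (\<lambda>\<theta>. of_real (weight zr t \<theta>) * g0 (of_real (exp (- t)) * cis \<theta>)) (- n))"
    by (rule fourier_cnj) (intro continuous_intros cs cf f0g0)
  ultimately show ?thesis by (rule trans_eq_add)
qed

text \<open>The weighted f0 has only positive frequencies and the weighted conjugate of g0 only
  negative ones. So frequency 0 is absent, which is the whole point of centring the weight at the
  zero of Hx.\<close>

lemma weighted_limits:
  "\<exists>p. p 0 = 0 \<and> (\<forall>n. ((\<lambda>t. wH t n) \<longlongrightarrow> p n) (at_right 0))"
proof -
  obtain d where d: "d > 0" "\<And>t. 0 < t \<and> t < d \<Longrightarrow> cmod zr < exp (- t)" using ev_zr by blast
  have "\<exists>l. ((\<lambda>t. wH t n) \<longlongrightarrow> l) (at_right 0)" for n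
  proof -
    obtain a where a: "((\<lambda>t. fourier (\<lambda>\<theta>. of_real (weight zr t \<theta>) * f0 (of_real (exp (- t)) * cis \<theta>)) n) \<longlongrightarrow> a) (at_right 0)"
      using weighted_fourier_tendsto(1)[OF f0g0(1,3) zr(1)] by blast
    obtain b where b: "((\<lambda>t. fourier (\<lambda>\<theta>. of_real (weight zr t \<theta>) * g0 (of_real (exp (- t)) * cis \<theta>)) (- n)) \<longlongrightarrow> b) (at_right 0)"
      using weighted_fourier_tendsto(1)[OF f0g0(2,4) zr(1)] by blast
    have "((\<lambda>t. wH t n) \<longlongrightarrow> a + cnj b) (at_right 0)"
      by (rule Lim_transform_eventually[OF tendsto_add[OF a tendsto_cnj[OF b]]], rule eventually_right_0I[OF d(1)])
         (rule wH_split[symmetric], use d in auto)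
    then show ?thesis ..
  qed
  then have "\<forall>n. \<exists>l. ((\<lambda>t. wH t n) \<longlongrightarrow> l) (at_right 0)" by (rule allI)
  from choice[OF this] obtain p where all: "\<forall>n. ((\<lambda>t. wH t n) \<longlongrightarrow> p n) (at_right 0)" by (rule exE)
  have p: "((\<lambda>t. wH t n) \<longlongrightarrow> p n) (at_right 0)" for n using all by (rule spec)
  have "((\<lambda>t. wH t 0) \<longlongrightarrow> 0) (at_right 0)"
  proof (rule Lim_transform_eventually[OF tendsto_const], rule eventually_right_0I[OF d(1)])
    fix t assume t: "0 < t" "t < d"
    have z: "cmod zr < exp (- t)" using d(2) t by blast
    show "0 = wH t 0"
      unfolding wH_split[OF t(1) z] using weighted_fourier_tendsto(2)[OF f0g0(1,3) zr(1) order_refl t(1) z]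
        weighted_fourier_tendsto(2)[OF f0g0(2,4) zr(1) order_refl t(1) z] by simp
  qed
  then have "p 0 = 0" using tendsto_unique[OF _ p] by simp
  then show ?thesis using p by blast
qed

text \<open>Multiplying the weighted function by |u - zr|^2 returns a multiple of Hx; on the circle
  |u - zr|^2 is a trigonometric polynomial of degree 1, so three neighbouring coefficients
  occur.\<close>

lemma wH_recurrence:
  assumes t: "t > 0" "cmod zr < exp (- t)"
  shows "of_real (1 - om) * (x n * of_real (dec n t))
     = of_real ((exp (- t))\<^sup>2 + om) * wH t n - cnj zr * of_real (exp (- t)) * wH t (n - 1) - zr * of_real (exp (- t)) * wH t (n + 1)"
proof -
  let ?r = "complex_of_real (exp (- t))"
  define W where "W = (\<lambda>\<theta>. of_real (weight zr t \<theta>) * Ht t \<theta>)"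
  have cW: "circle_cont W" unfolding W_def by (intro continuous_intros circle_cont_weight t circle_cont_Ht)
  have cc: "circle_cont (\<lambda>\<theta>. cis \<theta> * W \<theta>)" "circle_cont (\<lambda>\<theta>. cnj (cis \<theta>) * W \<theta>)"
    by (intro continuous_intros cW)+
  have pw: "of_real (1 - om) * Ht t \<theta> = of_real ((exp (- t))\<^sup>2 + om) * W \<theta> - (cnj zr * ?r) * (cis \<theta> * W \<theta>) - (zr * ?r) * (cnj (cis \<theta>) * W \<theta>)" for \<theta>
  proof -
    have nz: "?r * cis \<theta> - zr \<noteq> 0" by (rule polar_diff_nonzero) fact
    have w: "(cmod (?r * cis \<theta> - zr))\<^sup>2 * weight zr t \<theta> = 1 - om"
      unfolding weight_def om_def using nz by (simp del: of_real_exp)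
    have "of_real (1 - om) * Ht t \<theta> = of_real ((cmod (?r * cis \<theta> - zr))\<^sup>2) * W \<theta>"
      unfolding w[symmetric] W_def by (simp only: of_real_mult mult.assoc)
    then show ?thesis unfolding cmod_diff_polar om_def[symmetric] by (simp only: ring_distribs mult.assoc)
  qed
  have "fourier (\<lambda>\<theta>. of_real (1 - om) * Ht t \<theta>) n = of_real ((exp (- t))\<^sup>2 + om) * fourier W n
      - (cnj zr * ?r) * fourier (\<lambda>\<theta>. cis \<theta> * W \<theta>) n - (zr * ?r) * fourier (\<lambda>\<theta>. cnj (cis \<theta>) * W \<theta>) n"
    unfolding pw by (subst fourier_diff fourier_mult_const | intro continuous_intros cW cc)+ (rule refl)
  then show ?thesis unfolding fourier_cis_mult fourier_mult_const[OF circle_cont_Ht[OF t(1)]] fourier_Ht[OF t(1)] W_def .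
qed

lemma sum_wH_le:
  assumes t: "t > 0" "cmod zr < exp (- t)"
  shows "(\<Sum>n\<in>{-int K..int K}. (cmod (wH t n))\<^sup>2) \<le> (1 - om)\<^sup>2 * (((exp (- t))\<^sup>2 + om) / ((exp (- t))\<^sup>2 - om) ^ 3)"
proof -
  note c = circle_cont_weight[OF t(2)] circle_cont_Ht[OF t(1)]
  have "(\<Sum>n\<in>{-int K..int K}. (cmod (wH t n))\<^sup>2) \<le> circle_mean (\<lambda>\<theta>. (cmod (of_real (weight zr t \<theta>) * Ht t \<theta>))\<^sup>2)"
    by (rule bessel_inequality) (intro continuous_intros c, simp)
  also have "\<dots> \<le> circle_mean (\<lambda>\<theta>. (weight zr t \<theta>)\<^sup>2)"
  proof (rule circle_mean_mono)
    fix \<theta>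
    have "cmod (of_real (weight zr t \<theta>) * Ht t \<theta>) \<le> weight zr t \<theta> * 1"
      unfolding norm_mult by (intro mult_mono) (use weight_nonneg Hx_le_1[OF exp_ball[OF t(1)]] in auto)
    then show "(cmod (of_real (weight zr t \<theta>) * Ht t \<theta>))\<^sup>2 \<le> (weight zr t \<theta>)\<^sup>2"
      by (intro power_mono) auto
  qed (intro continuous_intros c)+
  finally show ?thesis unfolding mean_weight_sq[OF t(2)] .
qed

text \<open>The mean of the squared Poisson kernel of \<open>zr\<close> on the unit circle.\<close>

definition Pm :: real where "Pm = (1 + om) / (1 - om)"

lemma Pm_form: "(1 - om)\<^sup>2 * (1 + om) / (1 - om) ^ 3 = Pm"
  unfolding Pm_def power2_eq_square power3_eq_cube using om by (simp add: divide_simps)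

text \<open>The limits p of the weighted coefficients replace x. \<open>Pm\<close> enters twice:
  Bessel bounds the mass of p by it, and the second weighted mean in the Schwarz-Pick estimate makes
  it the lower bound for the pairing with \<open>nu\<close>. The mean of the weight tends to 1, so
  the tail error remains \<open>eps K\<close>.\<close>

lemma weighted_limit:
  "\<exists>p. p 0 = 0 \<and> (\<forall>n. of_real (1 - om) * x n = of_real (1 + om) * p n - cnj zr * p (n - 1) - zr * p (n + 1))
     \<and> (\<forall>K. (\<Sum>n\<in>{-int K..int K}. (cmod (p n))\<^sup>2) \<le> Pm)
     \<and> (\<forall>K. Pm \<le> (\<Sum>n\<in>{-int K..int K}. Re (cnj (nu n) * p n)) + eps K)"
proof -
  obtain p where p: "p 0 = 0" "\<And>n. ((\<lambda>t. wH t n) \<longlongrightarrow> p n) (at_right 0)" using weighted_limits by blast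
  obtain d where d: "d > 0" "\<And>t. 0 < t \<and> t < d \<Longrightarrow> cmod zr < exp (- t)" using ev_zr by blast
  note e = exp_minus_tendsto
  have sq: "((\<lambda>t. ((exp (- t))\<^sup>2 + om) / ((exp (- t))\<^sup>2 - om) ^ 3) \<longlongrightarrow> (1\<^sup>2 + om) / (1\<^sup>2 - om) ^ 3) (at_right 0)"
    by (intro tendsto_intros e) (use om in auto)
  have "of_real (1 - om) * x n = of_real (1 + om) * p n - cnj zr * p (n - 1) - zr * p (n + 1)" for n
  proof -
    have "((\<lambda>t. of_real (1 - om) * (x n * of_real (dec n t))) \<longlongrightarrow> of_real (1 - om) * (x n * of_real (dec n 0))) (at_right 0)"
      unfolding dec_def by (intro tendsto_intros)
    then have 1: "((\<lambda>t. of_real (1 - om) * (x n * of_real (dec n t))) \<longlongrightarrow> of_real (1 - om) * x n) (at_right 0)"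
      by (simp add: dec_def)
    have "((\<lambda>t. of_real ((exp (- t))\<^sup>2 + om) * wH t n - cnj zr * of_real (exp (- t)) * wH t (n - 1) - zr * of_real (exp (- t)) * wH t (n + 1))
       \<longlongrightarrow> of_real (1\<^sup>2 + om) * p n - cnj zr * of_real 1 * p (n - 1) - zr * of_real 1 * p (n + 1)) (at_right 0)"
      by (intro tendsto_intros p e)
    then have "((\<lambda>t. of_real (1 - om) * (x n * of_real (dec n t)))
       \<longlongrightarrow> of_real (1\<^sup>2 + om) * p n - cnj zr * of_real 1 * p (n - 1) - zr * of_real 1 * p (n + 1)) (at_right 0)"
      by (rule Lim_transform_eventually, intro eventually_right_0I[OF d(1)])
         (rule wH_recurrence[symmetric], use d in auto)
    from tendsto_unique[OF _ 1 this] show ?thesis by simp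
  qed
  moreover have "(\<Sum>n\<in>{-int K..int K}. (cmod (p n))\<^sup>2) \<le> Pm" for K
  proof -
    have 1: "((\<lambda>t. \<Sum>n\<in>{-int K..int K}. (cmod (wH t n))\<^sup>2) \<longlongrightarrow> (\<Sum>n\<in>{-int K..int K}. (cmod (p n))\<^sup>2)) (at_right 0)"
      by (intro tendsto_intros p)
    have 2: "((\<lambda>t. (1 - om)\<^sup>2 * (((exp (- t))\<^sup>2 + om) / ((exp (- t))\<^sup>2 - om) ^ 3)) \<longlongrightarrow> (1 - om)\<^sup>2 * ((1\<^sup>2 + om) / (1\<^sup>2 - om) ^ 3)) (at_right 0)"
      by (intro tendsto_intros sq)
    have "(\<Sum>n\<in>{-int K..int K}. (cmod (p n))\<^sup>2) \<le> (1 - om)\<^sup>2 * ((1\<^sup>2 + om) / (1\<^sup>2 - om) ^ 3)"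
      by (rule tendsto_le[OF _ 2 1], simp, intro eventually_right_0I[OF d(1)]) (rule sum_wH_le, use d in auto)
    then show ?thesis using Pm_form by simp
  qed
  moreover have "Pm \<le> (\<Sum>n\<in>{-int K..int K}. Re (cnj (nu n) * p n)) + eps K" for K
  proof (rule le_by_squares)
    fix m :: real assume m: "0 < m" "m < 1"
    obtain d where d: "d > 0" "\<And>t. 0 < t \<and> t < d \<Longrightarrow> cmod zr < exp (- t)" "\<And>t \<theta>. 0 < t \<and> t < d \<Longrightarrow> m \<le> cmod (Ht t \<theta>)"
      using Ht_lower[OF m] by blast
    define L where "L = (\<lambda>t. (1 - om)\<^sup>2 * m\<^sup>2 * (1 - (exp (- t))\<^sup>2) * (((exp (- t))\<^sup>2 + om) / ((exp (- t))\<^sup>2 - om) ^ 3))"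
    have "m\<^sup>2 * Pm \<le> (\<Sum>n\<in>{-int K..int K}. Re (cnj (nu n) * p n)) + eps K * 1"
    proof (rule limit_inequality[where s = "weight zr" and d = d and L = L])
      fix t assume t: "0 < t" "t < d"
      then have z: "cmod zr < exp (- t)" using d(2) by blast
      show "circle_cont (weight zr t)" by (rule circle_cont_weight[OF z])
      have nz: "of_real (exp (- t)) * cis \<theta> - zr \<noteq> 0" for \<theta> by (rule polar_diff_nonzero) fact
      have "(1 - (cmod zr)\<^sup>2) * (1 - (exp (- t))\<^sup>2) * m\<^sup>2 * ((exp (- t))\<^sup>2 + (cmod zr)\<^sup>2) / ((exp (- t))\<^sup>2 - (cmod zr)\<^sup>2) ^ 3
         \<le> circle_mean (\<lambda>\<theta>. (1 - (cmod (Ht t \<theta>))\<^sup>2) / (cmod (of_real (exp (- t)) * cis \<theta> - zr))\<^sup>2)"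
        using harmonic_zero_weighted_means(2)[OF f0g0(1,2,6,3,4), of "exp (- t)" m] z d(3)[of t] t m
        unfolding f0g0(5)[OF exp_ball[OF t(1)], symmetric] by simp
      then have "(1 - om) * ((1 - om) * (1 - (exp (- t))\<^sup>2) * m\<^sup>2 * ((exp (- t))\<^sup>2 + om) / ((exp (- t))\<^sup>2 - om) ^ 3)
         \<le> (1 - om) * circle_mean (\<lambda>\<theta>. (1 - (cmod (Ht t \<theta>))\<^sup>2) / (cmod (of_real (exp (- t)) * cis \<theta> - zr))\<^sup>2)"
        unfolding om_def[symmetric] using om by (intro mult_left_mono) auto
      moreover have "(1 - om) * circle_mean (\<lambda>\<theta>. (1 - (cmod (Ht t \<theta>))\<^sup>2) / (cmod (of_real (exp (- t)) * cis \<theta> - zr))\<^sup>2)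
        = circle_mean (\<lambda>\<theta>. (1 - om) * ((1 - (cmod (Ht t \<theta>))\<^sup>2) / (cmod (of_real (exp (- t)) * cis \<theta> - zr))\<^sup>2))"
        by (rule circle_mean_mult_right_real[symmetric])
          (intro continuous_intros circle_cont_Ht t(1), use nz in \<open>simp del: of_real_exp\<close>)
      moreover have "(1 - om) * ((1 - (cmod (Ht t \<theta>))\<^sup>2) / (cmod (of_real (exp (- t)) * cis \<theta> - zr))\<^sup>2) = weight zr t \<theta> * (1 - (cmod (Ht t \<theta>))\<^sup>2)" for \<theta>
        unfolding weight_def om_def by (simp only: times_divide_eq_left times_divide_eq_right)
      ultimately show "L t \<le> circle_mean (\<lambda>\<theta>. weight zr t \<theta> * (1 - (cmod (Ht t \<theta>))\<^sup>2))"
        unfolding L_def bound_scale by (simp only:)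
    next
      have l: "((\<lambda>t. (1 - om) / ((exp (- t))\<^sup>2 - om)) \<longlongrightarrow> (1 - om) / (1\<^sup>2 - om)) (at_right 0)"
        by (intro tendsto_intros e) (use om in auto)
      have l1: "(1 - om) / (1\<^sup>2 - om) = 1" using om by simp
      show "((\<lambda>t. circle_mean (weight zr t)) \<longlongrightarrow> 1) (at_right 0)"
        by (rule Lim_transform_eventually[OF l[unfolded l1]], intro eventually_right_0I[OF d(1)])
          (rule mean_weight[symmetric], use d in auto)
    next
      have "((\<lambda>t. ((1 - (exp (- t))\<^sup>2) / (2 * t)) * ((1 - om)\<^sup>2 * m\<^sup>2 * (((exp (- t))\<^sup>2 + om) / ((exp (- t))\<^sup>2 - om) ^ 3)))
          \<longlongrightarrow> 1 * ((1 - om)\<^sup>2 * m\<^sup>2 * ((1\<^sup>2 + om) / (1\<^sup>2 - om) ^ 3))) (at_right 0)"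
        by (intro tendsto_mult one_minus_exp_over_t tendsto_const sq)
      moreover have "1 * ((1 - om)\<^sup>2 * m\<^sup>2 * ((1\<^sup>2 + om) / (1\<^sup>2 - om) ^ 3)) = m\<^sup>2 * Pm"
        unfolding Pm_form[symmetric] by simp
      moreover have "((1 - (exp (- t))\<^sup>2) / (2 * t)) * ((1 - om)\<^sup>2 * m\<^sup>2 * b) = (1 - om)\<^sup>2 * m\<^sup>2 * (1 - (exp (- t))\<^sup>2) * b / (2 * t)" for t b :: real
        by simp
      ultimately show "((\<lambda>t. L t / (2 * t)) \<longlongrightarrow> m\<^sup>2 * Pm) (at_right 0)" unfolding L_def by (simp only:)
    qed (use d weight_nonneg p in auto)
    then show "m\<^sup>2 * Pm \<le> (\<Sum>n\<in>{-int K..int K}. Re (cnj (nu n) * p n)) + eps K" by simp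
  qed
  ultimately show ?thesis using p(1) by blast
qed

end

section \<open>Elementary estimates for hyperbolic functions and quadratic sums\<close>

lemma sinh_Suc_mult_le:
  assumes "(T::real) \<ge> 0"
  shows "sinh (real (Suc k) * T) \<le> real (Suc k) * sinh T * cosh (real k * T)"
proof (induction k)
  case (Suc k)
  have 1: "real (Suc (Suc k)) * T = real (Suc k) * T + T" by (simp add: algebra_simps)
  have 2: "cosh (real (Suc k) * T) = cosh (real k * T) * cosh T + sinh (real k * T) * sinh T"
  proof -
    have "real (Suc k) * T = real k * T + T" by (simp add: algebra_simps)
    then show ?thesis by (simp only: cosh_add)
  qed
  have S: "sinh T \<ge> 0" "sinh (real k * T) \<ge> 0" using assms by simp_all
  have "sinh (real (Suc (Suc k)) * T) = sinh (real (Suc k) * T) * cosh T + cosh (real (Suc k) * T) * sinh T"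
    unfolding 1 sinh_add ..
  also have "\<dots> \<le> (real (Suc k) * sinh T * cosh (real k * T)) * cosh T + cosh (real (Suc k) * T) * sinh T"
    by (intro add_right_mono mult_right_mono Suc.IH) simp
  also have "(real (Suc k) * sinh T * cosh (real k * T)) * cosh T = (real (Suc k) * sinh T) * (cosh (real k * T) * cosh T)"
    by simp
  also have "\<dots> + cosh (real (Suc k) * T) * sinh T \<le> (real (Suc k) * sinh T) * cosh (real (Suc k) * T) + cosh (real (Suc k) * T) * sinh T"
    by (intro add_right_mono mult_left_mono) (use S 2 in simp_all)
  also have "\<dots> = real (Suc (Suc k)) * sinh T * cosh (real (Suc k) * T)" by (simp add: algebra_simps)
  finally show ?case .
qed simp

lemma cosh_mono_mult: "(T::real) \<ge> 0 \<Longrightarrow> cosh T \<le> cosh (real (Suc k) * T)"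
  by (subst cosh_real_nonneg_le_iff) (simp_all add: algebra_simps)

text \<open>Induction by the addition formula, starting from the doubling formula; it is the
  estimate behind \<open>lam * Sn n \<le> 1\<close> for |n| \<ge> 2.\<close>

lemma mult_cosh_sinh_le_sinh:
  assumes "(T::real) \<ge> 0"
  shows "real (Suc (Suc k)) * (cosh T * sinh T) \<le> sinh (real (Suc (Suc k)) * T)"
proof (induction k)
  case 0
  have "real (Suc (Suc 0)) * T = 2 * T" by simp
  then show ?case using sinh_double[of T] by (simp add: mult_ac)
next
  case (Suc k)
  have 1: "real (Suc (Suc (Suc k))) * T = real (Suc (Suc k)) * T + T" by (simp add: algebra_simps)
  have S: "sinh T \<ge> 0" using assms by simp
  have "real (Suc (Suc (Suc k))) * (cosh T * sinh T) = real (Suc (Suc k)) * (cosh T * sinh T) * 1 + cosh T * sinh T"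
    by (simp add: algebra_simps)
  also have "\<dots> \<le> sinh (real (Suc (Suc k)) * T) * cosh T + cosh (real (Suc (Suc k)) * T) * sinh T"
    by (intro add_mono mult_mono Suc.IH cosh_mono_mult) (use assms S cosh_real_ge_1 in auto)
  also have "\<dots> = sinh (real (Suc (Suc (Suc k))) * T)" unfolding 1 sinh_add ..
  finally show ?case .
qed

text \<open>The first three terms of the Taylor series of artanh, in the variable tanh T.\<close>

lemma artanh_lower: "(T::real) \<ge> 0 \<Longrightarrow> tanh T + tanh T ^ 3 / 3 + tanh T ^ 5 / 5 \<le> T"
proof -
  assume T: "T \<ge> 0"
  have d: "((\<lambda>T. T - (tanh T + tanh T ^ 3 / 3 + tanh T ^ 5 / 5)) has_real_derivative tanh y ^ 6) (at y)" for y :: real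
  proof -
    have "((\<lambda>T. T - (tanh T + tanh T ^ 3 / 3 + tanh T ^ 5 / 5)) has_real_derivative
       1 - ((1 - tanh y ^ 2) + 3 * tanh y ^ 2 * (1 - tanh y ^ 2) / 3 + 5 * tanh y ^ 4 * (1 - tanh y ^ 2) / 5)) (at y)"
      by (rule derivative_eq_intros refl | simp)+
    moreover have "1 - ((1 - a ^ 2) + 3 * a ^ 2 * (1 - a ^ 2) / 3 + 5 * a ^ 4 * (1 - a ^ 2) / 5) = a ^ 6" for a :: real
      by (simp add: field_simps flip: power_add)
    ultimately show ?thesis by simp
  qed
  have "0 - (tanh 0 + tanh 0 ^ 3 / 3 + tanh 0 ^ 5 / 5) \<le> T - (tanh T + tanh T ^ 3 / 3 + tanh T ^ 5 / 5)"
    using T by (rule DERIV_nonneg_imp_nondecreasing) (use d in \<open>auto intro!: exI[of _ "tanh _ ^ 6"]\<close>)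
  then show ?thesis by simp
qed

lemma sinh_ge_self: "(T::real) \<ge> 0 \<Longrightarrow> T \<le> sinh T"
proof -
  assume T: "T \<ge> 0"
  have "sinh 0 - 0 \<le> sinh T - T"
    using T
  proof (rule DERIV_nonneg_imp_nondecreasing)
    fix y :: real
    have "((\<lambda>T. sinh T - T) has_real_derivative cosh y - 1) (at y)" by (auto intro!: derivative_eq_intros)
    then show "\<exists>D. ((\<lambda>T. sinh T - T) has_real_derivative D) (at y) \<and> 0 \<le> D" using cosh_real_ge_1[of y] by auto
  qed
  then show ?thesis by simp
qed

text \<open>Here s stands for (tanh T)^2 and 1 + u for T / tanh T. The expression increases in u on
  the relevant range, so u may be replaced by its lower bound v from the artanh series, leaving a
  polynomial inequality in s.\<close>

lemma constant_term_polynomial: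
  assumes s: "0 < (s::real)" "s \<le> 25 / 36" and u: "s / 3 + s\<^sup>2 / 5 \<le> u" "u * (1 - s) \<le> s"
  shows "0 < 2 * s * (1 + u)\<^sup>2 - u\<^sup>2 - s / (1 - s)"
proof -
  define v where "v = s / 3 + s\<^sup>2 / 5"
  have s1: "1 - s > 0" using s by simp
  have v0: "v \<ge> 0" using s by (simp add: v_def)
  have mono: "2 * s * (1 + v)\<^sup>2 - v\<^sup>2 \<le> 2 * s * (1 + u)\<^sup>2 - u\<^sup>2"
  proof -
    have uv: "v \<le> u" using u v_def by simp
    have "2 * s * (1 + u)\<^sup>2 - u\<^sup>2 - (2 * s * (1 + v)\<^sup>2 - v\<^sup>2) = (u - v) * (4 * s - (1 - 2 * s) * (u + v))"
      by (simp add: power2_eq_square algebra_simps)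
    moreover have "4 * s - (1 - 2 * s) * (u + v) \<ge> 0"
    proof (cases "s \<le> 1 / 2")
      case True
      have "(1 - 2 * s) * (u + v) \<le> (1 - s) * (2 * u)" using True s uv v0 by (intro mult_mono) auto
      also have "\<dots> \<le> 4 * s" using u s by (simp add: algebra_simps)
      finally show ?thesis by simp
    next
      case False
      then have "(1 - 2 * s) * (u + v) \<le> 0" using uv v0 by (intro mult_nonpos_nonneg) auto
      then show ?thesis using s by linarith
    qed
    ultimately show ?thesis using uv by (metis diff_ge_0_iff_ge mult_nonneg_nonneg)
  qed
  have "s * 1 < s * ((1 - s) * (2 * (1 + v)\<^sup>2 - s * (1 / 3 + s / 5)\<^sup>2))"
  proof (rule mult_strict_left_mono[OF _ s(1)])
    have eq: "(1 - s) * (2 * (1 + v)\<^sup>2 - s * (1 / 3 + s / 5)\<^sup>2)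
       = 2 - 7/9 * s - 1/3 * s^2 - 149/225 * s^3 - 11/75 * s^4 - 2/25 * s^5"
      unfolding v_def by (simp add: power2_eq_square power3_eq_cube power4_eq_xxxx field_simps eval_nat_numeral)
    \<comment> \<open>All nonconstant coefficients of the polynomial are negative, so the worst case
      is s = 25/36, where the value still exceeds 1.\<close>
    have "s ^ k \<le> (25/36) ^ k" for k using s by (intro power_mono) auto
    note b = this[of 1] this[of 2] this[of 3] this[of 4] this[of 5]
    show "1 < (1 - s) * (2 * (1 + v)\<^sup>2 - s * (1 / 3 + s / 5)\<^sup>2)"
      unfolding eq using b by (simp add: power_divide)
  qed
  moreover have "s * ((1 - s) * (2 * (1 + v)\<^sup>2 - s * (1 / 3 + s / 5)\<^sup>2)) = (1 - s) * (2 * s * (1 + v)\<^sup>2 - v\<^sup>2)"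
    unfolding v_def by (simp add: power2_eq_square algebra_simps)
  ultimately have "s < (1 - s) * (2 * s * (1 + v)\<^sup>2 - v\<^sup>2)" by simp
  then have "s / (1 - s) < 2 * s * (1 + v)\<^sup>2 - v\<^sup>2" using s1 by (simp add: pos_divide_less_eq mult.commute)
  then show ?thesis using mono by linarith
qed

text \<open>The inequality needed for frequency 0 in the small regime. For large T the square on the
  right dominates and the inequality fails, hence a restriction such as tanh T \<le> 5/6, that is
  (tanh T)^2 \<le> 25/36.\<close>

lemma constant_term:
  assumes T: "(T::real) > 0" and tau: "tanh T \<le> 5 / 6"
  shows "2 - (cosh T)\<^sup>2 < 2 * (cosh T * sinh T) / T - (cosh T * sinh T / T)\<^sup>2"
proof -
  define \<tau> where "\<tau> = tanh T"
  define C where "C = cosh T"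
  define s where "s = \<tau>\<^sup>2"
  define u where "u = T / \<tau> - 1"
  have C: "C > 0" by (simp add: C_def)
  have t0: "\<tau> > 0" using T by (simp add: \<tau>_def)
  have S: "sinh T = \<tau> * C" by (simp add: \<tau>_def C_def tanh_def)
  have CC: "C\<^sup>2 * (1 - s) = 1"
  proof -
    have "C\<^sup>2 - (sinh T)\<^sup>2 = 1" unfolding C_def cosh_square_eq by simp
    then have "C\<^sup>2 - (\<tau> * C)\<^sup>2 = 1" unfolding S .
    then show ?thesis by (simp add: s_def power_mult_distrib algebra_simps)
  qed
  have Tu: "T = \<tau> * (1 + u)" using t0 by (simp add: u_def)
  have s: "0 < s" "s \<le> 25 / 36"
    using t0 power_mono[of \<tau> "5/6" 2] tau by (auto simp: s_def \<tau>_def power_divide)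
  have u1: "s / 3 + s\<^sup>2 / 5 \<le> u"
  proof -
    have "\<tau> * (1 + (s / 3 + s\<^sup>2 / 5)) \<le> \<tau> * (1 + u)"
      using artanh_lower[of T] T unfolding Tu[symmetric] \<tau>_def[symmetric] s_def
      by (simp add: algebra_simps power2_eq_square power3_eq_cube eval_nat_numeral)
    then show ?thesis using t0 by simp
  qed
  have u2: "u * (1 - s) \<le> s"
  proof -
    have "\<tau> * C * 1 \<le> \<tau> * C * C" using C t0 cosh_real_ge_1[of T] by (intro mult_left_mono) (auto simp: C_def)
    then have "T \<le> \<tau> * C * C" using sinh_ge_self[of T] T S by linarith
    then have "T * (1 - s) \<le> \<tau> * C * C * (1 - s)" using s by (intro mult_right_mono) auto
    also have "\<dots> = \<tau>" using CC by (simp add: power2_eq_square mult_ac)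
    finally have "\<tau> * ((1 + u) * (1 - s)) \<le> \<tau> * 1" unfolding Tu by (simp add: mult_ac)
    then have "(1 + u) * (1 - s) \<le> 1" using t0 by simp
    then show ?thesis by (simp add: algebra_simps)
  qed
  have 1: "0 < 2 * s * (1 + u)\<^sup>2 - u\<^sup>2 - s / (1 - s)" by (rule constant_term_polynomial[OF s u1 u2])
  have u0: "1 + u > 0" using Tu T t0 by (simp add: zero_less_mult_iff)
  have sC: "1 / (1 - s) = C\<^sup>2" using CC s by (simp add: field_simps)
  have 2: "s / (1 - s) = C\<^sup>2 - 1" unfolding sC[symmetric] using s by (simp add: field_simps)
  have 3: "C\<^sup>2 * s = C\<^sup>2 - 1" using CC by (simp add: algebra_simps)
  have "0 < C\<^sup>2 * (2 * s * (1 + u)\<^sup>2 - u\<^sup>2 - (C\<^sup>2 - 1))" using 1 C unfolding 2 by simp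
  also have "\<dots> = 2 * (C\<^sup>2 * s) * (1 + u)\<^sup>2 - C\<^sup>2 * u\<^sup>2 - C\<^sup>2 * (C\<^sup>2 - 1)" by (simp add: algebra_simps)
  also have "\<dots> = 2 * C\<^sup>2 * (1 + u) - (C\<^sup>2)\<^sup>2 - (2 - C\<^sup>2) * (1 + u)\<^sup>2" unfolding 3 by (simp add: power2_eq_square algebra_simps)
  finally have "(2 - C\<^sup>2) * (1 + u)\<^sup>2 < 2 * C\<^sup>2 * (1 + u) - (C\<^sup>2)\<^sup>2" by simp
  then have "(2 - C\<^sup>2) < (2 * C\<^sup>2 * (1 + u) - (C\<^sup>2)\<^sup>2) / (1 + u)\<^sup>2" using u0 by (simp add: pos_less_divide_eq)
  also have "\<dots> = 2 * (C\<^sup>2 / (1 + u)) - (C\<^sup>2 / (1 + u))\<^sup>2"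
  proof -
    have F: "(2 * c * v - c\<^sup>2) / v\<^sup>2 = 2 * (c / v) - (c / v)\<^sup>2" if "v \<noteq> 0" for c v :: real
      using that by (simp add: diff_divide_distrib power2_eq_square)
    show ?thesis by (rule F) (use u0 in simp)
  qed
  also have "C\<^sup>2 / (1 + u) = C * (\<tau> * C) / T" unfolding Tu using t0 by (simp add: power2_eq_square)
  finally show ?thesis unfolding S C_def[symmetric] by simp
qed

text \<open>The weights 5/6 and 3/10 have product 1/4.\<close>

lemma weighted_amgm: "r * p * q \<le> 5 / 6 * r\<^sup>2 * p\<^sup>2 + 3 / 10 * (q::real)\<^sup>2"
proof -
  have "5 / 6 * r\<^sup>2 * p\<^sup>2 + 3 / 10 * q\<^sup>2 - r * p * q = 5 / 6 * (r * p - 3 / 5 * q)\<^sup>2"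
    by (simp add: power2_eq_square algebra_simps)
  moreover have "(r * p - 3 / 5 * q)\<^sup>2 \<ge> 0" by simp
  ultimately show ?thesis by linarith
qed

text \<open>Cross terms of neighbouring frequencies are split by \<open>weighted_amgm\<close>. The
  induction carries a surplus of r^2 / 6 times the weighted last square: splitting the next cross
  term costs 5/6 with a weight at most one fifth as large, exactly 1/6, and splitting the following
  one leaves 1 - 5/6 = 1/6 again. The deficits 3/10 accumulate in the second term.\<close>

lemma weighted_recurrence_sum:
  fixes a e :: "nat \<Rightarrow> real"
  assumes a: "\<And>k. a k \<ge> 0" "a 0 = 0" and e: "\<And>k. k \<ge> 1 \<Longrightarrow> e k \<ge> 0" "\<And>k. k \<ge> 1 \<Longrightarrow> e (Suc k) \<le> e k / 5" and r: "r \<ge> 0"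
  shows "e 1 * (a 1)\<^sup>2 - 3 / 10 * e 1 * (\<Sum>k<K. (a (k + 2))\<^sup>2) - 3 / 10 * e (Suc K) * (a (K + 2))\<^sup>2 + r\<^sup>2 / 6 * e (Suc K) * (a (Suc K))\<^sup>2
    \<le> (\<Sum>k<Suc K. e (Suc k) * ((1 + r\<^sup>2) * (a (Suc k))\<^sup>2 - r * a (Suc k) * a k - r * a (Suc k) * a (k + 2)))"
proof (induction K)
  case 0
  have "e 1 * (r * a 1 * a 2) \<le> e 1 * (5 / 6 * r\<^sup>2 * (a 1)\<^sup>2 + 3 / 10 * (a 2)\<^sup>2)"
    by (intro mult_left_mono weighted_amgm e) simp
  then show ?case using a(2) by (simp add: algebra_simps numeral_2_eq_2)
next
  case (Suc K)
  define e0 e1 e2 where "e0 = e 1" "e1 = e (Suc K)" "e2 = e (Suc (Suc K))"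
  define x y z where "x = a (Suc K)" "y = a (Suc (Suc K))" "z = a (Suc (Suc (Suc K)))"
  have e1_le: "e1 \<le> e0"
  proof -
    have "e (Suc K) \<le> e 1"
    proof (induction K)
      case (Suc K) then show ?case using e(1)[of "Suc K"] e(2)[of "Suc K"] by simp
    qed simp
    then show ?thesis by (simp add: e0_e1_e2_def)
  qed
  have e2: "0 \<le> e2" "e2 \<le> e1 / 5" using e by (auto simp: e0_e1_e2_def)
  have 1: "e2 * (r * x * y) \<le> e2 * (5 / 6 * r\<^sup>2 * x\<^sup>2 + 3 / 10 * y\<^sup>2)" by (intro mult_left_mono weighted_amgm e2)
  have 2: "e2 * (r * y * z) \<le> e2 * (5 / 6 * r\<^sup>2 * y\<^sup>2 + 3 / 10 * z\<^sup>2)" by (intro mult_left_mono weighted_amgm e2)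
  have 3: "e2 * (r\<^sup>2 * x\<^sup>2) \<le> e1 / 5 * (r\<^sup>2 * x\<^sup>2)" by (intro mult_right_mono e2) simp
  have 4: "e1 * y\<^sup>2 \<le> e0 * y\<^sup>2" by (intro mult_right_mono e1_le) simp
  have 5: "0 \<le> e2 * y\<^sup>2" using e2 by simp
  define S where "S = (\<Sum>k<K. (a (k + 2))\<^sup>2)"
  define B where "B = e0 * (a 1)\<^sup>2"
  define L where "L = (\<Sum>k<Suc K. e (Suc k) * ((1 + r\<^sup>2) * (a (Suc k))\<^sup>2 - r * a (Suc k) * a k - r * a (Suc k) * a (k + 2)))"
  have IH: "B - 3 / 10 * e0 * S - 3 / 10 * e1 * y\<^sup>2 + r\<^sup>2 / 6 * e1 * x\<^sup>2 \<le> L"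
    using Suc.IH by (simp add: B_def S_def L_def e0_e1_e2_def x_y_z_def)
  have "B - 3 / 10 * e0 * (S + y\<^sup>2) - 3 / 10 * e2 * z\<^sup>2 + r\<^sup>2 / 6 * e2 * y\<^sup>2
     \<le> L + e2 * ((1 + r\<^sup>2) * y\<^sup>2 - r * y * x - r * y * z)"
  proof -
    have "B - 3 / 10 * (e0 * S) - 3 / 10 * (e1 * y\<^sup>2) + 1 / 6 * (e1 * (r\<^sup>2 * x\<^sup>2)) \<le> L" using IH by (simp add: mult_ac)
    moreover have "e2 * ((1 + r\<^sup>2) * y\<^sup>2 - r * y * x - r * y * z) = e2 * y\<^sup>2 + e2 * (r\<^sup>2 * y\<^sup>2) - e2 * (r * x * y) - e2 * (r * y * z)"
      by (simp add: algebra_simps)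
    moreover have "e2 * (5 / 6 * r\<^sup>2 * p + 3 / 10 * q) = 5 / 6 * (e2 * (r\<^sup>2 * p)) + 3 / 10 * (e2 * q)" for p q by (simp add: algebra_simps)
    moreover have "B - 3 / 10 * e0 * (S + y\<^sup>2) - 3 / 10 * e2 * z\<^sup>2 + r\<^sup>2 / 6 * e2 * y\<^sup>2
       = B - 3 / 10 * (e0 * S) - 3 / 10 * (e0 * y\<^sup>2) - 3 / 10 * (e2 * z\<^sup>2) + 1 / 6 * (e2 * (r\<^sup>2 * y\<^sup>2))"
      by (simp add: algebra_simps)
    moreover have "e1 / 5 * (r\<^sup>2 * x\<^sup>2) = 1 / 5 * (e1 * (r\<^sup>2 * x\<^sup>2))" by simp
    ultimately show ?thesis using 1 2 3 4 5 by (simp only:)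
  qed
  moreover have "(\<Sum>k<Suc K. (a (k + 2))\<^sup>2) = S + y\<^sup>2" by (simp add: S_def x_y_z_def)
  moreover have "(\<Sum>k<Suc (Suc K). e (Suc k) * ((1 + r\<^sup>2) * (a (Suc k))\<^sup>2 - r * a (Suc k) * a k - r * a (Suc k) * a (k + 2)))
      = L + e2 * ((1 + r\<^sup>2) * y\<^sup>2 - r * y * x - r * y * z)"
    unfolding sum.lessThan_Suc[of _ "Suc K"] L_def[symmetric] by (simp add: e0_e1_e2_def x_y_z_def del: sum.lessThan_Suc)
  moreover have "a (Suc K + 2) = z" "a (Suc (Suc K)) = y" "e (Suc (Suc K)) = e2" "e 1 = e0"
    by (simp_all add: e0_e1_e2_def x_y_z_def)
  ultimately show ?case unfolding B_def by (simp only:)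
qed

lemma sum_symmetric_int_interval_Suc:
  fixes d :: "int \<Rightarrow> 'a::ab_group_add"
  shows "(\<Sum>n\<in>{-int N..int N}. d n) = d 0 + (\<Sum>k<N. d (int (Suc k)) + d (- int (Suc k)))"
  unfolding sum_symmetric_int_interval by (simp add: add.commute)

lemma norm_square_completion:
  "(cmod z)\<^sup>2 = 2 * L * Re (cnj z * p) - L\<^sup>2 * (cmod p)\<^sup>2 + (cmod (z - of_real L * p))\<^sup>2"
  unfolding cmod_power2 by (simp add: power2_eq_square algebra_simps)

text \<open>Here P is the mass of p at frequencies 1 and -1, N its mass beyond, U stands for
  \<open>Pm\<close> and o' for |zr|^2. The constants leave room: 2 \<tau> - 1 dominates 6/10 \<tau>
  \<epsilon> + (1 - \<tau>^2) + 1/20, and the 1/20 becomes the remainder used for rigidity.\<close>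

lemma large_modulus_scalar:
  fixes \<tau> \<epsilon> P N U o' :: real
  assumes \<tau>: "5 / 6 \<le> \<tau>" "\<tau> < 1" and \<epsilon>: "1 - \<tau> \<le> \<tau> * \<epsilon>" "\<epsilon> \<le> 2 / 5" and N: "N \<ge> 0" "P \<ge> 0" "P + N \<le> U" and o: "1 + o' \<le> U"
  shows "1 + o' + N / 20 \<le> 2 * \<tau> * (U + \<epsilon> * (P - 3 / 10 * N)) - P - (1 - \<tau>\<^sup>2) * N"
proof -
  have "\<tau> * \<epsilon> \<le> \<tau> * (2 / 5)" using \<tau> \<epsilon> by (intro mult_left_mono) auto
  moreover have "25 / 36 \<le> \<tau>\<^sup>2" using power_mono[of "5/6" \<tau> 2] \<tau> by (simp add: power_divide)
  ultimately have "6 / 10 * (\<tau> * \<epsilon>) + (1 - \<tau>\<^sup>2) + 1 / 20 \<le> 2 * \<tau> - 1"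
    using \<tau> by linarith
  then have 1: "(6 / 10 * (\<tau> * \<epsilon>) + (1 - \<tau>\<^sup>2) + 1 / 20) * N \<le> (2 * \<tau> - 1) * N" by (rule mult_right_mono[OF _ N(1)])
  have 2: "2 * (1 - \<tau>) * P \<le> 2 * (\<tau> * \<epsilon>) * P" using \<epsilon> N by (intro mult_right_mono) auto
  have 3: "(2 * \<tau> - 1) * (P + N) \<le> (2 * \<tau> - 1) * U" using \<tau> N by (intro mult_left_mono) auto
  have "2 * \<tau> * (U + \<epsilon> * (P - 3 / 10 * N)) - P - (1 - \<tau>\<^sup>2) * N - N / 20
     = 2 * \<tau> * U + 2 * (\<tau> * \<epsilon>) * P - P - (6 / 10 * (\<tau> * \<epsilon>) + (1 - \<tau>\<^sup>2) + 1 / 20) * N"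
    by (simp add: algebra_simps)
  moreover have "2 * (1 - \<tau>) * P - P - (2 * \<tau> - 1) * N = - ((2 * \<tau> - 1) * (P + N))" "2 * \<tau> * U - (2 * \<tau> - 1) * U = U"
    by (simp_all add: algebra_simps)
  ultimately show ?thesis using 1 2 3 o by linarith
qed

lemma half_bound: "(a::real) \<le> b \<Longrightarrow> 2 * b \<le> c \<Longrightarrow> a \<le> c / 2"
  by simp

lemma negate_bound: "e * (- r) \<le> f * (s / 2) \<Longrightarrow> - (f / 2) * s \<le> e * (r::real)"
  by simp

lemma distribute_two: "a * (b - c - d * e) = a * b - a * c - (a * d) * (e::real)"
  by (simp add: algebra_simps)

section \<open>Completing the square: the bound cosh T and the extremal coefficients\<close>

context nitsche
begin

text \<open>\<open>Sn n\<close> is the derivative of \<open>sg n\<close> at 0, and \<open>nu\<close>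
  is the combination of z and x with coefficients \<open>Sn\<close> and \<open>- en\<close>. The
  multiplier \<open>lam\<close> is chosen so that \<open>lam * Sn 1\<close> is cosh T, the ratio of
  outer to inner coefficient for the expected extremal map.\<close>

definition Sn :: "int \<Rightarrow> real" where "Sn n = (if n = 0 then 1 / T else of_int n / sinh (of_int n * T))"
definition en :: "int \<Rightarrow> real" where "en n = Sn n * dec n T"
definition lam :: real where "lam = cosh T * sinh T"

lemma nu_eq: "nu n = of_real (Sn n) * z n - of_real (en n) * x n"
  unfolding nu_def Sn_def en_def by (simp add: algebra_simps)

lemma Sn_abs: "n \<noteq> 0 \<Longrightarrow> Sn n = of_int \<bar>n\<bar> / sinh (of_int \<bar>n\<bar> * T)"
  by (cases "n > 0") (auto simp: Sn_def)

lemma Sn_minus: "Sn (- n) = Sn n" "en (- n) = en n"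
  by (simp_all add: Sn_def en_def dec_def)

lemma abs_int_obtain:
  assumes "n \<noteq> 0" obtains k where "real_of_int \<bar>n\<bar> = real (Suc k)" "\<bar>n\<bar> = int (Suc k)"
proof -
  obtain k where "nat \<bar>n\<bar> = Suc k" using assms by (cases "nat \<bar>n\<bar>") auto
  then have k: "\<bar>n\<bar> = int (Suc k)" by simp
  then have "real_of_int \<bar>n\<bar> = real (Suc k)" by (simp only: of_int_of_nat_eq)
  then show thesis using k that by blast
qed

lemma Sn_nonneg: "Sn n \<ge> 0" "en n \<ge> 0"
proof -
  show "Sn n \<ge> 0" using T by (cases "n = 0") (simp_all add: Sn_abs, simp add: Sn_def)
  then show "en n \<ge> 0" by (simp add: en_def dec_def)
qed

lemma lam_pos: "lam > 0" using T by (simp add: lam_def)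

lemma lam_Sn_1: "\<bar>n\<bar> = 1 \<Longrightarrow> lam * Sn n = cosh T"
  using T Sn_abs[of n] by (auto simp: lam_def)

lemma lam_Sn_le: "\<bar>n\<bar> \<ge> 2 \<Longrightarrow> lam * Sn n \<le> 1"
proof -
  assume n: "\<bar>n\<bar> \<ge> 2"
  then have n0: "n \<noteq> 0" by auto
  obtain k' where k': "real_of_int \<bar>n\<bar> = real (Suc k')" "\<bar>n\<bar> = int (Suc k')" by (rule abs_int_obtain[OF n0])
  then obtain k where k: "k' = Suc k" using n by (cases k') auto
  have "sinh (real (Suc (Suc k)) * T) > 0" using T by (simp add: mult_pos_pos del: of_nat_Suc)
  then show ?thesis
    using mult_cosh_sinh_le_sinh[of T k] T unfolding Sn_abs[OF n0] k' k lam_def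
    by (simp add: pos_divide_le_eq mult_ac del: of_nat_Suc)
qed

lemma lam_Sn_le_cosh: "n \<noteq> 0 \<Longrightarrow> lam * Sn n \<le> cosh T"
proof (cases "\<bar>n\<bar> = 1")
  case True then show ?thesis using lam_Sn_1 by simp
next
  case False assume "n \<noteq> 0"
  then have "\<bar>n\<bar> \<ge> 2" using False by auto
  then show ?thesis using lam_Sn_le[of n] cosh_real_ge_1[of T] by linarith
qed

lemma en_form:
  assumes "n \<noteq> 0" "real_of_int \<bar>n\<bar> = m"
  shows "en n = m * cosh (m * T) / sinh (m * T) - m"
proof -
  have m: "m > 0" using assms by auto
  then have "sinh (m * T) \<noteq> 0" using T by simp
  then have "m / sinh (m * T) * (A - sinh (m * T)) = m * A / sinh (m * T) - m" for A by (simp add: field_simps)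
  moreover have "dec n T = cosh (m * T) - sinh (m * T)" unfolding dec_def assms(2) cosh_minus_sinh ..
  ultimately show ?thesis unfolding en_def Sn_abs[OF assms(1)] assms(2) by (simp only:)
qed

text \<open>With m = |n| the product simplifies to m sinh T cosh ((m - 1) T) / sinh (m T). The
  weight 1 - tanh T makes this exactly 1 for |n| = 1, where no loss is allowed.\<close>

lemma lam_coeff_ge_1:
  assumes "n \<noteq> 0"
  shows "1 \<le> lam * ((1 - tanh T) * of_int \<bar>n\<bar> + en n)"
proof -
  obtain k where k: "real_of_int \<bar>n\<bar> = real (Suc k)" by (rule abs_int_obtain[OF assms])
  define m where "m = real (Suc k)"
  have m: "m > 0" by (simp add: m_def)
  have B: "sinh (m * T) > 0" using m T by simp
  have C: "cosh T > 0" by simp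
  have mk: "cosh (real k * T) = cosh T * cosh (m * T) - sinh T * sinh (m * T)"
  proof -
    have "real k * T = m * T - T" by (simp add: m_def algebra_simps)
    then show ?thesis by (simp add: cosh_diff mult_ac)
  qed
  have alg: "C' * S * ((1 - S / C') * m' + (m' * A / B' - m')) = m' * S * (C' * A - S * B') / B'"
    if "C' > 0" "B' > 0" for C' S A B' m' :: real using that by (simp add: field_simps)
  have "lam * ((1 - tanh T) * of_int \<bar>n\<bar> + en n) = m * sinh T * cosh (real k * T) / sinh (m * T)"
    unfolding en_form[OF assms k] k m_def[symmetric] lam_def tanh_def mk by (rule alg[OF C B])
  also have "\<dots> \<ge> 1"
    using sinh_Suc_mult_le[of T k] T B unfolding m_def[symmetric] by (simp add: pos_le_divide_eq)
  finally show ?thesis .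
qed

lemma en_1: "tanh T * en 1 = 1 - tanh T"
  using en_form[of 1 1] T by (simp add: tanh_def field_simps)

text \<open>tanh T \<ge> 5/6 means e^(-2T) \<le> 1/11, the ratio is at most (k + 1) / k times that,
  and 2/11 < 1/5.\<close>

lemma en_ratio:
  assumes "5 / 6 \<le> tanh T" "k \<ge> 1"
  shows "en (int (Suc k)) \<le> en (int k) / 5"
proof -
  define y where "y = exp (- T) * exp (- T)"
  have y: "y > 0" "y \<le> 1 / 11"
  proof -
    show "y > 0" by (simp add: y_def)
    have "tanh T = exp (- T) * (exp T - exp (- T)) / (exp (- T) * (exp T + exp (- T)))" unfolding tanh_altdef by simp
    moreover have "exp (- T) * (exp T - exp (- T)) = 1 - y" "exp (- T) * (exp T + exp (- T)) = 1 + y"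
      unfolding y_def right_diff_distrib distrib_left by (simp_all flip: exp_add)
    ultimately have "tanh T = (1 - y) / (1 + y)" by (simp only:)
    then have "5 / 6 * (1 + y) \<le> 1 - y" using assms \<open>y > 0\<close> by (simp add: pos_le_divide_eq)
    then show "y \<le> 1 / 11" by simp
  qed
  define a where "a = sinh (real k * T)"
  define b where "b = sinh (real (Suc k) * T)"
  define d where "d = exp (- (real k * T))"
  have a: "a > 0" using T assms by (simp add: a_def)
  have d: "d > 0" by (simp add: d_def)
  have b: "exp T * a \<le> b"
  proof -
    have "real (Suc k) * T = real k * T + T" by (simp add: algebra_simps)
    then have "b = a * cosh T + cosh (real k * T) * sinh T" by (simp only: a_def b_def sinh_add)
    moreover have "a * sinh T \<le> cosh (real k * T) * sinh T"
      using sinh_le_cosh_real[of "real k * T"] T by (intro mult_right_mono) (auto simp: a_def)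
    moreover have "exp T * a = a * cosh T + a * sinh T" unfolding cosh_plus_sinh[symmetric, of T] by (simp add: algebra_simps)
    ultimately show ?thesis by linarith
  qed
  have ek: "en (int k) = real k * d / a" and ek1: "en (int (Suc k)) = real (Suc k) * (d * exp (- T)) / b"
  proof -
    show "en (int k) = real k * d / a" using assms by (simp add: en_def Sn_def dec_def d_def a_def)
    have "dec (int (Suc k)) T = d * exp (- T)"
      unfolding dec_def d_def exp_add[symmetric] by (simp add: algebra_simps)
    moreover have "Sn (int (Suc k)) = real (Suc k) / b" unfolding Sn_def b_def by (simp del: of_nat_Suc)
    ultimately show "en (int (Suc k)) = real (Suc k) * (d * exp (- T)) / b" unfolding en_def by simp
  qed
  have "real (Suc k) * (d * exp (- T)) / b \<le> real (Suc k) * (d * exp (- T)) / (exp T * a)"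
    using a d b by (intro divide_left_mono) (auto intro!: mult_pos_pos less_le_trans[OF _ b])
  also have "\<dots> = real (Suc k) * y * (d / a)" unfolding y_def by (simp add: exp_minus field_simps)
  also have "\<dots> \<le> (2 * real k) * (1 / 11) * (d / a)"
    using assms y a d by (intro mult_right_mono mult_mono) auto
  also have "\<dots> \<le> real k * d / a / 5" using a d by (simp add: field_simps)
  finally show ?thesis unfolding ek ek1 .
qed

text \<open>Insert \<open>nu\<close> in terms of z and x, multiply by 2 lam, and complete the square
  of z n around lam Sn p n; then use that the squares of z sum to at most M^2. The square is kept on
  the left because equality must force it to vanish.\<close>

lemma completed_inequality:
  assumes "Q \<le> (\<Sum>n\<in>{-int K..int K}. Re (cnj (nu n) * p n)) + eps K"
  shows "2 * lam * (Q + (\<Sum>n\<in>{-int K..int K}. en n * Re (cnj (x n) * p n))) - (\<Sum>n\<in>{-int K..int K}. (lam * Sn n)\<^sup>2 * (cmod (p n))\<^sup>2)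
     + (\<Sum>n\<in>{-int K..int K}. (cmod (z n - of_real (lam * Sn n) * p n))\<^sup>2) \<le> M\<^sup>2 + 2 * lam * eps K"
proof -
  let ?I = "{-int K..int K}"
  define A where "A = (\<Sum>n\<in>?I. Sn n * Re (cnj (z n) * p n))"
  define B where "B = (\<Sum>n\<in>?I. en n * Re (cnj (x n) * p n))"
  define E where "E = (\<Sum>n\<in>?I. (lam * Sn n)\<^sup>2 * (cmod (p n))\<^sup>2)"
  define D where "D = (\<Sum>n\<in>?I. (cmod (z n - of_real (lam * Sn n) * p n))\<^sup>2)"
  have "(\<Sum>n\<in>?I. Re (cnj (nu n) * p n)) = A - B"
    unfolding A_def B_def sum_subtractf[symmetric] nu_eq by (intro sum.cong refl) (simp add: algebra_simps)
  then have "Q + B \<le> A + eps K" using assms by linarith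
  then have "2 * lam * (Q + B) \<le> 2 * lam * (A + eps K)" using lam_pos by (intro mult_left_mono) auto
  moreover have "2 * lam * (A + eps K) = 2 * lam * A + 2 * lam * eps K" by (simp add: algebra_simps)
  moreover have "2 * lam * A - E + D = (\<Sum>n\<in>?I. (cmod (z n))\<^sup>2)"
    unfolding A_def E_def D_def sum_distrib_left sum_subtractf[symmetric] sum.distrib[symmetric]
  proof (intro sum.cong refl)
    fix n
    have "2 * lam * (Sn n * q) = 2 * (lam * Sn n) * q" for q by simp
    then show "2 * lam * (Sn n * Re (cnj (z n) * p n)) - (lam * Sn n)\<^sup>2 * (cmod (p n))\<^sup>2 + (cmod (z n - of_real (lam * Sn n) * p n))\<^sup>2 = (cmod (z n))\<^sup>2"
      using norm_square_completion[of "z n" "lam * Sn n" "p n"] by (simp only:)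
  qed
  moreover have "(\<Sum>n\<in>?I. (cmod (z n))\<^sup>2) \<le> M\<^sup>2" by (rule sum_z_le) simp
  ultimately show ?thesis unfolding A_def[symmetric] B_def[symmetric] E_def[symmetric] D_def[symmetric] by linarith
qed

text \<open>The common outcome of both regimes: the sharp bound together with the defects whose
  vanishing identifies the extremal map. In the small regime v = 0 and p = x; in the large one v is
  |zr|^2, and v = 0 means that the Poisson weight was constant, so p = x again.\<close>

definition core :: "(nat \<Rightarrow> real) \<Rightarrow> real \<Rightarrow> real \<Rightarrow> (int \<Rightarrow> complex) \<Rightarrow> bool" where
  "core E \<delta> v p \<longleftrightarrow> E \<longlonglongrightarrow> 0 \<and> \<delta> > 0 \<and> v \<ge> 0 \<and> (v = 0 \<longrightarrow> p = x) \<and>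
     (\<forall>K. (cosh T)\<^sup>2 + \<delta> * (v + (\<Sum>n\<in>{-int K..int K}. if \<bar>n\<bar> = 1 then 0 else (cmod (p n))\<^sup>2))
       + (\<Sum>n\<in>{-int K..int K}. (cmod (z n - of_real (lam * Sn n) * p n))\<^sup>2) \<le> M\<^sup>2 + E K)"

lemma mass_tendsto: "(\<lambda>K. \<Sum>n\<in>{-int K..int K}. (cmod (x n))\<^sup>2) \<longlonglongrightarrow> 1"
proof (rule order_tendstoI)
  fix a :: real assume "a < 1"
  then have "(1 - a) / 2 > 0" by simp
  from mass_one[OF this] obtain K where K: "1 - (1 - a) / 2 \<le> (\<Sum>n\<in>{-int K..int K}. (cmod (x n))\<^sup>2)" by blast
  show "\<forall>\<^sub>F K in sequentially. a < (\<Sum>n\<in>{-int K..int K}. (cmod (x n))\<^sup>2)"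
  proof (rule eventually_sequentiallyI[of K])
    fix K' assume "K \<le> K'"
    then have "(\<Sum>n\<in>{-int K..int K}. (cmod (x n))\<^sup>2) \<le> (\<Sum>n\<in>{-int K'..int K'}. (cmod (x n))\<^sup>2)"
      by (intro sum_mono2) auto
    then show "a < (\<Sum>n\<in>{-int K'..int K'}. (cmod (x n))\<^sup>2)" using K \<open>a < 1\<close> by (simp add: field_simps)
  qed
next
  fix a :: real assume "1 < a"
  have "(\<Sum>n\<in>{-int K..int K}. (cmod (x n))\<^sup>2) < a" for K
    by (rule le_less_trans[OF sum_x_le \<open>1 < a\<close>]) simp
  then show "\<forall>\<^sub>F K in sequentially. (\<Sum>n\<in>{-int K..int K}. (cmod (x n))\<^sup>2) < a" by simp
qed

text \<open>The two bounds of \<open>unweighted_limit\<close> are combined with weights tanh T and 1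
  - tanh T. The first contributes 2 (C^2 - 1), where C = cosh T, and the frequencies together
  contribute at least 2 - C^2 times the mass of x, total C^2. As 2 - C^2 may have either sign, the
  mass must be known exactly in the limit.\<close>

lemma core_small:
  assumes tau: "tanh T \<le> 5 / 6"
  shows "\<exists>E \<delta>. core E \<delta> 0 x"
proof -
  define C where "C = cosh T"
  define \<tau> where "\<tau> = tanh T"
  have C1: "C > 1" using T cosh_real_nonneg_less_iff[of 0 T] by (simp add: C_def)
  have t: "0 < \<tau>" "\<tau> < 1" using T by (auto simp: \<tau>_def tanh_real_lt_1)
  have lt: "lam * \<tau> = C\<^sup>2 - 1"
    unfolding lam_def \<tau>_def tanh_def C_def cosh_square_eq by (simp add: power2_eq_square)
  \<comment> \<open>The smaller of the margins available at |n| \<ge> 2 and at n = 0; frequencies 1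
    and -1 have no margin.\<close>
  define \<delta> where "\<delta> = min (C\<^sup>2 - 1) (2 * lam / T - (lam / T)\<^sup>2 - (2 - C\<^sup>2))"
  have d: "\<delta> > 0"
    using constant_term[OF T tau] one_less_power[OF C1, of 2] unfolding \<delta>_def C_def lam_def by simp
  define E where "E = (\<lambda>K. 2 * lam * eps K + (2 - C\<^sup>2) * (1 - (\<Sum>n\<in>{-int K..int K}. (cmod (x n))\<^sup>2)))"
  have "E \<longlonglongrightarrow> 2 * lam * 0 + (2 - C\<^sup>2) * (1 - 1)"
    unfolding E_def by (intro tendsto_intros eps_tendsto mass_tendsto)
  then have E: "E \<longlonglongrightarrow> 0" by simp
  \<comment> \<open>Frequency 0 is \<open>constant_term\<close>; for |n| = 1 the square equals C^2
    and the first term is at least 2; for |n| \<ge> 2 the square is at most 1.\<close>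
  have coef: "2 - C\<^sup>2 + (if \<bar>n\<bar> = 1 then 0 else \<delta>) \<le> 2 * (lam * ((1 - \<tau>) * of_int \<bar>n\<bar> + en n)) - (lam * Sn n)\<^sup>2" for n
  proof (cases "n = 0")
    case True
    have "en 0 = 1 / T" "Sn 0 = 1 / T" by (simp_all add: en_def Sn_def dec_def)
    then show ?thesis using True by (simp add: \<delta>_def)
  next
    case False
    note 1 = lam_coeff_ge_1[OF False, folded \<tau>_def]
    show ?thesis
    proof (cases "\<bar>n\<bar> = 1")
      case True
      then show ?thesis using 1 lam_Sn_1[OF True] by (simp add: C_def)
    next
      case F: False
      then have "\<bar>n\<bar> \<ge> 2" using False by auto
      from lam_Sn_le[OF this] have "(lam * Sn n)\<^sup>2 \<le> 1"
        using lam_pos Sn_nonneg(1)[of n] by (simp add: power_le_one)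
      moreover have "\<delta> \<le> C\<^sup>2 - 1" by (simp add: \<delta>_def)
      ultimately show ?thesis using 1 F by simp
    qed
  qed
  have "(cosh T)\<^sup>2 + \<delta> * (0 + (\<Sum>n\<in>{-int K..int K}. if \<bar>n\<bar> = 1 then 0 else (cmod (x n))\<^sup>2))
       + (\<Sum>n\<in>{-int K..int K}. (cmod (z n - of_real (lam * Sn n) * x n))\<^sup>2) \<le> M\<^sup>2 + E K" for K
  proof -
    let ?I = "{-int K..int K}"
    define Q where "Q = (\<Sum>n\<in>?I. Re (cnj (nu n) * x n)) + eps K"
    define m where "m = (\<Sum>n\<in>?I. of_int \<bar>n\<bar> * (cmod (x n))\<^sup>2)"
    define b where "b = (\<Sum>n\<in>?I. en n * (cmod (x n))\<^sup>2)"
    define e where "e = (\<Sum>n\<in>?I. (lam * Sn n)\<^sup>2 * (cmod (x n))\<^sup>2)"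
    define \<mu> where "\<mu> = (\<Sum>n\<in>?I. (cmod (x n))\<^sup>2)"
    define N where "N = (\<Sum>n\<in>?I. if \<bar>n\<bar> = 1 then 0 else (cmod (x n))\<^sup>2)"
    define D where "D = (\<Sum>n\<in>?I. (cmod (z n - of_real (lam * Sn n) * x n))\<^sup>2)"
    have "\<tau> * 1 \<le> \<tau> * Q" using unweighted_limit(1)[of K] t unfolding Q_def by (intro mult_left_mono) auto
    moreover have "(1 - \<tau>) * m \<le> (1 - \<tau>) * Q" using unweighted_limit(2)[of K] t unfolding Q_def m_def by (intro mult_left_mono) auto
    moreover have "\<tau> * Q + (1 - \<tau>) * Q = Q" by (simp add: algebra_simps)
    ultimately have "\<tau> + (1 - \<tau>) * m \<le> Q" by linarith
    from completed_inequality[OF this[unfolded Q_def]]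
    have 1: "2 * lam * (\<tau> + (1 - \<tau>) * m + b) - e + D \<le> M\<^sup>2 + 2 * lam * eps K"
    proof -
      have "Re (cnj (x n) * x n) = (cmod (x n))\<^sup>2" for n unfolding cmod_power2 by (simp add: power2_eq_square)
      then show ?thesis using completed_inequality[OF \<open>\<tau> + (1 - \<tau>) * m \<le> Q\<close>[unfolded Q_def]] by (simp only: b_def e_def D_def)
    qed
    have "(\<Sum>n\<in>?I. (2 - C\<^sup>2 + (if \<bar>n\<bar> = 1 then 0 else \<delta>)) * (cmod (x n))\<^sup>2)
       \<le> (\<Sum>n\<in>?I. (2 * (lam * ((1 - \<tau>) * of_int \<bar>n\<bar> + en n)) - (lam * Sn n)\<^sup>2) * (cmod (x n))\<^sup>2)"
      by (intro sum_mono mult_right_mono coef) simp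
    moreover have "(\<Sum>n\<in>?I. (2 - C\<^sup>2 + (if \<bar>n\<bar> = 1 then 0 else \<delta>)) * (cmod (x n))\<^sup>2) = (2 - C\<^sup>2) * \<mu> + \<delta> * N"
      unfolding \<mu>_def N_def sum_distrib_left sum.distrib[symmetric] by (intro sum.cong refl) (simp add: algebra_simps)
    moreover have "(\<Sum>n\<in>?I. (2 * (lam * ((1 - \<tau>) * of_int \<bar>n\<bar> + en n)) - (lam * Sn n)\<^sup>2) * (cmod (x n))\<^sup>2)
       = 2 * lam * ((1 - \<tau>) * m + b) - e"
      unfolding m_def b_def e_def sum_distrib_left sum.distrib[symmetric] sum_subtractf[symmetric]
      by (intro sum.cong refl) (simp add: algebra_simps)
    moreover have "2 * lam * (\<tau> + (1 - \<tau>) * m + b) = 2 * (lam * \<tau>) + 2 * lam * ((1 - \<tau>) * m + b)" by (simp add: algebra_simps)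
    moreover have "E K = 2 * lam * eps K + (2 - C\<^sup>2) - (2 - C\<^sup>2) * \<mu>" unfolding E_def \<mu>_def by (simp add: algebra_simps)
    ultimately show ?thesis using 1 unfolding lt N_def[symmetric] D_def[symmetric] C_def[symmetric] by simp
  qed
  then show ?thesis using E d unfolding core_def by blast
qed

text \<open>The weighted coefficients p have no frequency 0, so the term that fails for large T
  disappears. The price is the mixed sum of en Re (cnj x p), which is expressed through p alone by
  the recurrence when |zr|^2 \<le> 1/2 and estimated crudely otherwise.\<close>

lemma core_large:
  assumes tau: "5 / 6 \<le> tanh T"
  shows "\<exists>E \<delta> v p. core E \<delta> v p"
proof -
  obtain p where p0: "p 0 = 0"
    and rec: "\<And>n. of_real (1 - om) * x n = of_real (1 + om) * p n - cnj zr * p (n - 1) - zr * p (n + 1)"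
    and bes: "\<And>K. (\<Sum>n\<in>{-int K..int K}. (cmod (p n))\<^sup>2) \<le> Pm"
    and lim: "\<And>K. Pm \<le> (\<Sum>n\<in>{-int K..int K}. Re (cnj (nu n) * p n)) + eps K"
    using weighted_limit by blast
  define C where "C = cosh T"
  define \<tau> where "\<tau> = tanh T"
  have C1: "C \<ge> 1" by (simp add: C_def cosh_real_ge_1)
  have t: "5 / 6 \<le> \<tau>" "\<tau> < 1" using tau by (auto simp: \<tau>_def tanh_real_lt_1)
  have lC: "lam = C\<^sup>2 * \<tau>"
    unfolding lam_def \<tau>_def tanh_def C_def by (simp add: power2_eq_square)
  have Ct: "C\<^sup>2 * (1 - \<tau>\<^sup>2) = 1"
  proof -
    have "C\<^sup>2 * (1 - \<tau>\<^sup>2) = C\<^sup>2 - (sinh T)\<^sup>2" unfolding \<tau>_def tanh_def C_def by (simp add: power_divide field_simps)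
    then show ?thesis unfolding C_def cosh_square_eq by simp
  qed
  define e1 where "e1 = en 1"
  have e1: "\<tau> * e1 = 1 - \<tau>" "0 \<le> e1" "e1 \<le> 1 / 5"
  proof -
    show a: "\<tau> * e1 = 1 - \<tau>" unfolding \<tau>_def e1_def by (rule en_1)
    show b: "0 \<le> e1" unfolding e1_def by (rule Sn_nonneg)
    have "5 / 6 * e1 \<le> \<tau> * e1" using t b by (intro mult_right_mono) auto
    then show "e1 \<le> 1 / 5" using a t by linarith
  qed
  have e_le: "en n \<le> e1" if nz: "n \<noteq> 0" for n
  proof -
    have "en (int (Suc k)) \<le> e1" for k
    proof (induction k)
      case (Suc k)
      then show ?case using en_ratio[of "Suc k"] tau Sn_nonneg(2)[of "int (Suc k)"] by simp
    qed (simp add: e1_def)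
    moreover obtain k where "\<bar>n\<bar> = int (Suc k)" by (rule abs_int_obtain[OF nz])
    ultimately show ?thesis using Sn_minus(2)[of n] by (cases "n > 0") (metis abs_of_pos, metis abs_of_nonpos not_less)
  qed
  have Pm1: "1 + om \<le> Pm"
    using om unfolding Pm_def by (simp add: pos_le_divide_eq mult_nonneg_nonneg)
  define E where "E = (\<lambda>K. 2 * lam * eps (Suc K))"
  have "E \<longlonglongrightarrow> 2 * lam * 0"
    unfolding E_def by (intro tendsto_intros LIMSEQ_Suc eps_tendsto)
  then have E: "E \<longlonglongrightarrow> 0" by simp
  \<comment> \<open>The margin 1/20 of \<open>large_modulus_scalar\<close>. Below, the claim is
    written with F / 20 and om - 19/20 om so that multiplication by C^2 produces C^2 + \<delta> (om
    + F).\<close>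
  define \<delta> where "\<delta> = C\<^sup>2 / 20"
  have d: "\<delta> > 0" using C1 by (simp add: \<delta>_def)
  have px: "om = 0 \<longrightarrow> p = x"
  proof
    assume "om = 0"
    then have "zr = 0" by (simp add: om_def)
    then show "p = x" using rec \<open>om = 0\<close> by (intro ext) simp
  qed
  have low: "C\<^sup>2 + \<delta> * (om + (\<Sum>n\<in>{-int K..int K}. if \<bar>n\<bar> = 1 then 0 else (cmod (p n))\<^sup>2))
     \<le> 2 * lam * (Pm + (\<Sum>n\<in>{-int (Suc K)..int (Suc K)}. en n * Re (cnj (x n) * p n)))
       - (\<Sum>n\<in>{-int (Suc K)..int (Suc K)}. (lam * Sn n)\<^sup>2 * (cmod (p n))\<^sup>2)" for K
  proof -
    let ?I = "{-int (Suc K)..int (Suc K)}"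
    define R where "R = (\<Sum>n\<in>?I. en n * Re (cnj (x n) * p n))"
    define G where "G = (\<Sum>n\<in>?I. (lam * Sn n)\<^sup>2 * (cmod (p n))\<^sup>2)"
    define F where "F = (\<Sum>n\<in>{-int K..int K}. if \<bar>n\<bar> = 1 then 0 else (cmod (p n))\<^sup>2)"
    have "C\<^sup>2 * (1 + om + F / 20 - om * (19 / 20)) \<le> C\<^sup>2 * (2 * \<tau> * (Pm + R)) - G"
    proof (cases "om \<le> 1 / 2")
      case True
      define ap where "ap = (\<lambda>k. cmod (p (int k)))"
      define am where "am = (\<lambda>k. cmod (p (- int k)))"
      define P1 where "P1 = (ap 1)\<^sup>2 + (am 1)\<^sup>2"
      define N2 where "N2 = (\<Sum>k<Suc K. (ap (k + 2))\<^sup>2) + (\<Sum>k<Suc K. (am (k + 2))\<^sup>2)"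
      have PN: "P1 + N2 \<le> Pm"
      proof -
        have "(\<Sum>n\<in>{-int (Suc (Suc K))..int (Suc (Suc K))}. (cmod (p n))\<^sup>2) = P1 + N2"
          unfolding sum_symmetric_int_interval_Suc sum.lessThan_Suc_shift[of _ "Suc K"] P1_def N2_def ap_def am_def p0 sum.distrib
          by simp
        then show ?thesis using bes[of "Suc (Suc K)"] by simp
      qed
      have F: "F \<le> N2"
      proof (cases K)
        case 0 then show ?thesis by (simp add: F_def p0 N2_def add_nonneg_nonneg)
      next
        case (Suc K')
        have "F = (\<Sum>k<K'. (ap (k + 2))\<^sup>2) + (\<Sum>k<K'. (am (k + 2))\<^sup>2)"
          unfolding F_def Suc sum_symmetric_int_interval_Suc sum.lessThan_Suc_shift ap_def am_def p0 sum.distrib[symmetric]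
          by (simp del: of_nat_Suc add: numeral_2_eq_2)
        moreover have "(\<Sum>k<K'. (ap (k + 2))\<^sup>2) \<le> (\<Sum>k<Suc K. (ap (k + 2))\<^sup>2)" "(\<Sum>k<K'. (am (k + 2))\<^sup>2) \<le> (\<Sum>k<Suc K. (am (k + 2))\<^sup>2)"
          using Suc by (intro sum_mono2; simp)+
        ultimately show ?thesis by (simp add: N2_def)
      qed
      have G: "G \<le> C\<^sup>2 * P1 + N2"
      proof -
        have q: "(lam * Sn n)\<^sup>2 \<le> 1" if "\<bar>n\<bar> \<ge> 2" for n
          using lam_Sn_le[OF that] lam_pos Sn_nonneg(1)[of n] by (simp add: power_le_one)
        define gp where "gp = (\<lambda>k. (lam * Sn (int (k + 2)))\<^sup>2 * (ap (k + 2))\<^sup>2)"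
        define gm where "gm = (\<lambda>k. (lam * Sn (- int (k + 2)))\<^sup>2 * (am (k + 2))\<^sup>2)"
        have "gp k \<le> (ap (k + 2))\<^sup>2" for k
          unfolding gp_def using q[of "int (k + 2)"] by (intro mult_left_le_one_le) auto
        then have 1: "(\<Sum>k<K. gp k) \<le> (\<Sum>k<K. (ap (k + 2))\<^sup>2)" by (rule sum_mono)
        have "gm k \<le> (am (k + 2))\<^sup>2" for k
          unfolding gm_def using q[of "- int (k + 2)"] by (intro mult_left_le_one_le) auto
        then have 2: "(\<Sum>k<K. gm k) \<le> (\<Sum>k<K. (am (k + 2))\<^sup>2)" by (rule sum_mono)
        have "G = C\<^sup>2 * P1 + ((\<Sum>k<K. gp k) + (\<Sum>k<K. gm k))"
          unfolding G_def sum_symmetric_int_interval_Suc sum.lessThan_Suc_shift ap_def am_def p0 sum.distrib P1_def gp_def gm_def C_def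
          using lam_Sn_1[of 1] lam_Sn_1[of "-1"] by (simp add: algebra_simps)
        moreover have "(\<Sum>k<K. (ap (k + 2))\<^sup>2) + (\<Sum>k<K. (am (k + 2))\<^sup>2) \<le> N2" unfolding N2_def by simp
        ultimately show ?thesis using 1 2 by linarith
      qed
      \<comment> \<open>The recurrence, multiplied by the conjugate coefficient, bounds (1 - om) Re
        (cnj x p) below by (1 + om) |p n|^2 minus products with the two neighbours. Positive and
        negative frequencies decouple since p 0 = 0, and \<open>weighted_recurrence_sum\<close>
        applies to each half.\<close>
      have R: "e1 * (P1 - 3 / 10 * N2) \<le> (1 - om) * R"
      proof -
        let ?r = "cmod zr"
        have om_r: "?r\<^sup>2 = om" by (simp add: om_def)
        have pt: "(1 + om) * (cmod (p n))\<^sup>2 - ?r * cmod (p n) * cmod (p (n - 1)) - ?r * cmod (p n) * cmod (p (n + 1)) \<le> (1 - om) * Re (cnj (x n) * p n)" for n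
        proof -
          have "(1 - om) * Re (cnj (x n) * p n) = Re (cnj (of_real (1 - om) * x n) * p n)" by (simp add: algebra_simps)
          also have "\<dots> = (1 + om) * (cmod (p n))\<^sup>2 - Re (cnj (cnj zr * p (n - 1)) * p n) - Re (cnj (zr * p (n + 1)) * p n)"
            unfolding rec cmod_power2 by (simp add: algebra_simps power2_eq_square)
          finally have 1: "(1 - om) * Re (cnj (x n) * p n) = (1 + om) * (cmod (p n))\<^sup>2 - Re (cnj (cnj zr * p (n - 1)) * p n) - Re (cnj (zr * p (n + 1)) * p n)" .
          have 2: "Re (cnj (cnj zr * p (n - 1)) * p n) \<le> ?r * cmod (p n) * cmod (p (n - 1))"
            by (rule order_trans[OF complex_Re_le_cmod]) (simp add: norm_mult mult_ac)
          have 3: "Re (cnj (zr * p (n + 1)) * p n) \<le> ?r * cmod (p n) * cmod (p (n + 1))"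
            by (rule order_trans[OF complex_Re_le_cmod]) (simp add: norm_mult mult_ac)
          show ?thesis using 1 2 3 by linarith
        qed
        define fp where "fp = (\<lambda>k. en (int (Suc k)) * ((1 + ?r\<^sup>2) * (ap (Suc k))\<^sup>2 - ?r * ap (Suc k) * ap k - ?r * ap (Suc k) * ap (k + 2)))"
        define fm where "fm = (\<lambda>k. en (int (Suc k)) * ((1 + ?r\<^sup>2) * (am (Suc k))\<^sup>2 - ?r * am (Suc k) * am k - ?r * am (Suc k) * am (k + 2)))"
        have eS: "en (int (Suc K)) \<le> e1" by (rule e_le) simp
        have gen: "e1 * (a 1)\<^sup>2 - 3 / 10 * (e1 * (\<Sum>k<Suc K. (a (k + 2))\<^sup>2))
            \<le> (\<Sum>k<Suc K. en (int (Suc k)) * ((1 + ?r\<^sup>2) * (a (Suc k))\<^sup>2 - ?r * a (Suc k) * a k - ?r * a (Suc k) * a (k + 2)))"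
          if "\<And>k. a k \<ge> 0" "a 0 = 0" for a :: "nat \<Rightarrow> real"
        proof -
          have "en (int (Suc K)) * (a (K + 2))\<^sup>2 \<le> e1 * (a (K + 2))\<^sup>2" using eS by (rule mult_right_mono) simp
          moreover have "0 \<le> ?r\<^sup>2 / 6 * en (int (Suc K)) * (a (Suc K))\<^sup>2" using Sn_nonneg(2) by (intro mult_nonneg_nonneg) auto
          moreover have "e1 * (\<Sum>k<Suc K. (a (k + 2))\<^sup>2) = e1 * (\<Sum>k<K. (a (k + 2))\<^sup>2) + e1 * (a (K + 2))\<^sup>2" by (simp add: algebra_simps)
          moreover have "e1 * (a 1)\<^sup>2 - 3 / 10 * e1 * (\<Sum>k<K. (a (k + 2))\<^sup>2) - 3 / 10 * en (int (Suc K)) * (a (K + 2))\<^sup>2 + ?r\<^sup>2 / 6 * en (int (Suc K)) * (a (Suc K))\<^sup>2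
            \<le> (\<Sum>k<Suc K. en (int (Suc k)) * ((1 + ?r\<^sup>2) * (a (Suc k))\<^sup>2 - ?r * a (Suc k) * a k - ?r * a (Suc k) * a (k + 2)))"
            using weighted_recurrence_sum[of a "\<lambda>k. en (int k)" ?r K] that Sn_nonneg(2) en_ratio[OF tau] by (simp add: e1_def)
          ultimately show ?thesis by linarith
        qed
        have gp: "e1 * (ap 1)\<^sup>2 - 3 / 10 * (e1 * (\<Sum>k<Suc K. (ap (k + 2))\<^sup>2)) \<le> sum fp {..<Suc K}"
          unfolding fp_def by (rule gen) (simp_all add: ap_def p0)
        have gm: "e1 * (am 1)\<^sup>2 - 3 / 10 * (e1 * (\<Sum>k<Suc K. (am (k + 2))\<^sup>2)) \<le> sum fm {..<Suc K}"
          unfolding fm_def by (rule gen) (simp_all add: am_def p0)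
        have "fp k \<le> (1 - om) * (en (int (Suc k)) * Re (cnj (x (int (Suc k))) * p (int (Suc k))))" for k
        proof -
          have i: "int (Suc k) - 1 = int k" "int (Suc k) + 1 = int (k + 2)" by simp_all
          have "fp k \<le> en (int (Suc k)) * ((1 - om) * Re (cnj (x (int (Suc k))) * p (int (Suc k))))"
            unfolding fp_def ap_def om_r using pt[of "int (Suc k)"] unfolding i by (rule mult_left_mono[OF _ Sn_nonneg(2)])
          then show ?thesis by (simp only: mult_ac)
        qed
        moreover have "fm k \<le> (1 - om) * (en (- int (Suc k)) * Re (cnj (x (- int (Suc k))) * p (- int (Suc k))))" for k
        proof -
          have i: "- int (Suc k) - 1 = - int (k + 2)" "- int (Suc k) + 1 = - int k" by simp_all
          have "(1 + om) * (am (Suc k))\<^sup>2 - ?r * am (Suc k) * am k - ?r * am (Suc k) * am (k + 2) \<le> (1 - om) * Re (cnj (x (- int (Suc k))) * p (- int (Suc k)))"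
            using pt[of "- int (Suc k)"] unfolding i am_def by linarith
          then have "fm k \<le> en (int (Suc k)) * ((1 - om) * Re (cnj (x (- int (Suc k))) * p (- int (Suc k))))"
            unfolding fm_def om_r by (rule mult_left_mono[OF _ Sn_nonneg(2)])
          then show ?thesis unfolding Sn_minus by (simp only: mult_ac)
        qed
        ultimately have "sum fp {..<Suc K} + sum fm {..<Suc K} \<le> (1 - om) * R"
          unfolding R_def sum_symmetric_int_interval_Suc p0 distrib_left sum_distrib_left sum.distrib mult_zero_right zero_complex.sel add_0
          by (intro add_mono sum_mono)
        moreover have "e1 * (P1 - 3 / 10 * N2) = (e1 * (ap 1)\<^sup>2 - 3 / 10 * (e1 * (\<Sum>k<Suc K. (ap (k + 2))\<^sup>2))) + (e1 * (am 1)\<^sup>2 - 3 / 10 * (e1 * (\<Sum>k<Suc K. (am (k + 2))\<^sup>2)))"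
          unfolding P1_def N2_def by (simp only: ring_distribs)
        ultimately show ?thesis using gp gm by linarith
      qed
      define ee where "ee = e1 / (1 - om)"
      have o1: "1 - om > 0" using om by simp
      have ee: "ee * (P1 - 3 / 10 * N2) \<le> R"
        using R o1 unfolding ee_def by (simp add: pos_divide_le_eq mult.commute)
      have ee1: "1 - \<tau> \<le> \<tau> * ee"
      proof -
        have "e1 * (1 - om) \<le> e1 * 1" using e1 om by (intro mult_left_mono) auto
        then have "e1 \<le> ee" unfolding ee_def using o1 by (simp add: pos_le_divide_eq)
        then have "\<tau> * e1 \<le> \<tau> * ee" using t by (intro mult_left_mono) auto
        then show ?thesis using e1 by simp
      qed
      have ee2: "ee \<le> 2 / 5" unfolding ee_def using True e1 o1 by (simp add: pos_divide_le_eq)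
      have N0: "N2 \<ge> 0" "P1 \<ge> 0" by (auto simp: N2_def P1_def intro!: add_nonneg_nonneg sum_nonneg)
      have "1 + om + N2 / 20 \<le> 2 * \<tau> * (Pm + ee * (P1 - 3 / 10 * N2)) - P1 - (1 - \<tau>\<^sup>2) * N2"
        by (rule large_modulus_scalar[OF t ee1 ee2 N0 PN Pm1])
      also have "2 * \<tau> * (Pm + ee * (P1 - 3 / 10 * N2)) - P1 - (1 - \<tau>\<^sup>2) * N2 \<le> 2 * \<tau> * (Pm + R) - P1 - (1 - \<tau>\<^sup>2) * N2"
        using ee t by (intro diff_right_mono mult_left_mono add_left_mono) auto
      finally have "C\<^sup>2 * (1 + om + N2 / 20) \<le> C\<^sup>2 * (2 * \<tau> * (Pm + R) - P1 - (1 - \<tau>\<^sup>2) * N2)"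
        by (rule mult_left_mono) simp
      also have "\<dots> = C\<^sup>2 * (2 * \<tau> * (Pm + R)) - C\<^sup>2 * P1 - (C\<^sup>2 * (1 - \<tau>\<^sup>2)) * N2" by (rule distribute_two)
      also have "\<dots> \<le> C\<^sup>2 * (2 * \<tau> * (Pm + R)) - G" using G unfolding Ct by simp
      finally have "C\<^sup>2 * (1 + om + N2 / 20) \<le> C\<^sup>2 * (2 * \<tau> * (Pm + R)) - G" .
      moreover have "C\<^sup>2 * (1 + om + F / 20 - om * (19 / 20)) \<le> C\<^sup>2 * (1 + om + N2 / 20)"
        using F om by (intro mult_left_mono) auto
      ultimately show ?thesis by linarith
    next
      \<comment> \<open>When |zr|^2 > 1/2 the mean \<open>Pm\<close> is at least 3, and bounding
        every coefficient by the arithmetic-geometric inequality leaves enough room.\<close>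
      case False
      have Pm3: "3 \<le> Pm" using False om unfolding Pm_def by (simp add: pos_le_divide_eq)
      have G: "G \<le> C\<^sup>2 * Pm"
      proof -
        have "G \<le> (\<Sum>n\<in>?I. C\<^sup>2 * (cmod (p n))\<^sup>2)"
          unfolding G_def
        proof (rule sum_mono)
          fix n
          show "(lam * Sn n)\<^sup>2 * (cmod (p n))\<^sup>2 \<le> C\<^sup>2 * (cmod (p n))\<^sup>2"
            using lam_Sn_le_cosh[of n] lam_pos Sn_nonneg(1)[of n] p0
            by (cases "n = 0") (auto simp: C_def intro!: mult_right_mono power_mono)
        qed
        also have "\<dots> = C\<^sup>2 * (\<Sum>n\<in>?I. (cmod (p n))\<^sup>2)" by (rule sum_distrib_left[symmetric])
        also have "\<dots> \<le> C\<^sup>2 * Pm" by (intro mult_left_mono bes) simp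
        finally show ?thesis .
      qed
      have R: "- (e1 / 2) * (1 + Pm) \<le> R"
      proof -
        have "(\<Sum>n\<in>?I. - (e1 / 2) * ((cmod (x n))\<^sup>2 + (cmod (p n))\<^sup>2)) \<le> R"
          unfolding R_def
        proof (rule sum_mono)
          fix n
          have "- Re (cnj (x n) * p n) \<le> cmod (x n) * cmod (p n)"
            using abs_Re_le_cmod[of "cnj (x n) * p n"] by (simp only: norm_mult complex_mod_cnj)
          moreover have "2 * (cmod (x n) * cmod (p n)) \<le> (cmod (x n))\<^sup>2 + (cmod (p n))\<^sup>2"
            using sum_squares_bound[of "cmod (x n)" "cmod (p n)"] by simp
          ultimately have 1: "- Re (cnj (x n) * p n) \<le> ((cmod (x n))\<^sup>2 + (cmod (p n))\<^sup>2) / 2" by (rule half_bound)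
          show "- (e1 / 2) * ((cmod (x n))\<^sup>2 + (cmod (p n))\<^sup>2) \<le> en n * Re (cnj (x n) * p n)"
          proof (cases "n = 0")
            case True
            then show ?thesis using e1 by (simp add: p0 mult_nonneg_nonneg)
          next
            case False
            have "en n * - Re (cnj (x n) * p n) \<le> en n * (((cmod (x n))\<^sup>2 + (cmod (p n))\<^sup>2) / 2)"
              by (rule mult_left_mono[OF 1 Sn_nonneg(2)])
            also have "\<dots> \<le> e1 * (((cmod (x n))\<^sup>2 + (cmod (p n))\<^sup>2) / 2)"
              by (rule mult_right_mono[OF e_le[OF False]]) simp
            finally show ?thesis by (rule negate_bound)
          qed
        qed
        moreover have "(\<Sum>n\<in>?I. (cmod (x n))\<^sup>2 + (cmod (p n))\<^sup>2) \<le> 1 + Pm"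
          unfolding sum.distrib by (intro add_mono bes sum_x_le) simp
        then have "e1 / 2 * (\<Sum>n\<in>?I. (cmod (x n))\<^sup>2 + (cmod (p n))\<^sup>2) \<le> e1 / 2 * (1 + Pm)" using e1 by (intro mult_left_mono) auto
        ultimately show ?thesis unfolding sum_distrib_left[symmetric] by linarith
      qed
      have F: "F \<le> Pm"
        by (rule order_trans[OF _ bes[of K]]) (auto simp: F_def intro!: sum_mono)
      have "1 + om + F / 20 - om * (19 / 20) \<le> 2 * \<tau> * (Pm + - (e1 / 2) * (1 + Pm)) - Pm"
      proof -
        have "2 * \<tau> * (Pm + - (e1 / 2) * (1 + Pm)) = 2 * \<tau> * Pm - (\<tau> * e1) * (1 + Pm)" by (simp add: algebra_simps)
        also have "\<dots> = 3 * \<tau> * Pm - Pm - (1 - \<tau>)" unfolding e1 by (simp add: algebra_simps)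
        finally have "2 * \<tau> * (Pm + - (e1 / 2) * (1 + Pm)) = 3 * \<tau> * Pm - Pm - (1 - \<tau>)" .
        moreover have "5 / 2 * Pm \<le> 3 * \<tau> * Pm" using t Pm3 by (intro mult_right_mono) auto
        ultimately show ?thesis using F Pm3 om t by linarith
      qed
      also have "2 * \<tau> * (Pm + - (e1 / 2) * (1 + Pm)) - Pm \<le> 2 * \<tau> * (Pm + R) - Pm"
        using R t by (intro diff_right_mono mult_left_mono add_left_mono) auto
      finally have "C\<^sup>2 * (1 + om + F / 20 - om * (19 / 20)) \<le> C\<^sup>2 * (2 * \<tau> * (Pm + R) - Pm)" by (rule mult_left_mono) simp
      also have "\<dots> = C\<^sup>2 * (2 * \<tau> * (Pm + R)) - C\<^sup>2 * Pm" by (simp only: right_diff_distrib)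
      finally show ?thesis using G by linarith
    qed
    moreover have "C\<^sup>2 * (1 + om + F / 20 - om * (19 / 20)) = C\<^sup>2 + \<delta> * (om + F)" by (simp add: \<delta>_def algebra_simps)
    moreover have "C\<^sup>2 * (2 * \<tau> * (Pm + R)) = 2 * lam * (Pm + R)" unfolding lC by (simp only: mult_ac)
    ultimately show ?thesis unfolding R_def[symmetric] G_def[symmetric] F_def[symmetric] by linarith
  qed
  have "(cosh T)\<^sup>2 + \<delta> * (om + (\<Sum>n\<in>{-int K..int K}. if \<bar>n\<bar> = 1 then 0 else (cmod (p n))\<^sup>2))
       + (\<Sum>n\<in>{-int K..int K}. (cmod (z n - of_real (lam * Sn n) * p n))\<^sup>2) \<le> M\<^sup>2 + E K" for K
  proof -
    have "(\<Sum>n\<in>{-int K..int K}. (cmod (z n - of_real (lam * Sn n) * p n))\<^sup>2)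
        \<le> (\<Sum>n\<in>{-int (Suc K)..int (Suc K)}. (cmod (z n - of_real (lam * Sn n) * p n))\<^sup>2)"
      by (intro sum_mono2) auto
    then show ?thesis using low[of K] completed_inequality[OF lim[of "Suc K"]] unfolding E_def C_def[symmetric] by linarith
  qed
  then have "core E \<delta> om p" unfolding core_def using E d px om by blast
  then show ?thesis by blast
qed

text \<open>In \<open>core\<close> a single frequency is kept from each defect sum and K tends to
  infinity. All defects are nonnegative, so M^2 \<le> (cosh T)^2 makes each of them zero; v = 0 then
  identifies p with x.\<close>

lemma extremal:
  assumes le: "M\<^sup>2 \<le> (cosh T)\<^sup>2"
  shows "M\<^sup>2 = (cosh T)\<^sup>2" "\<bar>n\<bar> \<noteq> 1 \<Longrightarrow> x n = 0" "z n = of_real (lam * Sn n) * x n"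
proof -
  obtain E \<delta> v p where c: "core E \<delta> v p"
    using core_small core_large by (cases "tanh T \<le> 5 / 6") (blast, fastforce)
  note c' = c[unfolded core_def]
  have E: "E \<longlonglongrightarrow> 0" and d: "\<delta> > 0" and v: "v \<ge> 0" "v = 0 \<longrightarrow> p = x" using c' by blast+
  define f where "f = (\<lambda>n. if \<bar>n\<bar> = 1 then 0 else (cmod (p n))\<^sup>2)"
  define g where "g = (\<lambda>n. (cmod (z n - of_real (lam * Sn n) * p n))\<^sup>2)"
  have fg: "f n \<ge> 0" "g n \<ge> 0" for n by (auto simp: f_def g_def)
  have ineq: "(cosh T)\<^sup>2 + \<delta> * (v + f n) + g n \<le> M\<^sup>2" for n
  proof -
    have "(cosh T)\<^sup>2 + \<delta> * (v + f n) + g n \<le> M\<^sup>2 + E K" if "K \<ge> nat \<bar>n\<bar>" for K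
    proof -
      have n: "n \<in> {-int K..int K}" using that by auto
      have 1: "f n \<le> sum f {-int K..int K}" "g n \<le> sum g {-int K..int K}"
        using n fg by (intro member_le_sum; simp)+
      have "\<delta> * (v + f n) \<le> \<delta> * (v + sum f {-int K..int K})" using 1 d by (intro mult_left_mono) auto
      moreover have "(cosh T)\<^sup>2 + \<delta> * (v + sum f {-int K..int K}) + sum g {-int K..int K} \<le> M\<^sup>2 + E K"
        using c' unfolding f_def g_def by blast
      ultimately show ?thesis using 1 by linarith
    qed
    moreover have "(\<lambda>K. M\<^sup>2 + E K) \<longlonglongrightarrow> M\<^sup>2 + 0" by (intro tendsto_intros E)
    ultimately have "(cosh T)\<^sup>2 + \<delta> * (v + f n) + g n \<le> M\<^sup>2 + 0" by (intro LIMSEQ_le_const) blast+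
    then show ?thesis by simp
  qed
  have nn: "0 \<le> \<delta> * (v + f n)" for n using d v fg by simp
  show "M\<^sup>2 = (cosh T)\<^sup>2" using ineq[of 0] nn[of 0] fg(2)[of 0] le by linarith
  have z: "\<delta> * (v + f n) = 0" "g n = 0" for n using ineq[of n] nn[of n] fg(2)[of n] le by linarith+
  then have "v + f n = 0" for n using d by simp
  then have "v = 0" "f n = 0" for n using v(1) fg(1)[of n] by (smt (verit))+
  then have px: "p = x" using v by simp
  show "\<bar>n\<bar> \<noteq> 1 \<Longrightarrow> x n = 0" using \<open>f n = 0\<close> px by (simp add: f_def)
  show "z n = of_real (lam * Sn n) * x n" using z(2)[of n] px by (simp add: g_def)
qed

lemma cosh_le: "cosh T \<le> M"
proof (rule ccontr)
  assume "\<not> cosh T \<le> M"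
  then have "M\<^sup>2 < (cosh T)\<^sup>2" using M1 by (intro power_strict_mono) auto
  then show False using extremal(1) by simp
qed

end

section \<open>Topology of circles and annuli, and the rigid extremal map\<close>

lemma sign_constant:
  fixes g :: "'a::topological_space \<Rightarrow> real"
  assumes "connected S" "continuous_on S g" "a > 0" "\<And>x. x \<in> S \<Longrightarrow> (g x)\<^sup>2 = a\<^sup>2"
  shows "(\<forall>x\<in>S. g x = a) \<or> (\<forall>x\<in>S. g x = - a)"
proof (rule ccontr)
  assume "\<not> ?thesis"
  then obtain x y where xy: "x \<in> S" "y \<in> S" "g x \<noteq> a" "g y \<noteq> - a" by blast
  then have "g x = - a" "g y = a" using assms(4) power2_eq_iff by metis+
  moreover have "connected (g ` S)" by (rule connected_continuous_image[OF assms(2,1)])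
  ultimately have "0 \<in> g ` S"
    using xy assms(3) unfolding connected_iff_interval by (metis imageI less_eq_real_def neg_le_0_iff_le)
  then show False using assms(3,4) by force
qed

text \<open>For a logarithm q, the function q - i \<theta> has constant exponential, hence takes
  values in a discrete set and is constant on [0, 2 pi]; but q returns to its starting value while i
  \<theta> does not.\<close>

lemma no_logarithm_on_circle:
  assumes q: "continuous_on (sphere 0 \<rho>) q" "\<And>\<xi>. cmod \<xi> = \<rho> \<Longrightarrow> exp (q \<xi>) = \<xi> / s" and \<rho>: "\<rho> > 0" "s \<noteq> 0"
  shows False
proof -
  define L where "L = (\<lambda>\<theta>. q (of_real \<rho> * cis \<theta>) - \<i> * of_real \<theta>)"
  have cL: "continuous_on {0..2*pi} L"
    unfolding L_def
    by (intro continuous_intros continuous_on_compose2[OF q(1)]) (use \<rho> in \<open>auto simp: norm_mult\<close>)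
  have eL: "exp (L \<theta>) = of_real \<rho> / s" for \<theta>
    unfolding L_def exp_diff cis_conv_exp[symmetric] by (subst q(2)) (use \<rho> in \<open>auto simp: norm_mult\<close>)
  have "L constant_on {0..2*pi}"
  proof (rule continuous_discrete_range_constant[OF _ cL])
    fix x :: real
    have "2 * pi \<le> cmod (L y - L x)" if ne: "L y \<noteq> L x" for y
    proof -
      have "exp (L y) = exp (L x)" by (simp only: eL)
      then obtain n where n: "L y = L x + (of_int (2 * n) * pi) * \<i>" unfolding exp_eq by blast
      then have "n \<noteq> 0" using ne by auto
      then have "1 \<le> \<bar>real_of_int n\<bar>" by linarith
      moreover have "cmod (L y - L x) = 2 * pi * \<bar>real_of_int n\<bar>" using n by (simp add: norm_mult)
      ultimately show ?thesis using pi_gt_zero by simp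
    qed
    then show "\<exists>e>0. \<forall>y. y \<in> {0..2*pi} \<and> L y \<noteq> L x \<longrightarrow> e \<le> cmod (L y - L x)"
      by (intro exI[of _ "2 * pi"]) auto
  qed auto
  then obtain k where k: "\<And>\<theta>. \<theta> \<in> {0..2*pi} \<Longrightarrow> L \<theta> = k" unfolding constant_on_def by blast
  have "L 0 = L (2 * pi)" using k[of 0] k[of "2 * pi"] by simp
  then show False using pi_gt_zero by (simp add: L_def)
qed

text \<open>A homeomorphism is proper, so thin collars of the domain are mapped into thin collars of
  the target. Collars of the domain are connected, so each goes to a single end; surjectivity
  excludes that both go to the same end.\<close>

lemma annulus_homeomorphism_ends:
  assumes hom: "homeomorphism (annulus a b) (annulus c d) h g" and ab: "0 < a" "a < b" and cd: "0 < c" "c < d"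
  shows "(\<forall>e>0. \<exists>\<delta>>0. \<forall>z\<in>annulus a b. (cmod z < a + \<delta> \<longrightarrow> cmod (h z) < c + e) \<and> (b - \<delta> < cmod z \<longrightarrow> d - e < cmod (h z)))
       \<or> (\<forall>e>0. \<exists>\<delta>>0. \<forall>z\<in>annulus a b. (cmod z < a + \<delta> \<longrightarrow> d - e < cmod (h z)) \<and> (b - \<delta> < cmod z \<longrightarrow> cmod (h z) < c + e))"
proof -
  let ?A = "annulus a b" and ?B = "annulus c d"
  have ch: "continuous_on ?A h" and cg: "continuous_on ?B g" and hB: "\<And>z. z \<in> ?A \<Longrightarrow> h z \<in> ?B"
    and gA: "\<And>\<xi>. \<xi> \<in> ?B \<Longrightarrow> g \<xi> \<in> ?A" and gh: "\<And>z. z \<in> ?A \<Longrightarrow> g (h z) = z" and hg: "\<And>\<xi>. \<xi> \<in> ?B \<Longrightarrow> h (g \<xi>) = \<xi>"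
    using hom unfolding homeomorphism_def by blast+
  define K where "K = (\<lambda>e. {\<xi>::complex. c + e \<le> cmod \<xi> \<and> cmod \<xi> \<le> d - e})"
  have cK: "compact (K e)" for e
  proof -
    have "K e = cball 0 (d - e) \<inter> {\<xi>. c + e \<le> cmod \<xi>}" by (auto simp: K_def)
    moreover have "closed {\<xi>::complex. c + e \<le> cmod \<xi>}" by (intro closed_Collect_le continuous_intros)
    ultimately show ?thesis by (simp add: compact_Int_closed)
  qed
  \<comment> \<open>The preimage of the compact middle part \<open>K e\<close> is compact in the
    open annulus and therefore keeps a positive distance from both boundary circles.\<close>
  have collar: "\<exists>\<delta>>0. a + \<delta> < b \<and> (\<forall>z\<in>?A. cmod z < a + \<delta> \<or> b - \<delta> < cmod z \<longrightarrow> cmod (h z) < c + e \<or> d - e < cmod (h z))" if e: "e > 0" for e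
  proof (cases "K e = {}")
    case True
    have "cmod (h z) < c + e \<or> d - e < cmod (h z)" for z
      using True unfolding K_def by (auto simp: not_le)
    then show ?thesis using ab by (intro exI[of _ "(b - a) / 2"]) (auto simp: field_simps)
  next
    case False
    have KB: "K e \<subseteq> ?B" using e by (auto simp: K_def annulus_def)
    have cgK: "continuous_on (K e) (\<lambda>\<xi>. cmod (g \<xi>))" by (intro continuous_intros continuous_on_subset[OF cg KB])
    obtain p where p: "p \<in> K e" "\<And>\<xi>. \<xi> \<in> K e \<Longrightarrow> cmod (g p) \<le> cmod (g \<xi>)"
      using continuous_attains_inf[OF cK False cgK] by blast
    obtain q where q: "q \<in> K e" "\<And>\<xi>. \<xi> \<in> K e \<Longrightarrow> cmod (g \<xi>) \<le> cmod (g q)"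
      using continuous_attains_sup[OF cK False cgK] by blast
    have "g p \<in> ?A" "g q \<in> ?A" using p q KB gA by auto
    then have pq: "a < cmod (g p)" "cmod (g q) < b" by (auto simp: annulus_def)
    define \<delta> where "\<delta> = min ((b - a) / 2) (min (cmod (g p) - a) (b - cmod (g q)))"
    have \<delta>: "\<delta> > 0" "a + \<delta> < b" "\<delta> \<le> cmod (g p) - a" "\<delta> \<le> b - cmod (g q)" using pq ab by (auto simp: \<delta>_def min_def field_simps)
    have "cmod (h z) < c + e \<or> d - e < cmod (h z)" if z: "z \<in> ?A" "cmod z < a + \<delta> \<or> b - \<delta> < cmod z" for z
    proof (rule ccontr)
      assume "\<not> ?thesis"
      then have "h z \<in> K e" by (auto simp: K_def)
      from p(2)[OF this] q(2)[OF this] show False using z \<delta> unfolding gh[OF z(1)] by linarith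
    qed
    then show ?thesis using \<delta> by blast
  qed
  have one: "(\<forall>z\<in>S. cmod (h z) < c + e) \<or> (\<forall>z\<in>S. d - e < cmod (h z))"
    if S: "connected S" "S \<subseteq> ?A" "\<And>z. z \<in> S \<Longrightarrow> cmod (h z) < c + e \<or> d - e < cmod (h z)" and e: "c + e \<le> d - e" for S e
  proof (rule ccontr)
    assume "\<not> ?thesis"
    then have "\<exists>x\<in>S. \<not> cmod (h x) < c + e" "\<exists>y\<in>S. \<not> d - e < cmod (h y)" by blast+
    then obtain x y where "x \<in> S" "\<not> cmod (h x) < c + e" "y \<in> S" "\<not> d - e < cmod (h y)" by blast
    then have xy: "x \<in> S" "y \<in> S" "d - e < cmod (h x)" "cmod (h y) < c + e" using S(3)[of x] S(3)[of y] by blast+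
    have "connected ((\<lambda>z. cmod (h z)) ` S)"
      by (rule connected_continuous_image[OF _ S(1)]) (intro continuous_intros continuous_on_subset[OF ch S(2)])
    then have "c + e \<in> (\<lambda>z. cmod (h z)) ` S"
      by (rule connectedD_interval[of _ "cmod (h y)" "cmod (h x)"]) (use xy e in auto)
    then obtain v where "v \<in> S" "cmod (h v) = c + e" by auto
    then show False using S(3)[of v] e by linarith
  qed
  have conn: "connected (annulus r1 r2)" for r1 r2
    using connected_annulus(1)[of r1 "0::complex" r2] by (simp add: annulus_def)
  have dich: "\<exists>\<delta>>0. a + \<delta> < b \<and> ((\<forall>z\<in>annulus a (a + \<delta>). cmod (h z) < c + e) \<or> (\<forall>z\<in>annulus a (a + \<delta>). d - e < cmod (h z)))
      \<and> ((\<forall>z\<in>annulus (b - \<delta>) b. cmod (h z) < c + e) \<or> (\<forall>z\<in>annulus (b - \<delta>) b. d - e < cmod (h z)))" if e: "e > 0" "c + e \<le> d - e" for e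
  proof -
    obtain \<delta> where \<delta>: "\<delta> > 0" "a + \<delta> < b" "\<And>z. z \<in> ?A \<Longrightarrow> cmod z < a + \<delta> \<or> b - \<delta> < cmod z \<Longrightarrow> cmod (h z) < c + e \<or> d - e < cmod (h z)"
      using collar[OF e(1)] by blast
    have "(\<forall>z\<in>annulus a (a + \<delta>). cmod (h z) < c + e) \<or> (\<forall>z\<in>annulus a (a + \<delta>). d - e < cmod (h z))"
      by (rule one[OF conn _ _ e(2)]) (use \<delta> in \<open>auto simp: annulus_def\<close>)
    moreover have "(\<forall>z\<in>annulus (b - \<delta>) b. cmod (h z) < c + e) \<or> (\<forall>z\<in>annulus (b - \<delta>) b. d - e < cmod (h z))"
      by (rule one[OF conn _ _ e(2)]) (use \<delta> in \<open>auto simp: annulus_def\<close>)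
    ultimately show ?thesis using \<delta> by blast
  qed
  define e0 where "e0 = (d - c) / 3"
  have e0: "e0 > 0" "c + e0 < d - e0" using cd by (auto simp: e0_def field_simps)
  define mid where "mid = (\<lambda>\<delta>. {z::complex. a + \<delta> \<le> cmod z \<and> cmod z \<le> b - \<delta>})"
  have cmid: "compact (mid \<delta>)" for \<delta>
  proof -
    have "mid \<delta> = cball 0 (b - \<delta>) \<inter> {z. a + \<delta> \<le> cmod z}" by (auto simp: mid_def)
    moreover have "closed {z::complex. a + \<delta> \<le> cmod z}" by (intro closed_Collect_le continuous_intros)
    ultimately show ?thesis by (simp add: compact_Int_closed)
  qed
  have notmid: "z \<in> annulus a (a + \<delta>) \<or> z \<in> annulus (b - \<delta>) b" if "z \<in> ?A" "z \<notin> mid \<delta>" for z \<delta>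
    using that by (auto simp: mid_def annulus_def)
  have pt: "\<exists>\<xi>\<in>?B. cmod \<xi> = r" if "c < r" "r < d" for r
    using that cd by (intro bexI[of _ "of_real r"]) (auto simp: annulus_def)
  obtain \<delta>0 where \<delta>0: "\<delta>0 > 0" "a + \<delta>0 < b"
    and in0: "(\<forall>z\<in>annulus a (a + \<delta>0). cmod (h z) < c + e0) \<or> (\<forall>z\<in>annulus a (a + \<delta>0). d - e0 < cmod (h z))"
    and out0: "(\<forall>z\<in>annulus (b - \<delta>0) b. cmod (h z) < c + e0) \<or> (\<forall>z\<in>annulus (b - \<delta>0) b. d - e0 < cmod (h z))"
    using dich[OF e0(1)] e0(2) by auto
  have midA: "mid \<delta>0 \<subseteq> ?A" using \<delta>0 by (auto simp: mid_def annulus_def)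
  have chm: "continuous_on (mid \<delta>0) (\<lambda>z. cmod (h z))" by (intro continuous_intros continuous_on_subset[OF ch midA])
  \<comment> \<open>If both collars were sent outward, all points of small modulus would come from
    the compact set \<open>mid\<close>, where |h| has a minimum larger than c; points of modulus
    between c and this minimum would have no preimage.\<close>
  have not_high: False if hi: "\<And>z. z \<in> annulus a (a + \<delta>0) \<or> z \<in> annulus (b - \<delta>0) b \<Longrightarrow> d - e0 < cmod (h z)"
  proof -
    have low: "g \<xi> \<in> mid \<delta>0" if "\<xi> \<in> ?B" "cmod \<xi> \<le> c + e0" for \<xi>
      using notmid[OF gA[OF that(1)], of \<delta>0] hi[of "g \<xi>"] hg[OF that(1)] that(2) e0 by auto
    obtain \<xi>1 where \<xi>1: "\<xi>1 \<in> ?B" "cmod \<xi>1 = c + e0" using pt[of "c + e0"] e0 by auto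
    have "mid \<delta>0 \<noteq> {}" using low[OF \<xi>1(1)] \<xi>1(2) by auto
    then obtain p where p: "p \<in> mid \<delta>0" "\<And>z. z \<in> mid \<delta>0 \<Longrightarrow> cmod (h p) \<le> cmod (h z)"
      using continuous_attains_inf[OF cmid _ chm] by blast
    have hp: "c < cmod (h p)" using hB p(1) midA by (auto simp: annulus_def)
    define r where "r = min (c + e0) ((c + cmod (h p)) / 2)"
    have r: "c < r" "r < d" "r \<le> c + e0" "r < cmod (h p)" using hp e0 by (auto simp: r_def min_def field_simps)
    obtain \<xi> where \<xi>: "\<xi> \<in> ?B" "cmod \<xi> = r" using pt[OF r(1,2)] by blast
    have "cmod (h p) \<le> cmod (h (g \<xi>))" using p(2)[OF low[OF \<xi>(1)]] \<xi>(2) r by simp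
    then show False using hg[OF \<xi>(1)] \<xi>(2) r by simp
  qed
  have not_low: False if lo: "\<And>z. z \<in> annulus a (a + \<delta>0) \<or> z \<in> annulus (b - \<delta>0) b \<Longrightarrow> cmod (h z) < c + e0"
  proof -
    have high: "g \<xi> \<in> mid \<delta>0" if "\<xi> \<in> ?B" "d - e0 \<le> cmod \<xi>" for \<xi>
      using notmid[OF gA[OF that(1)], of \<delta>0] lo[of "g \<xi>"] hg[OF that(1)] that(2) e0 by auto
    obtain \<xi>1 where \<xi>1: "\<xi>1 \<in> ?B" "cmod \<xi>1 = d - e0" using pt[of "d - e0"] e0 by auto
    have "mid \<delta>0 \<noteq> {}" using high[OF \<xi>1(1)] \<xi>1(2) by auto
    then obtain p where p: "p \<in> mid \<delta>0" "\<And>z. z \<in> mid \<delta>0 \<Longrightarrow> cmod (h z) \<le> cmod (h p)"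
      using continuous_attains_sup[OF cmid _ chm] by blast
    have hp: "cmod (h p) < d" using hB p(1) midA by (auto simp: annulus_def)
    define r where "r = max (d - e0) ((d + cmod (h p)) / 2)"
    have r: "c < r" "r < d" "d - e0 \<le> r" "cmod (h p) < r" using hp e0 by (auto simp: r_def max_def field_simps)
    obtain \<xi> where \<xi>: "\<xi> \<in> ?B" "cmod \<xi> = r" using pt[OF r(1,2)] by blast
    have "cmod (h (g \<xi>)) \<le> cmod (h p)" using p(2)[OF high[OF \<xi>(1)]] \<xi>(2) r by simp
    then show False using hg[OF \<xi>(1)] \<xi>(2) r by simp
  qed
  have fin: "\<exists>\<delta>>0. \<forall>z\<in>?A. (cmod z < a + \<delta> \<longrightarrow> (if low then cmod (h z) < c + e else d - e < cmod (h z))) \<and> (b - \<delta> < cmod z \<longrightarrow> (if low then d - e < cmod (h z) else cmod (h z) < c + e))"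
    if e: "e > 0" and low: "\<forall>z\<in>annulus a (a + \<delta>0). if low then cmod (h z) < c + e0 else d - e0 < cmod (h z)"
      "\<forall>z\<in>annulus (b - \<delta>0) b. if low then d - e0 < cmod (h z) else cmod (h z) < c + e0" for e low
  proof -
    define e1 where "e1 = min e e0"
    have e1: "e1 > 0" "c + e1 \<le> d - e1" "e1 \<le> e" "e1 \<le> e0" using e e0 by (auto simp: e1_def)
    obtain \<delta>1 where \<delta>1: "\<delta>1 > 0" "a + \<delta>1 < b"
      and in1: "(\<forall>z\<in>annulus a (a + \<delta>1). cmod (h z) < c + e1) \<or> (\<forall>z\<in>annulus a (a + \<delta>1). d - e1 < cmod (h z))"
      and out1: "(\<forall>z\<in>annulus (b - \<delta>1) b. cmod (h z) < c + e1) \<or> (\<forall>z\<in>annulus (b - \<delta>1) b. d - e1 < cmod (h z))"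
      using dich[OF e1(1,2)] by blast
    define \<delta> where "\<delta> = min \<delta>0 \<delta>1"
    have \<delta>: "\<delta> > 0" "\<delta> \<le> \<delta>0" "\<delta> \<le> \<delta>1" using \<delta>0 \<delta>1 by (auto simp: \<delta>_def)
    define z1 where "z1 = complex_of_real (a + \<delta> / 2)"
    define z2 where "z2 = complex_of_real (b - \<delta> / 2)"
    have "cmod z1 = a + \<delta> / 2" "cmod z2 = b - \<delta> / 2"
      unfolding z1_def z2_def norm_of_real using ab \<delta> \<delta>0 by auto
    then have z1: "z1 \<in> annulus a (a + \<delta>0)" "z1 \<in> annulus a (a + \<delta>1)" and z2: "z2 \<in> annulus (b - \<delta>0) b" "z2 \<in> annulus (b - \<delta>1) b"
      using \<delta> by (auto simp: annulus_def)
    have in2: "\<forall>z\<in>annulus a (a + \<delta>1). if low then cmod (h z) < c + e1 else d - e1 < cmod (h z)"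
      using in1 bspec[OF low(1) z1(1)] z1(2) e1 e0 by (cases low) force+
    have out2: "\<forall>z\<in>annulus (b - \<delta>1) b. if low then d - e1 < cmod (h z) else cmod (h z) < c + e1"
      using out1 bspec[OF low(2) z2(1)] z2(2) e1 e0 by (cases low) force+
    have A1: "z \<in> annulus a (a + \<delta>1)" if "z \<in> ?A" "cmod z < a + \<delta>" for z using that \<delta> by (auto simp: annulus_def)
    have A2: "z \<in> annulus (b - \<delta>1) b" if "z \<in> ?A" "b - \<delta> < cmod z" for z using that \<delta> by (auto simp: annulus_def)
    show ?thesis
      using \<delta>(1) in2 out2 A1 A2 e1(3) by (intro exI[of _ \<delta>]) (cases low; force)
  qed
  show ?thesis
  proof (cases "\<forall>z\<in>annulus a (a + \<delta>0). cmod (h z) < c + e0")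
    case True
    then have "\<forall>z\<in>annulus (b - \<delta>0) b. d - e0 < cmod (h z)" using out0 not_low by blast
    then show ?thesis using fin[of _ True] True by simp
  next
    case False
    then have 1: "\<forall>z\<in>annulus a (a + \<delta>0). d - e0 < cmod (h z)" using in0 by blast
    then have "\<forall>z\<in>annulus (b - \<delta>0) b. cmod (h z) < c + e0" using out0 not_high by blast
    then show ?thesis using fin[of _ False] 1 by simp
  qed
qed

context annulus_harmonic
begin

lemma three_term:
  assumes t: "t \<in> {0<..<T}" and 0: "\<And>n. \<bar>n\<bar> > 1 \<Longrightarrow> coeff n t = 0"
  shows "h (of_real (exp t) * cis \<theta>) = coeff 0 t + coeff 1 t * cis \<theta> + coeff (-1) t * cis (- \<theta>)"
proof -
  define P where "P = (\<lambda>u. coeff 0 t + coeff 1 t * u + coeff (-1) t * cnj u)"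
  define g where "g = (\<lambda>u. h (of_real (exp t) * u) - P u)"
  have sub: "of_real (exp t) * u \<in> annulus 1 (exp T)" if "cmod u = 1" for u
    using that t by (simp add: annulus_def norm_mult)
  have cg: "continuous_on (sphere 0 1) g"
    unfolding g_def P_def by (intro continuous_intros continuous_on_compose2[OF conts(3)]) (use sub in auto)
  have Pc: "P (cis \<theta>) = (\<Sum>n\<in>{-1..1}. coeff n t * cis (of_int n * \<theta>))" for \<theta>
  proof -
    have "{-1..1} = {-1, 0, 1::int}" by auto
    then show ?thesis by (simp add: P_def cis_cnj)
  qed
  have "fourier (\<lambda>\<theta>. g (cis \<theta>)) n = 0" for n
  proof -
    have "fourier (\<lambda>\<theta>. g (cis \<theta>)) n = coeff n t - fourier (\<lambda>\<theta>. \<Sum>n\<in>{-1..1}. coeff n t * cis (of_int n * \<theta>)) n"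
      unfolding g_def Pc coeff_def[of n t]
      by (rule fourier_diff) (intro continuous_intros circle_cont_compose[OF conts(3) t])+
    also have "\<dots> = 0" by (subst fourier_trig) (use 0[of n] in auto)
    finally show ?thesis .
  qed
  then have "g (cis \<theta>) = 0" by (intro fourier_zero_imp_zero[OF cg]) auto
  then show ?thesis by (simp add: g_def P_def cis_cnj)
qed

lemma sg_isCont: "isCont (sg n) t"
proof (cases "n = 0")
  case True
  then have "sg n = (\<lambda>t. t / T)" by (simp add: sg_def fun_eq_iff)
  then show ?thesis by (auto intro!: continuous_intros simp: T less_imp_neq[OF T, symmetric])
next
  case False
  then have "sg n = (\<lambda>t. sinh (of_int n * t) / sinh (of_int n * T))" by (simp add: sg_def fun_eq_iff)
  moreover have "isCont (\<lambda>t. sinh (of_int n * t) / sinh (of_int n * T)) t"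
    using False T by (intro isCont_divide isCont_sinh continuous_intros) auto
  ultimately show ?thesis by simp
qed

text \<open>The uniform limits at the two ends determine the boundary coefficients: all x n are 0
  and only z 0 = L survives, so the function is the n = 0 profile t / T times L.\<close>

lemma linear_of_boundary_limits:
  assumes l0: "\<And>e. e > 0 \<Longrightarrow> \<exists>d>0. \<forall>t \<theta>. 0 < t \<and> t < d \<and> t < T \<longrightarrow> cmod (h (of_real (exp t) * cis \<theta>)) \<le> e"
    and lT: "\<And>e. e > 0 \<Longrightarrow> \<exists>d>0. \<forall>t \<theta>. 0 < t \<and> T - d < t \<and> t < T \<longrightarrow> cmod (h (of_real (exp t) * cis \<theta>) - L) \<le> e"
    and t: "t \<in> {0<..<T}"
  shows "h (of_real (exp t) * cis \<theta>) = of_real (t / T) * L"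
proof -
  obtain x z where "\<forall>n. \<forall>t\<in>{0<..<T}. coeff n t = of_real (sg n (T - t)) * x n + of_real (sg n t) * z n"
    using coeff_boundary_values by (elim exE)
  then have c: "coeff n t = of_real (sg n (T - t)) * x n + of_real (sg n t) * z n" if "t \<in> {0<..<T}" for n t
    using that by (elim allE ballE) auto
  have sg1: "sg n 0 = 0" "sg n T = 1" for n using T by (auto simp: sg_def)
  note st = isCont_tendsto_compose[OF sg_isCont]
  have fe: "cmod (fourier f n) \<le> e" if "circle_cont f" "\<And>\<theta>. cmod (f \<theta>) \<le> e" for f n e
    unfolding fourier_def by (rule circle_mean_norm_le) (use that in \<open>auto intro!: continuous_intros simp: norm_mult\<close>)
  have fc: "circle_cont (\<lambda>\<theta>. h (of_real (exp s) * cis \<theta>))" if "s \<in> {0<..<T}" for s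
    by (rule circle_cont_compose[OF conts(3) that])
  have x0: "x n = 0" for n
  proof -
    have "((\<lambda>t. of_real (sg n (T - t)) * x n + of_real (sg n t) * z n) \<longlongrightarrow> of_real (sg n (T - 0)) * x n + of_real (sg n 0) * z n) (at_right 0)"
      by (intro tendsto_intros st)
    then have 1: "((\<lambda>t. of_real (sg n (T - t)) * x n + of_real (sg n t) * z n) \<longlongrightarrow> x n) (at_right 0)" by (simp add: sg1)
    have "((\<lambda>t. coeff n t) \<longlongrightarrow> x n) (at_right 0)"
      by (rule Lim_transform_eventually[OF 1], rule eventually_right_0I[OF T]) (use c in auto)
    then have 2: "((\<lambda>t. cmod (coeff n t)) \<longlongrightarrow> cmod (x n)) (at_right 0)" by (rule tendsto_norm)
    have "cmod (x n) \<le> e" if e: "e > 0" for e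
    proof -
      obtain d where d: "d > 0" "\<And>t \<theta>. 0 < t \<and> t < d \<and> t < T \<Longrightarrow> cmod (h (of_real (exp t) * cis \<theta>)) \<le> e" using l0[OF e] by blast
      have "\<forall>\<^sub>F t in at_right 0. cmod (coeff n t) \<le> e"
        by (rule eventually_right_0I[of "min d T"]) (use d T in \<open>auto simp: coeff_def intro!: fe fc simp del: of_real_exp\<close>)
      from tendsto_upperbound[OF 2 this] show ?thesis by simp
    qed
    then have "cmod (x n) \<le> 0" by (rule field_le_epsilon[of _ 0, simplified])
    then show ?thesis by simp
  qed
  have z0: "z n = (if n = 0 then L else 0)" for n
  proof -
    let ?l = "if n = 0 then L else 0"
    have "((\<lambda>t. of_real (sg n (T - t)) * x n + of_real (sg n t) * z n) \<longlongrightarrow> of_real (sg n (T - T)) * x n + of_real (sg n T) * z n) (at_left T)"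
      by (intro tendsto_intros st)
    then have 1: "((\<lambda>t. of_real (sg n (T - t)) * x n + of_real (sg n t) * z n) \<longlongrightarrow> z n) (at_left T)" by (simp add: sg1)
    have "((\<lambda>t. coeff n t) \<longlongrightarrow> z n) (at_left T)"
      by (rule Lim_transform_eventually[OF 1]) (use c T in \<open>auto simp: eventually_at_left[of 0 T] intro!: exI[of _ 0]\<close>)
    then have 2: "((\<lambda>t. cmod (coeff n t - ?l)) \<longlongrightarrow> cmod (z n - ?l)) (at_left T)" by (intro tendsto_intros)
    have "cmod (z n - ?l) \<le> e" if e: "e > 0" for e
    proof -
      obtain d where d: "d > 0" "\<And>t \<theta>. 0 < t \<and> T - d < t \<and> t < T \<Longrightarrow> cmod (h (of_real (exp t) * cis \<theta>) - L) \<le> e" using lT[OF e] by blast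
      have "cmod (coeff n s - ?l) \<le> e" if s: "0 < s" "T - d < s" "s < T" for s
      proof -
        have "fourier (\<lambda>\<theta>. L) n = ?l" using fourier_trig[of "{0}" "\<lambda>_. L" n] by simp
        then have "coeff n s - ?l = fourier (\<lambda>\<theta>. h (of_real (exp s) * cis \<theta>) - L) n"
          unfolding coeff_def using fourier_diff[of "\<lambda>\<theta>. h (of_real (exp s) * cis \<theta>)" "\<lambda>\<theta>. L" n] fc[of s] s by simp
        moreover have "cmod (fourier (\<lambda>\<theta>. h (of_real (exp s) * cis \<theta>) - L) n) \<le> e"
          by (rule fe) (use d s fc[of s] in \<open>auto intro!: continuous_intros simp del: of_real_exp\<close>)
        ultimately show ?thesis by simp
      qed
      then have "\<forall>\<^sub>F s in at_left T. cmod (coeff n s - ?l) \<le> e"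
        using T d(1) unfolding eventually_at_left[OF T] by (intro exI[of _ "max 0 (T - d)"]) auto
      from tendsto_upperbound[OF 2 this] show ?thesis by simp
    qed
    then have "cmod (z n - ?l) \<le> 0" by (rule field_le_epsilon[of _ 0, simplified])
    then show ?thesis by simp
  qed
  have ct: "coeff n t = (if n = 0 then of_real (t / T) * L else 0)" for n
    unfolding c[OF t] x0 z0 by (simp add: sg_def)
  show ?thesis by (subst three_term[OF t]) (simp_all add: ct)
qed

end

context nitsche
begin

text \<open>Only the frequencies 1 and -1 survive, with outer coefficients cosh T times the inner
  ones, so h is cosh t times a fixed combination y of e^(i\<theta>) and e^(-i\<theta>). The modulus
  condition at the inner end gives |y| = 1 for every \<theta>, which forces one of the two
  coefficients to vanish.\<close>

lemma rigid:
  assumes "M = cosh T"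
  shows "\<exists>c \<sigma>. cmod c = 1 \<and> (\<sigma> = 1 \<or> \<sigma> = -1) \<and>
     (\<forall>t\<in>{0<..<T}. \<forall>\<theta>. h (of_real (exp t) * cis \<theta>) = of_real (cosh t) * c * cis (\<sigma> * \<theta>))"
proof -
  have le: "M\<^sup>2 \<le> (cosh T)\<^sup>2" using assms by simp
  note E = extremal[OF le]
  have z1: "z n = of_real (cosh T) * x n" if "\<bar>n\<bar> = 1" for n unfolding E(3) lam_Sn_1[OF that] ..
  have c1: "coeff n t = of_real (cosh t) * x n" if "\<bar>n\<bar> = 1" "t \<in> {0<..<T}" for n t
  proof -
    have "sg n (T - t) + sg n t * cosh T = cosh t"
    proof -
      have "sg n (T - t) = sinh (T - t) / sinh T" "sg n t = sinh t / sinh T"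
        using that sg_abs[of n] by auto
      moreover have "sinh (T - t) / sinh T + sinh t / sinh T * cosh T = cosh t"
        using T by (simp add: sinh_diff field_simps)
      ultimately show ?thesis by simp
    qed
    then have "of_real (sg n (T - t)) + of_real (sg n t) * of_real (cosh T) = complex_of_real (cosh t)"
      by (simp only: of_real_mult[symmetric] of_real_add[symmetric])
    then have "coeff n t = complex_of_real (cosh t) * x n"
      unfolding coeff_eq[OF that(2)] z1[OF that(1)] by (simp only: distrib_right[symmetric] mult.assoc[symmetric])
    then show ?thesis .
  qed
  have c0: "coeff n t = 0" if "\<bar>n\<bar> \<noteq> 1" "t \<in> {0<..<T}" for n t
    unfolding coeff_eq[OF that(2)] E(3) E(2)[OF that(1)] by simp
  define y where "y = (\<lambda>\<theta>. x 1 * cis \<theta> + x (-1) * cis (- \<theta>))"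
  have hy: "h (of_real (exp t) * cis \<theta>) = of_real (cosh t) * y \<theta>" if "t \<in> {0<..<T}" for t \<theta>
    by (subst three_term[OF that]) (use that c0[of _ t] c1[of _ t] in \<open>auto simp: y_def algebra_simps\<close>)
  have y1: "cmod (y \<theta>) = 1" for \<theta>
  proof -
    have ct: "((\<lambda>t. cosh t * cmod (y \<theta>)) \<longlongrightarrow> cosh 0 * cmod (y \<theta>)) (at_right 0)" by (intro tendsto_intros)
    have hc: "cmod (h (of_real (exp t) * cis \<theta>)) = cosh t * cmod (y \<theta>)" if "t \<in> {0<..<T}" for t
      unfolding hy[OF that] norm_mult norm_of_real by simp
    have "\<forall>\<^sub>F t in at_right 0. 1 \<le> cosh t * cmod (y \<theta>)"
    proof (rule eventually_right_0I[OF T])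
      fix t assume t: "0 < t" "t < T"
      show "1 \<le> cosh t * cmod (y \<theta>)"
        using lower[of "of_real (exp t) * cis \<theta>"] hc[of t] t by (simp del: of_real_exp)
    qed
    from tendsto_lowerbound[OF ct this] have 1: "1 \<le> cmod (y \<theta>)" by simp
    have "cmod (y \<theta>) \<le> 1 + e" if e: "e > 0" for e
    proof -
      obtain d where d: "d > 0" "\<And>t \<theta>. 0 < t \<and> t < d \<and> t < T \<Longrightarrow> cmod (h (of_real (exp t) * cis \<theta>)) \<le> 1 + e" using inner_limit[OF e] by blast
      have "\<forall>\<^sub>F t in at_right 0. cosh t * cmod (y \<theta>) \<le> 1 + e"
      proof (rule eventually_right_0I[of "min d T"])
        fix t assume t: "0 < t" "t < min d T"
        then show "cosh t * cmod (y \<theta>) \<le> 1 + e" using d(2)[of t \<theta>] hc[of t] by (simp del: of_real_exp)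
      qed (use d T in auto)
      from tendsto_upperbound[OF ct this] show ?thesis by simp
    qed
    then have "cmod (y \<theta>) \<le> 1" by (rule field_le_epsilon)
    then show ?thesis using 1 by simp
  qed
  define A where "A = x 1 * cnj (x (-1))"
  have sq: "(cmod (x 1))\<^sup>2 + (cmod (x (-1)))\<^sup>2 + 2 * Re (A * (cis \<theta> * cis \<theta>)) = 1" for \<theta>
  proof -
    have id: "(cmod (a * u + b * cnj u))\<^sup>2 = (cmod a)\<^sup>2 * (cmod u)\<^sup>2 + (cmod b)\<^sup>2 * (cmod u)\<^sup>2 + 2 * Re (a * cnj b * (u * u))" for a b u
      unfolding cmod_power2 by (simp add: power2_eq_square algebra_simps)
    show ?thesis using id[of "x 1" "cis \<theta>" "x (-1)"] y1[of \<theta>] unfolding y_def A_def cis_cnj by simp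
  qed
  \<comment> \<open>|y|^2 is constant plus 2 Re (A e^(2 i \<theta>)); four angles show that both
    parts of A vanish.\<close>
  have "Re A = 0" using sq[of 0] sq[of "pi / 2"] by (simp add: cis_mult)
  moreover have "Im A = 0" using sq[of "pi / 4"] sq[of "- pi / 4"] by (simp add: cis_mult)
  ultimately have "A = 0" by (simp add: complex_eq_iff)
  then consider "x (-1) = 0" | "x 1 = 0" by (auto simp: A_def)
  then show ?thesis
  proof cases
    case 1
    then have "y \<theta> = x 1 * cis (1 * \<theta>)" for \<theta> by (simp add: y_def)
    moreover from this have "cmod (x 1) = 1" using y1[of 0] by simp
    ultimately show ?thesis using hy by (intro exI[of _ "x 1"] exI[of _ 1]) (simp add: mult.assoc)
  next
    case 2
    then have "y \<theta> = x (-1) * cis (-1 * \<theta>)" for \<theta> by (simp add: y_def)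
    moreover from this have "cmod (x (-1)) = 1" using y1[of 0] by simp
    ultimately show ?thesis using hy by (intro exI[of _ "x (-1)"] exI[of _ "-1"]) (simp add: mult.assoc)
  qed
qed

end

section \<open>Geometry of the normalised conformal parametrization\<close>

lemma polar_chain:
  assumes "(f has_derivative f') (at (of_real (exp t) * cis \<theta>))"
  shows "((\<lambda>t. f (of_real (exp t) * cis \<theta>)) has_vector_derivative f' (of_real (exp t) * cis \<theta>)) (at t)"
    and "((\<lambda>\<theta>. f (of_real (exp t) * cis \<theta>)) has_vector_derivative f' (\<i> * (of_real (exp t) * cis \<theta>))) (at \<theta>)"
proof -
  let ?z = "of_real (exp t) * cis \<theta>"
  have lin: "f' (s *\<^sub>R v) = s *\<^sub>R f' v" for s v
    by (rule linear_scale[OF has_derivative_linear[OF assms]])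
  have "((\<lambda>z. exp z * cis \<theta>) has_field_derivative exp (of_real t) * cis \<theta>) (at (of_real t))"
    by (auto intro!: derivative_eq_intros)
  from has_vector_derivative_real_field[OF this]
  have 1: "((\<lambda>t. of_real (exp t) * cis \<theta>) has_vector_derivative ?z) (at t)" by (simp add: exp_of_real)
  have "((\<lambda>z. of_real (exp t) * exp (\<i> * z)) has_field_derivative \<i> * (of_real (exp t) * exp (\<i> * of_real \<theta>))) (at (of_real \<theta>))"
    by (auto intro!: derivative_eq_intros)
  from has_vector_derivative_real_field[OF this]
  have 2: "((\<lambda>\<theta>. of_real (exp t) * cis \<theta>) has_vector_derivative \<i> * ?z) (at \<theta>)" by (simp add: cis_conv_exp)
  show "((\<lambda>t. f (of_real (exp t) * cis \<theta>)) has_vector_derivative f' ?z) (at t)"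
    using has_derivative_compose[OF 1[unfolded has_vector_derivative_def] assms] unfolding has_vector_derivative_def lin .
  show "((\<lambda>\<theta>. f (of_real (exp t) * cis \<theta>)) has_vector_derivative f' (\<i> * ?z)) (at \<theta>)"
    using has_derivative_compose[OF 2[unfolded has_vector_derivative_def] assms] unfolding has_vector_derivative_def lin .
qed

lemma polar_obtain:
  assumes "z \<in> annulus 1 (exp T)"
  obtains t \<theta> where "z = of_real (exp t) * cis \<theta>" "t \<in> {0<..<T}"
proof -
  have z: "1 < cmod z" "cmod z < exp T" using assms by (auto simp: annulus_def)
  have e: "exp (ln (cmod z)) = cmod z" using z by (intro exp_ln) linarith
  have "z = of_real (exp (ln (cmod z))) * cis (Arg z)"
    unfolding e using rcis_cmod_Arg[of z] by (simp add: rcis_def)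
  moreover have "ln (cmod z) < ln (exp T)" using z by (subst ln_less_cancel_iff) auto
  then have "ln (cmod z) \<in> {0<..<T}" using ln_gt_zero[of "cmod z"] z by simp
  ultimately show thesis by (rule that)
qed

lemma arcosh_scaled: "0 < r \<Longrightarrow> r \<le> s \<Longrightarrow> arcosh (s / r) = ln ((s + sqrt (s\<^sup>2 - r\<^sup>2)) / (r::real))"
proof -
  assume r: "0 < r" "r \<le> s"
  have "sqrt ((s / r)\<^sup>2 - 1) = sqrt (s\<^sup>2 - r\<^sup>2) / r"
  proof -
    have "(s / r)\<^sup>2 - 1 = (s\<^sup>2 - r\<^sup>2) / r\<^sup>2" using r by (simp add: power_divide diff_divide_distrib)
    then show ?thesis using r by (simp add: real_sqrt_divide)
  qed
  then show ?thesis using r by (simp add: arcosh_real_def add_divide_distrib)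
qed

text \<open>The difference quotient of G is that of G^2 divided by G y + G z, and by continuity this
  sum tends to 2 G z \<noteq> 0.\<close>

lemma holomorphic_if_square_holomorphic:
  assumes A: "open A" and c: "continuous_on A G" and nz: "\<And>z. z \<in> A \<Longrightarrow> G z \<noteq> 0" and sq: "(\<lambda>z. (G z)\<^sup>2) holomorphic_on A"
  shows "G holomorphic_on A"
  unfolding holomorphic_on_open[OF A]
proof
  fix z assume z: "z \<in> A"
  obtain D where D: "((\<lambda>z. (G z)\<^sup>2) has_field_derivative D) (at z)" using sq z unfolding holomorphic_on_open[OF A] by blast
  have "isCont G z" using c z A by (simp add: continuous_on_eq_continuous_at)
  then have l: "((\<lambda>y. G y + G z) \<longlongrightarrow> G z + G z) (at z)" by (intro tendsto_intros) (simp add: isCont_def)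
  have nz2: "G z + G z \<noteq> 0" using nz[OF z] by simp
  have q: "((\<lambda>y. ((G y)\<^sup>2 - (G z)\<^sup>2) / (y - z) / (G y + G z)) \<longlongrightarrow> D / (G z + G z)) (at z)"
    by (intro tendsto_divide l nz2) (use D in \<open>simp add: has_field_derivative_iff\<close>)
  have "\<forall>\<^sub>F y in at z. G y + G z \<noteq> 0" by (rule tendsto_imp_eventually_ne[OF l nz2])
  then have "\<forall>\<^sub>F y in at z. ((G y)\<^sup>2 - (G z)\<^sup>2) / (y - z) / (G y + G z) = (G y - G z) / (y - z)"
  proof eventually_elim
    case (elim y)
    have "(G y)\<^sup>2 - (G z)\<^sup>2 = (G y - G z) * (G y + G z)" by (simp add: power2_eq_square algebra_simps)
    then show ?case using elim by simp
  qed
  from Lim_transform_eventually[OF q this] show "\<exists>D. (G has_field_derivative D) (at z)" by (auto simp: has_field_derivative_iff)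
qed

lemma linear_complex_split:
  assumes "linear (f :: complex \<Rightarrow> 'a::real_vector)"
  shows "f v = Re v *\<^sub>R f 1 + Im v *\<^sub>R f \<i>"
proof -
  have "f v = f (Re v *\<^sub>R 1 + Im v *\<^sub>R \<i>)" by (rule arg_cong[of _ _ f]) (simp add: complex_eq_iff)
  then show ?thesis by (simp only: linear_add[OF assms] linear_scale[OF assms])
qed

lemma conformal_param_compose:
  assumes F: "conformal_param D F S" and hom: "homeomorphism D' D m m'"
    and der: "\<And>z. z \<in> D' \<Longrightarrow> \<exists>d. (m has_field_derivative d) (at z) \<and> d \<noteq> 0"
  shows "conformal_param D' (F \<circ> m) S"
  unfolding conformal_param_def
proof (intro conjI ballI)
  show "\<exists>G. homeomorphism D' S (F \<circ> m) G"
    using F homeomorphism_compose[OF hom] unfolding conformal_param_def by blast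
next
  fix z assume z: "z \<in> D'"
  then have "m z \<in> D" using hom by (auto simp: homeomorphism_def)
  then obtain F' where F': "(F has_derivative F') (at (m z))" "F' 1 \<noteq> 0" "norm (F' 1) = norm (F' \<i>)" "inner (F' 1) (F' \<i>) = 0"
    using F unfolding conformal_param_def by blast
  obtain d where d: "(m has_field_derivative d) (at z)" "d \<noteq> 0" using der[OF z] by blast
  have c: "((F \<circ> m) has_derivative (\<lambda>v. F' (d * v))) (at z)"
    unfolding o_def by (rule has_derivative_compose[OF d(1)[unfolded has_field_derivative_def] F'(1)])
  note lin = linear_complex_split[OF has_derivative_linear[OF F'(1)]]
  have n2: "inner (F' 1) (F' 1) = inner (F' \<i>) (F' \<i>)" using F'(3) by (simp add: dot_square_norm)
  have i2: "inner (F' \<i>) (F' 1) = 0" using F'(4) by (simp add: inner_commute)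
  have 1: "inner (F' (d * 1)) (F' (d * 1)) = ((Re d)\<^sup>2 + (Im d)\<^sup>2) * inner (F' 1) (F' 1)"
    unfolding lin[of "d * 1"] by (simp add: inner_simps F'(4) i2 n2 power2_eq_square algebra_simps)
  have 2: "inner (F' (d * \<i>)) (F' (d * \<i>)) = ((Re d)\<^sup>2 + (Im d)\<^sup>2) * inner (F' 1) (F' 1)"
    unfolding lin[of "d * \<i>"] by (simp add: inner_simps F'(4) i2 n2 power2_eq_square algebra_simps)
  have 3: "inner (F' (d * 1)) (F' (d * \<i>)) = 0"
    unfolding lin[of "d * 1"] lin[of "d * \<i>"] by (simp add: inner_simps F'(4) i2 n2 algebra_simps)
  have "(Re d)\<^sup>2 + (Im d)\<^sup>2 \<noteq> 0" using d(2) by (simp add: complex_eq_iff sum_power2_eq_zero_iff)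
  then have "F' (d * 1) \<noteq> 0" using 1 F'(2) by auto
  moreover have "norm (F' (d * 1)) = norm (F' (d * \<i>))" unfolding norm_eq_sqrt_inner 1 2 ..
  ultimately show "\<exists>F'. ((F \<circ> m) has_derivative F') (at z) \<and> F' 1 \<noteq> 0 \<and> norm (F' 1) = norm (F' \<i>) \<and> inner (F' 1) (F' \<i>) = 0"
    using c 3 by blast
qed

lemma homeomorphism_graph_fst:
  assumes G: "homeomorphism D (graph_surface U w) P G" and cw: "continuous_on U w"
  shows "homeomorphism D U (\<lambda>z. fst (P z)) (\<lambda>\<xi>. G (\<xi>, w \<xi>))"
proof -
  have cP: "continuous_on D P" and cG: "continuous_on (graph_surface U w) G" and PD: "\<And>z. z \<in> D \<Longrightarrow> P z \<in> graph_surface U w"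
    and GP: "\<And>z. z \<in> D \<Longrightarrow> G (P z) = z" and PG: "\<And>y. y \<in> graph_surface U w \<Longrightarrow> P (G y) = y \<and> G y \<in> D"
    using G unfolding homeomorphism_def by blast+
  have gr: "(\<xi>, w \<xi>) \<in> graph_surface U w" if "\<xi> \<in> U" for \<xi> using that by (auto simp: graph_surface_def)
  have Ph: "P z = (fst (P z), w (fst (P z)))" "fst (P z) \<in> U" if "z \<in> D" for z
    using PD[OF that] by (auto simp: graph_surface_def)
  show ?thesis
  proof (rule homeomorphismI)
    show "continuous_on D (\<lambda>z. fst (P z))" by (intro continuous_intros cP)
    show "continuous_on U (\<lambda>\<xi>. G (\<xi>, w \<xi>))"
      by (rule continuous_on_compose2[OF cG]) (use gr cw in \<open>auto intro!: continuous_intros\<close>)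
    show "(\<lambda>z. fst (P z)) ` D \<subseteq> U" using Ph(2) by blast
    show "(\<lambda>\<xi>. G (\<xi>, w \<xi>)) ` U \<subseteq> D" using PG gr by blast
    show "\<And>z. z \<in> D \<Longrightarrow> G (fst (P z), w (fst (P z))) = z" using Ph(1) GP by metis
    show "\<And>\<xi>. \<xi> \<in> U \<Longrightarrow> fst (P (G (\<xi>, w \<xi>))) = \<xi>" using PG gr by simp
  qed
qed

text \<open>The normalised situation: the inner radius of the parameter annulus is 1, and
  \<open>ends\<close> says that inner and outer ends of the two annuli correspond.\<close>

locale minimal_graph_param =
  fixes T rs Rs :: real and w :: "complex \<Rightarrow> real" and Dw D2w and P :: "complex \<Rightarrow> complex \<times> real"
  assumes T: "T > 0" and rs: "0 < rs" "rs < Rs"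
    and C2: "C2_with (annulus rs Rs) w Dw D2w"
    and mse: "\<And>z. z \<in> annulus rs Rs \<Longrightarrow> (1 + (Dw z \<i>)\<^sup>2) * D2w z 1 1 - 2 * Dw z 1 * Dw z \<i> * D2w z 1 \<i>
        + (1 + (Dw z 1)\<^sup>2) * D2w z \<i> \<i> = 0"
    and param: "conformal_param (annulus 1 (exp T)) P (graph_surface (annulus rs Rs) w)"
    and ends: "\<And>e. e > 0 \<Longrightarrow> \<exists>\<delta>>0. \<forall>z\<in>annulus 1 (exp T). (cmod z < 1 + \<delta> \<longrightarrow> cmod (fst (P z)) < rs + e)
        \<and> (exp T - \<delta> < cmod z \<longrightarrow> Rs - e < cmod (fst (P z)))"
begin

abbreviation "A \<equiv> annulus 1 (exp T)"
abbreviation "B \<equiv> annulus rs Rs"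

definition h :: "complex \<Rightarrow> complex" where "h z = fst (P z)"
definition h' :: "complex \<Rightarrow> complex \<Rightarrow> complex" where "h' z v = fst (frechet_derivative P (at z) v)"
definition W' :: "complex \<Rightarrow> complex \<Rightarrow> real" where "W' z v = Dw (h z) (h' z v)"
text \<open>\<phi> is the Wirtinger derivative of h in z, and \<psi> the conjugate of its derivative
  in the conjugate variable; both will be holomorphic.\<close>

definition \<phi> :: "complex \<Rightarrow> complex" where "\<phi> z = (h' z 1 - \<i> * h' z \<i>) / 2"
definition \<psi> :: "complex \<Rightarrow> complex" where "\<psi> z = cnj ((h' z 1 + \<i> * h' z \<i>) / 2)"

lemma w_deriv: "\<xi> \<in> B \<Longrightarrow> (w has_derivative Dw \<xi>) (at \<xi>)"
  using C2 by (simp add: C2_with_def)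

lemma Dw_cont: "continuous_on B Dw"
proof (intro continuous_at_imp_continuous_on ballI)
  fix \<xi> assume "\<xi> \<in> B"
  then have "(Dw has_derivative D2w \<xi>) (at \<xi>)" using C2 by (simp add: C2_with_def)
  then show "isCont Dw \<xi>" by (rule has_derivative_continuous)
qed

lemma param_point: "z \<in> A \<Longrightarrow> h z \<in> B \<and> snd (P z) = w (h z)"
proof -
  assume "z \<in> A"
  then have "P z \<in> graph_surface B w" using param by (auto simp: conformal_param_def homeomorphism_def)
  then show ?thesis by (auto simp: graph_surface_def h_def)
qed

lemma P_deriv: "z \<in> A \<Longrightarrow> (P has_derivative frechet_derivative P (at z)) (at z)"
  unfolding frechet_derivative_works[symmetric] differentiable_def using param unfolding conformal_param_def by blast

lemma h_deriv: "z \<in> A \<Longrightarrow> (h has_derivative h' z) (at z)"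
  unfolding h_def[abs_def] h'_def[abs_def] by (rule has_derivative_fst[OF P_deriv])

lemma W_deriv: "z \<in> A \<Longrightarrow> ((\<lambda>z. w (h z)) has_derivative W' z) (at z)"
  unfolding W'_def[abs_def] by (rule has_derivative_compose[OF h_deriv w_deriv]) (use param_point in auto)

lemma P_deriv_eq: "z \<in> A \<Longrightarrow> frechet_derivative P (at z) v = (h' z v, W' z v)"
proof -
  assume z: "z \<in> A"
  have "((\<lambda>z. snd (P z)) has_derivative W' z) (at z)"
    by (rule has_derivative_transform_within_open[OF W_deriv[OF z] open_annulus z]) (use param_point in auto)
  from has_derivative_unique[OF this has_derivative_snd[OF P_deriv[OF z]]] have "W' z v = snd (frechet_derivative P (at z) v)" by (rule fun_cong)
  then show ?thesis by (simp add: h'_def prod_eq_iff)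
qed

lemma h'_lin: "z \<in> A \<Longrightarrow> h' z v = of_real (Re v) * h' z 1 + of_real (Im v) * h' z \<i>"
proof -
  assume z: "z \<in> A"
  show "h' z v = of_real (Re v) * h' z 1 + of_real (Im v) * h' z \<i>"
    using linear_complex_split[OF has_derivative_linear[OF h_deriv[OF z]], of v] by (simp only: scaleR_conv_of_real)
qed

lemma W'_lin: "z \<in> A \<Longrightarrow> W' z v = Re v * W' z 1 + Im v * W' z \<i>"
proof -
  assume z: "z \<in> A"
  show "W' z v = Re v * W' z 1 + Im v * W' z \<i>"
    using linear_complex_split[OF has_derivative_linear[OF W_deriv[OF z]], of v] by (simp only: real_scaleR_def)
qed

lemma conf:
  assumes z: "z \<in> A"
  shows "h' z 1 \<noteq> 0"
    "(cmod (h' z 1))\<^sup>2 + (W' z 1)\<^sup>2 = (cmod (h' z \<i>))\<^sup>2 + (W' z \<i>)\<^sup>2"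
    "Re (h' z 1) * Re (h' z \<i>) + Im (h' z 1) * Im (h' z \<i>) + W' z 1 * W' z \<i> = 0"
proof -
  obtain F' where F': "(P has_derivative F') (at z)" "F' 1 \<noteq> 0" "norm (F' 1) = norm (F' \<i>)" "inner (F' 1) (F' \<i>) = 0"
    using param z unfolding conformal_param_def by blast
  have "F' = frechet_derivative P (at z)" by (rule frechet_derivative_at[OF F'(1)])
  then have F: "F' v = (h' z v, W' z v)" for v using P_deriv_eq[OF z] by simp
  show "h' z 1 \<noteq> 0"
  proof
    assume 0: "h' z 1 = 0"
    then have "W' z 1 = 0" by (simp add: W'_def)
    then show False using F'(2) 0 unfolding F by (simp add: zero_prod_def)
  qed
  have "(norm (F' 1))\<^sup>2 = (norm (F' \<i>))\<^sup>2" using F'(3) by simp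
  then show "(cmod (h' z 1))\<^sup>2 + (W' z 1)\<^sup>2 = (cmod (h' z \<i>))\<^sup>2 + (W' z \<i>)\<^sup>2"
    unfolding F norm_prod_def by simp
  show "Re (h' z 1) * Re (h' z \<i>) + Im (h' z 1) * Im (h' z \<i>) + W' z 1 * W' z \<i> = 0"
    using F'(4) unfolding F by (simp add: inner_complex_def)
qed

text \<open>A conformal differential maps any orthogonal pair of equally long vectors to such a
  pair; here the pair is radial and angular, z and i z, and the image vectors are (h', W').\<close>

lemma conf_radial:
  assumes z: "z \<in> A"
  shows "(cmod (h' z z))\<^sup>2 + (W' z z)\<^sup>2 = (cmod (h' z (\<i> * z)))\<^sup>2 + (W' z (\<i> * z))\<^sup>2"
    "Re (h' z z * cnj (h' z (\<i> * z))) + W' z z * W' z (\<i> * z) = 0"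
proof -
  have alg: "((a * p1 + b * q1)\<^sup>2 + (a * p2 + b * q2)\<^sup>2) + (a * p + b * q)\<^sup>2 = ((a * q1 - b * p1)\<^sup>2 + (a * q2 - b * p2)\<^sup>2) + (a * q - b * p)\<^sup>2"
    "(a * p1 + b * q1) * (a * q1 - b * p1) + (a * p2 + b * q2) * (a * q2 - b * p2) + (a * p + b * q) * (a * q - b * p) = 0"
    if "(p1\<^sup>2 + p2\<^sup>2) + p\<^sup>2 = (q1\<^sup>2 + q2\<^sup>2) + q\<^sup>2" "p1 * q1 + p2 * q2 + p * q = 0" for a b p q p1 q1 p2 q2 :: real
  proof -
    have "(((a * p1 + b * q1)\<^sup>2 + (a * p2 + b * q2)\<^sup>2) + (a * p + b * q)\<^sup>2) - (((a * q1 - b * p1)\<^sup>2 + (a * q2 - b * p2)\<^sup>2) + (a * q - b * p)\<^sup>2)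
      = (a\<^sup>2 - b\<^sup>2) * (((p1\<^sup>2 + p2\<^sup>2) + p\<^sup>2) - ((q1\<^sup>2 + q2\<^sup>2) + q\<^sup>2)) + 4 * a * b * (p1 * q1 + p2 * q2 + p * q)"
      by (simp add: power2_eq_square algebra_simps)
    then show "((a * p1 + b * q1)\<^sup>2 + (a * p2 + b * q2)\<^sup>2) + (a * p + b * q)\<^sup>2 = ((a * q1 - b * p1)\<^sup>2 + (a * q2 - b * p2)\<^sup>2) + (a * q - b * p)\<^sup>2"
      unfolding that by simp
    have "(a * p1 + b * q1) * (a * q1 - b * p1) + (a * p2 + b * q2) * (a * q2 - b * p2) + (a * p + b * q) * (a * q - b * p)
      = (a\<^sup>2 - b\<^sup>2) * (p1 * q1 + p2 * q2 + p * q) - a * b * (((p1\<^sup>2 + p2\<^sup>2) + p\<^sup>2) - ((q1\<^sup>2 + q2\<^sup>2) + q\<^sup>2))"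
      by (simp add: power2_eq_square algebra_simps)
    then show "(a * p1 + b * q1) * (a * q1 - b * p1) + (a * p2 + b * q2) * (a * q2 - b * p2) + (a * p + b * q) * (a * q - b * p) = 0"
      unfolding that by simp
  qed
  note c = conf(2,3)[OF z, unfolded cmod_power2]
  have e: "Re (h' z z) = Re z * Re (h' z 1) + Im z * Re (h' z \<i>)" "Im (h' z z) = Re z * Im (h' z 1) + Im z * Im (h' z \<i>)"
    "Re (h' z (\<i> * z)) = Re z * Re (h' z \<i>) - Im z * Re (h' z 1)" "Im (h' z (\<i> * z)) = Re z * Im (h' z \<i>) - Im z * Im (h' z 1)"
    unfolding h'_lin[OF z, of z] h'_lin[OF z, of "\<i> * z"] by simp_all
  have f: "W' z z = Re z * W' z 1 + Im z * W' z \<i>" "W' z (\<i> * z) = Re z * W' z \<i> - Im z * W' z 1"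
    unfolding W'_lin[OF z, of z] W'_lin[OF z, of "\<i> * z"] by simp_all
  show "(cmod (h' z z))\<^sup>2 + (W' z z)\<^sup>2 = (cmod (h' z (\<i> * z)))\<^sup>2 + (W' z (\<i> * z))\<^sup>2"
    unfolding cmod_power2 e f by (rule alg(1)[OF c])
  show "Re (h' z z * cnj (h' z (\<i> * z))) + W' z z * W' z (\<i> * z) = 0"
  proof -
    have "Re (a * cnj b) = Re a * Re b + Im a * Im b" for a b by simp
    then show ?thesis using alg(2)[OF c, of "Re z" "Im z"] by (simp only: e f)
  qed
qed

lemma homeo: "\<exists>g. homeomorphism A B h g"
proof -
  obtain G where G: "homeomorphism A (graph_surface B w) P G" using param by (auto simp: conformal_param_def)
  have "continuous_on B w" using w_deriv has_derivative_continuous by (blast intro!: continuous_at_imp_continuous_on)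
  from homeomorphism_graph_fst[OF G this] show ?thesis unfolding h_def[abs_def] by blast
qed

lemma h_inj: "inj_on h A"
proof -
  obtain g where "homeomorphism A B h g" using homeo by blast
  then show ?thesis by (intro inj_on_inverseI[of A g h]) (auto simp: homeomorphism_def)
qed

lemma h'_eq: "z \<in> A \<Longrightarrow> h' z v = \<phi> z * v + cnj (\<psi> z * v)"
proof -
  assume z: "z \<in> A"
  have "\<phi> z * v + cnj (\<psi> z * v) = of_real (Re v) * h' z 1 + of_real (Im v) * h' z \<i>"
    unfolding \<phi>_def \<psi>_def by (simp add: complex_eq_iff field_simps)
  then show "h' z v = \<phi> z * v + cnj (\<psi> z * v)" using h'_lin[OF z, of v] by (simp only:)
qed

text \<open>Near each point h = u + cnj v with u and v holomorphic. As \<phi> and \<psi> depend only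
  on the differential of h, they agree there with the derivatives of u and v.\<close>

lemma hol: "\<phi> holomorphic_on A" "\<psi> holomorphic_on A"
proof -
  have "\<exists>d d'. (\<phi> has_field_derivative d) (at z0) \<and> (\<psi> has_field_derivative d') (at z0)" if z0: "z0 \<in> A" for z0
  proof -
    obtain r u v where r: "r > 0" "ball z0 r \<subseteq> A" and u: "u holomorphic_on ball z0 r" and v: "v holomorphic_on ball z0 r"
      and huv: "\<And>z. z \<in> ball z0 r \<Longrightarrow> h z = u z + cnj (v z)"
      using conformal_graph_harmonic_locally[OF C2 open_annulus open_annulus z0 mse _ h_inj h_deriv] param_point conf
      unfolding W'_def by blast
    have eq: "\<phi> z = deriv u z \<and> \<psi> z = deriv v z" if z: "z \<in> ball z0 r" for z
    proof -
      have du: "(u has_derivative (\<lambda>d. deriv u z * d)) (at z)" "(v has_derivative (\<lambda>d. deriv v z * d)) (at z)"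
        using u v z by (auto intro!: holomorphic_derivI has_field_derivative_imp_has_derivative)
      have "((\<lambda>z. u z + cnj (v z)) has_derivative (\<lambda>d. deriv u z * d + cnj (deriv v z * d))) (at z)"
        by (intro has_derivative_add du(1) has_derivative_cnj du(2))
      then have "(h has_derivative (\<lambda>d. deriv u z * d + cnj (deriv v z * d))) (at z)"
        by (rule has_derivative_transform_within_open[OF _ open_ball z]) (simp add: huv)
      from has_derivative_unique[OF h_deriv this] have "h' z = (\<lambda>d. deriv u z * d + cnj (deriv v z * d))" using z r by blast
      then have "h' z 1 = deriv u z * 1 + cnj (deriv v z * 1)" "h' z \<i> = deriv u z * \<i> + cnj (deriv v z * \<i>)" by auto
      then show ?thesis unfolding \<phi>_def \<psi>_def by (simp add: complex_eq_iff)
    qed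
    have z00: "z0 \<in> ball z0 r" using r by simp
    have "deriv u holomorphic_on ball z0 r" "deriv v holomorphic_on ball z0 r"
      using u v by (auto intro: holomorphic_deriv)
    then obtain d d' where "(deriv u has_field_derivative d) (at z0)" "(deriv v has_field_derivative d') (at z0)"
      unfolding holomorphic_on_open[OF open_ball] using z00 by blast
    then have "(\<phi> has_field_derivative d) (at z0)" "(\<psi> has_field_derivative d') (at z0)"
      using eq by (auto intro: has_field_derivative_transform_within_open[OF _ open_ball z00])
    then show ?thesis by blast
  qed
  then show "\<phi> holomorphic_on A" "\<psi> holomorphic_on A" unfolding holomorphic_on_open[OF open_annulus] by blast+
qed

lemma scaled_harmonic: "annulus_harmonic T (\<lambda>z. h z / of_real rs) (\<lambda>z. \<phi> z / of_real rs) (\<lambda>z. \<psi> z / of_real rs)"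
proof
  show "T > 0" by (rule T)
  show "(\<lambda>z. \<phi> z / of_real rs) holomorphic_on A" "(\<lambda>z. \<psi> z / of_real rs) holomorphic_on A"
    using rs by (auto intro!: holomorphic_intros hol)
  fix z assume z: "z \<in> A"
  have "((\<lambda>z. h z / of_real rs) has_derivative (\<lambda>v. h' z v / of_real rs)) (at z)"
    by (rule bounded_linear.has_derivative[OF bounded_linear_divide h_deriv[OF z]])
  then show "((\<lambda>z. h z / of_real rs) has_derivative (\<lambda>v. \<phi> z / of_real rs * v + cnj (\<psi> z / of_real rs * v))) (at z)"
    unfolding h'_eq[OF z] by (simp add: add_divide_distrib)
qed

lemma h_range: "z \<in> A \<Longrightarrow> rs < cmod (h z) \<and> cmod (h z) < Rs"
  using param_point by (auto simp: annulus_def)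

lemma ends_h: "e > 0 \<Longrightarrow> \<exists>\<delta>>0. \<forall>z\<in>A. (cmod z < 1 + \<delta> \<longrightarrow> cmod (h z) < rs + e) \<and> (exp T - \<delta> < cmod z \<longrightarrow> Rs - e < cmod (h z))"
  using ends unfolding h_def .

lemma inner_end:
  assumes "e > 0"
  shows "\<exists>d>0. \<forall>t \<theta>. 0 < t \<and> t < d \<and> t < T \<longrightarrow> cmod (h (of_real (exp t) * cis \<theta>)) < rs + e"
proof -
  obtain \<delta> where \<delta>: "\<delta> > 0" "\<And>z. z \<in> A \<Longrightarrow> cmod z < 1 + \<delta> \<Longrightarrow> cmod (h z) < rs + e" using ends_h[OF assms] by blast
  show ?thesis
  proof (intro exI[of _ "ln (1 + \<delta>)"] conjI allI impI)
    show "0 < ln (1 + \<delta>)" using \<delta> by simp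
    fix t \<theta> assume t: "0 < t \<and> t < ln (1 + \<delta>) \<and> t < T"
    have "exp t < exp (ln (1 + \<delta>))" using t by (subst exp_less_cancel_iff) simp
    then show "cmod (h (of_real (exp t) * cis \<theta>)) < rs + e" using \<delta> t by (intro \<delta>(2)) (simp_all add: norm_mult del: of_real_exp)
  qed
qed

lemma outer_end:
  assumes "e > 0"
  shows "\<exists>d>0. \<forall>t \<theta>. 0 < t \<and> T - d < t \<and> t < T \<longrightarrow> Rs - e < cmod (h (of_real (exp t) * cis \<theta>))"
proof -
  obtain \<delta>0 where \<delta>0: "\<delta>0 > 0" "\<And>z. z \<in> A \<Longrightarrow> exp T - \<delta>0 < cmod z \<Longrightarrow> Rs - e < cmod (h z)" using ends_h[OF assms] by blast
  define \<delta> where "\<delta> = min \<delta>0 (exp T / 2)"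
  have \<delta>: "\<delta> > 0" "exp T - \<delta> > 0" "exp T - \<delta> < exp T" "\<delta> \<le> \<delta>0" using \<delta>0 by (auto simp: \<delta>_def min_def)
  show ?thesis
  proof (intro exI[of _ "T - ln (exp T - \<delta>)"] conjI allI impI)
    have "ln (exp T - \<delta>) < ln (exp T)" using \<delta> by (subst ln_less_cancel_iff) auto
    then show "0 < T - ln (exp T - \<delta>)" by simp
    fix t \<theta> assume t: "0 < t \<and> T - (T - ln (exp T - \<delta>)) < t \<and> t < T"
    then have "exp (ln (exp T - \<delta>)) < exp t" by (subst exp_less_cancel_iff) simp
    then show "Rs - e < cmod (h (of_real (exp t) * cis \<theta>))" using \<delta> t by (intro \<delta>0(2)) (simp_all add: norm_mult del: of_real_exp)
  qed
qed

lemma nitsche_instance: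
  "\<exists>x z. nitsche T (\<lambda>z. h z / of_real rs) (\<lambda>z. \<phi> z / of_real rs) (\<lambda>z. \<psi> z / of_real rs) x z (Rs / rs)"
proof -
  interpret H: annulus_harmonic T "\<lambda>z. h z / of_real rs" "\<lambda>z. \<phi> z / of_real rs" "\<lambda>z. \<psi> z / of_real rs" by (rule scaled_harmonic)
  obtain x z where xz: "\<forall>n. \<forall>t\<in>{0<..<T}. H.coeff n t = of_real (H.sg n (T - t)) * x n + of_real (H.sg n t) * z n"
    using H.coeff_boundary_values by (elim exE)
  obtain g where g: "homeomorphism A B h g" using homeo by blast
  have "nitsche T (\<lambda>z. h z / of_real rs) (\<lambda>z. \<phi> z / of_real rs) (\<lambda>z. \<psi> z / of_real rs) x z (Rs / rs)"
  proof
    show "H.coeff n t = of_real (H.sg n (T - t)) * x n + of_real (H.sg n t) * z n" if "t \<in> {0<..<T}" for n t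
      using xz that by blast
    show "1 \<le> cmod (h u / of_real rs)" if "u \<in> A" for u using h_range[OF that] rs by (simp add: norm_divide)
    show "cmod (h u / of_real rs) \<le> Rs / rs" if "u \<in> A" for u using h_range[OF that] rs by (simp add: norm_divide divide_right_mono)
    show "\<exists>d>0. \<forall>t \<theta>. 0 < t \<and> t < d \<and> t < T \<longrightarrow> cmod (h (of_real (exp t) * cis \<theta>) / of_real rs) \<le> 1 + e" if e: "e > 0" for e
    proof -
      obtain d where d: "d > 0" "\<And>t \<theta>. 0 < t \<and> t < d \<and> t < T \<Longrightarrow> cmod (h (of_real (exp t) * cis \<theta>)) < rs + rs * e"
        using inner_end[of "rs * e"] e rs by auto
      have "cmod (h (of_real (exp t) * cis \<theta>) / of_real rs) \<le> 1 + e" if "0 < t \<and> t < d \<and> t < T" for t \<theta>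
        using d(2)[OF that, of \<theta>] rs by (simp add: norm_divide pos_divide_le_eq algebra_simps del: of_real_exp)
      then show ?thesis using d(1) by blast
    qed
    show "\<not> (\<exists>q. continuous_on A q \<and> (\<forall>u\<in>A. h u / of_real rs = exp (q u)))"
    proof
      assume "\<exists>q. continuous_on A q \<and> (\<forall>u\<in>A. h u / of_real rs = exp (q u))"
      then obtain q where q: "continuous_on A q" "\<And>u. u \<in> A \<Longrightarrow> h u / of_real rs = exp (q u)" by blast
      \<comment> \<open>A circle inside the target annulus. Pulling a logarithm of h back by the
        inverse g would give a logarithm of the identity (up to scale) on this circle.\<close>
      let ?r = "(rs + Rs) / 2"
      have SB: "sphere 0 ?r \<subseteq> B" using rs by (auto simp: annulus_def)
      have gA: "g \<xi> \<in> A" "h (g \<xi>) = \<xi>" if "\<xi> \<in> B" for \<xi> using g that by (auto simp: homeomorphism_def)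
      have "continuous_on B g" using g by (simp add: homeomorphism_def)
      then have cg: "continuous_on (sphere 0 ?r) g" by (rule continuous_on_subset[OF _ SB])
      have c: "continuous_on (sphere 0 ?r) (\<lambda>\<xi>. q (g \<xi>))"
      proof (rule continuous_on_compose2[OF q(1) cg])
        show "g ` sphere 0 ?r \<subseteq> A" using SB gA(1) by blast
      qed
      have e: "exp (q (g \<xi>)) = \<xi> / of_real rs" if "cmod \<xi> = ?r" for \<xi>
      proof -
        have "\<xi> \<in> B" using SB that by (auto simp: sphere_def dist_norm)
        then show ?thesis using q(2)[of "g \<xi>"] gA[of \<xi>] by simp
      qed
      show False by (rule no_logarithm_on_circle[OF c e]) (use rs in auto)
    qed
  qed
  then show ?thesis by blast
qed

lemma cosh_bound: "cosh T \<le> Rs / rs"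
proof -
  obtain x z where "nitsche T (\<lambda>z. h z / of_real rs) (\<lambda>z. \<phi> z / of_real rs) (\<lambda>z. \<psi> z / of_real rs) x z (Rs / rs)"
    using nitsche_instance by blast
  then show ?thesis by (rule nitsche.cosh_le)
qed

lemma cont_h': "continuous_on A (\<lambda>z. h' z (k * z))" "continuous_on A (\<lambda>z. h' z k)"
proof -
  have c: "continuous_on A \<phi>" "continuous_on A \<psi>" using hol holomorphic_on_imp_continuous_on by blast+
  have "continuous_on A (\<lambda>z. \<phi> z * (k * z) + cnj (\<psi> z * (k * z)))" "continuous_on A (\<lambda>z. \<phi> z * k + cnj (\<psi> z * k))"
    by (intro continuous_intros c)+
  then show "continuous_on A (\<lambda>z. h' z (k * z))" "continuous_on A (\<lambda>z. h' z k)"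
    by (elim continuous_on_eq, simp add: h'_eq)+
qed

lemma cont_h: "continuous_on A h"
  using h_deriv has_derivative_continuous by (blast intro!: continuous_at_imp_continuous_on)

lemma cont_W': "continuous_on A (\<lambda>z. W' z (k * z))" "continuous_on A (\<lambda>z. W' z k)"
proof -
  have c: "continuous_on A (\<lambda>z. Dw (h z))"
    by (rule continuous_on_compose2[OF Dw_cont cont_h]) (use param_point in auto)
  show "continuous_on A (\<lambda>z. W' z (k * z))" "continuous_on A (\<lambda>z. W' z k)"
    unfolding W'_def by (intro bounded_bilinear.continuous_on[OF bounded_bilinear_blinfun_apply] c cont_h')+
qed

lemma connected_A: "connected A"
  using connected_annulus(1)[of 1 "0::complex" "exp T"] by (simp add: annulus_def)

end

section \<open>The catenoid and the case of equality\<close>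

text \<open>In the application e, m, k are the position h, its radial and its angular derivative. As
  k is nonzero and orthogonal to e and m in the plane, e and m are parallel; so their inner product
  determines |m|, the conformality relation determines |k| = a |e|, and k is the position vector
  turned by a right angle times a or -a.\<close>

lemma rotation_speed:
  fixes e1 e2 k1 k2 m1 m2 r a C S :: real
  assumes ek: "e1 * k1 + e2 * k2 = 0" and mk: "m1 * k1 + m2 * k2 = 0" and em: "e1 * m1 + e2 * m2 = r\<^sup>2 * a * C * S"
    and e: "e1\<^sup>2 + e2\<^sup>2 = r\<^sup>2 * C\<^sup>2" and k: "(m1\<^sup>2 + m2\<^sup>2) + r\<^sup>2 * a\<^sup>2 = k1\<^sup>2 + k2\<^sup>2"
    and CS: "C\<^sup>2 = 1 + S\<^sup>2" and pos: "r > 0" "a > 0"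
  shows "(k2 * e1 - k1 * e2)\<^sup>2 = (a * (r\<^sup>2 * C\<^sup>2))\<^sup>2"
    "k1 * (r\<^sup>2 * C\<^sup>2) = - ((k2 * e1 - k1 * e2) * e2)" "k2 * (r\<^sup>2 * C\<^sup>2) = (k2 * e1 - k1 * e2) * e1"
proof -
  define d where "d = e1 * m2 - e2 * m1"
  have "d * k1 = m2 * (e1 * k1 + e2 * k2) - e2 * (m1 * k1 + m2 * k2)" unfolding d_def by (simp add: algebra_simps)
  then have d1: "d * k1 = 0" unfolding ek mk by simp
  have "d * k2 = e1 * (m1 * k1 + m2 * k2) - m1 * (e1 * k1 + e2 * k2)" unfolding d_def by (simp add: algebra_simps)
  then have d2: "d * k2 = 0" unfolding ek mk by simp
  have "r\<^sup>2 * a\<^sup>2 > 0" using pos by simp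
  then have "k1\<^sup>2 + k2\<^sup>2 > 0" using k zero_le_power2[of m1] zero_le_power2[of m2] by linarith
  then have d0: "d = 0" using d1 d2 by auto
  have C: "C\<^sup>2 > 0" using CS by (smt (verit) zero_le_power2)
  have "(e1\<^sup>2 + e2\<^sup>2) * (m1\<^sup>2 + m2\<^sup>2) = (e1 * m1 + e2 * m2)\<^sup>2 + d\<^sup>2"
    unfolding d_def by (simp add: power2_eq_square algebra_simps)
  then have "(r\<^sup>2 * C\<^sup>2) * (m1\<^sup>2 + m2\<^sup>2) = (r\<^sup>2 * a * C * S)\<^sup>2" unfolding e em d0 by simp
  also have "\<dots> = (r\<^sup>2 * C\<^sup>2) * (r\<^sup>2 * a\<^sup>2 * S\<^sup>2)" by (simp add: power2_eq_square)
  finally have "m1\<^sup>2 + m2\<^sup>2 = r\<^sup>2 * a\<^sup>2 * S\<^sup>2" using C pos by simp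
  then have kk: "k1\<^sup>2 + k2\<^sup>2 = r\<^sup>2 * a\<^sup>2 * C\<^sup>2" unfolding k[symmetric] CS by (simp add: algebra_simps)
  have "(k2 * e1 - k1 * e2)\<^sup>2 = (k1\<^sup>2 + k2\<^sup>2) * (e1\<^sup>2 + e2\<^sup>2) - (e1 * k1 + e2 * k2)\<^sup>2"
    by (simp add: power2_eq_square algebra_simps)
  also have "\<dots> = (a * (r\<^sup>2 * C\<^sup>2))\<^sup>2" unfolding ek kk e by (simp add: power2_eq_square)
  finally show "(k2 * e1 - k1 * e2)\<^sup>2 = (a * (r\<^sup>2 * C\<^sup>2))\<^sup>2" .
  have "k1 * (e1\<^sup>2 + e2\<^sup>2) = - ((k2 * e1 - k1 * e2) * e2) + e1 * (e1 * k1 + e2 * k2)"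
    by (simp add: power2_eq_square algebra_simps)
  then show "k1 * (r\<^sup>2 * C\<^sup>2) = - ((k2 * e1 - k1 * e2) * e2)" unfolding e ek by simp
  have "k2 * (e1\<^sup>2 + e2\<^sup>2) = (k2 * e1 - k1 * e2) * e1 + e2 * (e1 * k1 + e2 * k2)"
    by (simp add: power2_eq_square algebra_simps)
  then show "k2 * (r\<^sup>2 * C\<^sup>2) = (k2 * e1 - k1 * e2) * e1" unfolding e ek by simp
qed

text \<open>Two plane vectors orthogonal to a common nonzero vector are parallel; being also
  orthogonal to each other and of equal length they vanish.\<close>

lemma orthogonal_frame_zero:
  fixes e1 e2 p1 p2 q1 q2 :: real
  assumes "e1 * p1 + e2 * p2 = 0" "e1 * q1 + e2 * q2 = 0" "p1 * q1 + p2 * q2 = 0" "p1\<^sup>2 + p2\<^sup>2 = q1\<^sup>2 + q2\<^sup>2" "e1 \<noteq> 0 \<or> e2 \<noteq> 0"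
  shows "p1 = 0 \<and> p2 = 0"
proof -
  define d where "d = p1 * q2 - p2 * q1"
  have "d * e1 = q2 * (e1 * p1 + e2 * p2) - p2 * (e1 * q1 + e2 * q2)" unfolding d_def by (simp add: algebra_simps)
  moreover have "d * e2 = p1 * (e1 * q1 + e2 * q2) - q1 * (e1 * p1 + e2 * p2)" unfolding d_def by (simp add: algebra_simps)
  ultimately have "d = 0" using assms by auto
  moreover have "(p1\<^sup>2 + p2\<^sup>2) * (q1\<^sup>2 + q2\<^sup>2) = (p1 * q1 + p2 * q2)\<^sup>2 + d\<^sup>2" unfolding d_def by (simp add: power2_eq_square algebra_simps)
  ultimately have "(p1\<^sup>2 + p2\<^sup>2) * (p1\<^sup>2 + p2\<^sup>2) = 0" using assms by simp
  then show ?thesis by (simp add: sum_power2_eq_zero_iff)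
qed

lemma cis_vector_derivative:
  "((\<lambda>\<theta>. c * cis (\<sigma> * \<theta>)) has_vector_derivative \<i> * of_real \<sigma> * (c * cis (\<sigma> * \<theta>))) (at \<theta>)"
proof -
  have "((\<lambda>z. c * exp (\<i> * of_real \<sigma> * z)) has_field_derivative \<i> * of_real \<sigma> * (c * exp (\<i> * of_real \<sigma> * of_real \<theta>))) (at (of_real \<theta>))"
    by (auto intro!: derivative_eq_intros)
  from has_vector_derivative_real_field[OF this] show ?thesis by (simp add: cis_conv_exp mult.assoc)
qed

lemma arcosh_nonneg_if: "1 \<le> x \<Longrightarrow> 0 \<le> arcosh (x::real)"
proof -
  assume x: "1 \<le> x"
  then have "0 \<le> sqrt (x\<^sup>2 - 1)" by simp
  then have "1 \<le> x + sqrt (x\<^sup>2 - 1)" using x by linarith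
  then show ?thesis using x by (simp add: arcosh_real_def ln_ge_zero)
qed

context minimal_graph_param
begin

definition pt :: "real \<Rightarrow> real \<Rightarrow> complex" where "pt t \<theta> = of_real (exp t) * cis \<theta>"

lemma pt_in: "pt t \<theta> \<in> A \<longleftrightarrow> t \<in> {0<..<T}"
  unfolding pt_def by (rule annulus_polar)

lemma polar_derivs:
  assumes "t \<in> {0<..<T}"
  shows "((\<lambda>t. h (pt t \<theta>)) has_vector_derivative h' (pt t \<theta>) (pt t \<theta>)) (at t)"
    "((\<lambda>\<theta>. h (pt t \<theta>)) has_vector_derivative h' (pt t \<theta>) (\<i> * pt t \<theta>)) (at \<theta>)"
    "((\<lambda>t. w (h (pt t \<theta>))) has_vector_derivative W' (pt t \<theta>) (pt t \<theta>)) (at t)"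
    "((\<lambda>\<theta>. w (h (pt t \<theta>))) has_vector_derivative W' (pt t \<theta>) (\<i> * pt t \<theta>)) (at \<theta>)"
proof -
  have z: "pt t \<theta> \<in> A" using assms pt_in by blast
  note H = h_deriv[OF z] and W = W_deriv[OF z]
  show "((\<lambda>t. h (pt t \<theta>)) has_vector_derivative h' (pt t \<theta>) (pt t \<theta>)) (at t)"
    using polar_chain(1)[OF H[unfolded pt_def]] unfolding pt_def .
  show "((\<lambda>\<theta>. h (pt t \<theta>)) has_vector_derivative h' (pt t \<theta>) (\<i> * pt t \<theta>)) (at \<theta>)"
    using polar_chain(2)[OF H[unfolded pt_def]] unfolding pt_def .
  show "((\<lambda>t. w (h (pt t \<theta>))) has_vector_derivative W' (pt t \<theta>) (pt t \<theta>)) (at t)"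
    using polar_chain(1)[OF W[unfolded pt_def]] unfolding pt_def .
  show "((\<lambda>\<theta>. w (h (pt t \<theta>))) has_vector_derivative W' (pt t \<theta>) (\<i> * pt t \<theta>)) (at \<theta>)"
    using polar_chain(2)[OF W[unfolded pt_def]] unfolding pt_def .
qed

text \<open>For h = rs cosh t times a unit vector turning at unit speed, conformality reads W_t^2 =
  rs^2 + W_\<theta>^2 and W_t W_\<theta> = 0, where W is the height. Hence W_\<theta> = 0 and W_t =
  rs or -rs with a constant sign, so the height is linear in t = arcosh (|h| / rs).\<close>

lemma extremal_imp_catenoid:
  assumes ext: "cosh T = Rs / rs"
  shows "\<exists>c s. (s = 1 \<or> s = -1) \<and> (\<forall>\<xi>\<in>B. w \<xi> = c + s * rs * arcosh (cmod \<xi> / rs))"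
proof -
  obtain x z where "nitsche T (\<lambda>z. h z / of_real rs) (\<lambda>z. \<phi> z / of_real rs) (\<lambda>z. \<psi> z / of_real rs) x z (Rs / rs)"
    using nitsche_instance by (elim exE)
  from nitsche.rigid[OF this ext[symmetric]] obtain c \<sigma> where c: "cmod c = 1" and \<sigma>: "\<sigma> = 1 \<or> \<sigma> = -1"
    and hc: "\<forall>t\<in>{0<..<T}. \<forall>\<theta>. h (of_real (exp t) * cis \<theta>) / of_real rs = of_real (cosh t) * c * cis (\<sigma> * \<theta>)"
    by (elim exE conjE)
  define u where "u = (\<lambda>\<theta>. c * cis (\<sigma> * \<theta>))"
  have u1: "cmod (u \<theta>) = 1" for \<theta> using c by (simp add: u_def norm_mult)
  have s2: "\<sigma>\<^sup>2 = 1" using \<sigma> by auto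
  have hp: "h (pt t \<theta>) = (rs * cosh t) *\<^sub>R u \<theta>" if "t \<in> {0<..<T}" for t \<theta>
  proof -
    have "h (pt t \<theta>) / of_real rs = of_real (cosh t) * u \<theta>" using hc that unfolding pt_def u_def mult.assoc by blast
    moreover have "h (pt t \<theta>) = of_real rs * (h (pt t \<theta>) / of_real rs)" using rs by simp
    ultimately show ?thesis by (simp add: scaleR_conv_of_real mult.assoc)
  qed
  have WP: "(W' (pt t \<theta>) (pt t \<theta>))\<^sup>2 = rs\<^sup>2 \<and> W' (pt t \<theta>) (\<i> * pt t \<theta>) = 0" if t: "t \<in> {0<..<T}" for t \<theta>
  proof -
    have z: "pt t \<theta> \<in> A" using t pt_in by blast
    have "((\<lambda>t. rs * cosh t) has_real_derivative rs * sinh t) (at t)" by (auto intro!: derivative_eq_intros)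
    from has_vector_derivative_scaleR[OF this has_vector_derivative_const[of "u \<theta>"]]
    have "((\<lambda>t. (rs * cosh t) *\<^sub>R u \<theta>) has_vector_derivative (rs * sinh t) *\<^sub>R u \<theta>) (at t)" by simp
    then have "((\<lambda>t. h (pt t \<theta>)) has_vector_derivative (rs * sinh t) *\<^sub>R u \<theta>) (at t)"
      by (rule has_vector_derivative_transform_within_open[of _ _ _ "{0<..<T}"]) (use t hp in auto)
    from vector_derivative_unique_at[OF polar_derivs(1)[OF t] this]
    have m: "h' (pt t \<theta>) (pt t \<theta>) = (rs * sinh t) *\<^sub>R u \<theta>" .
    have "((\<lambda>\<theta>. (rs * cosh t) *\<^sub>R u \<theta>) has_vector_derivative (rs * cosh t) *\<^sub>R (\<i> * of_real \<sigma> * u \<theta>)) (at \<theta>)"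
      unfolding u_def by (rule bounded_linear.has_vector_derivative[OF bounded_linear_scaleR_right cis_vector_derivative])
    then have "((\<lambda>\<theta>. h (pt t \<theta>)) has_vector_derivative (rs * cosh t) *\<^sub>R (\<i> * of_real \<sigma> * u \<theta>)) (at \<theta>)"
      unfolding hp[OF t] .
    from vector_derivative_unique_at[OF polar_derivs(2)[OF t] this]
    have k: "h' (pt t \<theta>) (\<i> * pt t \<theta>) = (rs * cosh t) *\<^sub>R (\<i> * of_real \<sigma> * u \<theta>)" .
    have "(cmod ((rs * sinh t) *\<^sub>R u \<theta>))\<^sup>2 = rs\<^sup>2 * (sinh t)\<^sup>2" by (simp add: u1 power_mult_distrib)
    moreover have "(cmod ((rs * cosh t) *\<^sub>R (\<i> * of_real \<sigma> * u \<theta>)))\<^sup>2 = rs\<^sup>2 * (cosh t)\<^sup>2"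
      by (simp add: u1 norm_mult power_mult_distrib s2)
    moreover have "Re ((rs * sinh t) *\<^sub>R u \<theta> * cnj ((rs * cosh t) *\<^sub>R (\<i> * of_real \<sigma> * u \<theta>))) = 0"
      by (simp add: algebra_simps)
    ultimately have 1: "rs\<^sup>2 * (sinh t)\<^sup>2 + (W' (pt t \<theta>) (pt t \<theta>))\<^sup>2 = rs\<^sup>2 * (cosh t)\<^sup>2 + (W' (pt t \<theta>) (\<i> * pt t \<theta>))\<^sup>2"
      and 2: "W' (pt t \<theta>) (pt t \<theta>) * W' (pt t \<theta>) (\<i> * pt t \<theta>) = 0"
      using conf_radial[OF z] unfolding m k by linarith+
    have 3: "(W' (pt t \<theta>) (pt t \<theta>))\<^sup>2 = rs\<^sup>2 + (W' (pt t \<theta>) (\<i> * pt t \<theta>))\<^sup>2"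
      using 1 unfolding cosh_square_eq by (simp add: algebra_simps)
    have "rs\<^sup>2 > 0" using rs by simp
    then have "W' (pt t \<theta>) (pt t \<theta>) \<noteq> 0" using 3 by (smt (verit) zero_le_power2 zero_power2)
    then show ?thesis using 2 3 by simp
  qed
  have WA: "(W' z (1 * z))\<^sup>2 = rs\<^sup>2" if "z \<in> A" for z
    using polar_obtain[OF that] WP unfolding pt_def by (metis mult_1)
  have "(\<forall>z\<in>A. W' z (1 * z) = rs) \<or> (\<forall>z\<in>A. W' z (1 * z) = - rs)"
    by (rule sign_constant[OF connected_A cont_W'(1) rs(1) WA])
  then have "\<exists>s. (s = 1 \<or> s = -1) \<and> (\<forall>z\<in>A. W' z z = s * rs)"
    by (elim disjE) (rule exI[of _ 1], simp, rule exI[of _ "-1"], simp)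
  then obtain s where s: "s = 1 \<or> s = -1" "\<And>z. z \<in> A \<Longrightarrow> W' z z = s * rs" by blast
  have c\<theta>: "w (h (pt t \<theta>)) = w (h (pt t 0))" if t: "t \<in> {0<..<T}" for t \<theta>
  proof -
    have "((\<lambda>\<theta>. w (h (pt t \<theta>))) has_real_derivative 0) (at y)" for y
      using polar_derivs(4)[OF t, of y] WP[OF t, of y] by (simp add: has_real_derivative_iff_has_vector_derivative)
    then show ?thesis by (intro DERIV_isconst_all) auto
  qed
  have "\<exists>c0. \<forall>t\<in>{0<..<T}. w (h (pt t 0)) - s * rs * t = c0"
  proof (rule has_vector_derivative_zero_constant[of "{0<..<T}" "\<lambda>t. w (h (pt t 0)) - s * rs * t"])
    fix t assume t: "t \<in> {0<..<T}"
    have "((\<lambda>t. s * rs * t) has_vector_derivative s * rs) (at t)"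
      unfolding has_real_derivative_iff_has_vector_derivative[symmetric] by (auto intro!: derivative_eq_intros)
    from has_vector_derivative_diff[OF polar_derivs(3)[OF t, of 0] this]
    have "((\<lambda>t. w (h (pt t 0)) - s * rs * t) has_vector_derivative 0) (at t)" using s(2)[of "pt t 0"] t pt_in[of t 0] by simp
    then show "((\<lambda>t. w (h (pt t 0)) - s * rs * t) has_vector_derivative 0) (at t within {0<..<T})" by (rule has_vector_derivative_at_within)
  qed auto
  then obtain c0 where c0: "\<And>t. t \<in> {0<..<T} \<Longrightarrow> w (h (pt t 0)) - s * rs * t = c0" by blast
  have "w \<xi> = c0 + s * rs * arcosh (cmod \<xi> / rs)" if \<xi>: "\<xi> \<in> B" for \<xi>
  proof -
    obtain g where "homeomorphism A B h g" using homeo by blast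
    then have "g \<xi> \<in> A" "h (g \<xi>) = \<xi>" using \<xi> by (auto simp: homeomorphism_def)
    then obtain t \<theta> where t: "t \<in> {0<..<T}" "\<xi> = h (pt t \<theta>)"
      using polar_obtain[of "g \<xi>" T] unfolding pt_def by metis
    have "cmod \<xi> = rs * cosh t" unfolding t(2) hp[OF t(1)] using rs by (simp add: u1)
    then have "arcosh (cmod \<xi> / rs) = t" using rs t by (simp add: arcosh_cosh_real)
    then show ?thesis using c0[OF t(1)] c\<theta>[OF t(1), of \<theta>] unfolding t(2) by simp
  qed
  then show ?thesis using s(1) by blast
qed

text \<open>The function V = arcosh (|h| / rs) is an affine function of the height and turns out to
  be harmonic with limits 0 and L = arcosh (Rs / rs) at the ends, so V = a t with a = L / T. On a
  fixed circle h then moves with constant angular speed a or -a about the origin, and injectivity on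
  the circle gives a \<le> 1.\<close>

lemma catenoid_imp_extremal:
  assumes s: "s = 1 \<or> s = -1" and cat: "\<And>\<xi>. \<xi> \<in> B \<Longrightarrow> w \<xi> = c + s * rs * arcosh (cmod \<xi> / rs)"
  shows "Rs / rs \<le> cosh T"
proof -
  define V where "V = (\<lambda>z. s * (w (h z) - c) / rs)"
  define L where "L = arcosh (Rs / rs)"
  define a where "a = L / T"
  have ss: "s * s = 1" using s by auto
  have R1: "1 < Rs / rs" using rs by simp
  have cL: "cosh L = Rs / rs" using R1 by (simp add: L_def)
  have L0: "L \<ge> 0" using R1 by (simp add: L_def arcosh_nonneg_if)
  have "L \<noteq> 0" using cL R1 by auto
  then have L: "L > 0" using L0 by simp
  have a: "a > 0" using L T by (simp add: a_def)
  have Va: "V z = arcosh (cmod (h z) / rs)" if "z \<in> A" for z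
  proof -
    have "s * (s * rs * q) / rs = (s * s) * q" for q using rs by simp
    then show ?thesis using cat[of "h z"] param_point[OF that] ss by (simp add: V_def)
  qed
  have hr: "1 < cmod (h z) / rs" if "z \<in> A" for z using h_range[OF that] rs by simp
  have Vc: "cosh (V z) = cmod (h z) / rs" "V z \<ge> 0" if "z \<in> A" for z
    using hr[OF that] by (simp_all add: Va[OF that] arcosh_nonneg_if)
  have Vd: "(V has_derivative (\<lambda>v. s / rs * W' z v)) (at z)" if z: "z \<in> A" for z
  proof -
    have "((\<lambda>z. s / rs * (w (h z) - c)) has_derivative (\<lambda>v. s / rs * (W' z v - 0))) (at z)"
      by (intro has_derivative_mult_right has_derivative_diff W_deriv z has_derivative_const)
    then show ?thesis unfolding V_def by simp
  qed
  \<comment> \<open>Both sides come from differentiating |h|^2 = rs^2 (cosh V)^2.\<close>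
  have hin: "h z \<bullet> h' z v = rs * s * (cosh (V z) * sinh (V z)) * W' z v" if z: "z \<in> A" for z v
  proof -
    have 1: "((\<lambda>y. h y \<bullet> h y) has_derivative (\<lambda>v. h z \<bullet> h' z v + h' z v \<bullet> h z)) (at z)"
      by (intro has_derivative_inner h_deriv z)
    have "((\<lambda>x. rs\<^sup>2 * (cosh x)\<^sup>2) has_real_derivative rs\<^sup>2 * (2 * cosh (V z) * sinh (V z))) (at (V z))"
      by (auto intro!: derivative_eq_intros)
    from has_derivative_compose[OF Vd[OF z] this[unfolded has_field_derivative_def]]
    have "((\<lambda>y. rs\<^sup>2 * (cosh (V y))\<^sup>2) has_derivative (\<lambda>v. rs\<^sup>2 * (2 * cosh (V z) * sinh (V z)) * (s / rs * W' z v))) (at z)" .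
    then have 2: "((\<lambda>y. h y \<bullet> h y) has_derivative (\<lambda>v. rs\<^sup>2 * (2 * cosh (V z) * sinh (V z)) * (s / rs * W' z v))) (at z)"
      by (rule has_derivative_transform_within_open[OF _ open_annulus z])
        (use rs in \<open>simp add: Vc power_divide dot_square_norm\<close>)
    have "h z \<bullet> h' z v + h' z v \<bullet> h z = rs\<^sup>2 * (2 * cosh (V z) * sinh (V z)) * (s / rs * W' z v)"
      using has_derivative_unique[OF 1 2] by (rule fun_cong)
    moreover have "h' z v \<bullet> h z = h z \<bullet> h' z v" by (rule inner_commute)
    moreover have "rs\<^sup>2 * (2 * C * S) * (s / rs * q) = 2 * (rs * s * (C * S) * q)" for C S q
      using rs by (simp add: power2_eq_square)
    ultimately show ?thesis by simp
  qed
  \<comment> \<open>Twice the z-derivative of the height. Conformality gives G^2 = -4 \<phi> \<psi>,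
    so G^2 is holomorphic; a continuous zero-free square root is holomorphic too, which proves the
    height harmonic without second derivatives.\<close>
  define G where "G = (\<lambda>z. complex_of_real (W' z 1) - \<i> * of_real (W' z \<i>))"
  \<comment> \<open>At a critical point of the height, the catenoid relation makes both derivatives
    of h orthogonal to h, and conformality makes them orthogonal to each other and equally long; so
    they would vanish.\<close>
  have G0: "G z \<noteq> 0" if z: "z \<in> A" for z
  proof
    assume "G z = 0"
    then have W0: "W' z 1 = 0" "W' z \<i> = 0" by (simp_all add: G_def complex_eq_iff)
    have "h z \<bullet> h' z 1 = 0" "h z \<bullet> h' z \<i> = 0" using hin[OF z] W0 by simp_all
    moreover have "h z \<noteq> 0" using h_range[OF z] rs by auto
    then have "Re (h z) \<noteq> 0 \<or> Im (h z) \<noteq> 0" by (simp add: complex_eq_iff)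
    ultimately have "Re (h' z 1) = 0 \<and> Im (h' z 1) = 0"
      using conf(2,3)[OF z] W0 unfolding inner_complex_def cmod_power2
      by (intro orthogonal_frame_zero[of "Re (h z)" _ "Im (h z)"]) simp_all
    then show False using conf(1)[OF z] by (simp add: complex_eq_iff)
  qed
  have Gsq: "(G z)\<^sup>2 = - 4 * (\<phi> z * \<psi> z)" if z: "z \<in> A" for z
  proof -
    have id: "(of_real p - \<i> * of_real q)\<^sup>2 + 4 * ((u - \<i> * v) / 2 * cnj ((u + \<i> * v) / 2))
       = of_real (((cmod u)\<^sup>2 + p\<^sup>2) - ((cmod v)\<^sup>2 + q\<^sup>2)) - 2 * \<i> * of_real (Re u * Re v + Im u * Im v + p * q)" for p q u v
    proof -
      have "4 * (A / 2 * cnj (B / 2)) = A * cnj B" for A B by simp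
      then have e: "4 * ((u - \<i> * v) / 2 * cnj ((u + \<i> * v) / 2)) = (u - \<i> * v) * cnj (u + \<i> * v)" .
      show ?thesis unfolding e cmod_power2 by (simp add: complex_eq_iff power2_eq_square algebra_simps)
    qed
    have "(G z)\<^sup>2 + 4 * (\<phi> z * \<psi> z) = 0"
      unfolding G_def \<phi>_def \<psi>_def id conf(2)[OF z] conf(3)[OF z] by simp
    then show ?thesis by (simp add: add_eq_0_iff)
  qed
  have Gh: "G holomorphic_on A"
  proof (rule holomorphic_if_square_holomorphic[OF open_annulus _ G0])
    show "continuous_on A G" unfolding G_def by (intro continuous_intros cont_W'(2))
    have "(\<lambda>z. - 4 * (\<phi> z * \<psi> z)) holomorphic_on A" by (intro holomorphic_intros hol)
    then show "(\<lambda>z. (G z)\<^sup>2) holomorphic_on A" by (rule holomorphic_transform) (simp add: Gsq)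
  qed
  define K where "K = (\<lambda>z. of_real (s / (2 * rs)) * G z)"
  interpret V: annulus_harmonic T "\<lambda>z. complex_of_real (V z)" K K
  proof
    show "T > 0" by (rule T)
    show "K holomorphic_on A" unfolding K_def by (intro holomorphic_intros Gh)
    fix z assume z: "z \<in> A"
    have "K z * v + cnj (K z * v) = complex_of_real (s / rs * W' z v)" for v
      unfolding K_def G_def W'_lin[OF z, of v] using rs by (simp add: complex_eq_iff field_simps)
    then have e: "(\<lambda>v. K z * v + cnj (K z * v)) = (\<lambda>v. complex_of_real (s / rs * W' z v))" by (rule ext)
    show "((\<lambda>z. complex_of_real (V z)) has_derivative (\<lambda>v. K z * v + cnj (K z * v))) (at z)"
      unfolding e by (rule has_derivative_of_real[OF Vd[OF z]])
  qed
  have Vlin: "V (pt t \<theta>) = t * a" if t: "t \<in> {0<..<T}" for t \<theta>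
  proof -
    have "complex_of_real (V (of_real (exp t) * cis \<theta>)) = of_real (t / T) * of_real L"
    proof (rule V.linear_of_boundary_limits[OF _ _ t])
      fix e :: real assume e: "e > 0"
      have "cosh e > 1" using e cosh_real_nonneg_less_iff[of 0 e] by simp
      then have "rs * (cosh e - 1) > 0" using rs by simp
      from inner_end[OF this] obtain d where d: "d > 0" "\<And>t \<theta>. 0 < t \<and> t < d \<and> t < T \<Longrightarrow> cmod (h (of_real (exp t) * cis \<theta>)) < rs + rs * (cosh e - 1)"
        by blast
      have "cmod (complex_of_real (V (of_real (exp t) * cis \<theta>))) \<le> e" if tt: "0 < t \<and> t < d \<and> t < T" for t \<theta>
      proof -
        have z: "pt t \<theta> \<in> A" using tt pt_in by simp
        have "cmod (h (pt t \<theta>)) < rs * cosh e" using d(2)[OF tt, of \<theta>] unfolding pt_def by (simp add: algebra_simps del: of_real_exp)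
        then have "cosh (V (pt t \<theta>)) \<le> cosh e" unfolding Vc(1)[OF z] using rs by (simp add: pos_divide_le_eq mult.commute)
        then have "V (pt t \<theta>) \<le> e" using Vc(2)[OF z] e by (simp add: cosh_real_nonneg_le_iff)
        then show ?thesis using Vc(2)[OF z] unfolding pt_def norm_of_real by (simp del: of_real_exp)
      qed
      then show "\<exists>d>0. \<forall>t \<theta>. 0 < t \<and> t < d \<and> t < T \<longrightarrow> cmod (complex_of_real (V (of_real (exp t) * cis \<theta>))) \<le> e"
        using d(1) by blast
    next
      fix e :: real assume e: "e > 0"
      define e' where "e' = min e L"
      have e': "e' > 0" "e' \<le> e" "e' \<le> L" using e L by (auto simp: e'_def)
      have "cosh (L - e') < cosh L" using e' L by (subst cosh_real_nonneg_less_iff) auto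
      then have "Rs - rs * cosh (L - e') > 0" unfolding cL using rs by (simp add: pos_less_divide_eq mult.commute)
      from outer_end[OF this] obtain d where d: "d > 0" "\<And>t \<theta>. 0 < t \<and> T - d < t \<and> t < T \<Longrightarrow> Rs - (Rs - rs * cosh (L - e')) < cmod (h (of_real (exp t) * cis \<theta>))"
        by blast
      have "cmod (complex_of_real (V (of_real (exp t) * cis \<theta>)) - of_real L) \<le> e" if tt: "0 < t \<and> T - d < t \<and> t < T" for t \<theta>
      proof -
        have z: "pt t \<theta> \<in> A" using tt pt_in by simp
        have "rs * cosh (L - e') < cmod (h (pt t \<theta>))" using d(2)[OF tt, of \<theta>] unfolding pt_def by simp
        then have "cosh (L - e') \<le> cosh (V (pt t \<theta>))" unfolding Vc(1)[OF z] using rs by (simp add: pos_le_divide_eq mult.commute)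
        then have 1: "L - e' \<le> V (pt t \<theta>)" using Vc(2)[OF z] e' by (simp add: cosh_real_nonneg_le_iff)
        have "cosh (V (pt t \<theta>)) \<le> cosh L" unfolding Vc(1)[OF z] cL using h_range[OF z] rs by (simp add: divide_right_mono)
        then have 2: "V (pt t \<theta>) \<le> L" using Vc(2)[OF z] L by (simp add: cosh_real_nonneg_le_iff)
        have "\<bar>V (pt t \<theta>) - L\<bar> \<le> e" using 1 2 e' by linarith
        then show ?thesis unfolding pt_def of_real_diff[symmetric] norm_of_real .
      qed
      then show "\<exists>d>0. \<forall>t \<theta>. 0 < t \<and> T - d < t \<and> t < T \<longrightarrow> cmod (complex_of_real (V (of_real (exp t) * cis \<theta>)) - of_real L) \<le> e"
        using d(1) by blast
    qed
    then have "V (pt t \<theta>) = t / T * L" unfolding pt_def of_real_mult[symmetric] of_real_eq_iff .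
    then show ?thesis by (simp add: a_def)
  qed
  define t where "t = T / 2"
  have t: "t \<in> {0<..<T}" using T by (simp add: t_def)
  define C where "C = cosh (t * a)"
  define S where "S = sinh (t * a)"
  have CS: "C\<^sup>2 = 1 + S\<^sup>2" unfolding C_def S_def cosh_square_eq by simp
  define \<eta> where "\<eta> = (\<lambda>\<theta>. h (pt t \<theta>))"
  define k where "k = (\<lambda>\<theta>. h' (pt t \<theta>) (\<i> * pt t \<theta>))"
  \<comment> \<open>Angular velocity of h about the origin on the middle circle: cross product of
    position and derivative over the squared radius.\<close>
  define y where "y = (\<lambda>\<theta>. (Im (k \<theta>) * Re (\<eta> \<theta>) - Re (k \<theta>) * Im (\<eta> \<theta>)) / (rs\<^sup>2 * C\<^sup>2))"
  have q0: "rs\<^sup>2 * C\<^sup>2 > 0" using rs by (simp add: C_def)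
  have y: "(y \<theta>)\<^sup>2 = a\<^sup>2 \<and> k \<theta> = \<i> * of_real (y \<theta>) * \<eta> \<theta>" for \<theta>
  proof -
    have z: "pt t \<theta> \<in> A" using t pt_in by blast
    define m where "m = h' (pt t \<theta>) (pt t \<theta>)"
    have "((\<lambda>t. V (pt t \<theta>)) has_vector_derivative s / rs * W' (pt t \<theta>) (pt t \<theta>)) (at t)"
      using polar_chain(1)[OF Vd[OF z, unfolded pt_def]] unfolding pt_def .
    moreover have "((\<lambda>t. V (pt t \<theta>)) has_vector_derivative a) (at t)"
    proof (rule has_vector_derivative_transform_within_open[of _ _ _ "{0<..<T}"])
      show "((\<lambda>t. t * a) has_vector_derivative a) (at t)"
        unfolding has_real_derivative_iff_has_vector_derivative[symmetric] by (auto intro!: derivative_eq_intros)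
    qed (use t Vlin in auto)
    ultimately have "s / rs * W' (pt t \<theta>) (pt t \<theta>) = a" by (rule vector_derivative_unique_at)
    then have "rs * s * (s / rs * W' (pt t \<theta>) (pt t \<theta>)) = rs * s * a" by simp
    moreover have "rs * s * (s / rs * q) = (s * s) * q" for q using rs by simp
    ultimately have Wt: "W' (pt t \<theta>) (pt t \<theta>) = rs * s * a" unfolding ss by simp
    have "((\<lambda>\<theta>. V (pt t \<theta>)) has_vector_derivative s / rs * W' (pt t \<theta>) (\<i> * pt t \<theta>)) (at \<theta>)"
      using polar_chain(2)[OF Vd[OF z, unfolded pt_def]] unfolding pt_def .
    moreover have "((\<lambda>\<theta>. V (pt t \<theta>)) has_vector_derivative 0) (at \<theta>)" unfolding Vlin[OF t] by (rule has_vector_derivative_const)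
    ultimately have "s / rs * W' (pt t \<theta>) (\<i> * pt t \<theta>) = 0" by (rule vector_derivative_unique_at)
    then have Wi: "W' (pt t \<theta>) (\<i> * pt t \<theta>) = 0" using rs s by auto
    have V: "cosh (V (pt t \<theta>)) = C" "sinh (V (pt t \<theta>)) = S" unfolding Vlin[OF t] C_def S_def by auto
    have Wsq: "(rs * s * a)\<^sup>2 = rs\<^sup>2 * a\<^sup>2" using s by (auto simp: power_mult_distrib)
    have i1: "Re (\<eta> \<theta>) * Re (k \<theta>) + Im (\<eta> \<theta>) * Im (k \<theta>) = 0"
      using hin[OF z, of "\<i> * pt t \<theta>"] unfolding Wi inner_complex_def \<eta>_def k_def by simp
    have i2: "Re m * Re (k \<theta>) + Im m * Im (k \<theta>) = 0"
      using conf_radial(2)[OF z] unfolding Wi m_def k_def by simp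
    have i3: "Re (\<eta> \<theta>) * Re m + Im (\<eta> \<theta>) * Im m = rs\<^sup>2 * a * C * S"
    proof -
      have "rs * s * (C * S) * (rs * s * a) = (s * s) * (rs\<^sup>2 * a * C * S)" by (simp add: power2_eq_square)
      then show ?thesis using hin[OF z, of "pt t \<theta>"] unfolding Wt V inner_complex_def \<eta>_def m_def ss by simp
    qed
    have i4: "(Re (\<eta> \<theta>))\<^sup>2 + (Im (\<eta> \<theta>))\<^sup>2 = rs\<^sup>2 * C\<^sup>2"
    proof -
      have "cmod (\<eta> \<theta>) = rs * C" using Vc(1)[OF z] rs unfolding V \<eta>_def by simp
      then show ?thesis unfolding cmod_power2[symmetric] by (simp add: power_mult_distrib)
    qed
    have i5: "((Re m)\<^sup>2 + (Im m)\<^sup>2) + rs\<^sup>2 * a\<^sup>2 = (Re (k \<theta>))\<^sup>2 + (Im (k \<theta>))\<^sup>2"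
      using conf_radial(1)[OF z] unfolding Wi Wt Wsq cmod_power2 m_def k_def by simp
    note rsp = rotation_speed[OF i1 i2 i3 i4 i5 CS rs(1) a]
    have "(b * q)\<^sup>2 / q\<^sup>2 = b\<^sup>2" if "q > 0" for b q :: real using that by (simp add: power_mult_distrib)
    from this[OF q0] have "(y \<theta>)\<^sup>2 = a\<^sup>2" unfolding y_def power_divide rsp(1) .
    moreover have "Re (k \<theta>) = - (y \<theta> * Im (\<eta> \<theta>))" "Im (k \<theta>) = y \<theta> * Re (\<eta> \<theta>)"
    proof -
      have sol: "K = - (N / q * E)" if "q > 0" "K * q = - (N * E)" for K q N E :: real
        using that by (simp add: field_simps)
      have sol': "K = N / q * E" if "q > 0" "K * q = N * E" for K q N E :: real
        using that by (simp add: field_simps)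
      show "Re (k \<theta>) = - (y \<theta> * Im (\<eta> \<theta>))" unfolding y_def by (rule sol[OF q0 rsp(2)])
      show "Im (k \<theta>) = y \<theta> * Re (\<eta> \<theta>)" unfolding y_def by (rule sol'[OF q0 rsp(3)])
    qed
    then have "k \<theta> = \<i> * of_real (y \<theta>) * \<eta> \<theta>" by (simp add: complex_eq_iff)
    ultimately show ?thesis by blast
  qed
  have cpt: "continuous_on UNIV (pt t)" unfolding pt_def[abs_def] by (intro continuous_intros)
  have ptA: "range (pt t) \<subseteq> A" using t pt_in by blast
  have "continuous_on UNIV \<eta>" "continuous_on UNIV k"
    unfolding \<eta>_def k_def
    by (rule continuous_on_compose2[OF cont_h cpt ptA], rule continuous_on_compose2[OF cont_h'(1) cpt ptA])
  then have "continuous_on UNIV y" unfolding y_def using q0 by (intro continuous_intros) auto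
  then have "(\<forall>\<theta>\<in>UNIV. y \<theta> = a) \<or> (\<forall>\<theta>\<in>UNIV. y \<theta> = - a)"
    by (rule sign_constant[OF connected_UNIV _ a]) (use y in blast)
  then have "\<exists>s'. (s' = 1 \<or> s' = -1) \<and> (\<forall>\<theta>. y \<theta> = s' * a)"
    by (elim disjE) (rule exI[of _ 1], simp, rule exI[of _ "-1"], simp)
  then obtain s' where s': "s' = 1 \<or> s' = -1" "\<And>\<theta>. y \<theta> = s' * a" by blast
  \<comment> \<open>Undoing the rotation: the position times exp (- i s' a \<theta>) has zero
    derivative.\<close>
  have "\<exists>l. \<forall>\<theta>\<in>UNIV. \<eta> \<theta> * (1 * cis (- (s' * a) * \<theta>)) = l"
  proof (rule has_vector_derivative_zero_constant[of UNIV "\<lambda>\<theta>. \<eta> \<theta> * (1 * cis (- (s' * a) * \<theta>))"])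
    fix \<theta> :: real
    have "(\<eta> has_vector_derivative k \<theta>) (at \<theta>)" unfolding \<eta>_def k_def by (rule polar_derivs(2)[OF t])
    from has_vector_derivative_mult[OF this cis_vector_derivative[of 1 "- (s' * a)"]]
    show "((\<lambda>\<theta>. \<eta> \<theta> * (1 * cis (- (s' * a) * \<theta>))) has_vector_derivative 0) (at \<theta> within UNIV)"
      using y[of \<theta>] s'(2)[of \<theta>] by simp
  qed auto
  then obtain l where l: "\<And>\<theta>. \<eta> \<theta> * cis (- (s' * a) * \<theta>) = l" by auto
  have "a \<le> 1"
  proof (rule ccontr)
    assume "\<not> a \<le> 1"
    then have a1: "a > 1" by simp
    define \<theta> where "\<theta> = 2 * pi / a"
    have \<theta>: "0 < \<theta>" "\<theta> < 2 * pi" using a1 pi_gt_zero by (simp_all add: \<theta>_def pos_divide_less_eq)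
    have "cis (- (s' * a) * \<theta>) = 1"
    proof -
      have "- (s' * a) * \<theta> = - s' * (2 * pi)" using a by (simp add: \<theta>_def)
      moreover have "cis (- s' * (2 * pi)) = 1" using s'(1) by (auto simp: complex_eq_iff)
      ultimately show ?thesis by (simp only:)
    qed
    then have "\<eta> \<theta> = \<eta> 0" using l[of \<theta>] l[of 0] by simp
    then have "pt t \<theta> = pt t 0" using inj_onD[OF h_inj, of "pt t \<theta>" "pt t 0"] ptA unfolding \<eta>_def by blast
    then have "cis \<theta> = 1" by (simp add: pt_def)
    then have "cos \<theta> = 1" by (simp add: complex_eq_iff)
    then obtain n :: int where n: "\<theta> = real_of_int n * 2 * pi" unfolding cos_one_2pi_int by blast
    have "0 < real_of_int n" using \<theta>(1) n pi_gt_zero by (simp add: zero_less_mult_iff)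
    moreover have "real_of_int n < 1" using \<theta>(2) n pi_gt_zero by simp
    ultimately have "0 < n" "n < 1" by simp_all
    then show False by simp
  qed
  then have "L \<le> T" using T by (simp add: a_def)
  then have "cosh L \<le> cosh T" using L T by (subst cosh_real_nonneg_le_iff) auto
  then show ?thesis unfolding cL .
qed

end

section \<open>Reduction to the normalised parametrization\<close>

theorem theorem1p2:
  fixes rs Rs r R :: real and w :: "complex \<Rightarrow> real" and F :: "complex \<Rightarrow> complex \<times> real"
  assumes "0 < rs" and "rs < Rs"
    and "minimal_graph (annulus rs Rs) w"
    and "0 < r" and "r < R"
    and "conformal_param (annulus r R) F (graph_surface (annulus rs Rs) w)"
  shows "Mod_annulus r R \<le> ln (Rs / rs + sqrt (Rs\<^sup>2 / rs\<^sup>2 - 1)) \<and>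
         (Mod_annulus r R = ln (Rs / rs + sqrt (Rs\<^sup>2 / rs\<^sup>2 - 1)) \<longleftrightarrow>
         (\<exists>c::real. (\<forall>\<xi>\<in>annulus rs Rs.
              w \<xi> = c + rs * ln ((cmod \<xi> + sqrt ((cmod \<xi>)\<^sup>2 - rs\<^sup>2)) / rs)) \<or>
            (\<forall>\<xi>\<in>annulus rs Rs.
              w \<xi> = c - rs * ln ((cmod \<xi> + sqrt ((cmod \<xi>)\<^sup>2 - rs\<^sup>2)) / rs))))"
proof -
  define X where "X = Rs / rs"
  have X1: "1 < X" using assms(1,2) by (simp add: X_def)
  define T where "T = ln (R / r)"
  have Rr: "1 < R / r" using assms(4,5) by simp
  have T: "T > 0" unfolding T_def using Rr by (rule ln_gt_zero)
  have eT: "exp T = R / r" unfolding T_def using Rr by (intro exp_ln) linarith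
  obtain Dw D2w where C2: "C2_with (annulus rs Rs) w Dw D2w"
    and mse: "\<And>z. z \<in> annulus rs Rs \<Longrightarrow> (1 + (Dw z \<i>)\<^sup>2) * D2w z 1 1 - 2 * Dw z 1 * Dw z \<i> * D2w z 1 \<i>
        + (1 + (Dw z 1)\<^sup>2) * D2w z \<i> \<i> = 0"
    using assms(3) unfolding minimal_graph_def Let_def by (elim exE conjE) (erule that, blast)
  have cw: "continuous_on (annulus rs Rs) w"
    using C2 unfolding C2_with_def by (intro continuous_at_imp_continuous_on ballI) (blast intro: has_derivative_continuous)
  let ?A = "annulus 1 (exp T)"
  let ?S = "graph_surface (annulus rs Rs) w"
  have param: "conformal_param ?A (F \<circ> (\<lambda>z. of_real r * z)) ?S" (is "conformal_param _ ?P1 _")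
  proof (rule conformal_param_compose[OF assms(6)])
    show "homeomorphism ?A (annulus r R) (\<lambda>z. of_real r * z) (\<lambda>z. z / of_real r)"
      using assms(4) by (intro homeomorphismI continuous_intros)
        (auto simp: annulus_def norm_mult norm_divide eT pos_less_divide_eq pos_divide_less_eq mult.commute)
    show "\<exists>d. ((\<lambda>z. of_real r * z) has_field_derivative d) (at z) \<and> d \<noteq> 0" for z
      using assms(4) by (intro exI[of _ "of_real r"] conjI) (auto intro!: derivative_eq_intros)
  qed
  obtain G where "homeomorphism ?A ?S ?P1 G" using param unfolding conformal_param_def by blast
  from homeomorphism_graph_fst[OF this cw]
  have hom: "homeomorphism ?A (annulus rs Rs) (\<lambda>z. fst (?P1 z)) (\<lambda>\<xi>. G (\<xi>, w \<xi>))" .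
  have eT1: "1 < exp T" using T by simp
  have "\<exists>P. minimal_graph_param T rs Rs w Dw D2w P"
    using annulus_homeomorphism_ends[OF hom zero_less_one eT1 assms(1,2)]
  proof (elim disjE)
    assume e: "\<forall>e>0. \<exists>\<delta>>0. \<forall>z\<in>?A. (cmod z < 1 + \<delta> \<longrightarrow> cmod (fst (?P1 z)) < rs + e) \<and> (exp T - \<delta> < cmod z \<longrightarrow> Rs - e < cmod (fst (?P1 z)))"
    have "minimal_graph_param T rs Rs w Dw D2w ?P1"
      by unfold_locales (use T assms(1,2) C2 mse param e in blast)+
    then show ?thesis by blast
  next
    assume e: "\<forall>e>0. \<exists>\<delta>>0. \<forall>z\<in>?A. (cmod z < 1 + \<delta> \<longrightarrow> Rs - e < cmod (fst (?P1 z))) \<and> (exp T - \<delta> < cmod z \<longrightarrow> cmod (fst (?P1 z)) < rs + e)"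
    \<comment> \<open>If the parametrization sends the inner end to the outer one, precomposing with
      this inversion of the parameter annulus swaps its ends and stays conformal.\<close>
    let ?j = "\<lambda>z. of_real (exp T) / z"
    have jA: "?j z \<in> ?A" and nj: "cmod (?j z) = exp T / cmod z" and z0: "z \<noteq> 0" and jj: "?j (?j z) = z" if "z \<in> ?A" for z
    proof -
      have z: "1 < cmod z" "cmod z < exp T" using that by (auto simp: annulus_def)
      show n: "cmod (?j z) = exp T / cmod z" by (simp add: norm_divide del: of_real_exp)
      show z0: "z \<noteq> 0" using z by auto
      have "exp T / cmod z < exp T / 1" using z by (intro divide_strict_left_mono) auto
      then have "exp T / cmod z < exp T" by simp
      moreover have "1 < exp T / cmod z" using z by (subst pos_less_divide_eq) auto
      ultimately show "?j z \<in> ?A" unfolding annulus_def mem_Collect_eq n by blast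
      show "?j (?j z) = z" using z0 by simp
    qed
    have param2: "conformal_param ?A (?P1 \<circ> ?j) ?S"
    proof (rule conformal_param_compose[OF param])
      show "homeomorphism ?A ?A ?j ?j"
        by (intro homeomorphismI continuous_intros ballI) (use jA z0 jj in blast)+
      show "\<exists>d. (?j has_field_derivative d) (at z) \<and> d \<noteq> 0" if z: "z \<in> ?A" for z
        using z0[OF z] by (intro exI[of _ "- (of_real (exp T) / z\<^sup>2)"] conjI)
          (auto intro!: derivative_eq_intros simp: power2_eq_square)
    qed
    have ends: "\<exists>\<delta>>0. \<forall>z\<in>?A. (cmod z < 1 + \<delta> \<longrightarrow> cmod (fst ((?P1 \<circ> ?j) z)) < rs + e') \<and> (exp T - \<delta> < cmod z \<longrightarrow> Rs - e' < cmod (fst ((?P1 \<circ> ?j) z)))"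
      if e': "e' > 0" for e'
    proof -
      obtain \<delta>0 where \<delta>0: "\<delta>0 > 0" "\<And>z. z \<in> ?A \<Longrightarrow> cmod z < 1 + \<delta>0 \<Longrightarrow> Rs - e' < cmod (fst (?P1 z))"
        "\<And>z. z \<in> ?A \<Longrightarrow> exp T - \<delta>0 < cmod z \<Longrightarrow> cmod (fst (?P1 z)) < rs + e'"
        using e e' by blast
      \<comment> \<open>The two bounds make |z| < 1 + \<delta> imply e^T / |z| > e^T - \<delta>0,
        and |z| > e^T - \<delta> imply e^T / |z| < 1 + \<delta>0.\<close>
      define \<delta> where "\<delta> = min (\<delta>0 / exp T) (\<delta>0 * exp T / (1 + \<delta>0))"
      have \<delta>: "\<delta> > 0" "\<delta> \<le> \<delta>0 / exp T" "\<delta> \<le> \<delta>0 * exp T / (1 + \<delta>0)" using \<delta>0(1) by (auto simp: \<delta>_def)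
      have \<delta>': "\<delta> * exp T \<le> \<delta>0" "\<delta> * (1 + \<delta>0) \<le> \<delta>0 * exp T"
        using \<delta> \<delta>0(1) by (simp_all add: pos_le_divide_eq)
      have in1: "exp T - \<delta>0 < cmod (?j z)" if z: "z \<in> ?A" "cmod z < 1 + \<delta>" for z
      proof -
        have "1 < cmod z" using z by (simp add: annulus_def)
        then have c: "0 < cmod z" by linarith
        show ?thesis
        proof (cases "exp T - \<delta>0 \<le> 0")
          case True
          have "0 < exp T / cmod z" using c by (intro divide_pos_pos) auto
          then show ?thesis unfolding nj[OF z(1)] using True by linarith
        next
          case False
          then have "(exp T - \<delta>0) * cmod z < (exp T - \<delta>0) * (1 + \<delta>)" using z(2) by (intro mult_strict_left_mono) auto
          also have "\<dots> = exp T + (\<delta> * exp T - \<delta>0) - \<delta>0 * \<delta>" by (simp add: algebra_simps)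
          also have "\<dots> \<le> exp T" using \<delta>'(1) mult_pos_pos[OF \<delta>0(1) \<delta>(1)] by linarith
          finally show ?thesis unfolding nj[OF z(1)] using c by (simp add: pos_less_divide_eq)
        qed
      qed
      have out1: "cmod (?j z) < 1 + \<delta>0" if z: "z \<in> ?A" "exp T - \<delta> < cmod z" for z
      proof -
        have "1 < cmod z" using z by (simp add: annulus_def)
        then have c: "0 < cmod z" by linarith
        have "exp T \<le> (1 + \<delta>0) * (exp T - \<delta>)" using \<delta>'(2) by (simp add: algebra_simps)
        also have "\<dots> < (1 + \<delta>0) * cmod z" using z(2) \<delta>0(1) by (intro mult_strict_left_mono) auto
        finally show ?thesis unfolding nj[OF z(1)] using c by (simp add: pos_divide_less_eq)
      qed
      show ?thesis
        unfolding comp_apply[of ?P1 ?j] using \<delta>(1) \<delta>0(2,3) in1 out1 jA by (intro exI[of _ \<delta>]) blast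
    qed
    have "minimal_graph_param T rs Rs w Dw D2w (?P1 \<circ> ?j)"
      by unfold_locales (use T assms(1,2) C2 mse param2 ends in blast)+
    then show ?thesis by blast
  qed
  then obtain P where P: "minimal_graph_param T rs Rs w Dw D2w P" by blast
  note bound = minimal_graph_param.cosh_bound[OF P, folded X_def]
  have M: "Mod_annulus r R = T" by (simp add: Mod_annulus_def T_def)
  have aX: "ln (Rs / rs + sqrt (Rs\<^sup>2 / rs\<^sup>2 - 1)) = arcosh X"
    using X1 unfolding X_def by (simp add: arcosh_real_def power_divide)
  have cX: "cosh (arcosh X) = X" "arcosh X \<ge> 0" using X1 by (simp_all add: arcosh_nonneg_if)
  have le: "T \<le> arcosh X"
    using bound cosh_real_nonneg_le_iff[of T "arcosh X"] T cX by simp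
  have eq: "T = arcosh X \<longleftrightarrow> cosh T = X"
    using cX T arcosh_cosh_real[of T] by auto
  have arc: "ln ((cmod \<xi> + sqrt ((cmod \<xi>)\<^sup>2 - rs\<^sup>2)) / rs) = arcosh (cmod \<xi> / rs)" if "\<xi> \<in> annulus rs Rs" for \<xi>
    using arcosh_scaled[of rs "cmod \<xi>"] assms(1) that by (simp add: annulus_def)
  have "cosh T = X \<longleftrightarrow> (\<exists>c. (\<forall>\<xi>\<in>annulus rs Rs. w \<xi> = c + rs * arcosh (cmod \<xi> / rs)) \<or> (\<forall>\<xi>\<in>annulus rs Rs. w \<xi> = c - rs * arcosh (cmod \<xi> / rs)))"
  proof
    assume "cosh T = X"
    then obtain c s where "s = 1 \<or> s = -1" "\<forall>\<xi>\<in>annulus rs Rs. w \<xi> = c + s * rs * arcosh (cmod \<xi> / rs)"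
      using minimal_graph_param.extremal_imp_catenoid[OF P] unfolding X_def by blast
    then show "\<exists>c. (\<forall>\<xi>\<in>annulus rs Rs. w \<xi> = c + rs * arcosh (cmod \<xi> / rs)) \<or> (\<forall>\<xi>\<in>annulus rs Rs. w \<xi> = c - rs * arcosh (cmod \<xi> / rs))"
      by (intro exI[of _ c]) auto
  next
    assume "\<exists>c. (\<forall>\<xi>\<in>annulus rs Rs. w \<xi> = c + rs * arcosh (cmod \<xi> / rs)) \<or> (\<forall>\<xi>\<in>annulus rs Rs. w \<xi> = c - rs * arcosh (cmod \<xi> / rs))"
    then obtain c where c: "(\<forall>\<xi>\<in>annulus rs Rs. w \<xi> = c + rs * arcosh (cmod \<xi> / rs)) \<or> (\<forall>\<xi>\<in>annulus rs Rs. w \<xi> = c - rs * arcosh (cmod \<xi> / rs))"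
      by (elim exE)
    have "X \<le> cosh T"
      using c
    proof
      assume "\<forall>\<xi>\<in>annulus rs Rs. w \<xi> = c + rs * arcosh (cmod \<xi> / rs)"
      then show "X \<le> cosh T" unfolding X_def by (intro minimal_graph_param.catenoid_imp_extremal[OF P, of 1 c]) simp_all
    next
      assume "\<forall>\<xi>\<in>annulus rs Rs. w \<xi> = c - rs * arcosh (cmod \<xi> / rs)"
      then show "X \<le> cosh T" unfolding X_def by (intro minimal_graph_param.catenoid_imp_extremal[OF P, of "-1" c]) simp_all
    qed
    then show "cosh T = X" using bound by simp
  qed
  then show ?thesis
    unfolding M aX using le eq arc by (simp cong: ball_cong)
qed

end
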